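(* Let $\mathcal{H}$ be a cocommutative Hopf $K$-algebra with a symmetric partial action on a unital $K$-algebra $A$. Consider the functors $$F_1=A\otimes_{A^e}-:(A\#\mathcal{H})^e\operatorname{-Mod}\to\mathcal{H}_{par}\operatorname{-Mod},\qquad F_2=\mathcal{B}\otimes_{\mathcal{H}_{par}}-:\mathcal{H}_{par}\operatorname{-Mod}\to K\operatorname{-Mod},$$ $$F=A\#\mathcal{H}\otimes_{(A\#\mathcal{H})^e}-:(A\#\mathcal{H})^e\operatorname{-Mod}\to K\operatorname{-Mod}.$$ Then the functors $F_2F_1$ and $F$ are naturally isomorphic.
   Context: $K$ is a commutative unital ring, $\otimes=\otimes_K$, all algebras are associative unital $K$-algebras. $\mathcal{H}$ has counit $\varepsilon$, antipode $S$, and Sweedler notation $\Delta(h)=h_{(1)}\otimes h_{(2)}$ is used. Symmetric partial action: a linear map $\mathcal{H}\otimes A\to A$, $h\otimes a\mapsto h\cdot a$, with $1_{\mathcal{H}}\cdot a=a$; $h\cdot(ab)=(h_{(1)}\cdot a)(h_{(2)}\cdot b)$; $h\cdot(k\cdot a)=(h_{(1)}\cdot 1_A)(h_{(2)}k\cdot a)$; and $h\cdot(k\cdot a)=(h_{(1)}k\cdot a)(h_{(2)}\cdot 1_A)$ (symmetry). Partial smash product: $A\otimes\mathcal{H}$ has the associative product $(a\otimes h)(b\otimes k)=a(h_{(1)}\cdot b)\otimes h_{(2)}k$, and $A\#\mathcal{H}:=(A\otimes\mathcal{H})(1_A\otimes 1_{\mathcal{H}})$, a unital algebra generated by the elements $a\#h:=a(h_{(1)}\cdot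 1_A)\otimes h_{(2)}$. For an algebra $R$, $R^e=R\otimes R^{op}$; an $R$-bimodule $X$ is a left $R^e$-module by $(a\otimes b)\cdot x=a\cdot x\cdot b$ and a right $R^e$-module by $x\cdot(a\otimes b)=b\cdot x\cdot a$. An $A\#\mathcal{H}$-bimodule is an $A$-bimodule via $a\mapsto a\#1_{\mathcal{H}}$. The algebra $\mathcal{H}_{par}$ is the quotient of the tensor algebra $T(\mathcal{H})$ by the ideal generated by the elements ($h,k\in\mathcal{H}$): $1_{\mathcal{H}}-1_{T(\mathcal{H})}$; $h\otimes k_{(1)}\otimes S(k_{(2)})-hk_{(1)}\otimes S(k_{(2)})$; $h_{(1)}\otimes S(h_{(2)})\otimes k-h_{(1)}\otimes S(h_{(2)})k$; $h\otimes S(k_{(1)})\otimes k_{(2)}-hS(k_{(1)})\otimes k_{(2)}$; $S(h_{(1)})\otimes h_{(2)}\otimes k-S(h_{(1)})\otimes h_{(2)}k$. The class of $h$ is $[h]$. $\mathcal{B}\subseteq\mathcal{H}_{par}$ is the subalgebra generated by the elements $e_h:=[h_{(1)}][S(h_{(2)})]$, $h\in\mathcal{H}$; it is a right $\mathcal{H}_{par}$-module by $b\triangleleft[h]=[S(h_{(1)})]b[h_{(2)}]$. For an $A\#\mathcal{H}$-bimodule $M$, the left $\mathcal{H}_{par}$-module structure on $F_1(M)=A\otimes_{A^e}M$ is $[h]\triangleright(a\otimes_{A^e}m)=(h_{(1)}\cdot a)\otimes_{A^e}(1_A\#h_{(2)})\cdot m\cdot(1_A\#S(h_{(3)}))$.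 *)

theory Defs
  imports "HOL-Algebra.Free_Abelian_Groups" "HOL-Algebra.Module" "HOL-Algebra.QuotRing" "HOL-Algebra.Subrings"
begin

section \<open>Modules, algebras and functors between module categories\<close>

text \<open>The library locale \<^locale>\<open>module\<close> requires a commutative base ring and \<^locale>\<open>algebra\<close>
  a commutative algebra; the two locales below drop these requirements. Modules are
  represented by records of type \<^typ>\<open>('r, 'm) module\<close>, whose multiplicative fields are irrelevant.\<close>

locale left_module = R?: ring R + M?: abelian_group M
  for R :: "('r, 'x) ring_scheme" (structure) and M :: "('r, 'm, 'y) module_scheme" (structure) +
  assumes smult_closed: "\<lbrakk>r \<in> carrier R; x \<in> carrier M\<rbrakk> \<Longrightarrow> r \<odot>\<^bsub>M\<^esub> x \<in> carrier M"
    and smult_l_distr: "\<lbrakk>r \<in> carrier R; s \<in> carrier R; x \<in> carrier M\<rbrakk>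
      \<Longrightarrow> (r \<oplus> s) \<odot>\<^bsub>M\<^esub> x = r \<odot>\<^bsub>M\<^esub> x \<oplus>\<^bsub>M\<^esub> s \<odot>\<^bsub>M\<^esub> x"
    and smult_r_distr: "\<lbrakk>r \<in> carrier R; x \<in> carrier M; y \<in> carrier M\<rbrakk>
      \<Longrightarrow> r \<odot>\<^bsub>M\<^esub> (x \<oplus>\<^bsub>M\<^esub> y) = r \<odot>\<^bsub>M\<^esub> x \<oplus>\<^bsub>M\<^esub> r \<odot>\<^bsub>M\<^esub> y"
    and smult_assoc: "\<lbrakk>r \<in> carrier R; s \<in> carrier R; x \<in> carrier M\<rbrakk>
      \<Longrightarrow> (r \<otimes> s) \<odot>\<^bsub>M\<^esub> x = r \<odot>\<^bsub>M\<^esub> (s \<odot>\<^bsub>M\<^esub> x)"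
    and smult_one: "x \<in> carrier M \<Longrightarrow> \<one> \<odot>\<^bsub>M\<^esub> x = x"

lemma module_iff_left_module: "module K M \<longleftrightarrow> cring K \<and> left_module K M"
  unfolding module_def module_axioms_def left_module_def left_module_axioms_def
  by (auto simp: cring_def)

locale k_algebra = module R M + ring M
  for R :: "('k, 'x) ring_scheme" (structure) and M :: "('k, 'a, 'y) module_scheme" (structure) +
  assumes smult_mult_left: "\<lbrakk>k \<in> carrier R; x \<in> carrier M; y \<in> carrier M\<rbrakk>
      \<Longrightarrow> (k \<odot>\<^bsub>M\<^esub> x) \<otimes>\<^bsub>M\<^esub> y = k \<odot>\<^bsub>M\<^esub> (x \<otimes>\<^bsub>M\<^esub> y)"
    and smult_mult_right: "\<lbrakk>k \<in> carrier R; x \<in> carrier M; y \<in> carrier M\<rbrakk>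
      \<Longrightarrow> x \<otimes>\<^bsub>M\<^esub> (k \<odot>\<^bsub>M\<^esub> y) = k \<odot>\<^bsub>M\<^esub> (x \<otimes>\<^bsub>M\<^esub> y)"

text \<open>Morphisms are extensional functions, so that equality of morphisms is equality in HOL,
  the identity of \<open>M\<close> is \<open>restrict id (carrier M)\<close> and composition is \<^const>\<open>compose\<close>.\<close>

definition module_hom ::
  "('r, 'x) ring_scheme \<Rightarrow> ('r, 'm, 'y) module_scheme \<Rightarrow> ('r, 'n, 'z) module_scheme \<Rightarrow> ('m \<Rightarrow> 'n) set"
  where "module_hom R M N = {f \<in> carrier M \<rightarrow>\<^sub>E carrier N.
    (\<forall>x \<in> carrier M. \<forall>y \<in> carrier M. f (x \<oplus>\<^bsub>M\<^esub> y) = f x \<oplus>\<^bsub>N\<^esub> f y) \<and>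
    (\<forall>r \<in> carrier R. \<forall>x \<in> carrier M. f (r \<odot>\<^bsub>M\<^esub> x) = r \<odot>\<^bsub>N\<^esub> f x)}"

definition module_iso ::
  "('r, 'x) ring_scheme \<Rightarrow> ('r, 'm, 'y) module_scheme \<Rightarrow> ('r, 'n, 'z) module_scheme \<Rightarrow> ('m \<Rightarrow> 'n) set"
  where "module_iso R M N = {f \<in> module_hom R M N. bij_betw f (carrier M) (carrier N)}"

text \<open>A pair of an object map and a morphism map; the latter also receives the source and the
  target of the morphism. The type \<open>'m\<close> plays the role of the universe in which the underlying sets
  of the modules in the source category live, \<open>'n\<close> that of the target category.\<close>

type_synonym ('r, 'm, 's, 'n) mod_functor =
  "(('r, 'm) module \<Rightarrow> ('s, 'n) module) \<times>
   (('r, 'm) module \<Rightarrow> ('r, 'm) module \<Rightarrow> ('m \<Rightarrow> 'm) \<Rightarrow> ('n \<Rightarrow> 'n))"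

definition functor_comp ::
  "('s, 'n, 't, 'p) mod_functor \<Rightarrow> ('r, 'm, 's, 'n) mod_functor \<Rightarrow> ('r, 'm, 't, 'p) mod_functor"
  where "functor_comp G F =
    (fst G \<circ> fst F, \<lambda>M N f. snd G (fst F M) (fst F N) (snd F M N f))"

definition is_module_functor ::
  "('r, 'x) ring_scheme \<Rightarrow> ('s, 'y) ring_scheme \<Rightarrow> ('r, 'm, 's, 'n) mod_functor \<Rightarrow> bool"
  where "is_module_functor R S F \<longleftrightarrow>
    (\<forall>M. left_module R M \<longrightarrow> left_module S (fst F M)) \<and>
    (\<forall>M N. left_module R M \<longrightarrow> left_module R N \<longrightarrow>
      (\<forall>f \<in> module_hom R M N. snd F M N f \<in> module_hom S (fst F M) (fst F N))) \<and>
    (\<forall>M. left_module R M \<longrightarrow>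
      snd F M M (restrict id (carrier M)) = restrict id (carrier (fst F M))) \<and>
    (\<forall>L M N. left_module R L \<longrightarrow> left_module R M \<longrightarrow> left_module R N \<longrightarrow>
      (\<forall>f \<in> module_hom R L M. \<forall>g \<in> module_hom R M N.
        snd F L N (compose (carrier L) g f)
          = compose (carrier (fst F L)) (snd F M N g) (snd F L M f)))"

definition naturally_isomorphic ::
  "('r, 'x) ring_scheme \<Rightarrow> ('s, 'y) ring_scheme \<Rightarrow>
    ('r, 'm, 's, 'n) mod_functor \<Rightarrow> ('r, 'm, 's, 'p) mod_functor \<Rightarrow> bool"
  where "naturally_isomorphic R S F G \<longleftrightarrow>
    is_module_functor R S F \<and> is_module_functor R S G \<and>
    (\<exists>\<eta> :: ('r, 'm) module \<Rightarrow> 'n \<Rightarrow> 'p.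
      (\<forall>M. left_module R M \<longrightarrow> \<eta> M \<in> module_iso S (fst F M) (fst G M)) \<and>
      (\<forall>M N. left_module R M \<longrightarrow> left_module R N \<longrightarrow>
        (\<forall>f \<in> module_hom R M N.
          compose (carrier (fst F M)) (\<eta> N) (snd F M N f)
            = compose (carrier (fst F M)) (snd G M N f) (\<eta> M))))"


section \<open>Tensor products\<close>

text \<open>The tensor product over a ring \<open>R\<close> of a right module \<open>X\<close> and a left module \<open>M\<close>, as the free
  abelian group on \<open>X \<times> M\<close> modulo the balancing relations. The right action of \<open>R\<close> on \<open>X\<close> is passed
  as a function \<open>ra\<close>, since the field \<^const>\<open>smult\<close> of \<open>X\<close> holds the action of the ground ring \<open>K\<close>;
  the latter makes the tensor product a \<open>K\<close>-module.\<close>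

type_synonym ('x, 'm) tensor = "(('x \<times> 'm) \<Rightarrow>\<^sub>0 int) set"

definition tensor_rels ::
  "('r, 'a) ring_scheme \<Rightarrow> ('x \<Rightarrow> 'r \<Rightarrow> 'x) \<Rightarrow> ('k, 'x, 'b) module_scheme \<Rightarrow>
    ('r, 'm, 'c) module_scheme \<Rightarrow> (('x \<times> 'm) \<Rightarrow>\<^sub>0 int) set"
  where "tensor_rels R ra X M =
      {frag_of (x \<oplus>\<^bsub>X\<^esub> y, m) - frag_of (x, m) - frag_of (y, m) | x y m.
        x \<in> carrier X \<and> y \<in> carrier X \<and> m \<in> carrier M}
    \<union> {frag_of (x, m \<oplus>\<^bsub>M\<^esub> n) - frag_of (x, m) - frag_of (x, n) | x m n.
        x \<in> carrier X \<and> m \<in> carrier M \<and> n \<in> carrier M}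
    \<union> {frag_of (ra x r, m) - frag_of (x, r \<odot>\<^bsub>M\<^esub> m) | x r m.
        x \<in> carrier X \<and> r \<in> carrier R \<and> m \<in> carrier M}"

definition tensor_group ::
  "('r, 'a) ring_scheme \<Rightarrow> ('x \<Rightarrow> 'r \<Rightarrow> 'x) \<Rightarrow> ('k, 'x, 'b) module_scheme \<Rightarrow>
    ('r, 'm, 'c) module_scheme \<Rightarrow> ('x, 'm) tensor monoid"
  where "tensor_group R ra X M =
    (let G = free_Abelian_group (carrier X \<times> carrier M)
     in G Mod generate G (tensor_rels R ra X M))"

definition pure_tensor ::
  "('r, 'a) ring_scheme \<Rightarrow> ('x \<Rightarrow> 'r \<Rightarrow> 'x) \<Rightarrow> ('k, 'x, 'b) module_scheme \<Rightarrow>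
    ('r, 'm, 'c) module_scheme \<Rightarrow> 'x \<Rightarrow> 'm \<Rightarrow> ('x, 'm) tensor"
  where "pure_tensor R ra X M x m =
    (let G = free_Abelian_group (carrier X \<times> carrier M)
     in generate G (tensor_rels R ra X M) #>\<^bsub>G\<^esub> frag_of (x, m))"

text \<open>For a balanced biadditive map \<open>b\<close> into the abelian group \<open>G\<close>, \<open>tensor_lift G b\<close> is the
  homomorphism with \<open>x \<otimes> m \<mapsto> b x m\<close>; its value is computed on an arbitrary representative.\<close>

definition tensor_lift :: "('g, 'a) ring_scheme \<Rightarrow> ('x \<Rightarrow> 'm \<Rightarrow> 'g) \<Rightarrow> ('x, 'm) tensor \<Rightarrow> 'g"
  where "tensor_lift G b t =
    (let c = (SOME c. c \<in> t)
     in \<Oplus>\<^bsub>G\<^esub>p \<in> Poly_Mapping.keys c. [Poly_Mapping.lookup c p] \<cdot>\<^bsub>G\<^esub> b (fst p) (snd p))"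

definition tensor_additive ::
  "('r, 'a) ring_scheme \<Rightarrow> ('x \<Rightarrow> 'r \<Rightarrow> 'x) \<Rightarrow> ('k, 'x, 'b) module_scheme \<Rightarrow>
    ('r, 'm, 'c) module_scheme \<Rightarrow> ('x, 'm) tensor ring"
  where "tensor_additive R ra X M =
    (let T = tensor_group R ra X M
     in \<lparr>carrier = carrier T, monoid.mult = undefined, one = undefined,
         zero = \<one>\<^bsub>T\<^esub>, add = monoid.mult T\<rparr>)"

definition tensor_product ::
  "('r, 'a) ring_scheme \<Rightarrow> ('x \<Rightarrow> 'r \<Rightarrow> 'x) \<Rightarrow> ('k, 'x, 'b) module_scheme \<Rightarrow>
    ('r, 'm, 'c) module_scheme \<Rightarrow> ('k, ('x, 'm) tensor) module"
  where "tensor_product R ra X M =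
    (let T = tensor_additive R ra X M
     in \<lparr>carrier = carrier T, monoid.mult = undefined, one = undefined,
         zero = \<zero>\<^bsub>T\<^esub>, add = add T,
         smult = \<lambda>k. tensor_lift T (\<lambda>x m. pure_tensor R ra X M (k \<odot>\<^bsub>X\<^esub> x) m)\<rparr>)"

text \<open>The functor \<open>X \<otimes>\<^sub>R -\<close>.\<close>

definition tensor_functor ::
  "('r, 'a) ring_scheme \<Rightarrow> ('x \<Rightarrow> 'r \<Rightarrow> 'x) \<Rightarrow> ('k, 'x, 'b) module_scheme \<Rightarrow>
    ('r, 'm, 'k, ('x, 'm) tensor) mod_functor"
  where "tensor_functor R ra X =
    (\<lambda>M. tensor_product R ra X M,
     \<lambda>M N f. restrict
       (tensor_lift (tensor_product R ra X N) (\<lambda>x m. pure_tensor R ra X N x (f m)))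
       (carrier (tensor_product R ra X M)))"

abbreviation k_action :: "('k, 'x, 'b) module_scheme \<Rightarrow> 'x \<Rightarrow> 'k \<Rightarrow> 'x"
  where "k_action X \<equiv> \<lambda>x k. k \<odot>\<^bsub>X\<^esub> x"

definition ktensor ::
  "('k, 'a) ring_scheme \<Rightarrow> ('k, 'x, 'b) module_scheme \<Rightarrow> ('k, 'y, 'c) module_scheme \<Rightarrow>
    ('k, ('x, 'y) tensor) module"
  where "ktensor K X Y = tensor_product K (k_action X) X Y"

definition kpure ::
  "('k, 'a) ring_scheme \<Rightarrow> ('k, 'x, 'b) module_scheme \<Rightarrow> ('k, 'y, 'c) module_scheme \<Rightarrow>
    'x \<Rightarrow> 'y \<Rightarrow> ('x, 'y) tensor"
  where "kpure K X Y = pure_tensor K (k_action X) X Y"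

definition alg_tensor ::
  "('k, 'a) ring_scheme \<Rightarrow> ('k, 'x, 'b) module_scheme \<Rightarrow> ('k, 'y, 'c) module_scheme \<Rightarrow>
    ('k, ('x, 'y) tensor) module"
  where "alg_tensor K X Y = (ktensor K X Y)
    \<lparr>monoid.mult := \<lambda>u v.
        tensor_lift (ktensor K X Y) (\<lambda>x y.
          tensor_lift (ktensor K X Y) (\<lambda>x' y'.
            kpure K X Y (x \<otimes>\<^bsub>X\<^esub> x') (y \<otimes>\<^bsub>Y\<^esub> y')) v) u,
     one := kpure K X Y \<one>\<^bsub>X\<^esub> \<one>\<^bsub>Y\<^esub>\<rparr>"

definition opposite :: "('k, 'x, 'b) module_scheme \<Rightarrow> ('k, 'x, 'b) module_scheme"
  where "opposite R = R\<lparr>monoid.mult := \<lambda>x y. y \<otimes>\<^bsub>R\<^esub> x\<rparr>"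

definition enveloping ::
  "('k, 'a) ring_scheme \<Rightarrow> ('k, 'x, 'b) module_scheme \<Rightarrow> ('k, ('x, 'x) tensor) module"
  where "enveloping K R = alg_tensor K R (opposite R)"

text \<open>The right \<open>R\<^sup>e\<close>-module structure \<open>x \<cdot> (a \<otimes> b) = b x a\<close> on \<open>R\<close>.\<close>

definition env_right_action :: "('k, 'x, 'b) module_scheme \<Rightarrow> 'x \<Rightarrow> ('x, 'x) tensor \<Rightarrow> 'x"
  where "env_right_action R x t = tensor_lift R (\<lambda>a b. b \<otimes>\<^bsub>R\<^esub> x \<otimes>\<^bsub>R\<^esub> a) t"

definition restrict_scalars :: "('s \<Rightarrow> 'r) \<Rightarrow> ('r, 'm) module \<Rightarrow> ('s, 'm) module"
  where "restrict_scalars \<phi> M =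
    \<lparr>carrier = carrier M, monoid.mult = monoid.mult M, one = one M, zero = zero M, add = add M,
     smult = \<lambda>s m. \<phi> s \<odot>\<^bsub>M\<^esub> m\<rparr>"


section \<open>Cocommutative Hopf algebras and partial actions\<close>

record ('k, 'h) hopf = "('k, 'h) module" +
  comult :: "'h \<Rightarrow> ('h, 'h) tensor"
  counit :: "'h \<Rightarrow> 'k"
  antipode :: "'h \<Rightarrow> 'h"

text \<open>\<open>sweedler G H b h\<close> stands for \<open>b h\<^sub>1 h\<^sub>2\<close> (summation in \<open>G\<close> understood), and
  \<open>sweedler3 G H b h\<close> for \<open>b h\<^sub>1 h\<^sub>2 h\<^sub>3\<close>.\<close>

definition sweedler ::
  "('g, 'a) ring_scheme \<Rightarrow> ('k, 'h, 'b) hopf_scheme \<Rightarrow> ('h \<Rightarrow> 'h \<Rightarrow> 'g) \<Rightarrow> 'h \<Rightarrow> 'g"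
  where "sweedler G H b h = tensor_lift G b (comult H h)"

definition sweedler3 ::
  "('g, 'a) ring_scheme \<Rightarrow> ('k, 'h, 'b) hopf_scheme \<Rightarrow> ('h \<Rightarrow> 'h \<Rightarrow> 'h \<Rightarrow> 'g) \<Rightarrow> 'h \<Rightarrow> 'g"
  where "sweedler3 G H b h =
    sweedler G H (\<lambda>x y. sweedler G H (\<lambda>y' z. b x y' z) y) h"

locale hopf_algebra = k_algebra K H
  for K :: "('k, 'x) ring_scheme" (structure) and H :: "('k, 'h, 'y) hopf_scheme" (structure) +
  assumes comult_ring_hom: "comult H \<in> ring_hom H (alg_tensor K H H)"
    and comult_smult: "\<lbrakk>k \<in> carrier K; h \<in> carrier H\<rbrakk>
      \<Longrightarrow> comult H (k \<odot>\<^bsub>H\<^esub> h) = k \<odot>\<^bsub>alg_tensor K H H\<^esub> comult H h"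
    and counit_ring_hom: "counit H \<in> ring_hom H K"
    and counit_smult: "\<lbrakk>k \<in> carrier K; h \<in> carrier H\<rbrakk>
      \<Longrightarrow> counit H (k \<odot>\<^bsub>H\<^esub> h) = k \<otimes>\<^bsub>K\<^esub> counit H h"
    and coassoc: "h \<in> carrier H \<Longrightarrow>
      sweedler (ktensor K (ktensor K H H) H) H
        (\<lambda>x y. kpure K (ktensor K H H) H (comult H x) y) h =
      sweedler3 (ktensor K (ktensor K H H) H) H
        (\<lambda>x y z. kpure K (ktensor K H H) H (kpure K H H x y) z) h"
    and counit_left: "h \<in> carrier H \<Longrightarrow> sweedler H H (\<lambda>x y. counit H x \<odot>\<^bsub>H\<^esub> y) h = h"
    and counit_right: "h \<in> carrier H \<Longrightarrow> sweedler H H (\<lambda>x y. counit H y \<odot>\<^bsub>H\<^esub> x) h = h"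
    and antipode_closed: "antipode H \<in> carrier H \<rightarrow> carrier H"
    and antipode_add: "\<lbrakk>g \<in> carrier H; h \<in> carrier H\<rbrakk>
      \<Longrightarrow> antipode H (g \<oplus>\<^bsub>H\<^esub> h) = antipode H g \<oplus>\<^bsub>H\<^esub> antipode H h"
    and antipode_smult: "\<lbrakk>k \<in> carrier K; h \<in> carrier H\<rbrakk>
      \<Longrightarrow> antipode H (k \<odot>\<^bsub>H\<^esub> h) = k \<odot>\<^bsub>H\<^esub> antipode H h"
    and antipode_left: "h \<in> carrier H \<Longrightarrow>
      sweedler H H (\<lambda>x y. antipode H x \<otimes>\<^bsub>H\<^esub> y) h = counit H h \<odot>\<^bsub>H\<^esub> \<one>\<^bsub>H\<^esub>"
    and antipode_right: "h \<in> carrier H \<Longrightarrow>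
      sweedler H H (\<lambda>x y. x \<otimes>\<^bsub>H\<^esub> antipode H y) h = counit H h \<odot>\<^bsub>H\<^esub> \<one>\<^bsub>H\<^esub>"

locale cocommutative_hopf_algebra = hopf_algebra +
  assumes cocommutative: "h \<in> carrier H \<Longrightarrow>
    sweedler (ktensor K H H) H (\<lambda>x y. kpure K H H y x) h = comult H h"

text \<open>A linear map \<open>H \<otimes> A \<rightarrow> A\<close> is given as a \<open>K\<close>-bilinear function.\<close>

locale symmetric_partial_action =
  hopf_algebra K H + A: k_algebra K A
  for K :: "('k, 'x) ring_scheme" (structure) and H :: "('k, 'h, 'y) hopf_scheme" (structure)
    and A :: "('k, 'a, 'z) module_scheme" (structure) and act :: "'h \<Rightarrow> 'a \<Rightarrow> 'a" +
  assumes act_closed: "\<lbrakk>h \<in> carrier H; a \<in> carrier A\<rbrakk> \<Longrightarrow> act h a \<in> carrier A"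
    and act_add_left: "\<lbrakk>g \<in> carrier H; h \<in> carrier H; a \<in> carrier A\<rbrakk>
      \<Longrightarrow> act (g \<oplus>\<^bsub>H\<^esub> h) a = act g a \<oplus>\<^bsub>A\<^esub> act h a"
    and act_smult_left: "\<lbrakk>k \<in> carrier K; h \<in> carrier H; a \<in> carrier A\<rbrakk>
      \<Longrightarrow> act (k \<odot>\<^bsub>H\<^esub> h) a = k \<odot>\<^bsub>A\<^esub> act h a"
    and act_add_right: "\<lbrakk>h \<in> carrier H; a \<in> carrier A; b \<in> carrier A\<rbrakk>
      \<Longrightarrow> act h (a \<oplus>\<^bsub>A\<^esub> b) = act h a \<oplus>\<^bsub>A\<^esub> act h b"
    and act_smult_right: "\<lbrakk>k \<in> carrier K; h \<in> carrier H; a \<in> carrier A\<rbrakk>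
      \<Longrightarrow> act h (k \<odot>\<^bsub>A\<^esub> a) = k \<odot>\<^bsub>A\<^esub> act h a"
    and act_one: "a \<in> carrier A \<Longrightarrow> act \<one>\<^bsub>H\<^esub> a = a"
    and act_mult: "\<lbrakk>h \<in> carrier H; a \<in> carrier A; b \<in> carrier A\<rbrakk>
      \<Longrightarrow> act h (a \<otimes>\<^bsub>A\<^esub> b) = sweedler A H (\<lambda>x y. act x a \<otimes>\<^bsub>A\<^esub> act y b) h"
    and act_act: "\<lbrakk>h \<in> carrier H; g \<in> carrier H; a \<in> carrier A\<rbrakk>
      \<Longrightarrow> act h (act g a) = sweedler A H (\<lambda>x y. act x \<one>\<^bsub>A\<^esub> \<otimes>\<^bsub>A\<^esub> act (y \<otimes>\<^bsub>H\<^esub> g) a) h"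
    and act_act_symmetric: "\<lbrakk>h \<in> carrier H; g \<in> carrier H; a \<in> carrier A\<rbrakk>
      \<Longrightarrow> act h (act g a) = sweedler A H (\<lambda>x y. act (x \<otimes>\<^bsub>H\<^esub> g) a \<otimes>\<^bsub>A\<^esub> act y \<one>\<^bsub>A\<^esub>) h"


section \<open>The partial smash product\<close>

text \<open>The associative, in general non-unital, algebra \<open>A \<otimes> H\<close>. Its element \<open>1 \<otimes> 1\<close> is
  idempotent and a left unit, hence a two-sided unit of \<open>A # H = (A \<otimes> H)(1 \<otimes> 1)\<close>; this is why
  it is stored in the field \<^const>\<open>one\<close>.\<close>

definition smash_ambient ::
  "('k, 'x) ring_scheme \<Rightarrow> ('k, 'h, 'y) hopf_scheme \<Rightarrow> ('k, 'a, 'z) module_scheme \<Rightarrow>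
    ('h \<Rightarrow> 'a \<Rightarrow> 'a) \<Rightarrow> ('k, ('a, 'h) tensor) module"
  where "smash_ambient K H A act = (ktensor K A H)
    \<lparr>monoid.mult := \<lambda>u v.
        tensor_lift (ktensor K A H) (\<lambda>a h.
          tensor_lift (ktensor K A H) (\<lambda>b g.
            sweedler (ktensor K A H) H (\<lambda>x y.
              kpure K A H (a \<otimes>\<^bsub>A\<^esub> act x b) (y \<otimes>\<^bsub>H\<^esub> g)) h) v) u,
     one := kpure K A H \<one>\<^bsub>A\<^esub> \<one>\<^bsub>H\<^esub>\<rparr>"

definition smash ::
  "('k, 'x) ring_scheme \<Rightarrow> ('k, 'h, 'y) hopf_scheme \<Rightarrow> ('k, 'a, 'z) module_scheme \<Rightarrow>
    ('h \<Rightarrow> 'a \<Rightarrow> 'a) \<Rightarrow> ('k, ('a, 'h) tensor) module"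
  where "smash K H A act = (let P = smash_ambient K H A act
    in P\<lparr>carrier := {u \<otimes>\<^bsub>P\<^esub> kpure K A H \<one>\<^bsub>A\<^esub> \<one>\<^bsub>H\<^esub> | u. u \<in> carrier P}\<rparr>)"

definition smash_elem ::
  "('k, 'x) ring_scheme \<Rightarrow> ('k, 'h, 'y) hopf_scheme \<Rightarrow> ('k, 'a, 'z) module_scheme \<Rightarrow>
    ('h \<Rightarrow> 'a \<Rightarrow> 'a) \<Rightarrow> 'a \<Rightarrow> 'h \<Rightarrow> ('a, 'h) tensor"
  where "smash_elem K H A act a h =
    sweedler (ktensor K A H) H (\<lambda>x y. kpure K A H (a \<otimes>\<^bsub>A\<^esub> act x \<one>\<^bsub>A\<^esub>) y) h"

abbreviation smash_env ::
  "('k, 'x) ring_scheme \<Rightarrow> ('k, 'h, 'y) hopf_scheme \<Rightarrow> ('k, 'a, 'z) module_scheme \<Rightarrow>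
    ('h \<Rightarrow> 'a \<Rightarrow> 'a) \<Rightarrow> ('k, (('a, 'h) tensor, ('a, 'h) tensor) tensor) module"
  where "smash_env K H A act \<equiv> enveloping K (smash K H A act)"

text \<open>The left \<open>A\<^sup>e\<close>-module underlying a left \<open>(A # H)\<^sup>e\<close>-module, along \<open>a \<mapsto> a # 1\<close>.\<close>

definition base_restriction ::
  "('k, 'x) ring_scheme \<Rightarrow> ('k, 'h, 'y) hopf_scheme \<Rightarrow> ('k, 'a, 'z) module_scheme \<Rightarrow>
    ('h \<Rightarrow> 'a \<Rightarrow> 'a) \<Rightarrow> ((('a, 'h) tensor, ('a, 'h) tensor) tensor, 'm) module \<Rightarrow>
    (('a, 'a) tensor, 'm) module"
  where "base_restriction K H A act = restrict_scalars
    (tensor_lift (smash_env K H A act) (\<lambda>a b.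
      kpure K (smash K H A act) (opposite (smash K H A act))
        (smash_elem K H A act a \<one>\<^bsub>H\<^esub>) (smash_elem K H A act b \<one>\<^bsub>H\<^esub>)))"


section \<open>The tensor algebra and the algebra \<open>H\<^sub>p\<^sub>a\<^sub>r\<close>\<close>

text \<open>The free algebra \<open>K\<langle>S\<rangle>\<close>: finitely supported functions on words, with convolution.\<close>

definition free_algebra :: "('k, 'x) ring_scheme \<Rightarrow> 's set \<Rightarrow> ('k, 's list \<Rightarrow> 'k) module"
  where "free_algebra K S =
    \<lparr>carrier = {f. (\<forall>w. f w \<in> carrier K) \<and> finite {w. f w \<noteq> \<zero>\<^bsub>K\<^esub>} \<and>
                  {w. f w \<noteq> \<zero>\<^bsub>K\<^esub>} \<subseteq> lists S},
     monoid.mult = \<lambda>f g w. \<Oplus>\<^bsub>K\<^esub>i \<in> {..length w}. f (take i w) \<otimes>\<^bsub>K\<^esub> g (drop i w),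
     one = \<lambda>w. if w = [] then \<one>\<^bsub>K\<^esub> else \<zero>\<^bsub>K\<^esub>,
     zero = \<lambda>w. \<zero>\<^bsub>K\<^esub>,
     add = \<lambda>f g w. f w \<oplus>\<^bsub>K\<^esub> g w,
     smult = \<lambda>k f w. k \<otimes>\<^bsub>K\<^esub> f w\<rparr>"

definition free_gen :: "('k, 'x) ring_scheme \<Rightarrow> 's \<Rightarrow> 's list \<Rightarrow> 'k"
  where "free_gen K s = (\<lambda>w. if w = [s] then \<one>\<^bsub>K\<^esub> else \<zero>\<^bsub>K\<^esub>)"

definition quotient_algebra ::
  "('k, 'a, 'z) module_scheme \<Rightarrow> 'a set \<Rightarrow> ('k, 'a set) module"
  where "quotient_algebra R I =
    \<lparr>carrier = carrier (R Quot I), monoid.mult = monoid.mult (R Quot I), one = one (R Quot I),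
     zero = zero (R Quot I), add = add (R Quot I),
     smult = \<lambda>k X. \<Union>x \<in> X. I +>\<^bsub>R\<^esub> (k \<odot>\<^bsub>R\<^esub> x)\<rparr>"

text \<open>The ideal below is homogeneous, and its part of degree \<open>n\<close> is the submodule of the free module
  on the words of length \<open>n\<close> (i.e. on \<open>H\<^sup>n\<close>) generated by the multilinearity relations. So the
  quotient is \<open>\<Oplus>\<^sub>n H\<^sup>\<otimes>\<^sup>n\<close>, with the concatenation product.\<close>

definition tensor_alg_rels ::
  "('k, 'x) ring_scheme \<Rightarrow> ('k, 'h, 'y) module_scheme \<Rightarrow> ('h list \<Rightarrow> 'k) set"
  where "tensor_alg_rels K H = (let F = free_algebra K (carrier H) in
      {free_gen K (g \<oplus>\<^bsub>H\<^esub> h) \<ominus>\<^bsub>F\<^esub> (free_gen K g \<oplus>\<^bsub>F\<^esub> free_gen K h) | g h.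
        g \<in> carrier H \<and> h \<in> carrier H}
    \<union> {free_gen K (k \<odot>\<^bsub>H\<^esub> h) \<ominus>\<^bsub>F\<^esub> k \<odot>\<^bsub>F\<^esub> free_gen K h | k h.
        k \<in> carrier K \<and> h \<in> carrier H})"

definition tensor_alg_ideal ::
  "('k, 'x) ring_scheme \<Rightarrow> ('k, 'h, 'y) module_scheme \<Rightarrow> ('h list \<Rightarrow> 'k) set"
  where "tensor_alg_ideal K H = Idl\<^bsub>free_algebra K (carrier H)\<^esub> (tensor_alg_rels K H)"

definition tensor_algebra ::
  "('k, 'x) ring_scheme \<Rightarrow> ('k, 'h, 'y) module_scheme \<Rightarrow> ('k, ('h list \<Rightarrow> 'k) set) module"
  where "tensor_algebra K H =
    quotient_algebra (free_algebra K (carrier H)) (tensor_alg_ideal K H)"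

definition tensor_gen ::
  "('k, 'x) ring_scheme \<Rightarrow> ('k, 'h, 'y) module_scheme \<Rightarrow> 'h \<Rightarrow> ('h list \<Rightarrow> 'k) set"
  where "tensor_gen K H h = tensor_alg_ideal K H +>\<^bsub>free_algebra K (carrier H)\<^esub> free_gen K h"

type_synonym ('k, 'h) par = "('h list \<Rightarrow> 'k) set set"

definition par_rels ::
  "('k, 'x) ring_scheme \<Rightarrow> ('k, 'h, 'y) hopf_scheme \<Rightarrow> ('h list \<Rightarrow> 'k) set set"
  where "par_rels K H = (let T = tensor_algebra K H; \<iota> = tensor_gen K H; S = antipode H in
      {\<iota> \<one>\<^bsub>H\<^esub> \<ominus>\<^bsub>T\<^esub> \<one>\<^bsub>T\<^esub>}
    \<union> {sweedler T H (\<lambda>x y. \<iota> h \<otimes>\<^bsub>T\<^esub> \<iota> x \<otimes>\<^bsub>T\<^esub> \<iota> (S y) \<ominus>\<^bsub>T\<^esub> \<iota> (h \<otimes>\<^bsub>H\<^esub> x) \<otimes>\<^bsub>T\<^esub> \<iota> (S y)) k | h k.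
        h \<in> carrier H \<and> k \<in> carrier H}
    \<union> {sweedler T H (\<lambda>x y. \<iota> x \<otimes>\<^bsub>T\<^esub> \<iota> (S y) \<otimes>\<^bsub>T\<^esub> \<iota> k \<ominus>\<^bsub>T\<^esub> \<iota> x \<otimes>\<^bsub>T\<^esub> \<iota> (S y \<otimes>\<^bsub>H\<^esub> k)) h | h k.
        h \<in> carrier H \<and> k \<in> carrier H}
    \<union> {sweedler T H (\<lambda>x y. \<iota> h \<otimes>\<^bsub>T\<^esub> \<iota> (S x) \<otimes>\<^bsub>T\<^esub> \<iota> y \<ominus>\<^bsub>T\<^esub> \<iota> (h \<otimes>\<^bsub>H\<^esub> S x) \<otimes>\<^bsub>T\<^esub> \<iota> y) k | h k.
        h \<in> carrier H \<and> k \<in> carrier H}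
    \<union> {sweedler T H (\<lambda>x y. \<iota> (S x) \<otimes>\<^bsub>T\<^esub> \<iota> y \<otimes>\<^bsub>T\<^esub> \<iota> k \<ominus>\<^bsub>T\<^esub> \<iota> (S x) \<otimes>\<^bsub>T\<^esub> \<iota> (y \<otimes>\<^bsub>H\<^esub> k)) h | h k.
        h \<in> carrier H \<and> k \<in> carrier H})"

definition par_ideal ::
  "('k, 'x) ring_scheme \<Rightarrow> ('k, 'h, 'y) hopf_scheme \<Rightarrow> ('h list \<Rightarrow> 'k) set set"
  where "par_ideal K H = Idl\<^bsub>tensor_algebra K H\<^esub> (par_rels K H)"

definition Hpar :: "('k, 'x) ring_scheme \<Rightarrow> ('k, 'h, 'y) hopf_scheme \<Rightarrow> ('k, ('k, 'h) par) module"
  where "Hpar K H = quotient_algebra (tensor_algebra K H) (par_ideal K H)"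

definition par_class ::
  "('k, 'x) ring_scheme \<Rightarrow> ('k, 'h, 'y) hopf_scheme \<Rightarrow> 'h \<Rightarrow> ('k, 'h) par"
  where "par_class K H h = par_ideal K H +>\<^bsub>tensor_algebra K H\<^esub> tensor_gen K H h"

text \<open>\<open>par_extend K V \<phi>\<close> is the \<open>K\<close>-linear map from \<open>H\<^sub>p\<^sub>a\<^sub>r\<close> to the \<open>K\<close>-module \<open>V\<close> with
  \<open>[h\<^sub>1]\<cdots>[h\<^sub>n] \<mapsto> \<phi> [h\<^sub>1, \<dots>, h\<^sub>n]\<close> (for \<open>\<phi>\<close> compatible with the relations), computed on
  an arbitrary representative in the free algebra. It extends module structures that are given on
  the generators \<open>[h]\<close> only.\<close>

definition par_extend ::
  "('k, 'x) ring_scheme \<Rightarrow> ('k, 'v, 'y) module_scheme \<Rightarrow> ('h list \<Rightarrow> 'v) \<Rightarrow> ('k, 'h) par \<Rightarrow> 'v"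
  where "par_extend K V \<phi> z =
    (let t = (SOME t. t \<in> z); f = (SOME f. f \<in> t)
     in \<Oplus>\<^bsub>V\<^esub>w \<in> {w. f w \<noteq> \<zero>\<^bsub>K\<^esub>}. f w \<odot>\<^bsub>V\<^esub> \<phi> w)"

definition par_left_action ::
  "('k, 'x) ring_scheme \<Rightarrow> ('k, 'v, 'y) module_scheme \<Rightarrow> ('h \<Rightarrow> 'v \<Rightarrow> 'v) \<Rightarrow>
    ('k, 'h) par \<Rightarrow> 'v \<Rightarrow> 'v"
  where "par_left_action K V \<alpha> z v = par_extend K V (\<lambda>w. foldr \<alpha> w v) z"

definition par_right_action ::
  "('k, 'x) ring_scheme \<Rightarrow> ('k, 'v, 'y) module_scheme \<Rightarrow> ('v \<Rightarrow> 'h \<Rightarrow> 'v) \<Rightarrow>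
    'v \<Rightarrow> ('k, 'h) par \<Rightarrow> 'v"
  where "par_right_action K V \<beta> v z = par_extend K V (\<lambda>w. foldl \<beta> v w) z"

definition par_e :: "('k, 'x) ring_scheme \<Rightarrow> ('k, 'h, 'y) hopf_scheme \<Rightarrow> 'h \<Rightarrow> ('k, 'h) par"
  where "par_e K H h = sweedler (Hpar K H) H
    (\<lambda>x y. par_class K H x \<otimes>\<^bsub>Hpar K H\<^esub> par_class K H (antipode H y)) h"

definition generated_subalgebra ::
  "('k, 'x) ring_scheme \<Rightarrow> ('k, 'a, 'z) module_scheme \<Rightarrow> 'a set \<Rightarrow> 'a set"
  where "generated_subalgebra K R S =
    \<Inter>{U. subring U R \<and> (\<forall>k \<in> carrier K. \<forall>u \<in> U. k \<odot>\<^bsub>R\<^esub> u \<in> U) \<and> S \<subseteq> U}"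

definition B_alg :: "('k, 'x) ring_scheme \<Rightarrow> ('k, 'h, 'y) hopf_scheme \<Rightarrow> ('k, ('k, 'h) par) module"
  where "B_alg K H = (Hpar K H)
    \<lparr>carrier := generated_subalgebra K (Hpar K H) (par_e K H ` carrier H)\<rparr>"

text \<open>The right \<open>H\<^sub>p\<^sub>a\<^sub>r\<close>-module structure determined by \<open>b \<triangleleft> [h] = [S(h\<^sub>1)] b [h\<^sub>2]\<close>.\<close>

definition B_right_action ::
  "('k, 'x) ring_scheme \<Rightarrow> ('k, 'h, 'y) hopf_scheme \<Rightarrow> ('k, 'h) par \<Rightarrow> ('k, 'h) par \<Rightarrow> ('k, 'h) par"
  where "B_right_action K H = par_right_action K (B_alg K H)
    (\<lambda>b h. sweedler (Hpar K H) H
      (\<lambda>x y. par_class K H (antipode H x) \<otimes>\<^bsub>Hpar K H\<^esub> b \<otimes>\<^bsub>Hpar K H\<^esub> par_class K H y) h)"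


section \<open>The functors\<close>

text \<open>\<open>[h] \<triangleright> (a \<otimes> m) = (h\<^sub>1 \<cdot> a) \<otimes> (1 # h\<^sub>2) \<cdot> m \<cdot> (1 # S(h\<^sub>3))\<close>, where \<open>M\<close> is the given
  left \<open>(A # H)\<^sup>e\<close>-module, so that \<open>u \<cdot> m \<cdot> v = (u \<otimes> v) \<cdot> m\<close>.\<close>

definition F1_generator_action ::
  "('k, 'x) ring_scheme \<Rightarrow> ('k, 'h, 'y) hopf_scheme \<Rightarrow> ('k, 'a, 'z) module_scheme \<Rightarrow>
    ('h \<Rightarrow> 'a \<Rightarrow> 'a) \<Rightarrow> ((('a, 'h) tensor, ('a, 'h) tensor) tensor, 'm) module \<Rightarrow>
    'h \<Rightarrow> ('a, 'm) tensor \<Rightarrow> ('a, 'm) tensor"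
  where "F1_generator_action K H A act M h =
    (let N = base_restriction K H A act M;
         T = tensor_product (enveloping K A) (env_right_action A) A N;
         P = smash K H A act
     in tensor_lift T (\<lambda>a m. sweedler3 T H (\<lambda>x y z.
          pure_tensor (enveloping K A) (env_right_action A) A N (act x a)
            (kpure K P (opposite P) (smash_elem K H A act \<one>\<^bsub>A\<^esub> y)
               (smash_elem K H A act \<one>\<^bsub>A\<^esub> (antipode H z)) \<odot>\<^bsub>M\<^esub> m)) h))"

definition F1_object ::
  "('k, 'x) ring_scheme \<Rightarrow> ('k, 'h, 'y) hopf_scheme \<Rightarrow> ('k, 'a, 'z) module_scheme \<Rightarrow>
    ('h \<Rightarrow> 'a \<Rightarrow> 'a) \<Rightarrow> ((('a, 'h) tensor, ('a, 'h) tensor) tensor, 'm) module \<Rightarrow>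
    (('k, 'h) par, ('a, 'm) tensor) module"
  where "F1_object K H A act M =
    (let T = tensor_product (enveloping K A) (env_right_action A) A (base_restriction K H A act M)
     in \<lparr>carrier = carrier T, monoid.mult = undefined, one = undefined,
         zero = zero T, add = add T,
         smult = par_left_action K T (F1_generator_action K H A act M)\<rparr>)"

definition F1_functor ::
  "('k, 'x) ring_scheme \<Rightarrow> ('k, 'h, 'y) hopf_scheme \<Rightarrow> ('k, 'a, 'z) module_scheme \<Rightarrow>
    ('h \<Rightarrow> 'a \<Rightarrow> 'a) \<Rightarrow>
    ((('a, 'h) tensor, ('a, 'h) tensor) tensor, 'm, ('k, 'h) par, ('a, 'm) tensor) mod_functor"
  where "F1_functor K H A act =
    (F1_object K H A act,
     \<lambda>M N. snd (tensor_functor (enveloping K A) (env_right_action A) A)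
       (base_restriction K H A act M) (base_restriction K H A act N))"

definition F2_functor ::
  "('k, 'x) ring_scheme \<Rightarrow> ('k, 'h, 'y) hopf_scheme \<Rightarrow>
    (('k, 'h) par, 'n, 'k, (('k, 'h) par, 'n) tensor) mod_functor"
  where "F2_functor K H = tensor_functor (Hpar K H) (B_right_action K H) (B_alg K H)"

definition F_functor ::
  "('k, 'x) ring_scheme \<Rightarrow> ('k, 'h, 'y) hopf_scheme \<Rightarrow> ('k, 'a, 'z) module_scheme \<Rightarrow>
    ('h \<Rightarrow> 'a \<Rightarrow> 'a) \<Rightarrow>
    ((('a, 'h) tensor, ('a, 'h) tensor) tensor, 'm, 'k, (('a, 'h) tensor, 'm) tensor) mod_functor"
  where "F_functor K H A act =
    tensor_functor (smash_env K H A act) (env_right_action (smash K H A act)) (smash K H A act)"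

end

theory Submission
 imports Defs
begin

text \<open>
  Both functors compute coinvariants of the bimodule \<open>M\<close>. For a unital algebra \<open>R\<close>,
  \<open>R \<otimes> M\<close> over \<open>R\<^sup>e\<close> is the quotient of \<open>M\<close> by all \<open>r m - m r\<close>, because every \<open>r \<otimes> m\<close> equals
  \<open>1 \<otimes> r m\<close> and \<open>1 \<otimes> m r\<close>. So \<open>F M\<close> identifies \<open>u m\<close> with \<open>m u\<close> for all \<open>u\<close> in \<open>A # H\<close>, and
  \<open>F\<^sub>1 M\<close> does so only for \<open>u\<close> in the image of \<open>A\<close>. On \<open>F\<^sub>1 M\<close> the class \<open>[h]\<close> acts by
  \<open>\<sigma> h = \<Sum> (1 # h\<^sub>1) _ (1 # S h\<^sub>2)\<close>. The right module \<open>B\<close> is generated by \<open>1\<close>, since \<open>1\<close> acted on by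
  \<open>b \<in> B\<close> is \<open>b\<close>, and \<open>1\<close> acted on by \<open>[h]\<close> is \<open>\<Sum> [S h\<^sub>1] [h\<^sub>2]\<close>. Hence \<open>F\<^sub>2 F\<^sub>1 M\<close> is the quotient of
  \<open>F\<^sub>1 M\<close> that identifies \<open>\<sigma> h m\<close> with \<open>\<tau> h m\<close>, where \<open>\<tau> h = \<Sum> \<sigma> (S h\<^sub>1) \<sigma> h\<^sub>2\<close>. It remains to see that
  both sets of relations on \<open>M\<close> generate the same subgroup. The comparison map is
  \<open>b \<otimes> (1 \<otimes> m) \<mapsto> 1 \<otimes> b m\<close> and its inverse is \<open>1 \<otimes> m \<mapsto> 1 \<otimes> (1 \<otimes> m)\<close>.

  The computation behind this would be short if \<open>H\<close> were a group algebra. Write \<open>\<lambda>\<^sub>g\<close> for left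
  multiplication by \<open>1 # g\<close>, \<open>\<rho>\<^sub>g\<close> for right multiplication by \<open>1 # g\<^sup>-\<^sup>1\<close>, and \<open>\<sigma>\<^sub>g = \<lambda>\<^sub>g \<rho>\<^sub>g\<close>. Then \<open>\<tau>\<^sub>g\<close>
  is left and right multiplication by the idempotent \<open>(g\<^sup>-\<^sup>1 \<cdot> 1) # 1\<close>, so modulo
  \<open>u m - m u\<close> both \<open>\<sigma>\<^sub>g m\<close> and \<open>\<tau>\<^sub>g m\<close> become \<open>((g\<^sup>-\<^sup>1 \<cdot> 1) # 1) m\<close> (lemma \<open>trace_points\<close>); conversely
  \<open>\<lambda>\<^sub>g m\<close> is \<open>\<sigma>\<^sub>g\<close> applied to \<open>m\<close> times \<open>1 # g\<close>, up to such idempotents (lemma \<open>trace_of_coinvariant\<close>).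

  A cocommutative Hopf algebra is a group object in cocommutative coalgebras, and this makes the
  group computation valid as it stands. For a cocommutative coalgebra \<open>C\<close> the coalgebra maps
  \<open>C \<rightarrow> H\<close>, called points here, form a group under convolution. A linear map \<open>\<phi>\<close> from \<open>H\<close> to an algebra
  \<open>E\<close> sends a point \<open>g\<close> to \<open>\<phi> \<circ> g\<close> in the convolution algebra of maps \<open>C \<rightarrow> E\<close>, and each identity of
  Sweedler type becomes an identity between such elements. Conversely an identity that holds for all
  points returns the Sweedler identity: evaluate it at the identity point of \<open>C = H\<close> when there is one
  variable, and at the two projections of \<open>C = H \<otimes> H\<close> when there are two (lemma
  \<open>bilinear_eq_of_points\<close>). Thus the axioms of \<open>H\<^sub>p\<^sub>a\<^sub>r\<close> turn into those of a partial representation of a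
  group, and a symmetric partial action into a partial action of a group (lemma \<open>act_on_d\<close>).
\<close>

no_notation scaleR (infixr \<open>*\<^sub>R\<close> 75)
abbreviation (input) mult_in ("_ *\<^sub>_ _" [70, 1000, 71] 70)
 where "x *\<^sub>R y == x \<otimes>\<^bsub>R\<^esub> y"
abbreviation (input) add_in ("_ +\<^sub>_ _" [65, 1000, 66] 65)
 where "x +\<^sub>R y == x \<oplus>\<^bsub>R\<^esub> y"
abbreviation (input) minus_in ("_ \<ominus>\<^sub>_ _" [65, 1000, 66] 65)
 where "x \<ominus>\<^sub>R y == x \<ominus>\<^bsub>R\<^esub> y"
abbreviation (input) smult_in ("_ *.\<^sub>_ _" [70, 1000, 71] 70)
 where "k *.\<^sub>M x == k \<odot>\<^bsub>M\<^esub> x"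
abbreviation (input) one_in ("1\<^sub>_" [1000] 1000)
 where "1\<^sub>R == \<one>\<^bsub>R\<^esub>"
abbreviation (input) cmp :: "('c, 'u) partial_object_scheme \<Rightarrow> ('p \<Rightarrow> 'q) \<Rightarrow> ('c \<Rightarrow> 'p) \<Rightarrow> 'c \<Rightarrow> 'q"
 where "cmp C == compose (carrier C)"
abbreviation (input) zero_in ("0\<^sub>_" [1000] 1000)
 where "0\<^sub>R == \<zero>\<^bsub>R\<^esub>"
abbreviation (input) U :: "('c, 'u) partial_object_scheme \<Rightarrow> 'c set"
 where "U == carrier"

type_synonym ('a, 'h, 'm) smash_bimod = "((('a, 'h) tensor, ('a, 'h) tensor) tensor, 'm) module"

type_synonym ('a, 'h, 'm, 'k) composite_functor = "((('a, 'h) tensor, ('a, 'h) tensor) tensor, 'm, 'k, (('k, 'h) par, ('a, 'm) tensor) tensor) mod_functor"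

section \<open>Tensor products over a noncommutative ring\<close>

definition frag_lift :: "('g, 'a) ring_scheme => ('p => 'g) => ('p \<Rightarrow>\<^sub>0 int) => 'g"
 where "frag_lift G f c = (\<Oplus>\<^bsub>G\<^esub>p \<in> Poly_Mapping.keys c. [Poly_Mapping.lookup c p] \<cdot>\<^bsub>G\<^esub> f p)"

context abelian_group
begin

lemma add_pow_int_closed: "x \<in> U G ==> [(n::int)] \<cdot> x \<in> U G"
 by (rule add.int_pow_closed)

lemma eq_of_minus_eq_zero:
 assumes "x \<ominus> y = \<zero>" "x \<in> U G" "y \<in> U G" shows "x = y"
 using assms by (metis a_minus_def add.inv_closed minus_equality minus_minus)

lemma add_minus_add_minus:
 assumes "x \<in> U G" "y \<in> U G"
 shows "x \<oplus> (y \<oplus> (\<ominus> x \<oplus> \<ominus> y)) = \<zero>"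
proof -
 have "(x \<oplus> y) \<oplus> \<ominus> (x \<oplus> y) = \<zero>" using assms by (simp add: r_neg)
 then show ?thesis using assms by (simp add: minus_add a_assoc)
qed

lemma frag_lift_superset:
 assumes "f \<in> S \<rightarrow> U G" "finite S" "Poly_Mapping.keys c <= S"
 shows "frag_lift G f c = (\<Oplus>p \<in> S. [Poly_Mapping.lookup c p] \<cdot> f p)"
 unfolding frag_lift_def
proof (rule add.finprod_mono_neutral_cong_left)
 show "[Poly_Mapping.lookup c p] \<cdot> f p = \<zero>" if "p \<in> S - Poly_Mapping.keys c" for p
  using that by (simp add: in_keys_iff add_pow_def)
qed (use assms in \<open>auto intro: add_pow_int_closed\<close>)

lemma frag_lift_closed:
 assumes "f \<in> S \<rightarrow> U G" "Poly_Mapping.keys c <= S"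
 shows "frag_lift G f c \<in> U G"
 unfolding frag_lift_def using assms by (auto intro!: add.finprod_closed add_pow_int_closed)

lemma frag_lift_add:
 assumes f: "f \<in> S \<rightarrow> U G" and c: "Poly_Mapping.keys c <= S" and d: "Poly_Mapping.keys d <= S"
 shows "frag_lift G f (c + d) = frag_lift G f c \<oplus> frag_lift G f d"
proof -
 let ?U = "Poly_Mapping.keys c \<union> Poly_Mapping.keys d"
 have fU: "f \<in> ?U \<rightarrow> U G" using f c d by auto
 have "frag_lift G f (c + d) = (\<Oplus>p \<in> ?U. [Poly_Mapping.lookup (c + d) p] \<cdot> f p)"
  by (rule frag_lift_superset[OF fU]) (auto dest: subsetD[OF keys_add])
 also have "... = (\<Oplus>p \<in> ?U. [Poly_Mapping.lookup c p] \<cdot> f p \<oplus> [Poly_Mapping.lookup d p] \<cdot> f p)"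
 proof (rule add.finprod_cong[OF refl])
  show "p \<in> ?U =simp=> [Poly_Mapping.lookup (c + d) p] \<cdot> f p
    = [Poly_Mapping.lookup c p] \<cdot> f p \<oplus> [Poly_Mapping.lookup d p] \<cdot> f p" for p
   using fU by (auto simp: simp_implies_def lookup_add add.int_pow_mult Pi_def)
 qed (use fU in \<open>auto intro!: add_pow_int_closed\<close>)
 also have "... = frag_lift G f c \<oplus> frag_lift G f d"
  using fU by (subst add.finprod_multf)
   (auto intro!: add_pow_int_closed simp: frag_lift_superset[OF fU])
 finally show ?thesis .
qed

lemma frag_lift_frag_of:
 assumes "f p \<in> U G"
 shows "frag_lift G f (frag_of p) = f p"
 using assms by (simp add: frag_lift_def add.int_pow_1)

lemma frag_lift_zero: "frag_lift G f 0 = \<zero>"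
 by (simp add: frag_lift_def)

lemma frag_lift_uminus:
 assumes f: "f \<in> S \<rightarrow> U G" and c: "Poly_Mapping.keys c <= S"
 shows "frag_lift G f (- c) = \<ominus> frag_lift G f c"
proof (rule minus_equality[symmetric])
 show "frag_lift G f (- c) \<oplus> frag_lift G f c = \<zero>"
  using frag_lift_add[OF f, of "- c" c] c by (simp add: frag_lift_zero)
qed (use frag_lift_closed[OF f] c in auto)

lemma frag_lift_diff:
 assumes f: "f \<in> S \<rightarrow> U G" and "Poly_Mapping.keys c <= S" "Poly_Mapping.keys d <= S"
 shows "frag_lift G f (c - d) = frag_lift G f c \<ominus> frag_lift G f d"
 using frag_lift_add[OF f, of c "- d"] frag_lift_uminus[OF f, of d] assms by (simp add: a_minus_def)

lemma frag_lift_hom: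
 "f \<in> S \<rightarrow> U G ==> frag_lift G f \<in> hom (free_Abelian_group S) (add_monoid G)"
 by (rule homI) (auto intro: frag_lift_closed frag_lift_add)

end

locale tensor_data =
 fixes R :: "('r, 'a) ring_scheme" and ra :: "'x => 'r => 'x"
  and X :: "('k, 'x, 'b) module_scheme" and M :: "('r, 'm, 'c) module_scheme"
 assumes X: "abelian_group X" and M: "abelian_group M"
  and ra_closed: "[|x \<in> U X; r \<in> U R|] ==> ra x r \<in> U X"
  and sm_closed: "[|r \<in> U R; m \<in> U M|] ==> r *.\<^sub>M m \<in> U M"
begin

interpretation X: abelian_group X by (rule X)
interpretation M: abelian_group M by (rule M)

abbreviation (input) "FG == free_Abelian_group (U X \<times> U M)"
abbreviation (input) "RS == generate FG (tensor_rels R ra X M)"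
abbreviation (input) "TG == tensor_group R ra X M"
abbreviation (input) "T == tensor_product R ra X M"
abbreviation (input) "pt == pure_tensor R ra X M"

interpretation FG: comm_group FG by (rule abelian_free_Abelian_group)

lemma rels_closed: "tensor_rels R ra X M <= U FG"
 unfolding tensor_rels_def by (auto dest!: subsetD[OF keys_diff] simp: ra_closed sm_closed split: if_splits)

interpretation RS: normal RS FG
 by (rule FG.subgroup_imp_normal, rule FG.generate_is_subgroup, rule rels_closed)

interpretation TG: comm_group TG
 unfolding tensor_group_def Let_def by (rule FG.abelian_FactGroup) (rule RS.is_subgroup)

lemma T_carrier: "U T = U TG"
 and T_zero: "0\<^sub>T = 1\<^sub>TG"
 and T_add: "add T = monoid.mult TG"
 by (simp_all add: tensor_product_def tensor_additive_def Let_def)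

lemma T_abelian_group: "abelian_group T"
proof (rule abelian_groupI)
 show "EX y:U T. y +\<^sub>T x = 0\<^sub>T" if "x \<in> U T" for x
  using that unfolding T_carrier T_zero T_add by (intro bexI[of _ "inv\<^bsub>TG\<^esub> x"]) auto
qed (auto simp: T_carrier T_zero T_add TG.m_assoc TG.m_comm TG.m_lcomm)

interpretation T: abelian_group T by (rule T_abelian_group)

lemma TG_eq: "TG = FG Mod RS"
 by (simp add: tensor_group_def Let_def)

definition cs :: "('x \<times> 'm \<Rightarrow>\<^sub>0 int) => ('x, 'm) tensor"
 where "cs c = RS #>\<^bsub>FG\<^esub> c"

lemma coset_closed: "c \<in> U FG ==> cs c \<in> U T"
 unfolding cs_def T_carrier TG_eq by (auto simp: FactGroup_def RCOSETS_def)

lemma coset_add: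
 assumes "c \<in> U FG" "d \<in> U FG"
 shows "(cs c) +\<^sub>T (cs d) = cs (c + d)"
 unfolding cs_def T_add TG_eq using RS.rcos_sum[OF assms] by (simp add: FactGroup_def)

lemma coset_zero: "cs 0 = 0\<^sub>T"
proof -
 have "cs 1\<^sub>FG = RS" unfolding cs_def by (rule FG.coset_mult_one) (rule RS.subset)
 then show ?thesis unfolding T_zero TG_eq by (simp add: FactGroup_def)
qed

lemma coset_uminus:
 assumes "c \<in> U FG"
 shows "cs (- c) = \<ominus>\<^bsub>T\<^esub> (cs c)"
proof (rule T.minus_equality[symmetric])
 show "cs (- c) +\<^sub>T (cs c) = 0\<^sub>T"
  using coset_add[of "- c" c] assms by (simp add: coset_zero)
qed (use assms in \<open>auto intro!: coset_closed\<close>)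

lemma coset_diff:
 assumes "c \<in> U FG" "d \<in> U FG"
 shows "cs (c - d) = (cs c) \<ominus>\<^sub>T (cs d)"
 using coset_add[of c "- d"] coset_uminus[of d] assms by (simp add: a_minus_def)

lemma coset_rel:
 assumes "c \<in> tensor_rels R ra X M"
 shows "cs c = 0\<^sub>T"
proof -
 have "c \<in> RS" using assms by (rule generate.incl)
 then have "cs c = RS"
  unfolding cs_def using RS.rcos_const by blast
 then show ?thesis unfolding T_zero TG_eq by (simp add: FactGroup_def)
qed

lemma pure_def': "pt x m = cs (frag_of (x, m))"
 by (simp add: pure_tensor_def Let_def cs_def)

lemma pure_closed: "[|x \<in> U X; m \<in> U M|] ==> pt x m \<in> U T"
 unfolding pure_def' by (rule coset_closed) simp

lemma pure_rel3:
 assumes "frag_of a - frag_of b - frag_of c \<in> tensor_rels R ra X M"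
  "a \<in> U X \<times> U M" "b \<in> U X \<times> U M" "c \<in> U X \<times> U M"
 shows "cs (frag_of a) = cs (frag_of b) +\<^sub>T cs (frag_of c)"
proof -
 have fr: "frag_of a \<in> U FG" "frag_of b \<in> U FG" "frag_of c \<in> U FG"
  using assms by auto
 then have "frag_of a - frag_of b \<in> U FG"
  by (auto dest!: subsetD[OF keys_diff])
 then have "cs (frag_of a) \<ominus>\<^sub>T cs (frag_of b) \<ominus>\<^sub>T cs (frag_of c) = 0\<^sub>T"
  using coset_rel[OF assms(1)] fr by (simp add: coset_diff)
 then have "cs (frag_of a) \<ominus>\<^sub>T cs (frag_of b) = cs (frag_of c)"
  by (rule T.eq_of_minus_eq_zero) (use coset_closed fr in auto)
 then have "cs (frag_of b) +\<^sub>T cs (frag_of c) = cs (frag_of b) +\<^sub>T (cs (frag_of a) +\<^sub>T \<ominus>\<^bsub>T\<^esub> cs (frag_of b))"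
  by (simp add: a_minus_def)
 also have "... = cs (frag_of a)"
  using coset_closed[OF fr(1)] coset_closed[OF fr(2)] by (simp add: T.a_lcomm T.r_neg)
 finally show ?thesis ..
qed

lemma pure_add_left:
 "[|x \<in> U X; y \<in> U X; m \<in> U M|] ==> pt (x +\<^sub>X y) m = pt x m +\<^sub>T pt y m"
 unfolding pure_def' by (rule pure_rel3) (auto simp: tensor_rels_def)

lemma pure_add_right:
 "[|x \<in> U X; m \<in> U M; n \<in> U M|] ==> pt x (m +\<^sub>M n) = pt x m +\<^sub>T pt x n"
 unfolding pure_def' by (rule pure_rel3) (auto simp: tensor_rels_def)

lemma pure_balanced:
 assumes "x \<in> U X" "r \<in> U R" "m \<in> U M"
 shows "pt (ra x r) m = pt x (r *.\<^sub>M m)"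
proof -
 have fr: "frag_of (ra x r, m) \<in> U FG" "frag_of (x, r *.\<^sub>M m) \<in> U FG"
  using assms by (auto intro: ra_closed sm_closed)
 have "cs (frag_of (ra x r, m)) \<ominus>\<^sub>T cs (frag_of (x, r *.\<^sub>M m)) = 0\<^sub>T"
 proof (subst coset_diff[symmetric, OF fr], rule coset_rel)
  show "frag_of (ra x r, m) - frag_of (x, r *.\<^sub>M m) \<in> tensor_rels R ra X M"
   unfolding tensor_rels_def using assms by blast
 qed
 then show ?thesis unfolding pure_def'
  by (rule T.eq_of_minus_eq_zero) (use coset_closed[OF fr(1)] coset_closed[OF fr(2)] in auto)
qed

lemma pure_uminus_left:
 assumes "x \<in> U X" "m \<in> U M"
 shows "pt (\<ominus>\<^bsub>X\<^esub> x) m = \<ominus>\<^bsub>T\<^esub> pt x m"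
proof (rule T.minus_equality[symmetric])
 have z: "pt 0\<^sub>X m = 0\<^sub>T"
  using pure_add_left[of "0\<^sub>X" "0\<^sub>X" m] assms pure_closed[of "0\<^sub>X" m]
  by simp
 show "pt (\<ominus>\<^bsub>X\<^esub> x) m +\<^sub>T pt x m = 0\<^sub>T"
  using pure_add_left[of "\<ominus>\<^bsub>X\<^esub> x" x m] assms by (simp add: z X.l_neg)
qed (use assms in \<open>auto intro!: pure_closed\<close>)

lemma tensor_induct [consumes 1, case_names pure add]:
 assumes t: "t \<in> U T"
  and pure: "!!x m. [|x \<in> U X; m \<in> U M|] ==> P (pt x m)"
  and add: "!!s t. [|s \<in> U T; t \<in> U T; P s; P t|] ==> P (s +\<^sub>T t)"
 shows "P t"
proof -
 have z: "pt 0\<^sub>X 0\<^sub>M = 0\<^sub>T"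
  using pure_add_left[of "0\<^sub>X" "0\<^sub>X" "0\<^sub>M"] pure_closed[of "0\<^sub>X" "0\<^sub>M"]
  by simp
 have "Poly_Mapping.keys c <= U X \<times> U M ==>
   P (cs c) & P (\<ominus>\<^bsub>T\<^esub> (cs c))" for c
 proof (induction c rule: free_Abelian_group_induct[consumes 1, case_names 1 2 3])
  case 1
  have m: "\<ominus>\<^bsub>T\<^esub> 0\<^sub>T = 0\<^sub>T" by (rule T.minus_equality) auto
  have "P 0\<^sub>T" using pure[of "0\<^sub>X" "0\<^sub>M"] by (simp add: z)
  then show ?case unfolding coset_zero m by simp
 next
  case (2 x y)
  then have xy: "x \<in> U FG" "y \<in> U FG" by auto
  note cl = coset_closed[OF xy(1)] coset_closed[OF xy(2)]
  have "\<ominus>\<^bsub>T\<^esub> ((cs x) \<ominus>\<^sub>T (cs y)) = \<ominus>\<^bsub>T\<^esub> (cs x) +\<^sub>T (cs y)"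
   using cl by (simp add: a_minus_def T.minus_add T.minus_minus)
  then show ?case
   using 2 cl by (auto simp: coset_diff[OF xy] a_minus_def intro!: add)
 next
  case (3 p)
  then show ?case
   using pure pure_uminus_left pure[of "\<ominus>\<^bsub>X\<^esub> fst p" "snd p"]
   by (cases p) (auto simp: pure_def')
 qed
 moreover obtain c where "c \<in> U FG" "t = cs c"
  using t unfolding T_carrier TG_eq by (auto simp: FactGroup_def RCOSETS_def cs_def)
 ultimately show ?thesis by auto
qed

end

definition balanced ::
 "('r, 'a) ring_scheme => ('x => 'r => 'x) => ('k, 'x, 'b) module_scheme =>
  ('r, 'm, 'c) module_scheme => ('g, 'd) ring_scheme => ('x => 'm => 'g) => bool"
 where "balanced R ra X M G b \<longleftrightarrow>
  (ALL x:U X. ALL m:U M. b x m \<in> U G) &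
  (ALL x:U X. ALL y:U X. ALL m:U M. b (x +\<^sub>X y) m = b x m +\<^sub>G b y m) &
  (ALL x:U X. ALL m:U M. ALL n:U M. b x (m +\<^sub>M n) = b x m +\<^sub>G b x n) &
  (ALL x:U X. ALL r:U R. ALL m:U M. b (ra x r) m = b x (r *.\<^sub>M m))"

context tensor_data
begin

lemma rep_some:
 assumes t: "t \<in> U T"
 shows "(SOME c. c \<in> t) \<in> U FG" and "cs (SOME c. c \<in> t) = t"
proof -
 interpret FG: comm_group FG by (rule abelian_free_Abelian_group)
 interpret RS: normal RS FG
  by (rule FG.subgroup_imp_normal, rule FG.generate_is_subgroup, rule rels_closed)
 obtain c where c: "c \<in> U FG" "t = cs c"
  using t unfolding T_carrier TG_eq by (auto simp: FactGroup_def RCOSETS_def cs_def)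
 then have "c \<in> t" using FG.rcos_self[OF c(1)] cs_def RS.is_subgroup by simp
 then have s: "(SOME c. c \<in> t) \<in> t" by (rule someI)
 then show "(SOME c. c \<in> t) \<in> U FG"
  using c FG.r_coset_subset_G[OF RS.subset c(1)] unfolding cs_def by blast
 show "cs (SOME c. c \<in> t) = t"
  using FG.repr_independence[of "SOME c. c \<in> t" RS c] s c RS.is_subgroup by (simp add: cs_def)
qed

lemma tensor_lift_eq_frag_lift:
 "tensor_lift G b t = frag_lift G (%p. b (fst p) (snd p)) (SOME c. c \<in> t)"
 by (simp add: tensor_lift_def frag_lift_def Let_def)

lemma lift_cong:
 assumes "abelian_group G" "t \<in> U T" "!!x m. [|x \<in> U X; m \<in> U M|] ==> b x m = b' x m"
  "!!x m. [|x \<in> U X; m \<in> U M|] ==> b' x m \<in> U G"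
 shows "tensor_lift G b t = tensor_lift G b' t"
proof -
 interpret G: abelian_group G by fact
 have k: "Poly_Mapping.keys (SOME c. c \<in> t) <= U X \<times> U M"
  using rep_some(1)[OF assms(2)] by simp
 show ?thesis
  unfolding tensor_lift_def Let_def using k assms(3,4)
  by (intro G.add.finprod_cong[OF refl]) (auto simp: simp_implies_def intro!: G.add_pow_int_closed)
qed

context
 fixes G :: "('g, 'd) ring_scheme" and b
 assumes G: "abelian_group G" and b: "balanced R ra X M G b"
begin

interpretation G: abelian_group G by (rule G)

abbreviation (input) "b' == %p. b (fst p) (snd p)"

lemma b_closed: "b' \<in> U X \<times> U M \<rightarrow> U G"
 using b by (auto simp: balanced_def)

lemma frag_lift_generate:
 assumes "c \<in> RS" shows "frag_lift G b' c = 0\<^sub>G"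
proof -
 interpret FG: comm_group FG by (rule abelian_free_Abelian_group)
 interpret h: group_hom FG "add_monoid G" "frag_lift G b'"
  by (unfold_locales) (rule G.frag_lift_hom[OF b_closed])
 have fl: "!!x m. [|x \<in> U X; m \<in> U M|] ==> frag_lift G b' (frag_of (x, m)) = b x m"
  using b by (subst G.frag_lift_frag_of) (auto simp: balanced_def)
 note diff = G.frag_lift_diff[OF b_closed]
 have kd: "Poly_Mapping.keys (frag_of p - frag_of q) <= U X \<times> U M"
  if "p \<in> U X \<times> U M" "q \<in> U X \<times> U M" for p q
  using that by (auto dest!: subsetD[OF keys_diff])
 have "tensor_rels R ra X M <= kernel FG (add_monoid G) (frag_lift G b')"
 proof
  fix c assume c: "c \<in> tensor_rels R ra X M"
  then have "c \<in> U FG" using rels_closed by blast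
  moreover have "frag_lift G b' c = 0\<^sub>G"
   using c b X M unfolding tensor_rels_def
   by (auto simp: diff kd fl ra_closed sm_closed balanced_def abelian_groupE(1) a_minus_def
     G.r_neg G.a_ac G.minus_add G.add.inv_mult_group G.r_neg1 G.r_neg2 G.add_minus_add_minus)
  ultimately show "c \<in> kernel FG (add_monoid G) (frag_lift G b')"
   by (simp add: kernel_def)
 qed
 then have "RS <= kernel FG (add_monoid G) (frag_lift G b')"
  by (rule FG.generate_subgroup_incl[OF _ h.subgroup_kernel])
 then show ?thesis using assms by (auto simp: kernel_def)
qed

text \<open>\<open>tensor_lift\<close> evaluates a coset at an arbitrary representative. The value does not depend on it, since a
  balanced map kills the defining relations.\<close>
lemma lift_coset:
 assumes c: "c \<in> U FG"
 shows "tensor_lift G b (cs c) = frag_lift G b' c"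
proof -
 interpret FG: comm_group FG by (rule abelian_free_Abelian_group)
 interpret RS: normal RS FG
  by (rule FG.subgroup_imp_normal, rule FG.generate_is_subgroup, rule rels_closed)
 let ?d = "SOME d. d \<in> cs c"
 have d: "?d \<in> U FG" "cs ?d = cs c"
  using rep_some[OF coset_closed[OF c]] by simp_all
 have "?d \<in> cs ?d" using FG.rcos_self[OF d(1) RS.is_subgroup] by (simp add: cs_def)
 then obtain r where r: "r \<in> RS" "?d = r + c"
  unfolding d(2) unfolding cs_def r_coset_def by auto
 have rc: "r \<in> U FG" using r RS.subset by blast
 show ?thesis
  unfolding tensor_lift_eq_frag_lift r(2)
  using G.frag_lift_add[OF b_closed, of r c] rc c frag_lift_generate[OF r(1)]
   G.frag_lift_closed[OF b_closed, of c] by simp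
qed

lemma lift_closed: "t \<in> U T ==> tensor_lift G b t \<in> U G"
 unfolding tensor_lift_eq_frag_lift using rep_some(1) G.frag_lift_closed[OF b_closed] by simp

lemma lift_pure: "[|x \<in> U X; m \<in> U M|] ==> tensor_lift G b (pt x m) = b x m"
 unfolding pure_def' using b_closed by (subst lift_coset) (auto intro!: trans[OF G.frag_lift_frag_of])

lemma lift_add:
 assumes "s \<in> U T" "t \<in> U T"
 shows "tensor_lift G b (s +\<^sub>T t) = tensor_lift G b s +\<^sub>G tensor_lift G b t"
proof -
 obtain c d where cd: "c \<in> U FG" "d \<in> U FG" "s = cs c" "t = cs d"
  using rep_some assms by metis
 then have "c + d \<in> U FG" by (auto dest!: subsetD[OF keys_add])
 then show ?thesis
  using cd G.frag_lift_add[OF b_closed, of c d] by (simp add: coset_add lift_coset)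
qed

end

end

lemma balancedI:
 assumes "!!x m. [|x \<in> U X; m \<in> U M|] ==> b x m \<in> U G"
  and "!!x y m. [|x \<in> U X; y \<in> U X; m \<in> U M|] ==> b (x +\<^sub>X y) m = b x m +\<^sub>G b y m"
  and "!!x m n. [|x \<in> U X; m \<in> U M; n \<in> U M|] ==> b x (m +\<^sub>M n) = b x m +\<^sub>G b x n"
  and "!!x r m. [|x \<in> U X; r \<in> U R; m \<in> U M|] ==> b (ra x r) m = b x (r *.\<^sub>M m)"
 shows "balanced R ra X M G b"
 using assms unfolding balanced_def by blast

text \<open>\<open>tensor_lift\<close> only sees the additive structure of its target. So the scalar action may be
  defined by lifting into the additive group before the module exists.\<close>
lemma tensor_lift_additive_record:
 assumes "U G = U G'" "add G = add G'" "zero G = zero G'"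
 shows "tensor_lift G b = tensor_lift G' b"
proof -
 show ?thesis
  by (simp add: tensor_lift_def finsum_def Let_def finprod_def add_pow_def int_pow_def nat_pow_def
    m_inv_def assms fun_eq_iff cong: if_cong)
qed

locale tensor_module = tensor_data R ra X M + X: module K X
 for K :: "('k, 'd) ring_scheme" and R :: "('r, 'a) ring_scheme" and ra :: "'x => 'r => 'x"
  and X :: "('k, 'x, 'b) module_scheme" and M :: "('r, 'm, 'c) module_scheme" +
 assumes ra_smult: "[|k \<in> U K; x \<in> U X; r \<in> U R|]
   ==> ra (k *.\<^sub>X x) r = k *.\<^sub>X ra x r"
begin

interpretation T: abelian_group T by (rule T_abelian_group)

lemma T_smult: "smult T k = tensor_lift T (%x m. pt (k *.\<^sub>X x) m)"
 by (simp add: tensor_product_def Let_def,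
   rule tensor_lift_additive_record) simp_all

lemma balanced_smult:
 "k \<in> U K ==> balanced R ra X M T (%x m. pt (k *.\<^sub>X x) m)"
 by (rule balancedI)
  (auto simp: X.smult_r_distr pure_add_left pure_add_right pure_balanced simp flip: ra_smult
   intro: pure_closed)

lemmas smult_closed = lift_closed[OF T_abelian_group balanced_smult, folded T_smult]
lemmas smult_pure = lift_pure[OF T_abelian_group balanced_smult, folded T_smult]
lemmas smult_add = lift_add[OF T_abelian_group balanced_smult, folded T_smult]

lemma T_module: "module K T"
proof (rule moduleI)
 show "(a +\<^sub>K b) *.\<^sub>T t = a *.\<^sub>T t +\<^sub>T b *.\<^sub>T t"
  if "a \<in> U K" "b \<in> U K" "t \<in> U T" for a b t
  using that(3,1,2)
 proof (induction t rule: tensor_induct)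
  case (add s t)
  then show ?case by (simp add: smult_add smult_closed T.a_ac)
 qed (simp add: smult_pure X.smult_l_distr pure_add_left)
 show "(a *\<^sub>K b) *.\<^sub>T t = a *.\<^sub>T (b *.\<^sub>T t)"
  if "a \<in> U K" "b \<in> U K" "t \<in> U T" for a b t
  using that(3,1,2)
 proof (induction t rule: tensor_induct)
  case (add s t)
  then show ?case by (simp add: smult_add smult_closed)
 qed (simp add: smult_pure X.smult_assoc1)
 show "1\<^sub>K *.\<^sub>T t = t" if "t \<in> U T" for t
  using that
  by (induction t rule: tensor_induct) (simp_all add: smult_pure smult_add)
qed (simp_all add: X.is_cring T_abelian_group smult_closed smult_add)

lemma lift_smult:
 assumes G: "module K G" and b: "balanced R ra X M G b"
  and bk: "!!k x m. [|k \<in> U K; x \<in> U X; m \<in> U M|] ==> b (k *.\<^sub>X x) m = k *.\<^sub>G b x m"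
  and k: "k \<in> U K" and t: "t \<in> U T"
 shows "tensor_lift G b (k *.\<^sub>T t) = k *.\<^sub>G tensor_lift G b t"
 using t
proof (induction t rule: tensor_induct)
 case (pure x m)
 then show ?case using k bk G b
  by (simp add: smult_pure lift_pure[OF module.axioms(2)[OF G] b])
next
 case (add s t)
 interpret G: module K G by (rule G)
 show ?case using add k
  by (simp add: smult_add smult_closed lift_add[OF G.abelian_group_axioms b] G.smult_r_distr
    lift_closed[OF G.abelian_group_axioms b])
qed

end

lemma module_homD:
 assumes "f \<in> module_hom R M N"
 shows "f \<in> U M \<rightarrow>\<^sub>E U N"
  and "x \<in> U M ==> f x \<in> U N"
  and "[|x \<in> U M; y \<in> U M|] ==> f (x +\<^sub>M y) = f x +\<^sub>N f y"
  and "[|r \<in> U R; x \<in> U M|] ==> f (r *.\<^sub>M x) = r *.\<^sub>N f x"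
  and "f \<in> extensional (U M)"
 using assms by (auto simp: module_hom_def PiE_def)

lemma module_homI:
 assumes "!!x. x \<in> U M ==> f x \<in> U N"
  and "!!x y. [|x \<in> U M; y \<in> U M|] ==> f (x +\<^sub>M y) = f x +\<^sub>N f y"
  and "!!r x. [|r \<in> U R; x \<in> U M|] ==> f (r *.\<^sub>M x) = r *.\<^sub>N f x"
  and "f \<in> extensional (U M)"
 shows "f \<in> module_hom R M N"
 using assms by (auto simp: module_hom_def PiE_def)

locale tensor_functor_data = X: module K X
 for K :: "('k, 'd) ring_scheme" and R :: "('r, 'a) ring_scheme" and ra :: "'x => 'r => 'x"
  and X :: "('k, 'x, 'b) module_scheme" +
 assumes ra_closed: "[|x \<in> U X; r \<in> U R|] ==> ra x r \<in> U X"
  and ra_smult: "[|k \<in> U K; x \<in> U X; r \<in> U R|]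
   ==> ra (k *.\<^sub>X x) r = k *.\<^sub>X ra x r"
begin

lemma tensor_moduleI:
 fixes M :: "('r, 'm, 'c) module_scheme"
 assumes "abelian_group M" "!!r m. [|r \<in> U R; m \<in> U M|] ==> r *.\<^sub>M m \<in> U M"
 shows "tensor_module K R ra X M"
 by (intro tensor_module.intro tensor_data.intro tensor_module_axioms.intro
   X.abelian_group_axioms X.module_axioms ra_closed ra_smult assms)

lemma tensor_module:
 fixes M :: "('r, 'm, 'c) module_scheme"
 assumes "left_module R M"
 shows "tensor_module K R ra X M"
proof -
 interpret M: left_module R M by fact
 show ?thesis by (rule tensor_moduleI[OF M.M.abelian_group_axioms M.smult_closed])
qed

context
 fixes M N :: "('r, 'm) module" and f
 assumes M: "tensor_module K R ra X M" and N: "tensor_module K R ra X N"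
  and f: "f \<in> module_hom R M N"
begin

interpretation M: tensor_module K R ra X M by (rule M)
interpretation N: tensor_module K R ra X N by (rule N)

lemma balanced_hom:
 "balanced R ra X M (tensor_product R ra X N) (%x m. pure_tensor R ra X N x (f m))"
 by (rule balancedI)
  (auto simp: module_homD[OF f] N.pure_closed N.pure_add_left N.pure_add_right N.pure_balanced)

lemma tensor_functor_pure:
 assumes "x \<in> U X" "m \<in> U M"
 shows "snd (tensor_functor R ra X) M N f (pure_tensor R ra X M x m) = pure_tensor R ra X N x (f m)"
 using assms M.lift_pure[OF N.T_abelian_group balanced_hom assms]
 by (simp add: tensor_functor_def M.pure_closed)

lemma tensor_functor_hom:
 "snd (tensor_functor R ra X) M N f
  \<in> module_hom K (fst (tensor_functor R ra X) M) (fst (tensor_functor R ra X) N)"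
proof (rule module_homI)
 show "snd (tensor_functor R ra X) M N f (k \<odot>\<^bsub>fst (tensor_functor R ra X) M\<^esub> t)
   = k \<odot>\<^bsub>fst (tensor_functor R ra X) N\<^esub> snd (tensor_functor R ra X) M N f t"
  if "k \<in> U K" "t \<in> U (fst (tensor_functor R ra X) M)" for k t
  using that M.lift_smult[OF N.T_module balanced_hom, of k t] module_homD[OF f]
  by (simp add: tensor_functor_def M.smult_closed N.smult_pure)
qed (auto simp: tensor_functor_def M.lift_closed[OF N.T_abelian_group balanced_hom]
   M.lift_add[OF N.T_abelian_group balanced_hom] abelian_groupE(1)[OF M.T_abelian_group])

end

lemma tensor_functor_is_functor:
 "is_module_functor R K (tensor_functor R ra X :: ('r, 'm, 'k, ('x, 'm) tensor) mod_functor)"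
proof -
 let ?F = "tensor_functor R ra X :: ('r, 'm, 'k, ('x, 'm) tensor) mod_functor"
 have fst: "fst ?F = tensor_product R ra X" by (simp add: tensor_functor_def)
 have eqI: "g = h" if M: "left_module R M"
   and g: "g \<in> module_hom K (fst ?F M) T'" and h: "h \<in> module_hom K (fst ?F M) T'"
   and gh: "!!x m. [|x \<in> U X; m \<in> U M|]
    ==> g (pure_tensor R ra X M x m) = h (pure_tensor R ra X M x m)"
  for M and T' :: "('k, ('x, 'm) tensor) module" and g h
 proof (rule extensionalityI)
  interpret M: tensor_module K R ra X M by (rule tensor_module[OF M])
  show "g t = h t" if "t \<in> U (tensor_product R ra X M)" for t
   using that
  proof (induction t rule: M.tensor_induct)
   case (add s t)
   then show ?case using g h by (simp add: module_homD(3) fst)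
  qed (rule gh)
 qed (use g h module_homD(5) fst in metis)+
 have hom: "snd ?F M N f \<in> module_hom K (fst ?F M) (fst ?F N)"
  if "left_module R M" "left_module R N" "f \<in> module_hom R M N" for M N f
  using tensor_functor_hom that tensor_module by metis
 have mod: "left_module K (fst ?F M)" if "left_module R M" for M
  using tensor_module.T_module[OF tensor_module[OF that]]
  by (simp add: fst module_iff_left_module)
 have one: "snd ?F M M (restrict id (U M)) = restrict id (U (fst ?F M))"
  if M: "left_module R M" for M
 proof (rule eqI[OF M])
  interpret T: tensor_module K R ra X M by (rule tensor_module[OF M])
  interpret M: left_module R M by (rule M)
  have i: "restrict id (U M) \<in> module_hom R M M"
   by (rule module_homI) (auto simp: M.smult_closed)
  show "snd ?F M M (restrict id (U M)) \<in> module_hom K (fst ?F M) (fst ?F M)"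
   by (rule hom[OF M M i])
  show "restrict id (U (fst ?F M)) \<in> module_hom K (fst ?F M) (fst ?F M)"
   by (rule module_homI) (auto simp: fst T.smult_closed abelian_groupE(1)[OF T.T_abelian_group])
  show "snd ?F M M (restrict id (U M)) (pure_tensor R ra X M x m)
    = restrict id (U (fst ?F M)) (pure_tensor R ra X M x m)"
   if "x \<in> U X" "m \<in> U M" for x m
   using that
   by (simp add: tensor_functor_pure[OF tensor_module[OF M] tensor_module[OF M] i] fst T.pure_closed)
 qed
 have comp: "snd ?F L N (cmp L g f) = compose (U (fst ?F L)) (snd ?F M N g) (snd ?F L M f)"
  if L: "left_module R L" and M: "left_module R M" and N: "left_module R N"
   and f: "f \<in> module_hom R L M" and g: "g \<in> module_hom R M N" for L M N f g
 proof (rule eqI[OF L])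
  interpret L: tensor_module K R ra X L by (rule tensor_module[OF L])
  interpret L': left_module R L by (rule L)
  have gf: "cmp L g f \<in> module_hom R L N"
   by (rule module_homI)
    (auto simp: compose_def module_homD[OF f] module_homD[OF g] L'.smult_closed)
  show "snd ?F L N (cmp L g f) \<in> module_hom K (fst ?F L) (fst ?F N)"
   by (rule hom[OF L N gf])
  note hf = hom[OF L M f] and hg = hom[OF M N g]
  show "compose (U (fst ?F L)) (snd ?F M N g) (snd ?F L M f) \<in> module_hom K (fst ?F L) (fst ?F N)"
   by (rule module_homI)
    (auto simp: compose_def module_homD[OF hf[unfolded fst]] module_homD[OF hg[unfolded fst]] fst L.smult_closed
     abelian_groupE(1)[OF L.T_abelian_group])
  show "snd ?F L N (cmp L g f) (pure_tensor R ra X L x m)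
    = compose (U (fst ?F L)) (snd ?F M N g) (snd ?F L M f) (pure_tensor R ra X L x m)"
   if "x \<in> U X" "m \<in> U L" for x m
   using that
   by (simp add: tensor_functor_pure[OF tensor_module[OF L] tensor_module[OF N] gf]
    tensor_functor_pure[OF tensor_module[OF L] tensor_module[OF M] f]
    tensor_functor_pure[OF tensor_module[OF M] tensor_module[OF N] g]
    compose_eq fst L.pure_closed module_homD[OF f])
 qed
 show ?thesis
  unfolding is_module_functor_def using mod hom one comp by blast
qed

end

section \<open>Multilinear maps and tensor products over \<open>K\<close>\<close>

definition klinear ::
 "('k, 'w) ring_scheme => ('k, 'x, 'a) module_scheme => ('k, 'y, 'b) module_scheme => ('x => 'y) => bool"
 where "klinear K X Y f \<longleftrightarrow>
  (ALL x:U X. f x \<in> U Y) &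
  (ALL x:U X. ALL y:U X. f (x +\<^sub>X y) = f x +\<^sub>Y f y) &
  (ALL k:U K. ALL x:U X. f (k *.\<^sub>X x) = k *.\<^sub>Y f x)"

definition bilinear ::
 "('k, 'w) ring_scheme => ('k, 'x, 'a) module_scheme => ('k, 'y, 'b) module_scheme =>
  ('k, 'z, 'c) module_scheme => ('x => 'y => 'z) => bool"
 where "bilinear K X Y Z b \<longleftrightarrow>
  (ALL x:U X. klinear K Y Z (b x)) & (ALL y:U Y. klinear K X Z (%x. b x y))"

definition trilinear ::
 "('k, 'w) ring_scheme => ('k, 'x, 'a) module_scheme => ('k, 'y, 'b) module_scheme =>
  ('k, 'z, 'c) module_scheme => ('k, 'v, 'd) module_scheme => ('x => 'y => 'z => 'v) => bool"
 where "trilinear K X Y Z V t \<longleftrightarrow>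
  (ALL x:U X. bilinear K Y Z V (t x)) &
  (ALL y:U Y. ALL z:U Z. klinear K X V (%x. t x y z))"

definition quadrilinear ::
 "('k, 'w) ring_scheme => ('k, 'x, 'a) module_scheme => ('k, 'y, 'b) module_scheme =>
  ('k, 'z, 'c) module_scheme => ('k, 'u, 'd) module_scheme => ('k, 'v, 'e) module_scheme =>
  ('x => 'y => 'z => 'u => 'v) => bool"
 where "quadrilinear K X Y Z Q V q \<longleftrightarrow>
  (ALL x:U X. trilinear K Y Z Q V (q x)) &
  (ALL y:U Y. ALL z:U Z. ALL u:U Q. klinear K X V (%x. q x y z u))"

lemmas multilinear = klinear_def bilinear_def trilinear_def quadrilinear_def

lemma klinearD:
 assumes "klinear K X Y f"
 shows "x \<in> U X ==> f x \<in> U Y"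
  and "[|x \<in> U X; y \<in> U X|] ==> f (x +\<^sub>X y) = f x +\<^sub>Y f y"
  and "[|k \<in> U K; x \<in> U X|] ==> f (k *.\<^sub>X x) = k *.\<^sub>Y f x"
 using assms by (auto simp: klinear_def)

lemma bilinearD:
 assumes "bilinear K X Y Z b"
 shows "[|x \<in> U X; y \<in> U Y|] ==> b x y \<in> U Z"
  and "[|x \<in> U X; x' \<in> U X; y \<in> U Y|] ==> b (x +\<^sub>X x') y = b x y +\<^sub>Z b x' y"
  and "[|x \<in> U X; y \<in> U Y; y' \<in> U Y|] ==> b x (y +\<^sub>Y y') = b x y +\<^sub>Z b x y'"
  and "[|k \<in> U K; x \<in> U X; y \<in> U Y|] ==> b (k *.\<^sub>X x) y = k *.\<^sub>Z b x y"
  and "[|k \<in> U K; x \<in> U X; y \<in> U Y|] ==> b x (k *.\<^sub>Y y) = k *.\<^sub>Z b x y"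
 using assms by (auto simp: bilinear_def klinear_def)

lemma trilinearD:
 assumes "trilinear K X Y Z V t"
 shows "[|x \<in> U X; y \<in> U Y; z \<in> U Z|] ==> t x y z \<in> U V"
  and "[|x \<in> U X; x' \<in> U X; y \<in> U Y; z \<in> U Z|] ==> t (x +\<^sub>X x') y z = t x y z +\<^sub>V t x' y z"
  and "[|x \<in> U X; y \<in> U Y; y' \<in> U Y; z \<in> U Z|] ==> t x (y +\<^sub>Y y') z = t x y z +\<^sub>V t x y' z"
  and "[|x \<in> U X; y \<in> U Y; z \<in> U Z; z' \<in> U Z|] ==> t x y (z +\<^sub>Z z') = t x y z +\<^sub>V t x y z'"
  and "[|k \<in> U K; x \<in> U X; y \<in> U Y; z \<in> U Z|] ==> t (k *.\<^sub>X x) y z = k *.\<^sub>V t x y z"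
  and "[|k \<in> U K; x \<in> U X; y \<in> U Y; z \<in> U Z|] ==> t x (k *.\<^sub>Y y) z = k *.\<^sub>V t x y z"
  and "[|k \<in> U K; x \<in> U X; y \<in> U Y; z \<in> U Z|] ==> t x y (k *.\<^sub>Z z) = k *.\<^sub>V t x y z"
 using assms by (auto simp: trilinear_def bilinear_def klinear_def)

lemma module_hom_linear: "f \<in> module_hom K X Y ==> klinear K X Y f"
 by (auto simp: klinear_def module_homD)

lemma linear_restrict_hom:
 assumes "module K X" "klinear K X Y f"
 shows "restrict f (U X) \<in> module_hom K X Y"
proof -
 interpret module K X by fact
 show ?thesis using assms(2) by (intro module_homI) (auto simp: klinearD)
qed

lemma linear_comp:
 "[|klinear K Y Z g; klinear K X Y f|] ==> klinear K X Z (%x. g (f x))"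
 by (auto simp: multilinear)

lemma bilinear_comp:
 "[|bilinear K X Y Z b; klinear K C X f; klinear K D Y g|]
  ==> bilinear K C D Z (%x y. b (f x) (g y))"
 by (auto simp: multilinear)

lemma trilinear_comp:
 "[|trilinear K X Y Z V t; klinear K C X f; klinear K D Y g; klinear K E Z h|]
  ==> trilinear K C D E V (%x y z. t (f x) (g y) (h z))"
 by (auto simp: multilinear)

lemma quadrilinear_comp:
 "[|quadrilinear K X Y Z Q V t; klinear K C X f; klinear K D Y g; klinear K E Z h;
   klinear K F Q k|]
  ==> quadrilinear K C D E F V (%x y z u. t (f x) (g y) (h z) (k u))"
 by (auto simp: multilinear)

lemma bilinear_flip: "bilinear K X Y Z b ==> bilinear K Y X Z (%y x. b x y)"
 by (auto simp: bilinear_def)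

lemma linear_bilinear:
 "[|klinear K Z V f; bilinear K X Y Z b|] ==> bilinear K X Y V (%x y. f (b x y))"
 by (auto simp: multilinear)

lemma klinear_zero_eq:
 assumes "module K X" "module K Y" "klinear K X Y f"
 shows "f 0\<^sub>X = 0\<^sub>Y"
proof -
 interpret X: module K X by fact
 interpret Y: module K Y by fact
 show ?thesis
  using klinearD(3)[OF assms(3), of "0\<^sub>K" "0\<^sub>X"] klinearD(1)[OF assms(3), of "0\<^sub>X"]
  by simp
qed

lemma klinear_minus:
 assumes "module K X" "module K Y" "klinear K X Y f" "x \<in> U X" "y \<in> U X"
 shows "f (x \<ominus>\<^sub>X y) = f x \<ominus>\<^sub>Y f y"
proof -
 interpret X: module K X by fact
 interpret Y: module K Y by fact
 have "f (\<ominus>\<^bsub>X\<^esub> y) = \<ominus>\<^bsub>Y\<^esub> f y"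
 proof (rule Y.minus_equality[symmetric])
  show "f (\<ominus>\<^bsub>X\<^esub> y) +\<^sub>Y f y = 0\<^sub>Y"
   using klinearD(2)[OF assms(3), of "\<ominus>\<^bsub>X\<^esub> y" y] assms klinear_zero_eq[OF assms(1-3)]
   by (simp add: X.l_neg)
 qed (use assms klinearD(1)[OF assms(3)] in auto)
 then show ?thesis using assms by (simp add: a_minus_def klinearD)
qed

lemma module_of_subset:
 fixes W :: "('k, 'm, 'u) module_scheme" and Z :: "('k, 'm, 'v) module_scheme"
 assumes Z: "module K Z" and ops: "add W = add Z" "zero W = zero Z" "smult W = smult Z"
  and sub: "!!x. x \<in> U W ==> x \<in> U Z" and zero: "0\<^sub>Z \<in> U W"
  and add: "!!x y. [|x \<in> U W; y \<in> U W|] ==> x +\<^sub>Z y \<in> U W"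
  and smult: "!!k x. [|k \<in> U K; x \<in> U W|] ==> k *.\<^sub>Z x \<in> U W"
 shows "module K W"
proof -
 interpret Z: module K Z by (rule Z)
 have "abelian_group W"
 proof (rule abelian_groupI)
  fix x assume x: "x \<in> U W"
  show "EX y:U W. y +\<^sub>W x = 0\<^sub>W"
   using x sub[OF x] smult[of "\<ominus>\<^bsub>K\<^esub> 1\<^sub>K" x]
   by (intro bexI[of _ "\<ominus>\<^bsub>K\<^esub> 1\<^sub>K *.\<^sub>Z x"])
    (auto simp: ops Z.smult_l_minus Z.l_neg)
 qed (simp_all add: ops add zero sub Z.a_ac)
 then show ?thesis
  by (intro moduleI module.axioms(1)[OF Z]) (simp_all add: ops smult sub Z.smult_l_distr Z.smult_r_distr Z.smult_assoc1)
qed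

lemma ktensor_tensor_module:
 assumes "module K X" "module K Y"
 shows "tensor_module K K (k_action X) X Y"
proof -
 interpret X: module K X by fact
 interpret Y: module K Y by fact
 show ?thesis
  by unfold_locales (auto simp: X.smult_assoc1[symmetric] X.m_comm)
qed

context
 fixes K :: "('k, 'w) ring_scheme" and X :: "('k, 'x, 'a) module_scheme" and Y :: "('k, 'y, 'b) module_scheme"
 assumes X: "module K X" and Y: "module K Y"
begin

interpretation T: tensor_module K K "k_action X" X Y
 by (rule ktensor_tensor_module[OF X Y])

lemma ktensor_module: "module K (ktensor K X Y)"
 unfolding ktensor_def by (rule T.T_module)

lemma kpure_bilinear: "bilinear K X Y (ktensor K X Y) (kpure K X Y)"
 unfolding ktensor_def kpure_def bilinear_def klinear_def
 by (simp add: T.pure_closed T.pure_add_left T.pure_add_right T.smult_pure T.pure_balanced)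

lemma ktensor_induct [consumes 1, case_names pure add]:
 assumes "t \<in> U (ktensor K X Y)"
  and "!!x y. [|x \<in> U X; y \<in> U Y|] ==> P (kpure K X Y x y)"
  and "!!s t. [|s \<in> U (ktensor K X Y); t \<in> U (ktensor K X Y); P s; P t|]
   ==> P (s \<oplus>\<^bsub>ktensor K X Y\<^esub> t)"
 shows "P t"
 using T.tensor_induct[of t P] assms by (simp add: ktensor_def kpure_def)

lemma bilinear_balanced:
 assumes Z: "module K Z" and b: "bilinear K X Y Z b"
 shows "balanced K (k_action X) X Y Z b"
 by (rule balancedI) (simp_all add: bilinearD[OF b])

lemma tensor_lift_linear:
 assumes Z: "module K Z" and b: "bilinear K X Y Z b"
 shows "klinear K (ktensor K X Y) Z (tensor_lift Z b)"
proof -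
 interpret Z: module K Z by (rule Z)
 note bb = bilinear_balanced[OF Z b]
 show ?thesis unfolding ktensor_def klinear_def
  using T.lift_closed[OF Z.abelian_group_axioms bb] T.lift_add[OF Z.abelian_group_axioms bb]
   T.lift_smult[OF Z bb] bilinearD(4)[OF b] by blast
qed

lemma tensor_lift_kpure:
 assumes Z: "module K Z" and b: "bilinear K X Y Z b" and "x \<in> U X" "y \<in> U Y"
 shows "tensor_lift Z b (kpure K X Y x y) = b x y"
 unfolding kpure_def using T.lift_pure[OF module.axioms(2)[OF Z] bilinear_balanced[OF Z b]] assms by blast

lemma tensor_lift_cong:
 assumes "module K Z" "t \<in> U (ktensor K X Y)"
  "!!x y. [|x \<in> U X; y \<in> U Y|] ==> b x y = b' x y"
  "!!x y. [|x \<in> U X; y \<in> U Y|] ==> b' x y \<in> U Z"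
 shows "tensor_lift Z b t = tensor_lift Z b' t"
 using assms by (intro T.lift_cong) (auto simp: module.axioms ktensor_def)

text \<open>The standard way to prove an identity on a tensor product: check linearity of both sides and compare them on pure tensors.\<close>
lemma ktensor_linear_eq:
 assumes "klinear K (ktensor K X Y) Z f" "klinear K (ktensor K X Y) Z g"
  "!!x y. [|x \<in> U X; y \<in> U Y|] ==> f (kpure K X Y x y) = g (kpure K X Y x y)"
  "t \<in> U (ktensor K X Y)"
 shows "f t = g t"
 using assms(4) by (induction t rule: ktensor_induct) (simp_all add: assms(3) klinearD[OF assms(1)] klinearD[OF assms(2)])

lemma tensor_lift_map:
 assumes "module K Z" "module K Z'" "bilinear K X Y Z b" "klinear K Z Z' f"
  "t \<in> U (ktensor K X Y)"
 shows "f (tensor_lift Z b t) = tensor_lift Z' (%x y. f (b x y)) t"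
proof (rule ktensor_linear_eq[OF _ _ _ assms(5)])
 have b': "bilinear K X Y Z' (%x y. f (b x y))" by (rule linear_bilinear[OF assms(4,3)])
 show "klinear K (ktensor K X Y) Z' (%t. f (tensor_lift Z b t))"
  by (rule linear_comp[OF assms(4) tensor_lift_linear[OF assms(1,3)]])
 show "klinear K (ktensor K X Y) Z' (tensor_lift Z' (%x y. f (b x y)))"
  by (rule tensor_lift_linear[OF assms(2) b'])
 show "f (tensor_lift Z b (kpure K X Y x y)) = tensor_lift Z' (%x y. f (b x y)) (kpure K X Y x y)"
  if "x \<in> U X" "y \<in> U Y" for x y
  using that assms b' by (simp add: tensor_lift_kpure)
qed

lemma tensor_lift_param:
 assumes Z: "module K Z" and V: "module K V" and t: "trilinear K V X Y Z t" and s: "s \<in> U (ktensor K X Y)"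
 shows "klinear K V Z (%v. tensor_lift Z (t v) s)"
proof -
 interpret Z: module K Z by (rule Z)
 interpret V: module K V by (rule V)
 interpret KT: module K "ktensor K X Y" by (rule ktensor_module)
 have b: "bilinear K X Y Z (t v)" if "v \<in> U V" for v
  using t that by (simp add: trilinear_def)
 note ll = tensor_lift_linear[OF Z b]
 note d = klinearD[OF ll] tensor_lift_kpure[OF Z b] trilinearD[OF t]
 have "tensor_lift Z (t (v +\<^sub>V w)) s = tensor_lift Z (t v) s +\<^sub>Z tensor_lift Z (t w) s"
  if "v \<in> U V" "w \<in> U V" for v w
  using s that
  by (induction s rule: ktensor_induct) (simp_all add: d Z.a_ac)
 moreover have "tensor_lift Z (t (k *.\<^sub>V v)) s = k *.\<^sub>Z tensor_lift Z (t v) s"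
  if "v \<in> U V" "k \<in> U K" for v k
  using s that
  by (induction s rule: ktensor_induct) (simp_all add: d Z.smult_r_distr)
 ultimately show ?thesis using s by (simp add: klinear_def d)
qed

end

section \<open>Cocommutative coalgebras and convolution\<close>

locale cocommutative_coalgebra = C: module K C
 for K :: "('k, 'w) ring_scheme" (structure) and C :: "('k, 'c, 'y) hopf_scheme" +
 assumes comult_linear: "klinear K C (ktensor K C C) (comult C)"
  and counit_closed: "c \<in> U C ==> counit C c \<in> U K"
  and counit_add: "[|c \<in> U C; d \<in> U C|] ==> counit C (c +\<^sub>C d) = counit C c \<oplus> counit C d"
  and counit_smult: "[|k \<in> U K; c \<in> U C|] ==> counit C (k *.\<^sub>C c) = k \<otimes> counit C c"
  and coassociative: "c \<in> U C ==>
   sweedler (ktensor K (ktensor K C C) C) C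
    (%x y. kpure K (ktensor K C C) C (comult C x) y) c =
   sweedler3 (ktensor K (ktensor K C C) C) C
    (%x y z. kpure K (ktensor K C C) C (kpure K C C x y) z) c"
  and counital: "c \<in> U C ==> sweedler C C (%x y. counit C x *.\<^sub>C y) c = c"
  and cocommutative: "c \<in> U C ==> sweedler (ktensor K C C) C (%x y. kpure K C C y x) c = comult C c"
begin

lemma comult_closed: "c \<in> U C ==> comult C c \<in> U (ktensor K C C)"
 by (rule klinearD(1)[OF comult_linear])

text \<open>Sums over \<open>\<Delta> c\<close> commute with linear maps because both are induced from the tensor product.\<close>
lemma sweedler_map:
 assumes "module K Z" "module K Z'" "bilinear K C C Z b" "klinear K Z Z' f" "c \<in> U C"
 shows "f (sweedler Z C b c) = sweedler Z' C (%x y. f (b x y)) c"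
 unfolding sweedler_def
 by (rule tensor_lift_map[OF C.module_axioms C.module_axioms assms(1-4) comult_closed[OF assms(5)]])

context
 fixes Z :: "('k, 'z, 'v) module_scheme"
 assumes Z: "module K Z"
begin

interpretation Z: module K Z by (rule Z)

lemma sweedler_linear: "bilinear K C C Z b ==> klinear K C Z (sweedler Z C b)"
 unfolding sweedler_def
 by (rule linear_comp[OF tensor_lift_linear comult_linear]) (auto intro: Z C.module_axioms)

lemma sweedler_cong:
 assumes "c \<in> U C" "!!x y. [|x \<in> U C; y \<in> U C|] ==> b x y = b' x y"
  "!!x y. [|x \<in> U C; y \<in> U C|] ==> b' x y \<in> U Z"
 shows "sweedler Z C b c = sweedler Z C b' c"
 unfolding sweedler_def
 by (rule tensor_lift_cong[OF C.module_axioms C.module_axioms Z comult_closed]) (fact assms)+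

lemma sweedler_param:
 assumes "module K V" "trilinear K V C C Z t" "c \<in> U C"
 shows "klinear K V Z (%v. sweedler Z C (t v) c)"
 unfolding sweedler_def
 by (rule tensor_lift_param[OF C.module_axioms C.module_axioms Z assms(1,2) comult_closed[OF assms(3)]])

lemma sweedler_param_bilinear:
 assumes "module K V" "trilinear K V C C Z t"
 shows "bilinear K V C Z (%v. sweedler Z C (t v))"
 unfolding bilinear_def
 using sweedler_param[OF assms] sweedler_linear assms(2) by (auto simp: trilinear_def)

lemma sweedler_param_trilinear:
 assumes "module K V" "module K Q" "quadrilinear K Q V C C Z q"
 shows "trilinear K Q V C Z (%u v. sweedler Z C (q u v))"
proof -
 have "trilinear K Q C C Z (%u. q u v)" if "v \<in> U V" for v
  using assms(3) that by (simp add: multilinear)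
 then have "klinear K Q Z (%u. sweedler Z C (q u v) c)" if "v \<in> U V" "c \<in> U C" for v c
  using sweedler_param[OF assms(2), of "%u. q u v"] that by blast
 moreover have "bilinear K V C Z (%v. sweedler Z C (q u v))" if "u \<in> U Q" for u
  using sweedler_param_bilinear[OF assms(1)] assms(3) that by (simp add: quadrilinear_def)
 ultimately show ?thesis unfolding trilinear_def by blast
qed

lemma sweedler_swap:
 assumes b: "bilinear K C C Z b" and c: "c \<in> U C"
 shows "sweedler Z C (%x y. b y x) c = sweedler Z C b c"
proof -
 have "sweedler Z C b c = tensor_lift Z b (sweedler (ktensor K C C) C (%x y. kpure K C C y x) c)"
  by (simp add: sweedler_def[of Z] cocommutative[OF c])
 also have "... = sweedler Z C (%x y. tensor_lift Z b (kpure K C C y x)) c"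
  unfolding sweedler_def
  by (rule tensor_lift_map[OF C.module_axioms C.module_axioms ktensor_module Z])
   (auto intro: C.module_axioms bilinear_flip kpure_bilinear tensor_lift_linear Z b comult_closed c)
 also have "... = sweedler Z C (%x y. b y x) c"
  by (rule sweedler_cong[OF c]) (auto simp: tensor_lift_kpure[OF C.module_axioms C.module_axioms Z b] bilinearD[OF b])
 finally show ?thesis ..
qed

lemma sweedler3_linear:
 assumes t: "trilinear K C C C Z t"
 shows "klinear K C Z (sweedler3 Z C t)"
 unfolding sweedler3_def
 by (rule sweedler_linear) (rule sweedler_param_bilinear[OF C.module_axioms t])

lemma sweedler3_cong:
 assumes "c \<in> U C" "!!x y z. [|x \<in> U C; y \<in> U C; z \<in> U C|] ==> t x y z = t' x y z"
  and t': "trilinear K C C C Z t'"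
 shows "sweedler3 Z C t c = sweedler3 Z C t' c"
 unfolding sweedler3_def
proof (rule sweedler_cong[OF assms(1)])
 show "sweedler Z C (t x) y = sweedler Z C (t' x) y" if "x \<in> U C" "y \<in> U C" for x y
  using assms(2) trilinearD[OF t'] that by (intro sweedler_cong) auto
 show "sweedler Z C (t' x) y \<in> U Z" if "x \<in> U C" "y \<in> U C" for x y
  using bilinearD(1)[OF sweedler_param_bilinear[OF C.module_axioms t'] that] .
qed

lemma sweedler3_swap23:
 assumes t: "trilinear K C C C Z t" and c: "c \<in> U C"
 shows "sweedler3 Z C (%x y z. t x z y) c = sweedler3 Z C t c"
 unfolding sweedler3_def
proof (rule sweedler_cong[OF c])
 show "sweedler Z C (%y' z. t x z y') y = sweedler Z C (t x) y" if "x \<in> U C" "y \<in> U C" for x y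
  using t that by (intro sweedler_swap) (auto simp: trilinear_def)
 show "sweedler Z C (t x) y \<in> U Z" if "x \<in> U C" "y \<in> U C" for x y
  using bilinearD(1)[OF sweedler_param_bilinear[OF C.module_axioms t] that] .
qed

lemma tensor_lift_trilinear:
 assumes t: "trilinear K C C C Z t"
 shows "bilinear K (ktensor K C C) C Z (%u z. tensor_lift Z (%x y. t x y z) u)"
proof -
 have "trilinear K C C C Z (%z x y. t x y z)" using t by (simp add: multilinear)
 from tensor_lift_param[OF C.module_axioms C.module_axioms Z C.module_axioms this]
 have "klinear K C Z (%z. tensor_lift Z (%x y. t x y z) u)" if "u \<in> U (ktensor K C C)" for u
  using that by simp
 moreover have "klinear K (ktensor K C C) Z (%u. tensor_lift Z (%x y. t x y z) u)"
  if "z \<in> U C" for z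
  using t that by (intro tensor_lift_linear C.module_axioms Z) (simp add: multilinear)
 ultimately show ?thesis by (simp add: bilinear_def)
qed

text \<open>Coassociativity is given for the universal trilinear map; every other trilinear map factors through it.\<close>
lemma sweedler3_coassoc:
 assumes t: "trilinear K C C C Z t" and c: "c \<in> U C"
 shows "sweedler Z C (%x z. sweedler Z C (%x' y. t x' y z) x) c = sweedler3 Z C t c"
proof -
 note CC = C.module_axioms
 note CCC = ktensor_module[OF CC CC]
 let ?T = "ktensor K (ktensor K C C) C" and ?p = "kpure K (ktensor K C C) C"
 let ?b = "%u z. tensor_lift Z (%x y. t x y z) u"
 note b = tensor_lift_trilinear[OF t]
 have L: "klinear K ?T Z (tensor_lift Z ?b)" by (rule tensor_lift_linear[OF CCC CC Z b])
 have p: "bilinear K (ktensor K C C) C ?T ?p" by (rule kpure_bilinear[OF CCC CC])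
 have p1: "bilinear K C C ?T (%x y. ?p (comult C x) y)"
  using p comult_linear by (auto simp: multilinear)
 have tz: "bilinear K C C Z (%x y. t x y z)" if "z \<in> U C" for z
  using t that by (simp add: multilinear)
 have p3: "trilinear K C C C ?T (%x y z. ?p (kpure K C C x y) z)"
  using p kpure_bilinear[OF CC CC] by (auto simp: multilinear)
 have "sweedler Z C (%x z. sweedler Z C (%x' y. t x' y z) x) c
   = sweedler Z C (%x z. tensor_lift Z ?b (?p (comult C x) z)) c"
  by (rule sweedler_cong[OF c])
   (auto simp: tensor_lift_kpure[OF CCC CC Z b] comult_closed sweedler_def
    intro!: klinearD(1)[OF L] bilinearD(1)[OF p1] bilinearD(1)[OF b])
 also have "... = tensor_lift Z ?b (sweedler ?T C (%x z. ?p (comult C x) z) c)"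
  by (rule sweedler_map[OF ktensor_module[OF CCC CC] Z p1 L c, symmetric])
 also have "... = tensor_lift Z ?b (sweedler3 ?T C (%x y z. ?p (kpure K C C x y) z) c)"
  by (simp add: coassociative[OF c])
 also have "... = sweedler Z C (%x y. tensor_lift Z ?b (sweedler ?T C (%y' z. ?p (kpure K C C x y') z) y)) c"
  unfolding sweedler3_def
  by (rule sweedler_map[OF ktensor_module[OF CCC CC] Z _ L c])
   (rule cocommutative_coalgebra.sweedler_param_bilinear[OF cocommutative_coalgebra_axioms
    ktensor_module[OF CCC CC] CC p3])
 also have "... = sweedler3 Z C t c"
  unfolding sweedler3_def
 proof (rule sweedler_cong[OF c])
  fix x y assume xy: "x \<in> U C" "y \<in> U C"
  have bx: "bilinear K C C ?T (%y' z. ?p (kpure K C C x y') z)"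
   using p3 xy by (simp add: multilinear)
  have "tensor_lift Z ?b (sweedler ?T C (%y' z. ?p (kpure K C C x y') z) y)
   = sweedler Z C (%y' z. tensor_lift Z ?b (?p (kpure K C C x y') z)) y"
   by (rule sweedler_map[OF ktensor_module[OF CCC CC] Z bx L xy(2)])
  also have "... = sweedler Z C (t x) y"
   using xy by (intro sweedler_cong)
    (auto simp: tensor_lift_kpure[OF CCC CC Z b] bilinearD(1)[OF kpure_bilinear[OF CC CC]]
     tensor_lift_kpure[OF CC CC Z tz] trilinearD(1)[OF t])
  finally show "tensor_lift Z ?b (sweedler ?T C (%y' z. ?p (kpure K C C x y') z) y) = sweedler Z C (t x) y" .
  show "sweedler Z C (t x) y \<in> U Z"
   using bilinearD(1)[OF sweedler_param_bilinear[OF CC t] xy] .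
 qed
 finally show ?thesis .
qed

text \<open>Cocommutativity makes iterated Sweedler sums symmetric. This is where it enters the calculus, together with the lemmas \<open>sweedler_swap\<close> and \<open>sweedler3_swap23\<close>.\<close>
lemma sweedler3_swap12:
 assumes t: "trilinear K C C C Z t" and c: "c \<in> U C"
 shows "sweedler3 Z C (%x y z. t y x z) c = sweedler3 Z C t c"
proof -
 have t': "trilinear K C C C Z (%x y z. t y x z)" using t by (simp add: multilinear)
 have tz: "bilinear K C C Z (%x y. t x y z)" if "z \<in> U C" for z
  using t that by (simp add: multilinear)
 have "sweedler Z C (%x z. sweedler Z C (%x' y. t y x' z) x) c
   = sweedler Z C (%x z. sweedler Z C (%x' y. t x' y z) x) c"
  by (rule sweedler_cong[OF c])
   (auto intro!: sweedler_swap tz klinearD(1)[OF sweedler_linear[OF tz]])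
 then show ?thesis using sweedler3_coassoc[OF t c] sweedler3_coassoc[OF t' c] by simp
qed

end

lemma counit_smult_bilinear:
 "module K Z ==> bilinear K C Z Z (%x z. counit C x *.\<^sub>Z z)"
proof -
 assume "module K Z"
 then interpret Z: module K Z .
 show ?thesis
  by (auto simp: multilinear counit_closed counit_add counit_smult Z.smult_l_distr Z.smult_r_distr
   Z.smult_assoc1[symmetric] C.m_comm)
qed

lemma sweedler_counit_left:
 assumes "module K Z" "klinear K C Z f" "c \<in> U C"
 shows "sweedler Z C (%x y. counit C x *.\<^sub>Z f y) c = f c"
proof -
 interpret Z: module K Z by fact
 have "f c = f (sweedler C C (%x y. counit C x *.\<^sub>C y) c)" by (simp add: counital assms)
 also have "... = sweedler Z C (%x y. f (counit C x *.\<^sub>C y)) c"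
  by (rule sweedler_map[OF C.module_axioms assms(1) counit_smult_bilinear[OF C.module_axioms] assms(2,3)])
 also have "... = sweedler Z C (%x y. counit C x *.\<^sub>Z f y) c"
  by (rule sweedler_cong[OF assms(1,3)])
   (auto simp: klinearD[OF assms(2)] counit_closed)
 finally show ?thesis ..
qed

end

text \<open>Convolution is taken along an arbitrary bilinear map. With the multiplication of an algebra it is the usual product of
  maps on a coalgebra, with \<open>\<otimes>\<close> it pairs two points, and with an action it lets a point act. All functions are restricted to the carrier,
  so that equality of maps on \<open>C\<close> is equality of functions.\<close>
definition convolve ::
 "('k, 'z, 'v) module_scheme => ('k, 'c, 'y) hopf_scheme => ('p => 'q => 'z) =>
  ('c => 'p) => ('c => 'q) => 'c => 'z"
 where "convolve Z C b f g = restrict (sweedler Z C (%x y. b (f x) (g y))) (U C)"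

definition convolve3 ::
 "('k, 'z, 'v) module_scheme => ('k, 'c, 'y) hopf_scheme => ('p => 'q => 'r => 'z) =>
  ('c => 'p) => ('c => 'q) => ('c => 'r) => 'c => 'z"
 where "convolve3 Z C t f g h = restrict (sweedler3 Z C (%x y z. t (f x) (g y) (h z))) (U C)"

definition convolve4 ::
 "('k, 'z, 'v) module_scheme => ('k, 'c, 'y) hopf_scheme => ('p => 'q => 'r => 's => 'z) =>
  ('c => 'p) => ('c => 'q) => ('c => 'r) => ('c => 's) => 'c => 'z"
 where "convolve4 Z C q f g h k =
  restrict (sweedler Z C (%x y. sweedler3 Z C (%y' z u. q (f x) (g y') (h z) (k u)) y)) (U C)"

text \<open>Sums over two independent tensors may be exchanged: both orders are bilinear in the two tensors and agree on pure ones.\<close>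
lemma tensor_lift_fubini:
 assumes X: "module K X" and Y: "module K Y" and Q: "module K Q" and V: "module K V" and Z: "module K Z"
  and q: "quadrilinear K X Y Q V Z q"
  and s: "s \<in> U (ktensor K Q V)" and t: "t \<in> U (ktensor K X Y)"
 shows "tensor_lift Z (%x y. tensor_lift Z (q x y) s) t
  = tensor_lift Z (%u v. tensor_lift Z (%x y. q x y u v) t) s"
proof (rule ktensor_linear_eq[OF Q V _ _ _ s])
 have uv: "bilinear K Q V Z (q x y)" if "x \<in> U X" "y \<in> U Y" for x y
  using q that by (simp add: multilinear)
 have xy: "bilinear K X Y Z (%x y. q x y u v)" if "u \<in> U Q" "v \<in> U V" for u v
  using q that by (simp add: multilinear)
 have xuv: "trilinear K X Q V Z (%x. q x y)" if "y \<in> U Y" for y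
  using q that by (simp add: multilinear)
 have yuv: "trilinear K Y Q V Z (q x)" if "x \<in> U X" for x
  using q that by (simp add: quadrilinear_def)
 have uxy: "trilinear K Q X Y Z (%u x y. q x y u v)" if "v \<in> U V" for v
  using q that by (simp add: multilinear)
 have vxy: "trilinear K V X Y Z (%v x y. q x y u v)" if "u \<in> U Q" for u
  using q that by (simp add: multilinear)
 have "trilinear K (ktensor K Q V) X Y Z (%s x y. tensor_lift Z (q x y) s)"
  unfolding trilinear_def bilinear_def
  using tensor_lift_linear[OF Q V Z uv] tensor_lift_param[OF Q V Z X xuv] tensor_lift_param[OF Q V Z Y yuv]
  by simp
 then show "klinear K (ktensor K Q V) Z (%s. tensor_lift Z (%x y. tensor_lift Z (q x y) s) t)"
  by (rule tensor_lift_param[OF X Y Z ktensor_module[OF Q V] _ t])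
 have b: "bilinear K Q V Z (%u v. tensor_lift Z (%x y. q x y u v) t)"
  unfolding bilinear_def
  using tensor_lift_param[OF X Y Z Q uxy t] tensor_lift_param[OF X Y Z V vxy t] by simp
 then show "klinear K (ktensor K Q V) Z (tensor_lift Z (%u v. tensor_lift Z (%x y. q x y u v) t))"
  by (rule tensor_lift_linear[OF Q V Z])
 show "tensor_lift Z (%x y. tensor_lift Z (q x y) (kpure K Q V u v)) t =
   tensor_lift Z (%u v. tensor_lift Z (%x y. q x y u v) t) (kpure K Q V u v)"
  if "u \<in> U Q" "v \<in> U V" for u v
  using that
  by (simp add: tensor_lift_kpure[OF Q V Z b])
    (rule tensor_lift_cong[OF X Y Z t], auto simp: tensor_lift_kpure[OF Q V Z uv] bilinearD[OF uv])
qed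

context cocommutative_coalgebra
begin

abbreviation Hom :: "('k, 'z, 'v) module_scheme => ('c => 'z) set"
 where "Hom == module_hom K C"

lemma hom_eqI:
 assumes "f \<in> Hom Z" "g \<in> Hom Z" "!!c. c \<in> U C ==> f c = g c"
 shows "f = g"
 by (rule extensionalityI[of _ "U C"]) (use assms module_homD(5) in auto)

lemma restrict_sweedler_hom:
 assumes Z: "module K Z" and "bilinear K C C Z b"
 shows "restrict (sweedler Z C b) (U C) \<in> Hom Z"
 by (rule linear_restrict_hom[OF C.module_axioms sweedler_linear[OF assms]])

lemma convolve_hom:
 assumes Z: "module K Z" and "bilinear K X Y Z b" "f \<in> Hom X" "g \<in> Hom Y"
 shows "convolve Z C b f g \<in> Hom Z"
 unfolding convolve_def
 by (rule restrict_sweedler_hom[OF Z bilinear_comp]) (use assms module_hom_linear in auto)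

lemma compose_hom:
 assumes "klinear K X Y \<phi>" "f \<in> Hom X"
 shows "cmp C \<phi> f \<in> Hom Y"
 unfolding compose_def
 by (rule linear_restrict_hom[OF C.module_axioms linear_comp[OF assms(1)]]) (rule module_hom_linear[OF assms(2)])

lemma convolve_commute:
 assumes Z: "module K Z" and "bilinear K X Y Z b" "f \<in> Hom X" "g \<in> Hom Y"
 shows "convolve Z C (%y x. b x y) g f = convolve Z C b f g"
 unfolding convolve_def
 by (intro restrict_ext sweedler_swap[OF Z bilinear_comp]) (use assms module_hom_linear in auto)

lemma convolve_cong:
 assumes Z: "module K Z" and b: "bilinear K X Y Z b" and f: "f \<in> Hom X" and g: "g \<in> Hom Y"
  and bb': "!!x y. [|x \<in> U X; y \<in> U Y|] ==> b x y = b' x y"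
 shows "convolve Z C b f g = convolve Z C b' f g"
 unfolding convolve_def
proof (intro restrict_ext sweedler_cong[OF Z])
 show "b (f x) (g y) = b' (f x) (g y)" "b' (f x) (g y) \<in> U Z" if "x \<in> U C" "y \<in> U C" for x y
  using that bb' bilinearD(1)[OF b] module_homD(2)[OF f] module_homD(2)[OF g] by (metis)+
qed

lemma compose_convolve:
 assumes Z: "module K Z" and Z': "module K Z'" and b: "bilinear K X Y Z b" and f: "f \<in> Hom X" and g: "g \<in> Hom Y"
  and \<phi>: "klinear K Z Z' \<phi>"
 shows "cmp C \<phi> (convolve Z C b f g) = convolve Z' C (%x y. \<phi> (b x y)) f g"
 unfolding convolve_def compose_def
 by (rule restrict_ext, simp)
   (rule sweedler_map[OF Z Z' bilinear_comp[OF b module_hom_linear[OF f] module_hom_linear[OF g]] \<phi>])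

lemma convolve_compose_left:
 assumes Z: "module K Z" and b: "bilinear K X' Y Z b" and f: "f \<in> Hom X" and g: "g \<in> Hom Y"
  and \<phi>: "klinear K X X' \<phi>"
 shows "convolve Z C b (cmp C \<phi> f) g = convolve Z C (%x y. b (\<phi> x) y) f g"
 unfolding convolve_def
 by (intro restrict_ext sweedler_cong[OF Z])
   (auto simp: compose_eq bilinearD(1)[OF b] klinearD(1)[OF \<phi>] module_homD(2)[OF f] module_homD(2)[OF g])

lemma convolve_compose_right:
 assumes Z: "module K Z" and b: "bilinear K X Y' Z b" and f: "f \<in> Hom X" and g: "g \<in> Hom Y"
  and \<phi>: "klinear K Y Y' \<phi>"
 shows "convolve Z C b f (cmp C \<phi> g) = convolve Z C (%x y. b x (\<phi> y)) f g"
 unfolding convolve_def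
 by (intro restrict_ext sweedler_cong[OF Z])
   (auto simp: compose_eq bilinearD(1)[OF b] klinearD(1)[OF \<phi>] module_homD(2)[OF f] module_homD(2)[OF g])

text \<open>A constant, regarded as a generalized element with parameters in \<open>C\<close>. It is the unit of convolution times \<open>z\<close>.\<close>
definition const_hom :: "('k, 'z, 'v) module_scheme => 'z => 'c => 'z"
 where "const_hom Z z = restrict (%c. counit C c *.\<^sub>Z z) (U C)"

lemma const_hom_hom: "[|module K Z; z \<in> U Z|] ==> const_hom Z z \<in> Hom Z"
 unfolding const_hom_def
 by (rule linear_restrict_hom[OF C.module_axioms])
   (use counit_smult_bilinear[of Z] in \<open>simp add: bilinear_def\<close>)

lemma compose_const_hom:
 assumes "klinear K Z Z' \<phi>" "z \<in> U Z"
 shows "cmp C \<phi> (const_hom Z z) = const_hom Z' (\<phi> z)"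
 unfolding compose_def const_hom_def
 by (rule restrict_ext) (simp add: klinearD[OF assms(1)] assms(2) counit_closed)

lemma convolve_const_left:
 assumes Z: "module K Z" and X: "module K X" and b: "bilinear K X Y Z b" and x: "x \<in> U X" and g: "g \<in> Hom Y"
 shows "convolve Z C b (const_hom X x) g = cmp C (b x) g"
 unfolding convolve_def compose_def
proof (rule restrict_ext)
 fix c assume c: "c \<in> U C"
 have bx: "klinear K C Z (%y. b x (g y))"
  using b x module_hom_linear[OF g] by (simp add: multilinear)
 have "sweedler Z C (%x' y. b (const_hom X x x') (g y)) c = sweedler Z C (%x' y. counit C x' *.\<^sub>Z b x (g y)) c"
  by (rule sweedler_cong[OF Z c])
    (auto simp: const_hom_def bilinearD[OF b] x module_homD(2)[OF g] counit_closed
     intro!: module.smult_closed[OF Z])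
 also have "... = b x (g c)" by (rule sweedler_counit_left[OF Z bx c])
 finally show "sweedler Z C (%x' y. b (const_hom X x x') (g y)) c = b x (g c)" .
qed

lemma convolve_const_right:
 assumes Z: "module K Z" and Y: "module K Y" and b: "bilinear K X Y Z b" and y: "y \<in> U Y" and f: "f \<in> Hom X"
 shows "convolve Z C b f (const_hom Y y) = cmp C (%x. b x y) f"
 using convolve_const_left[OF Z Y bilinear_flip[OF b] y f]
 by (simp add: convolve_commute[OF Z b f const_hom_hom[OF Y y]])

lemma convolve_nest_right:
 assumes Z: "module K Z" and W: "module K W" and b: "bilinear K X W Z b" and b': "bilinear K Y V W b'"
  and f: "f \<in> Hom X" and g: "g \<in> Hom Y" and h: "h \<in> Hom V"
 shows "convolve Z C b f (convolve W C b' g h) = convolve3 Z C (%x y z. b x (b' y z)) f g h"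
 unfolding convolve_def convolve3_def sweedler3_def
proof (intro restrict_ext sweedler_cong[OF Z])
 note fl = module_hom_linear[OF f] and gl = module_hom_linear[OF g] and hl = module_hom_linear[OF h]
 fix x y assume xy: "x \<in> U C" "y \<in> U C"
 note s = sweedler_map[OF W Z bilinear_comp[OF b' gl hl], of "b (f x)" y]
 show "b (f x) (restrict (sweedler W C (%x y. b' (g x) (h y))) (U C) y)
   = sweedler Z C (%y' z. b (f x) (b' (g y') (h z))) y"
  using s b xy klinearD(1)[OF fl] by (simp add: bilinear_def)
 show "sweedler Z C (%y' z. b (f x) (b' (g y') (h z))) y \<in> U Z"
  by (rule klinearD(1)[OF sweedler_linear[OF Z linear_bilinear[OF _ bilinear_comp[OF b' gl hl]]] xy(2)])
    (use b xy klinearD(1)[OF fl] in \<open>simp add: bilinear_def\<close>)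
qed

lemma convolve_nest_left:
 assumes Z: "module K Z" and W: "module K W" and b: "bilinear K W V Z b" and b': "bilinear K X Y W b'"
  and f: "f \<in> Hom X" and g: "g \<in> Hom Y" and h: "h \<in> Hom V"
 shows "convolve Z C b (convolve W C b' f g) h = convolve3 Z C (%x y z. b (b' x y) z) f g h"
 unfolding convolve_def convolve3_def
proof (rule restrict_ext)
 note fl = module_hom_linear[OF f] and gl = module_hom_linear[OF g] and hl = module_hom_linear[OF h]
 fix c assume c: "c \<in> U C"
 have t: "trilinear K X Y V Z (%x y z. b (b' x y) z)"
  using b b' by (auto simp: multilinear)
 note t' = trilinear_comp[OF t fl gl hl]
 have b2: "bilinear K C C Z (%x y. b (b' (f x) (g y)) (h z))" if "z \<in> U C" for z
  using t' that by (simp add: multilinear)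
 have "sweedler Z C (%x z. b (restrict (sweedler W C (%x y. b' (f x) (g y))) (U C) x) (h z)) c
   = sweedler Z C (%x z. sweedler Z C (%x y. b (b' (f x) (g y)) (h z)) x) c"
 proof (rule sweedler_cong[OF Z c])
  fix x z assume xz: "x \<in> U C" "z \<in> U C"
  have "klinear K W Z (%w. b w (h z))" using b xz klinearD(1)[OF hl] by (simp add: bilinear_def)
  from sweedler_map[OF W Z bilinear_comp[OF b' fl gl] this xz(1)]
  show "b (restrict (sweedler W C (%x y. b' (f x) (g y))) (U C) x) (h z)
    = sweedler Z C (%x y. b (b' (f x) (g y)) (h z)) x" using xz by simp
  show "sweedler Z C (%x y. b (b' (f x) (g y)) (h z)) x \<in> U Z"
   by (rule klinearD(1)[OF sweedler_linear[OF Z b2] xz(1)]) (rule xz)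
 qed
 also have "... = sweedler3 Z C (%x y z. b (b' (f x) (g y)) (h z)) c"
  by (rule sweedler3_coassoc[OF Z t' c])
 finally show "sweedler Z C (%x z. b (restrict (sweedler W C (%x y. b' (f x) (g y))) (U C) x) (h z)) c
  = sweedler3 Z C (%x y z. b (b' (f x) (g y)) (h z)) c" .
qed

lemma convolve3_swap12:
 assumes Z: "module K Z" and t: "trilinear K X Y V Z t" and "f \<in> Hom X" "g \<in> Hom Y" "h \<in> Hom V"
 shows "convolve3 Z C (%y x z. t x y z) g f h = convolve3 Z C t f g h"
 unfolding convolve3_def
 by (intro restrict_ext sweedler3_swap12[OF Z trilinear_comp[OF t]]) (use assms module_hom_linear in auto)

lemma convolve3_swap23:
 assumes Z: "module K Z" and t: "trilinear K X Y V Z t" and "f \<in> Hom X" "g \<in> Hom Y" "h \<in> Hom V"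
 shows "convolve3 Z C (%x z y. t x y z) f h g = convolve3 Z C t f g h"
 unfolding convolve3_def
 by (intro restrict_ext sweedler3_swap23[OF Z trilinear_comp[OF t]]) (use assms module_hom_linear in auto)

lemma convolve3_cong:
 assumes Z: "module K Z" and t: "trilinear K X Y V Z t" and "f \<in> Hom X" "g \<in> Hom Y" "h \<in> Hom V"
  and tt': "!!x y z. [|x \<in> U X; y \<in> U Y; z \<in> U V|] ==> t' x y z = t x y z"
 shows "convolve3 Z C t' f g h = convolve3 Z C t f g h"
 unfolding convolve3_def
 by (intro restrict_ext sweedler3_cong[OF Z _ _ trilinear_comp[OF t]])
   (use assms module_hom_linear module_homD(2) in metis)+

lemma convolve3_nest:
 assumes Z: "module K Z" and W: "module K W" and t: "trilinear K X Y W Z t" and b: "bilinear K Q V W b"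
  and f: "f \<in> Hom X" and g: "g \<in> Hom Y" and h: "h \<in> Hom Q" and k: "k \<in> Hom V"
 shows "convolve3 Z C t f g (convolve W C b h k) = convolve4 Z C (%x y u v. t x y (b u v)) f g h k"
 unfolding convolve3_def convolve4_def
proof (rule restrict_ext)
 note fl = module_hom_linear[OF f] and gl = module_hom_linear[OF g] and hl = module_hom_linear[OF h]
  and kl = module_hom_linear[OF k]
 fix c assume c: "c \<in> U C"
 have inner: "sweedler Z C (%y z. t (f x) (g y) (convolve W C b h k z)) y
   = sweedler3 Z C (%y' z u. t (f x) (g y') (b (h z) (k u))) y"
  "sweedler3 Z C (%y' z u. t (f x) (g y') (b (h z) (k u))) y \<in> U Z"
  if "x \<in> U C" "y \<in> U C" for x y
 proof -
  have "bilinear K Y W Z (t (f x))" using t that klinearD(1)[OF fl] by (simp add: trilinear_def)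
  note n = convolve_nest_right[OF Z W this b g h k] convolve_hom[OF Z this g convolve_hom[OF W b h k]]
  show "sweedler Z C (%y z. t (f x) (g y) (convolve W C b h k z)) y
   = sweedler3 Z C (%y' z u. t (f x) (g y') (b (h z) (k u))) y"
   using fun_cong[OF n(1), of y] that by (simp add: convolve_def[of Z] convolve3_def)
  then show "sweedler3 Z C (%y' z u. t (f x) (g y') (b (h z) (k u))) y \<in> U Z"
   using module_homD(2)[OF n(2), of y] that by (simp add: convolve_def[of Z])
 qed
 show "sweedler3 Z C (%x y z. t (f x) (g y) (convolve W C b h k z)) c
  = sweedler Z C (%x y. sweedler3 Z C (%y' z u. t (f x) (g y') (b (h z) (k u))) y) c"
  unfolding sweedler3_def[of _ _ _ c]
  by (rule sweedler_cong[OF Z c]) (simp_all add: inner)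
qed

lemma convolve4_swap23:
 assumes Z: "module K Z" and q: "quadrilinear K X Y Q V Z q"
  and f: "f \<in> Hom X" and g: "g \<in> Hom Y" and h: "h \<in> Hom Q" and k: "k \<in> Hom V"
 shows "convolve4 Z C (%x u y v. q x y u v) f h g k = convolve4 Z C q f g h k"
 unfolding convolve4_def
proof (intro restrict_ext sweedler_cong[OF Z])
 note fl = module_hom_linear[OF f] and gl = module_hom_linear[OF g] and hl = module_hom_linear[OF h]
  and kl = module_hom_linear[OF k]
 fix x y assume xy: "x \<in> U C" "y \<in> U C"
 have "trilinear K Y Q V Z (q (f x))"
  using q xy klinearD(1)[OF fl] by (simp add: quadrilinear_def)
 note t = trilinear_comp[OF this gl hl kl]
 show "sweedler3 Z C (%y' z u. q (f x) (g z) (h y') (k u)) y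
   = sweedler3 Z C (%y' z u. q (f x) (g y') (h z) (k u)) y"
  by (rule sweedler3_swap12[OF Z t xy(2)])
 show "sweedler3 Z C (%y' z u. q (f x) (g y') (h z) (k u)) y \<in> U Z"
  by (rule klinearD(1)[OF sweedler3_linear[OF Z t] xy(2)])
qed

lemma convolve_nest_both:
 assumes Z: "module K Z" and W: "module K W" and W': "module K W'" and b: "bilinear K W W' Z b"
  and b1: "bilinear K X Y W b1" and b2: "bilinear K Q V W' b2"
  and f: "f \<in> Hom X" and g: "g \<in> Hom Y" and h: "h \<in> Hom Q" and k: "k \<in> Hom V"
 shows "convolve Z C b (convolve W C b1 f g) (convolve W' C b2 h k)
  = convolve4 Z C (%x y u v. b (b1 x y) (b2 u v)) f g h k"
proof -
 have t: "trilinear K X Y W' Z (%x y z. b (b1 x y) z)"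
  using b b1 by (auto simp: multilinear)
 show ?thesis
  by (simp add: convolve_nest_left[OF Z W b b1 f g convolve_hom[OF W' b2 h k]]
   convolve3_nest[OF Z W' t b2 f g h k])
qed

end

lemma module_record_cong:
 fixes M :: "('k, 'm, 'a) module_scheme" and N :: "('k, 'm, 'b) module_scheme"
 assumes "module K M" "U N = U M" "add N = add M" "zero N = zero M" "smult N = smult M"
 shows "module K N"
proof -
 interpret M: module K M by fact
 have "abelian_group N"
  by (rule abelian_groupI)
   (auto simp: assms M.a_ac intro: bexI[of _ "\<ominus>\<^bsub>M\<^esub> _"] M.l_neg)
 then show ?thesis
  by (intro moduleI M.is_cring) (auto simp: assms M.smult_l_distr M.smult_r_distr M.smult_assoc1)
qed

section \<open>Convolution monoids\<close>

lemma (in k_algebra) mult_bilinear: "bilinear R M M M (monoid.mult M)"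
 by (auto simp: multilinear smult_mult_left smult_mult_right l_distr r_distr)

definition conv ::
 "('k, 'w) ring_scheme => ('k, 'c, 'y) hopf_scheme => ('k, 'e, 'v) module_scheme => ('c => 'e) monoid"
 where "conv K C E = \<lparr>carrier = module_hom K C E, monoid.mult = convolve E C (monoid.mult E),
  one = restrict (%c. counit C c *.\<^sub>E 1\<^sub>E) (U C)\<rparr>"

lemma conv_simps [simp]:
 "U (conv K C E) = module_hom K C E"
 "monoid.mult (conv K C E) = convolve E C (monoid.mult E)"
 by (simp_all add: conv_def)

definition algebra_hom ::
 "('k, 'w) ring_scheme => ('k, 'x, 'a) module_scheme => ('k, 'y, 'b) module_scheme => ('x => 'y) => bool"
 where "algebra_hom K X Y \<phi> \<longleftrightarrow> klinear K X Y \<phi> & \<phi> 1\<^sub>X = 1\<^sub>Y &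
  (ALL x:U X. ALL y:U X. \<phi> (x *\<^sub>X y) = \<phi> x *\<^sub>Y \<phi> y)"

context cocommutative_coalgebra
begin

abbreviation (input) star ("_ \<star>\<^sub>_ _" [70, 1000, 71] 70)
 where "f \<star>\<^sub>E g == f \<otimes>\<^bsub>conv K C E\<^esub> g"

lemma one_conv: "\<one>\<^bsub>conv K C E\<^esub> = const_hom E 1\<^sub>E"
 by (simp add: conv_def const_hom_def)

lemma conv_monoid:
 assumes "k_algebra K E"
 shows "monoid (conv K C E)"
proof -
 interpret E: k_algebra K E by fact
 note E = E.module_axioms and m = E.mult_bilinear
 have t: "trilinear K E E E E (%x y z. x *\<^sub>E (y *\<^sub>E z))"
  using m by (simp add: multilinear)
 show ?thesis
 proof (rule monoidI)
  show "(f \<star>\<^sub>E g) \<star>\<^sub>E h = f \<star>\<^sub>E (g \<star>\<^sub>E h)"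
   if "f \<in> U (conv K C E)" "g \<in> U (conv K C E)" "h \<in> U (conv K C E)" for f g h
   using that by (simp add: convolve_nest_left[OF E E m m] convolve_nest_right[OF E E m m])
    (rule convolve3_cong[OF E t], simp_all add: E.m_assoc)
  show "f \<star>\<^sub>E g \<in> U (conv K C E)"
   if "f \<in> U (conv K C E)" "g \<in> U (conv K C E)" for f g
   using that by (simp add: convolve_hom[OF E m])
  show "\<one>\<^bsub>conv K C E\<^esub> \<in> U (conv K C E)"
   by (simp add: one_conv const_hom_hom[OF E])
  show "\<one>\<^bsub>conv K C E\<^esub> \<star>\<^sub>E f = f" if "f \<in> U (conv K C E)" for f
   using that
   by (simp add: one_conv convolve_const_left[OF E E m])
    (rule extensionalityI[of _ "U C"], auto simp: compose_eq module_homD(2,5))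
  show "f \<star>\<^sub>E \<one>\<^bsub>conv K C E\<^esub> = f" if "f \<in> U (conv K C E)" for f
   using that
   by (simp add: one_conv convolve_const_right[OF E E m])
    (rule extensionalityI[of _ "U C"], auto simp: compose_eq module_homD(2,5))
 qed
qed

lemma convolve_compose:
 assumes Z: "module K Z" and b: "bilinear K X' Y' Z b" and f: "f \<in> Hom X" and g: "g \<in> Hom Y"
  and \<phi>: "klinear K X X' \<phi>" and \<psi>: "klinear K Y Y' \<psi>"
 shows "convolve Z C b (cmp C \<phi> f) (cmp C \<psi> g)
  = convolve Z C (%x y. b (\<phi> x) (\<psi> y)) f g"
proof -
 have b': "bilinear K X Y' Z (%x y. b (\<phi> x) y)" using b \<phi> by (auto simp: multilinear)
 show ?thesis
  by (simp add: convolve_compose_left[OF Z b f compose_hom[OF \<psi> g] \<phi>] convolve_compose_right[OF Z b' f g \<psi>])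
qed

lemma compose_compose:
 assumes "f \<in> Hom X"
 shows "cmp C \<psi> (cmp C \<phi> f) = cmp C (%x. \<psi> (\<phi> x)) f"
 by (auto simp: compose_def)

lemma compose_cong:
 assumes "f \<in> Hom X" "!!x. x \<in> U X ==> \<phi> x = \<psi> x"
 shows "cmp C \<phi> f = cmp C \<psi> f"
 using assms by (auto simp: compose_def module_homD(2))

lemma compose_algebra_hom:
 assumes E: "k_algebra K E" and E': "k_algebra K E'" and \<phi>: "algebra_hom K E E' \<phi>"
 shows "[|f \<in> Hom E; g \<in> Hom E|] ==> cmp C \<phi> (f \<star>\<^sub>E g)
   = cmp C \<phi> f \<otimes>\<^bsub>conv K C E'\<^esub> cmp C \<phi> g"
  and "cmp C \<phi> \<one>\<^bsub>conv K C E\<^esub> = \<one>\<^bsub>conv K C E'\<^esub>"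
proof -
 interpret E: k_algebra K E by fact
 interpret E': k_algebra K E' by fact
 have l: "klinear K E E' \<phi>" and eq: "[|x \<in> U E; y \<in> U E|] ==> \<phi> (x *\<^sub>E y) = \<phi> x \<otimes>\<^bsub>E'\<^esub> \<phi> y" for x y
  using \<phi> by (auto simp: algebra_hom_def)
 note m = E.mult_bilinear E'.mult_bilinear
 note M = E.module_axioms E'.module_axioms
 show "cmp C \<phi> (f \<star>\<^sub>E g)
   = cmp C \<phi> f \<otimes>\<^bsub>conv K C E'\<^esub> cmp C \<phi> g" if f: "f \<in> Hom E" and g: "g \<in> Hom E"
  by (simp add: convolve_compose[OF M(2) m(2) f g l l] compose_convolve[OF M m(1) f g l])
    (rule convolve_cong[OF M(2) linear_bilinear[OF l m(1)] f g], simp add: eq)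
 show "cmp C \<phi> \<one>\<^bsub>conv K C E\<^esub> = \<one>\<^bsub>conv K C E'\<^esub>"
  using \<phi> by (simp add: one_conv compose_const_hom[OF l] algebra_hom_def)
qed

text \<open>If all values of two maps commute, then so do the maps; cocommutativity matches the order of the two legs.\<close>
lemma conv_commute:
 assumes E: "k_algebra K E" and f: "f \<in> Hom X" and g: "g \<in> Hom Y"
  and \<phi>: "klinear K X E \<phi>" and \<psi>: "klinear K Y E \<psi>"
  and eq: "!!x y. [|x \<in> U X; y \<in> U Y|] ==> \<phi> x *\<^sub>E \<psi> y = \<psi> y *\<^sub>E \<phi> x"
 shows "cmp C \<phi> f \<star>\<^sub>E cmp C \<psi> g
  = cmp C \<psi> g \<star>\<^sub>E cmp C \<phi> f"
proof -
 interpret E: k_algebra K E by fact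
 note m = E.mult_bilinear and M = E.module_axioms
 note b = bilinear_comp[OF m \<phi> \<psi>] bilinear_comp[OF m \<psi> \<phi>]
 show ?thesis
  by (simp add: convolve_compose[OF M m f g \<phi> \<psi>] convolve_compose[OF M m g f \<psi> \<phi>]
    convolve_commute[OF M bilinear_flip[OF b(2)] f g, symmetric])
   (rule convolve_commute[OF M b(1) f g, symmetric, THEN trans], rule convolve_cong[OF M _ g f],
    rule bilinear_flip[OF b(1)], simp add: eq)
qed

lemma convolve3_mult:
 assumes E: "k_algebra K E" and \<phi>: "klinear K X E \<phi>" and \<psi>: "klinear K Y E \<psi>" and \<chi>: "klinear K V E \<chi>"
  and f: "f \<in> Hom X" and g: "g \<in> Hom Y" and h: "h \<in> Hom V"
 shows "convolve3 E C (%x y z. \<phi> x *\<^sub>E \<psi> y *\<^sub>E \<chi> z) f g h = cmp C \<phi> f \<star>\<^sub>E cmp C \<psi> g \<star>\<^sub>E cmp C \<chi> h"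
proof -
 interpret E: k_algebra K E by (rule E)
 note M = E.module_axioms and m = E.mult_bilinear
 note b = bilinear_comp[OF m \<phi> \<psi>]
 have b': "bilinear K E V E (%u z. u *\<^sub>E \<chi> z)" using m \<chi> by (simp add: multilinear)
 show ?thesis
  unfolding conv_simps convolve_compose[OF M m f g \<phi> \<psi>] convolve_compose_right[OF M m convolve_hom[OF M b f g] h \<chi>]
  by (rule convolve_nest_left[OF M M b' b f g h, symmetric])
qed

end

section \<open>Tensor products of algebras\<close>

lemma alg_tensor_simps [simp]:
 "U (alg_tensor K X Y) = U (ktensor K X Y)"
 "add (alg_tensor K X Y) = add (ktensor K X Y)"
 "zero (alg_tensor K X Y) = zero (ktensor K X Y)"
 "smult (alg_tensor K X Y) = smult (ktensor K X Y)"
 "\<one>\<^bsub>alg_tensor K X Y\<^esub> = kpure K X Y 1\<^sub>X 1\<^sub>Y"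
 by (simp_all add: alg_tensor_def)

lemma klinear_alg_tensor [simp]:
 "klinear K (alg_tensor K X Y) Z = klinear K (ktensor K X Y) Z"
 "klinear K Z (alg_tensor K X Y) = klinear K Z (ktensor K X Y)"
 by (simp_all add: klinear_def fun_eq_iff)

lemma bilinear_alg_tensor [simp]:
 "bilinear K Q V (alg_tensor K X Y) = bilinear K Q V (ktensor K X Y)"
 by (simp add: bilinear_def fun_eq_iff)

lemma alg_tensor_module:
 "module K X ==> module K Y ==> module K (alg_tensor K X Y)"
 by (rule module_record_cong[OF ktensor_module]) simp_all

context
 fixes K :: "('k, 'w) ring_scheme" and X :: "('k, 'x, 'a) module_scheme" and Y :: "('k, 'y, 'b) module_scheme"
 assumes X: "module K X" and Y: "module K Y"
  and mX: "bilinear K X X X (monoid.mult X)" and mY: "bilinear K Y Y Y (monoid.mult Y)"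
begin

interpretation X: module K X by (rule X)
interpretation Y: module K Y by (rule Y)
interpretation XY: module K "ktensor K X Y" by (rule ktensor_module[OF X Y])

lemma alg_tensor_quadrilinear:
 "quadrilinear K X Y X Y (ktensor K X Y) (%x y x' y'. kpure K X Y (x *\<^sub>X x') (y *\<^sub>Y y'))"
 using mX mY kpure_bilinear[OF X Y] by (simp add: multilinear)

lemma alg_tensor_inner_bilinear:
 assumes "v \<in> U (ktensor K X Y)"
 shows "bilinear K X Y (ktensor K X Y) (%x y. tensor_lift (ktensor K X Y)
  (%x' y'. kpure K X Y (x *\<^sub>X x') (y *\<^sub>Y y')) v)"
 unfolding bilinear_def
proof (intro conjI ballI)
 note q = alg_tensor_quadrilinear
 fix x assume "x \<in> U X"
 then show "klinear K Y (ktensor K X Y) (%y. tensor_lift (ktensor K X Y)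
  (%x' y'. kpure K X Y (x *\<^sub>X x') (y *\<^sub>Y y')) v)"
  using q by (intro tensor_lift_param[OF X Y XY.module_axioms Y _ assms]) (simp add: quadrilinear_def)
next
 note q = alg_tensor_quadrilinear
 fix y assume y: "y \<in> U Y"
 have "trilinear K X X Y (ktensor K X Y) (%x x' y'. kpure K X Y (x *\<^sub>X x') (y *\<^sub>Y y'))"
  using q y by (simp add: multilinear)
 then show "klinear K X (ktensor K X Y) (%x. tensor_lift (ktensor K X Y)
  (%x' y'. kpure K X Y (x *\<^sub>X x') (y *\<^sub>Y y')) v)"
  by (rule tensor_lift_param[OF X Y XY.module_axioms X _ assms])
qed

lemma alg_tensor_mult_eq:
 "u \<otimes>\<^bsub>alg_tensor K X Y\<^esub> v = tensor_lift (ktensor K X Y) (%x y. tensor_lift (ktensor K X Y)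
  (%x' y'. kpure K X Y (x *\<^sub>X x') (y *\<^sub>Y y')) v) u"
 by (simp add: alg_tensor_def)

lemma alg_tensor_mult_bilinear:
 "bilinear K (alg_tensor K X Y) (alg_tensor K X Y) (alg_tensor K X Y) (monoid.mult (alg_tensor K X Y))"
proof -
 note q = alg_tensor_quadrilinear
 have inner: "bilinear K X Y (ktensor K X Y) (%x' y'. kpure K X Y (x *\<^sub>X x') (y *\<^sub>Y y'))"
  if "x \<in> U X" "y \<in> U Y" for x y
  using q that by (simp add: multilinear)
 have t: "trilinear K (ktensor K X Y) X Y (ktensor K X Y) (%v x y. tensor_lift (ktensor K X Y)
  (%x' y'. kpure K X Y (x *\<^sub>X x') (y *\<^sub>Y y')) v)"
  unfolding trilinear_def
  using alg_tensor_inner_bilinear tensor_lift_linear[OF X Y XY.module_axioms inner] by simp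
 show ?thesis
  unfolding bilinear_def alg_tensor_mult_eq[abs_def]
  using tensor_lift_linear[OF X Y XY.module_axioms alg_tensor_inner_bilinear]
   tensor_lift_param[OF X Y XY.module_axioms XY.module_axioms t]
  by simp
qed

text \<open>The multiplication is defined by two nested lifts; this evaluates them. Associativity and the unit laws follow by induction on tensors.\<close>
lemma alg_tensor_mult_kpure:
 assumes "x \<in> U X" "y \<in> U Y" "x' \<in> U X" "y' \<in> U Y"
 shows "kpure K X Y x y \<otimes>\<^bsub>alg_tensor K X Y\<^esub> kpure K X Y x' y' = kpure K X Y (x *\<^sub>X x') (y *\<^sub>Y y')"
proof -
 have inner: "bilinear K X Y (ktensor K X Y) (%x' y'. kpure K X Y (x *\<^sub>X x') (y *\<^sub>Y y'))"
  using alg_tensor_quadrilinear assms by (simp add: multilinear)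
 show ?thesis
  using assms bilinearD(1)[OF kpure_bilinear[OF X Y]]
  by (simp add: alg_tensor_mult_eq tensor_lift_kpure[OF X Y XY.module_axioms alg_tensor_inner_bilinear]
   tensor_lift_kpure[OF X Y XY.module_axioms inner])
qed

end

lemma alg_tensor_k_algebra:
 assumes "k_algebra K X" "k_algebra K Y"
 shows "k_algebra K (alg_tensor K X Y)"
proof -
 interpret X: k_algebra K X by fact
 interpret Y: k_algebra K Y by fact
 note XY = X.module_axioms Y.module_axioms
 note m = XY X.mult_bilinear Y.mult_bilinear
 let ?T = "alg_tensor K X Y" and ?p = "kpure K X Y"
 interpret T: module K ?T by (rule alg_tensor_module[OF XY])
 note d = bilinearD[OF alg_tensor_mult_bilinear[OF m]]
 note p = bilinearD(1)[OF kpure_bilinear[OF XY]]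
 note mk = alg_tensor_mult_kpure[OF m]
 have assoc: "(u \<otimes>\<^bsub>?T\<^esub> v) \<otimes>\<^bsub>?T\<^esub> w = u \<otimes>\<^bsub>?T\<^esub> (v \<otimes>\<^bsub>?T\<^esub> w)"
  if "u \<in> U (ktensor K X Y)" "v \<in> U (ktensor K X Y)" "w \<in> U (ktensor K X Y)" for u v w
  using that
 proof (induction u rule: ktensor_induct[OF XY, consumes 1, case_names pure add])
  case u: (pure x y)
  from u(3,4) show ?case
  proof (induction v rule: ktensor_induct[OF XY, consumes 1, case_names pure add])
   case v: (pure x' y')
   from v(3) show ?case
   proof (induction w rule: ktensor_induct[OF XY, consumes 1, case_names pure add])
    case w: (pure x'' y'')
    show ?case using u(1,2) v(1,2) w by (simp add: mk X.m_assoc Y.m_assoc)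
   qed (use u(1,2) v(1,2) d p in simp)
  qed (use u(1,2) d p in simp)
 qed (use d in simp)
 have one: "\<one>\<^bsub>?T\<^esub> \<otimes>\<^bsub>?T\<^esub> u = u" "u \<otimes>\<^bsub>?T\<^esub> \<one>\<^bsub>?T\<^esub> = u" if "u \<in> U (ktensor K X Y)" for u
  using that
  by (induction u rule: ktensor_induct[OF XY, consumes 1, case_names pure add])
   (use mk d p in simp_all)
 have "monoid ?T"
  by (rule monoidI) (use assoc one d p in simp_all)
 then have "ring ?T"
  by (intro ringI T.abelian_group_axioms) (use d in simp_all)
 then show ?thesis
  by (intro k_algebra.intro T.module_axioms k_algebra_axioms.intro) (use d in simp_all)
qed

section \<open>The coalgebra \<open>C \<otimes> D\<close>\<close>

lemma ktensor_record_cong: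
 assumes "U X' = U X" "add X' = add X" "smult X' = smult X"
  "U Y' = U Y" "add Y' = add Y" "smult Y' = smult Y"
 shows "ktensor K X' Y' = ktensor K X Y" and "kpure K X' Y' = kpure K X Y"
 by (simp_all add: assms ktensor_def kpure_def tensor_product_def tensor_additive_def tensor_group_def
  pure_tensor_def tensor_rels_def fun_eq_iff)

text \<open>Only the coalgebra part of the record is meaningful; it is a Hopf record so that it can be the source of
  points, in particular \<open>H \<otimes> H\<close>, whose two projections are the generic pair of points of \<open>H\<close>.\<close>
definition tensor_coalgebra ::
 "('k, 'w) ring_scheme => ('k, 'c, 'y) hopf_scheme => ('k, 'd, 'z) hopf_scheme => ('k, ('c, 'd) tensor) hopf"
 where "tensor_coalgebra K C D = (let T = ktensor K C D; TT = ktensor K T T in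
  \<lparr>carrier = U T, monoid.mult = undefined, one = undefined, zero = zero T, add = add T,
   smult = smult T,
   comult = tensor_lift TT (%c d. sweedler TT C (%c1 c2. sweedler TT D
    (%d1 d2. kpure K T T (kpure K C D c1 d1) (kpure K C D c2 d2)) d) c),
   counit = tensor_lift K (%c d. counit C c *\<^sub>K counit D d),
   antipode = undefined\<rparr>)"

locale coalgebra_pair = C: cocommutative_coalgebra K C + D: cocommutative_coalgebra K D
 for K :: "('k, 'w) ring_scheme" (structure) and C :: "('k, 'c, 'y) hopf_scheme"
  and D :: "('k, 'd, 'z) hopf_scheme"
begin

abbreviation (input) "T == ktensor K C D"
abbreviation (input) "CD == tensor_coalgebra K C D"
abbreviation (input) "p == kpure K C D"

lemma CD_simps [simp]:
 "U CD = U T" "add CD = add T" "zero CD = zero T" "smult CD = smult T"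
 by (simp_all add: tensor_coalgebra_def Let_def)

lemma CD_ktensor [simp]: "ktensor K CD CD = ktensor K T T" "kpure K CD CD = kpure K T T"
 "ktensor K (ktensor K T T) CD = ktensor K (ktensor K T T) T"
 "kpure K (ktensor K T T) CD = kpure K (ktensor K T T) T"
 by (rule ktensor_record_cong, simp_all)+

lemma CD_linear [simp]:
 "klinear K CD = klinear K T" "bilinear K CD = (%Y Z b. bilinear K T Y Z b)"
 by (simp_all add: klinear_def bilinear_def fun_eq_iff)

interpretation T: module K T by (rule ktensor_module[OF C.C.module_axioms D.C.module_axioms])

lemma CD_module: "module K CD"
 by (rule module_record_cong[OF T.module_axioms]) simp_all

lemma p_closed: "[|c \<in> U C; d \<in> U D|] ==> p c d \<in> U T"
 by (rule bilinearD(1)[OF kpure_bilinear[OF C.C.module_axioms D.C.module_axioms]])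

lemmas p_bilinear = kpure_bilinear[OF C.C.module_axioms D.C.module_axioms]

context
 fixes Z :: "('k, 'v, 'u) module_scheme"
 assumes Z: "module K Z"
begin

lemma double_bilinear:
 assumes q: "quadrilinear K C C D D Z q"
 shows "bilinear K C D Z (%c d. sweedler Z C (%c1 c2. sweedler Z D (q c1 c2) d) c)"
 unfolding bilinear_def
proof (intro conjI ballI)
 have t: "trilinear K C C D Z (%c1 c2. sweedler Z D (q c1 c2))"
  by (rule D.sweedler_param_trilinear[OF Z C.C.module_axioms C.C.module_axioms q])
 show "klinear K C Z (%c. sweedler Z C (%c1 c2. sweedler Z D (q c1 c2) d) c)" if "d \<in> U D" for d
  using t that by (intro C.sweedler_linear[OF Z]) (simp add: multilinear)
 show "klinear K D Z (%d. sweedler Z C (%c1 c2. sweedler Z D (q c1 c2) d) c)" if "c \<in> U C" for c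
  using t by (intro C.sweedler_param[OF Z D.C.module_axioms _ that]) (simp add: multilinear)
qed

lemma double_swap:
 assumes q: "quadrilinear K C C D D Z q" and c: "c \<in> U C" and d: "d \<in> U D"
 shows "sweedler Z C (%c1 c2. sweedler Z D (q c1 c2) d) c
  = sweedler Z D (%d1 d2. sweedler Z C (%c1 c2. q c1 c2 d1 d2) c) d"
 unfolding sweedler_def
 by (rule tensor_lift_fubini[OF C.C.module_axioms C.C.module_axioms D.C.module_axioms D.C.module_axioms Z q
   D.comult_closed[OF d] C.comult_closed[OF c]])

end

lemma double_map:
 assumes "module K Z" "module K Z'" "quadrilinear K C C D D Z q" "klinear K Z Z' f"
  "c \<in> U C" "d \<in> U D"
 shows "f (sweedler Z C (%c1 c2. sweedler Z D (q c1 c2) d) c)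
  = sweedler Z' C (%c1 c2. sweedler Z' D (%d1 d2. f (q c1 c2 d1 d2)) d) c"
proof -
 have t: "trilinear K C C D Z (%c1 c2. sweedler Z D (q c1 c2))"
  by (rule D.sweedler_param_trilinear[OF assms(1) C.C.module_axioms C.C.module_axioms assms(3)])
 have b: "bilinear K C C Z (%c1 c2. sweedler Z D (q c1 c2) d)"
  using t assms(6) by (simp add: multilinear)
 have q': "bilinear K D D Z (q c1 c2)" if "c1 \<in> U C" "c2 \<in> U C" for c1 c2
  using assms(3) that by (simp add: multilinear)
 have "f (sweedler Z C (%c1 c2. sweedler Z D (q c1 c2) d) c)
   = sweedler Z' C (%c1 c2. f (sweedler Z D (q c1 c2) d)) c"
  by (rule C.sweedler_map[OF assms(1,2) b assms(4,5)])
 also have "... = sweedler Z' C (%c1 c2. sweedler Z' D (%d1 d2. f (q c1 c2 d1 d2)) d) c"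
  by (rule C.sweedler_cong[OF assms(2,5)])
    (use D.sweedler_map[OF assms(1,2) q' assms(4,6)]
     klinearD(1)[OF D.sweedler_linear[OF assms(2) linear_bilinear[OF assms(4) q']] assms(6)] in auto)
 finally show ?thesis .
qed

lemma comult_bilinear:
 "quadrilinear K C C D D (ktensor K T T) (%c1 c2 d1 d2. kpure K T T (p c1 d1) (p c2 d2))"
 using kpure_bilinear[OF T.module_axioms T.module_axioms] p_bilinear by (simp add: multilinear)

lemmas TT_module = ktensor_module[OF T.module_axioms T.module_axioms]

lemma comult_CD: "comult CD = tensor_lift (ktensor K T T) (%c d. sweedler (ktensor K T T) C (%c1 c2.
  sweedler (ktensor K T T) D (%d1 d2. kpure K T T (p c1 d1) (p c2 d2)) d) c)"
 by (simp add: tensor_coalgebra_def Let_def)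

lemma comult_CD_linear: "klinear K T (ktensor K T T) (comult CD)"
 unfolding comult_CD
 by (rule tensor_lift_linear[OF C.C.module_axioms D.C.module_axioms TT_module double_bilinear[OF TT_module comult_bilinear]])

lemma comult_CD_pure:
 "[|c \<in> U C; d \<in> U D|] ==> comult CD (p c d) = sweedler (ktensor K T T) C (%c1 c2.
  sweedler (ktensor K T T) D (%d1 d2. kpure K T T (p c1 d1) (p c2 d2)) d) c"
 unfolding comult_CD
 by (rule tensor_lift_kpure[OF C.C.module_axioms D.C.module_axioms TT_module double_bilinear[OF TT_module comult_bilinear]])

text \<open>A sum over \<open>\<Delta> (c \<otimes> d)\<close> is a double sum over \<open>\<Delta> c\<close> and \<open>\<Delta> d\<close>; the coalgebra laws of \<open>C \<otimes> D\<close> are obtained from those of the factors by this rule.\<close>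
lemma sweedler_CD_pure:
 assumes Z: "module K Z" and b: "bilinear K T T Z b" and c: "c \<in> U C" and d: "d \<in> U D"
 shows "sweedler Z CD b (p c d)
  = sweedler Z C (%c1 c2. sweedler Z D (%d1 d2. b (p c1 d1) (p c2 d2)) d) c"
proof -
 note TM = T.module_axioms
 note L = tensor_lift_linear[OF TM TM Z b]
 have b1: "bilinear K D D Z (%d1 d2. b (p c1 d1) (p c2 d2))" if "c1 \<in> U C" "c2 \<in> U C" for c1 c2
  using b p_bilinear that by (simp add: multilinear)
 have "quadrilinear K C C D D Z (%c1 c2 d1 d2. b (p c1 d1) (p c2 d2))"
  using b p_bilinear by (simp add: multilinear)
 from D.sweedler_param_trilinear[OF Z C.C.module_axioms C.C.module_axioms this]
 have cl: "sweedler Z D (%d1 d2. b (p c1 d1) (p c2 d2)) d \<in> U Z" if "c1 \<in> U C" "c2 \<in> U C" for c1 c2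
  using that d by (rule trilinearD(1))
 have "sweedler Z CD b (p c d) = sweedler Z C (%c1 c2. sweedler Z D (%d1 d2.
   tensor_lift Z b (kpure K T T (p c1 d1) (p c2 d2))) d) c"
  unfolding sweedler_def[of Z CD] comult_CD_pure[OF c d]
  by (rule double_map[OF TT_module Z comult_bilinear L c d])
 also have "... = sweedler Z C (%c1 c2. sweedler Z D (%d1 d2. b (p c1 d1) (p c2 d2)) d) c"
  by (rule C.sweedler_cong[OF Z c], rule D.sweedler_cong[OF Z d])
   (auto simp: tensor_lift_kpure[OF TM TM Z b] p_closed cl bilinearD(1)[OF b])
 finally show ?thesis .
qed

lemma CD_sweedler_linear:
 assumes Z: "module K Z" and b: "bilinear K T T Z b"
 shows "klinear K T Z (sweedler Z CD b)"
 unfolding sweedler_def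
 by (rule linear_comp[OF tensor_lift_linear[OF T.module_axioms T.module_axioms Z b] comult_CD_linear])

lemma CD_param:
 assumes Z: "module K Z" and V: "module K V" and t: "trilinear K V T T Z t" and c: "c \<in> U T"
 shows "klinear K V Z (%v. sweedler Z CD (t v) c)"
 unfolding sweedler_def
 by (rule tensor_lift_param[OF T.module_axioms T.module_axioms Z V t klinearD(1)[OF comult_CD_linear c]])

text \<open>Both sides are expanded to sixfold sums; the exchange of a sum over \<open>C\<close> with one over \<open>D\<close>
  brings the three legs of each factor together, and coassociativity is applied in each factor.\<close>
lemma CD_coassoc:
 assumes Z: "module K Z" and t: "trilinear K T T T Z t" and x: "x \<in> U T"
 shows "sweedler Z CD (%x z. sweedler Z CD (%x' y. t x' y z) x) x = sweedler3 Z CD t x"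
proof (rule ktensor_linear_eq[OF C.C.module_axioms D.C.module_axioms _ _ _ x])
 note CM = C.C.module_axioms and DM = D.C.module_axioms
 have t1: "bilinear K T T Z (t x)" "bilinear K T T Z (%x y. t x y z)"
  if "x \<in> U T" "z \<in> U T" for x z
  using t that by (simp_all add: multilinear)
 have t2: "trilinear K T T T Z (%z x y. t x y z)" using t by (simp add: multilinear)
 have bl: "bilinear K T T Z (%x z. sweedler Z CD (%x' y. t x' y z) x)"
  unfolding bilinear_def
  using CD_param[OF Z T.module_axioms t2] CD_sweedler_linear[OF Z t1(2)] by simp
 have br: "bilinear K T T Z (%x. sweedler Z CD (t x))"
  unfolding bilinear_def
  using CD_param[OF Z T.module_axioms t] CD_sweedler_linear[OF Z t1(1)] by simp
 show "klinear K (ktensor K C D) Z (sweedler Z CD (%x z. sweedler Z CD (%x' y. t x' y z) x))"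
  by (rule CD_sweedler_linear[OF Z bl])
 show "klinear K (ktensor K C D) Z (sweedler3 Z CD t)"
  unfolding sweedler3_def using CD_sweedler_linear[OF Z br] by simp
 fix c d assume c: "c \<in> U C" and d: "d \<in> U D"
 let ?s = "%c1 c2 c3 d1 d2 d3. t (p c1 d1) (p c2 d2) (p c3 d3)"
 let ?G = "%c1 c2 c3. sweedler3 Z D (?s c1 c2 c3) d"
 note lin = t[unfolded multilinear] p_bilinear[unfolded multilinear]
 have sD: "trilinear K D D D Z (?s c1 c2 c3)"
  if "c1 \<in> U C" "c2 \<in> U C" "c3 \<in> U C" for c1 c2 c3
  using lin that by (simp add: multilinear)
 have F: "quadrilinear K C C D D Z (%c2 c3 d1 d2. sweedler Z D (?s c1 c2 c3 d1) d2)"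
  if c1: "c1 \<in> U C" for c1
 proof -
  have s1: "bilinear K D D Z (?s c1 c2 c3 d1)" if "c2 \<in> U C" "c3 \<in> U C" "d1 \<in> U D" for c2 c3 d1
   using lin that c1 by (simp add: multilinear)
  have s2: "trilinear K D D D Z (?s c1 c2 c3)" if "c2 \<in> U C" "c3 \<in> U C" for c2 c3
   using sD that c1 by simp
  have s3: "trilinear K C D D Z (%c3. ?s c1 c2 c3 d1)" if "c2 \<in> U C" "d1 \<in> U D" for c2 d1
   using lin that c1 by (simp add: multilinear)
  have s4: "trilinear K C D D Z (%c2. ?s c1 c2 c3 d1)" if "c3 \<in> U C" "d1 \<in> U D" for c3 d1
   using lin that c1 by (simp add: multilinear)
  show ?thesis
   unfolding quadrilinear_def trilinear_def bilinear_def
   using D.sweedler_linear[OF Z s1] D.sweedler_param[OF Z DM s2] D.sweedler_param[OF Z CM s3]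
    D.sweedler_param[OF Z CM s4] by simp
 qed
 have F': "quadrilinear K C C D D Z (%c1 c2 d1 d3. sweedler Z D (%d1 d2. ?s c1 c2 c3 d1 d2 d3) d1)"
  if c3: "c3 \<in> U C" for c3
 proof -
  have s1: "bilinear K D D Z (%d1 d2. ?s c1 c2 c3 d1 d2 d3)" if "c1 \<in> U C" "c2 \<in> U C" "d3 \<in> U D" for c1 c2 d3
   using lin that c3 by (simp add: multilinear)
  have s2: "trilinear K D D D Z (%d3 d1 d2. ?s c1 c2 c3 d1 d2 d3)" if "c1 \<in> U C" "c2 \<in> U C" for c1 c2
   using lin that c3 by (simp add: multilinear)
  have s3: "trilinear K C D D Z (%c2 d1 d2. ?s c1 c2 c3 d1 d2 d3)" if "c1 \<in> U C" "d3 \<in> U D" for c1 d3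
   using lin that c3 by (simp add: multilinear)
  have s4: "trilinear K C D D Z (%c1 d1 d2. ?s c1 c2 c3 d1 d2 d3)" if "c2 \<in> U C" "d3 \<in> U D" for c2 d3
   using lin that c3 by (simp add: multilinear)
  show ?thesis
   unfolding quadrilinear_def trilinear_def bilinear_def
   using D.sweedler_linear[OF Z s1] D.sweedler_param[OF Z DM s2] D.sweedler_param[OF Z CM s3]
    D.sweedler_param[OF Z CM s4] by simp
 qed
 have G: "trilinear K C C C Z ?G"
 proof -
  have "klinear K C Z (%u. sweedler3 Z D (q u) d)" if "quadrilinear K C D D D Z q" for q
   using D.sweedler_param_trilinear[OF Z DM CM that]
   unfolding sweedler3_def by (rule D.sweedler_param[OF Z CM _ d])
  note q = this[of "%c1. ?s c1 x y" for x y] this[of "%c2. ?s x c2 y" for x y] this[of "%c3. ?s x y c3" for x y]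
  show ?thesis unfolding trilinear_def bilinear_def using q lin by (simp add: multilinear)
 qed
 have R: "sweedler3 Z CD t (p c d) = sweedler3 Z C ?G c"
 proof -
  have "sweedler3 Z CD t (p c d)
    = sweedler Z C (%c1 c2. sweedler Z D (%d1 d2. sweedler Z CD (t (p c1 d1)) (p c2 d2)) d) c"
   unfolding sweedler3_def by (rule sweedler_CD_pure[OF Z br c d])
  also have "... = sweedler3 Z C ?G c"
   unfolding sweedler3_def[of Z C]
  proof (rule C.sweedler_cong[OF Z c])
   fix c1 c2 assume c12: "c1 \<in> U C" "c2 \<in> U C"
   note F1 = F[OF c12(1)]
   have "sweedler Z D (%d1 d2. sweedler Z CD (t (p c1 d1)) (p c2 d2)) d
     = sweedler Z D (%d1 d2. sweedler Z C (%c2 c3. sweedler Z D (?s c1 c2 c3 d1) d2) c2) d"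
   proof (rule D.sweedler_cong[OF Z d])
    fix d1 d2 assume d12: "d1 \<in> U D" "d2 \<in> U D"
    show "sweedler Z CD (t (p c1 d1)) (p c2 d2) = sweedler Z C (%c2 c3. sweedler Z D (?s c1 c2 c3 d1) d2) c2"
     by (rule sweedler_CD_pure[OF Z t1(1) c12(2) d12(2)]) (rule p_closed[OF c12(1) d12(1)], rule p_closed[OF c12(1) d12(1)])
    then show "sweedler Z C (%c2 c3. sweedler Z D (?s c1 c2 c3 d1) d2) c2 \<in> U Z"
     using klinearD(1)[OF CD_sweedler_linear[OF Z t1(1)[OF p_closed[OF c12(1) d12(1)] p_closed[OF c12(1) d12(1)]]]
      p_closed[OF c12(2) d12(2)]] by simp
   qed
   also have "... = sweedler Z C (?G c1) c2"
    unfolding sweedler3_def by (rule double_swap[OF Z F1 c12(2) d, symmetric])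
   finally show "sweedler Z D (%d1 d2. sweedler Z CD (t (p c1 d1)) (p c2 d2)) d = sweedler Z C (?G c1) c2" .
   show "sweedler Z C (?G c1) c2 \<in> U Z"
    by (rule klinearD(1)[OF C.sweedler_linear[OF Z] c12(2)]) (use G c12 in \<open>simp add: trilinear_def\<close>)
  qed
  finally show ?thesis .
 qed
 have "sweedler Z CD (%x z. sweedler Z CD (%x' y. t x' y z) x) (p c d) = sweedler Z C (%c1 c3. sweedler Z D
   (%d1 d3. sweedler Z CD (%x y. t x y (p c3 d3)) (p c1 d1)) d) c"
  by (rule sweedler_CD_pure[OF Z bl c d])
 also have "... = sweedler Z C (%c1 c3. sweedler Z C (%c1 c2. ?G c1 c2 c3) c1) c"
 proof (rule C.sweedler_cong[OF Z c])
  fix c1 c3 assume c13: "c1 \<in> U C" "c3 \<in> U C"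
  have "sweedler Z D (%d1 d3. sweedler Z CD (%x y. t x y (p c3 d3)) (p c1 d1)) d
    = sweedler Z D (%d1 d3. sweedler Z C (%c1 c2. sweedler Z D (%d1 d2. ?s c1 c2 c3 d1 d2 d3) d1) c1) d"
  proof (rule D.sweedler_cong[OF Z d])
   fix d1 d3 assume d13: "d1 \<in> U D" "d3 \<in> U D"
   note tt = t1(2)[OF p_closed[OF c13(2) d13(2)] p_closed[OF c13(2) d13(2)]]
   show "sweedler Z CD (%x y. t x y (p c3 d3)) (p c1 d1)
     = sweedler Z C (%c1 c2. sweedler Z D (%d1 d2. ?s c1 c2 c3 d1 d2 d3) d1) c1"
    by (rule sweedler_CD_pure[OF Z tt c13(1) d13(1)])
   then show "sweedler Z C (%c1 c2. sweedler Z D (%d1 d2. ?s c1 c2 c3 d1 d2 d3) d1) c1 \<in> U Z"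
    using klinearD(1)[OF CD_sweedler_linear[OF Z tt] p_closed[OF c13(1) d13(1)]] by simp
  qed
  also have "... = sweedler Z C (%c1 c2. sweedler Z D (%d1 d3. sweedler Z D (%d1 d2. ?s c1 c2 c3 d1 d2 d3) d1) d) c1"
   by (rule double_swap[OF Z F'[OF c13(2)] c13(1) d, symmetric])
  also have "... = sweedler Z C (%c1 c2. ?G c1 c2 c3) c1"
   by (rule C.sweedler_cong[OF Z c13(1)])
     (auto intro!: D.sweedler3_coassoc[OF Z sD d] trilinearD(1)[OF G] simp: c13)
  finally show "sweedler Z D (%d1 d3. sweedler Z CD (%x y. t x y (p c3 d3)) (p c1 d1)) d
    = sweedler Z C (%c1 c2. ?G c1 c2 c3) c1" .
  show "sweedler Z C (%c1 c2. ?G c1 c2 c3) c1 \<in> U Z"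
   by (rule klinearD(1)[OF C.sweedler_linear[OF Z] c13(1)]) (use G c13 in \<open>simp add: multilinear\<close>)
 qed
 also have "... = sweedler3 Z C ?G c"
  by (rule C.sweedler3_coassoc[OF Z G c])
 finally show "sweedler Z CD (%x z. sweedler Z CD (%x' y. t x' y z) x) (p c d) = sweedler3 Z CD t (p c d)"
  using R by simp
qed

lemma K_mult_bilinear: "bilinear K C D \<lparr>carrier = U K, monoid.mult = monoid.mult K, one = one K,
  zero = zero K, add = add K, smult = monoid.mult K\<rparr> (%c d. counit C c \<otimes> counit D d)"
 by (auto simp: multilinear C.counit_closed D.counit_closed C.counit_add D.counit_add
   C.counit_smult D.counit_smult C.C.l_distr C.C.r_distr C.C.m_assoc C.C.m_lcomm)

lemma K_module: "module K \<lparr>carrier = U K, monoid.mult = monoid.mult K, one = one K,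
  zero = zero K, add = add K, smult = monoid.mult K\<rparr>" (is "module K ?K")
proof (rule moduleI)
 show "abelian_group ?K"
  by (rule abelian_groupI)
   (auto simp: C.C.R.a_ac intro: bexI[of _ "\<ominus> _"] C.C.R.l_neg)
qed (auto simp: C.C.l_distr C.C.r_distr C.C.m_assoc C.C.is_cring)

lemma counit_CD: "counit CD = tensor_lift \<lparr>carrier = U K, monoid.mult = monoid.mult K, one = one K,
  zero = zero K, add = add K, smult = monoid.mult K\<rparr> (%c d. counit C c \<otimes> counit D d)"
 unfolding tensor_coalgebra_def Let_def by (simp, rule tensor_lift_additive_record) simp_all

lemma counit_CD_linear: "klinear K T \<lparr>carrier = U K, monoid.mult = monoid.mult K, one = one K,
  zero = zero K, add = add K, smult = monoid.mult K\<rparr> (counit CD)"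
 unfolding counit_CD
 by (rule tensor_lift_linear[OF C.C.module_axioms D.C.module_axioms K_module K_mult_bilinear])

lemma counit_CD_pure:
 "[|c \<in> U C; d \<in> U D|] ==> counit CD (p c d) = counit C c \<otimes> counit D d"
 unfolding counit_CD
 by (rule tensor_lift_kpure[OF C.C.module_axioms D.C.module_axioms K_module K_mult_bilinear])

lemma CD_cocommutative_coalgebra: "cocommutative_coalgebra K CD"
proof (intro cocommutative_coalgebra.intro CD_module cocommutative_coalgebra_axioms.intro)
 note CM = C.C.module_axioms and DM = D.C.module_axioms and TM = T.module_axioms
 note eq = ktensor_linear_eq[OF CM DM]
 show "klinear K CD (ktensor K CD CD) (comult CD)"
  using comult_CD_linear by simp
 note cl = counit_CD_linear[unfolded klinear_def, simplified]
 show "counit CD c \<in> U K" if "c \<in> U CD" for c using cl that by simp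
 show "counit CD (c +\<^sub>CD d) = counit CD c \<oplus> counit CD d" if "c \<in> U CD" "d \<in> U CD" for c d
  using cl that by simp
 show "counit CD (k *.\<^sub>CD d) = k \<otimes> counit CD d" if "k \<in> U K" "d \<in> U CD" for k d
  using cl that by simp
 have cu: "bilinear K T T T (%x y. counit CD x *.\<^sub>T y)"
  using cl by (auto simp: multilinear T.smult_l_distr T.smult_r_distr T.smult_assoc1[symmetric] C.C.m_comm)
 have fl: "bilinear K T T (ktensor K T T) (%x y. kpure K T T y x)"
  by (rule bilinear_flip[OF kpure_bilinear[OF TM TM]])
 show "sweedler CD CD (%x y. counit CD x *.\<^sub>CD y) c = c" if "c \<in> U CD" for c
 proof -
  have "sweedler CD CD (%x y. counit CD x *.\<^sub>CD y) = sweedler T CD (%x y. counit CD x *.\<^sub>T y)"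
   unfolding sweedler_def by (simp, rule ext, rule fun_cong[OF tensor_lift_additive_record]) simp_all
  moreover have "sweedler T CD (%x y. counit CD x *.\<^sub>T y) c = c"
  proof (rule eq)
   show "klinear K (ktensor K C D) T (sweedler T CD (%x y. counit CD x *.\<^sub>T y))"
    by (rule CD_sweedler_linear[OF TM cu])
   show "klinear K (ktensor K C D) T (%x. x)" by (simp add: klinear_def)
   fix c d assume cd: "c \<in> U C" "d \<in> U D"
   have lD: "klinear K D T (%d2. counit C c1 *.\<^sub>T p c2 d2)" if "c1 \<in> U C" "c2 \<in> U C" for c1 c2
    using p_bilinear that C.counit_closed
    by (auto simp: multilinear T.smult_r_distr T.smult_assoc1[symmetric] C.C.m_comm)
   have lC: "klinear K C T (%c2. p c2 d)" using p_bilinear cd by (simp add: bilinear_def)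
   have "sweedler T CD (%x y. counit CD x *.\<^sub>T y) (p c d) = sweedler T C (%c1 c2. sweedler T D
     (%d1 d2. counit CD (p c1 d1) *.\<^sub>T p c2 d2) d) c"
    by (rule sweedler_CD_pure[OF TM cu cd])
   also have "... = sweedler T C (%c1 c2. counit C c1 *.\<^sub>T p c2 d) c"
   proof (rule C.sweedler_cong[OF TM cd(1)])
    fix c1 c2 assume c12: "c1 \<in> U C" "c2 \<in> U C"
    have "sweedler T D (%d1 d2. counit CD (p c1 d1) *.\<^sub>T p c2 d2) d
      = sweedler T D (%d1 d2. counit D d1 *.\<^sub>T (counit C c1 *.\<^sub>T p c2 d2)) d"
     using c12
     by (intro D.sweedler_cong[OF TM cd(2)])
      (auto simp: counit_CD_pure p_closed C.counit_closed D.counit_closed C.C.m_comm T.smult_assoc1[symmetric])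
    also have "... = counit C c1 *.\<^sub>T p c2 d"
     by (rule D.sweedler_counit_left[OF TM lD[OF c12] cd(2)])
    finally show "sweedler T D (%d1 d2. counit CD (p c1 d1) *.\<^sub>T p c2 d2) d = counit C c1 *.\<^sub>T p c2 d" .
    show "counit C c1 *.\<^sub>T p c2 d \<in> U T"
     using c12 cd by (simp add: p_closed C.counit_closed)
   qed
   also have "... = p c d" by (rule C.sweedler_counit_left[OF TM lC cd(1)])
   finally show "sweedler T CD (%x y. counit CD x *.\<^sub>T y) (kpure K C D c d) = kpure K C D c d" .
  qed (use that in simp)
  ultimately show ?thesis by simp
 qed
 show "sweedler (ktensor K CD CD) CD (%x y. kpure K CD CD y x) c = comult CD c" if "c \<in> U CD" for c
 proof -
  have "sweedler (ktensor K T T) CD (%x y. kpure K T T y x) c = comult CD c"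
  proof (rule eq)
   show "klinear K (ktensor K C D) (ktensor K T T) (sweedler (ktensor K T T) CD (%x y. kpure K T T y x))"
    by (rule CD_sweedler_linear[OF TT_module fl])
   show "klinear K (ktensor K C D) (ktensor K T T) (comult CD)" by (rule comult_CD_linear)
   fix c d assume cd: "c \<in> U C" "d \<in> U D"
   note q = comult_bilinear
   have q1: "bilinear K D D (ktensor K T T) (%d1 d2. kpure K T T (p c1 d1) (p c2 d2))"
    if "c1 \<in> U C" "c2 \<in> U C" for c1 c2
    using q that by (simp add: multilinear)
   have q2: "bilinear K C C (ktensor K T T) (%c1 c2. sweedler (ktensor K T T) D (%d1 d2. kpure K T T (p c1 d1) (p c2 d2)) d)"
    using D.sweedler_param_trilinear[OF TT_module CM CM q] cd by (simp add: multilinear)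
   have "sweedler (ktensor K T T) CD (%x y. kpure K T T y x) (p c d)
    = sweedler (ktensor K T T) C (%c1 c2. sweedler (ktensor K T T) D (%d1 d2. kpure K T T (p c2 d2) (p c1 d1)) d) c"
    by (rule sweedler_CD_pure[OF TT_module fl cd])
   also have "... = sweedler (ktensor K T T) C (%c1 c2. sweedler (ktensor K T T) D (%d1 d2. kpure K T T (p c2 d1) (p c1 d2)) d) c"
    by (rule C.sweedler_cong[OF TT_module cd(1)])
     (auto intro!: D.sweedler_swap[OF TT_module q1 cd(2)] bilinearD(1)[OF q2])
   also have "... = comult CD (p c d)"
    unfolding comult_CD_pure[OF cd] by (rule C.sweedler_swap[OF TT_module q2 cd(1)])
   finally show "sweedler (ktensor K T T) CD (%x y. kpure K T T y x) (kpure K C D c d) = comult CD (kpure K C D c d)" .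
  qed (use that in simp)
  then show ?thesis by simp
 qed
 show "sweedler (ktensor K (ktensor K CD CD) CD) CD (%x y. kpure K (ktensor K CD CD) CD (comult CD x) y) c =
   sweedler3 (ktensor K (ktensor K CD CD) CD) CD
    (%x y z. kpure K (ktensor K CD CD) CD (kpure K CD CD x y) z) c" if c: "c \<in> U CD" for c
 proof -
  let ?Z = "ktensor K (ktensor K T T) T" and ?p = "kpure K (ktensor K T T) T"
  note Z = ktensor_module[OF TT_module TM]
  note pb = kpure_bilinear[OF TT_module TM]
  have t: "trilinear K T T T ?Z (%x y z. ?p (kpure K T T x y) z)"
   using pb kpure_bilinear[OF TM TM] by (simp add: multilinear)
  have id: "sweedler (ktensor K T T) CD (kpure K T T) x = comult CD x" if "x \<in> U T" for x
   unfolding sweedler_def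
   by (rule ktensor_linear_eq[OF TM TM, of "ktensor K T T" _ "%x. x"])
    (use tensor_lift_linear[OF TM TM TT_module kpure_bilinear[OF TM TM]] klinearD(1)[OF comult_CD_linear that]
     tensor_lift_kpure[OF TM TM TT_module kpure_bilinear[OF TM TM]] in \<open>simp_all add: klinear_def\<close>)
  have "sweedler ?Z CD (%x y. ?p (comult CD x) y) c
   = sweedler ?Z CD (%x z. sweedler ?Z CD (%x' y. ?p (kpure K T T x' y) z) x) c"
   unfolding sweedler_def[of ?Z CD _ c]
  proof (rule tensor_lift_cong[OF TM TM Z])
   show "comult CD c \<in> U (ktensor K T T)" using klinearD(1)[OF comult_CD_linear] c by simp
   fix x z assume xz: "x \<in> U T" "z \<in> U T"
   have "klinear K (ktensor K T T) ?Z (%w. ?p w z)" using pb xz by (simp add: bilinear_def)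
   from tensor_lift_map[OF TM TM TT_module Z kpure_bilinear[OF TM TM] this klinearD(1)[OF comult_CD_linear xz(1)]]
   show e: "?p (comult CD x) z = sweedler ?Z CD (%x' y. ?p (kpure K T T x' y) z) x"
    using id[OF xz(1)] by (simp add: sweedler_def)
   show "sweedler ?Z CD (%x' y. ?p (kpure K T T x' y) z) x \<in> U ?Z"
    using bilinearD(1)[OF pb klinearD(1)[OF comult_CD_linear xz(1)] xz(2)] by (simp add: e)
  qed
  also have "... = sweedler3 ?Z CD (%x y z. ?p (kpure K T T x y) z) c"
   by (rule CD_coassoc[OF Z t]) (use c in simp)
  finally show ?thesis by simp
 qed
qed

end

section \<open>Points of a Hopf algebra\<close>

context cocommutative_hopf_algebra
begin

lemma comult_algebra_hom: "algebra_hom K H (alg_tensor K H H) (comult H)"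
 using comult_ring_hom comult_smult
 by (auto simp: algebra_hom_def klinear_def ring_hom_def)

lemma cocommutative_coalgebra: "cocommutative_coalgebra K H"
proof (intro cocommutative_coalgebra.intro module_axioms cocommutative_coalgebra_axioms.intro)
 show "klinear K H (ktensor K H H) (comult H)"
  using comult_algebra_hom by (simp add: algebra_hom_def)
 show "counit H (c +\<^sub>H d) = counit H c \<oplus> counit H d" if "c \<in> U H" "d \<in> U H" for c d
  using counit_ring_hom that by (simp add: ring_hom_add)
 show "counit H c \<in> U K" if "c \<in> U H" for c
  using counit_ring_hom that by (simp add: ring_hom_closed)
qed (fact counit_smult coassoc counit_left cocommutative)+

lemma antipode_linear: "klinear K H H (antipode H)"
 using antipode_closed by (auto simp: klinear_def antipode_add antipode_smult)

lemma counit_one: "counit H 1\<^sub>H = \<one>"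
 using ring_hom_one[OF counit_ring_hom] .

lemma counit_mult: "[|g \<in> U H; h \<in> U H|] ==> counit H (g *\<^sub>H h) = counit H g \<otimes> counit H h"
 using ring_hom_mult[OF counit_ring_hom] .

end

context cocommutative_coalgebra
begin

lemma sweedler4_coassoc:
 assumes Z: "module K Z" and q: "quadrilinear K C C C C Z q" and c: "c \<in> U C"
 shows "sweedler Z C (%r z. sweedler3 Z C (%u v y. q u v y z) r) c
  = sweedler Z C (%u r. sweedler3 Z C (q u) r) c"
proof -
 note CM = C.module_axioms
 have t1: "trilinear K C C C Z (%u s z. sweedler Z C (%v y. q u v y z) s)"
 proof -
  have "quadrilinear K C C C C Z (%u z v y. q u v y z)"
   using q by (simp add: multilinear)
  from sweedler_param_trilinear[OF Z CM CM this] show ?thesis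
   by (simp add: multilinear)
 qed
 have t2: "trilinear K C C C Z (q u)" if "u \<in> U C" for u
  using q that by (simp add: quadrilinear_def)
 have "sweedler Z C (%r z. sweedler3 Z C (%u v y. q u v y z) r) c
   = sweedler3 Z C (%u s z. sweedler Z C (%v y. q u v y z) s) c"
  unfolding sweedler3_coassoc[OF Z t1 c, symmetric] by (simp add: sweedler3_def)
 also have "... = sweedler Z C (%u r. sweedler3 Z C (q u) r) c"
  unfolding sweedler3_def[of Z C _ c]
  by (rule sweedler_cong[OF Z c])
    (auto intro!: sweedler3_coassoc[OF Z t2] klinearD(1)[OF sweedler3_linear[OF Z t2]])
 finally show ?thesis .
qed

end

locale hopf_points = H: cocommutative_hopf_algebra K H + C: cocommutative_coalgebra K C
 for K :: "('k, 'w) ring_scheme" (structure) and H :: "('k, 'h, 'z) hopf_scheme"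
  and C :: "('k, 'c, 'y) hopf_scheme"
begin

interpretation HC: cocommutative_coalgebra K H by (rule H.cocommutative_coalgebra)

abbreviation "Hom == module_hom K C"
abbreviation (input) "cc == cmp C"
abbreviation (input) "HH == alg_tensor K H H"

lemmas H_module = H.module_axioms
lemmas HH_k_algebra = alg_tensor_k_algebra[OF H.k_algebra_axioms H.k_algebra_axioms]

interpretation HH: k_algebra K HH by (rule HH_k_algebra)

text \<open>Coalgebra maps \<open>C \<rightarrow> H\<close>, written as equations between maps on \<open>C\<close>: the first says that \<open>g\<close> commutes with comultiplication,
  the second that it preserves the counit (embedded into \<open>H\<close>, so that no target \<open>K\<close> is needed).\<close>
definition points :: "('c => 'h) set"
 where "points = {g \<in> Hom H.
  cc (comult H) g = convolve (ktensor K H H) C (kpure K H H) g g &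
  cc (%h. counit H h *.\<^sub>H 1\<^sub>H) g = \<one>\<^bsub>conv K C H\<^esub>}"

lemma points_hom: "g \<in> points ==> g \<in> Hom H"
 by (simp add: points_def)

text \<open>The reason for working with points: a Sweedler sum over \<open>\<Delta> (g c)\<close> becomes one over \<open>\<Delta> c\<close> in which \<open>g\<close> occurs twice.\<close>
lemma point_sweedler:
 assumes Z: "module K Z" and b: "bilinear K H H Z b" and g: "g \<in> points" and c: "c \<in> U C"
 shows "sweedler Z H b (g c) = sweedler Z C (%x y. b (g x) (g y)) c"
proof -
 note gl = module_hom_linear[OF points_hom[OF g]]
 have "comult H (g c) = convolve (ktensor K H H) C (kpure K H H) g g c"
  using g c by (auto simp: points_def compose_def dest: fun_cong[of _ _ c])
 then have "sweedler Z H b (g c) = tensor_lift Z b (sweedler (ktensor K H H) C (%x y. kpure K H H (g x) (g y)) c)"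
  using c by (simp add: sweedler_def[of Z H] convolve_def)
 also have "... = sweedler Z C (%x y. tensor_lift Z b (kpure K H H (g x) (g y))) c"
  by (rule C.sweedler_map[OF ktensor_module[OF H_module H_module] Z
    bilinear_comp[OF kpure_bilinear[OF H_module H_module] gl gl] tensor_lift_linear[OF H_module H_module Z b] c])
 also have "... = sweedler Z C (%x y. b (g x) (g y)) c"
  by (rule C.sweedler_cong[OF Z c])
   (auto simp: tensor_lift_kpure[OF H_module H_module Z b] klinearD(1)[OF gl] bilinearD(1)[OF b])
 finally show ?thesis .
qed

lemma compose_point:
 assumes "module K Z" "bilinear K H H Z b" "g \<in> points"
 shows "cc (sweedler Z H b) g = convolve Z C b g g"
 unfolding convolve_def compose_def
 by (rule restrict_ext) (rule point_sweedler[OF assms])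

text \<open>The comultiplication of a point duplicates it also inside a convolution. So a Sweedler expression in \<open>h\<close> becomes a word
  in which \<open>g\<close> is repeated, and words of points can be reordered.\<close>
lemma convolve_point_left:
 assumes Z: "module K Z" and W: "module K W" and t: "trilinear K H H W Z t" and g: "g \<in> points" and w: "w \<in> Hom W"
 shows "convolve Z C (%h w. sweedler Z H (%x y. t x y w) h) g w = convolve3 Z C t g g w"
 unfolding convolve_def convolve3_def
proof (rule restrict_ext)
 note gl = module_hom_linear[OF points_hom[OF g]] and wl = module_hom_linear[OF w]
 fix c assume c: "c \<in> U C"
 note t' = trilinear_comp[OF t gl gl wl]
 have b: "bilinear K H H Z (%u v. t u v (w y))" if "y \<in> U C" for y
  using t that klinearD(1)[OF wl] by (simp add: multilinear)
 have "sweedler Z C (%x y. sweedler Z H (%u v. t u v (w y)) (g x)) c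
   = sweedler Z C (%x y. sweedler Z C (%u v. t (g u) (g v) (w y)) x) c"
  by (rule C.sweedler_cong[OF Z c])
   (auto simp: point_sweedler[OF Z b g] intro!: klinearD(1)[OF C.sweedler_linear[OF Z bilinear_comp[OF b gl gl]]])
 also have "... = sweedler3 Z C (%x y z. t (g x) (g y) (w z)) c"
  by (rule C.sweedler3_coassoc[OF Z t' c])
 finally show "sweedler Z C (%x y. sweedler Z H (%u v. t u v (w y)) (g x)) c
  = sweedler3 Z C (%x y z. t (g x) (g y) (w z)) c" .
qed

lemma convolve_point_right:
 assumes Z: "module K Z" and W: "module K W" and t: "trilinear K W H H Z t" and g: "g \<in> points" and w: "w \<in> Hom W"
 shows "convolve Z C (%w. sweedler Z H (t w)) w g = convolve3 Z C t w g g"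
 unfolding convolve_def convolve3_def
proof (rule restrict_ext)
 note gl = module_hom_linear[OF points_hom[OF g]] and wl = module_hom_linear[OF w]
 fix c assume c: "c \<in> U C"
 note t' = trilinear_comp[OF t wl gl gl]
 have b: "bilinear K H H Z (t (w y))" if "y \<in> U C" for y
  using t that klinearD(1)[OF wl] by (simp add: multilinear)
 show "sweedler Z C (%x y. sweedler Z H (t (w x)) (g y)) c = sweedler3 Z C (%x y z. t (w x) (g y) (g z)) c"
  unfolding sweedler3_def
  by (rule C.sweedler_cong[OF Z c])
   (auto simp: point_sweedler[OF Z b g] intro!: klinearD(1)[OF C.sweedler_linear[OF Z bilinear_comp[OF b gl gl]]])
qed

lemma convolve3_point_left:
 assumes Z: "module K Z" and V: "module K V" and W: "module K W" and q: "quadrilinear K H H V W Z q"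
  and g: "g \<in> points" and v: "v \<in> Hom V" and w: "w \<in> Hom W"
 shows "convolve3 Z C (%h v w. sweedler Z H (%x y. q x y v w) h) g v w = convolve4 Z C q g g v w"
proof
 fix c
 note gl = module_hom_linear[OF points_hom[OF g]] and vl = module_hom_linear[OF v] and wl = module_hom_linear[OF w]
 note q' = quadrilinear_comp[OF q gl gl vl wl]
 have tz: "trilinear K H H V Z (%x y v. q x y v (w z))" if "z \<in> U C" for z
  using q that klinearD(1)[OF wl] by (simp add: multilinear)
 have tz': "trilinear K C C C Z (%x y u. q (g x) (g y) (v u) (w z))" if "z \<in> U C" for z
  using q' that by (simp add: multilinear)
 have "quadrilinear K V W H H Z (%v w x y. q x y v w)"
  using q by (simp add: multilinear)
 from HC.sweedler_param_trilinear[OF Z W V this]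
 have "trilinear K H V W Z (%h v w. sweedler Z H (%x y. q x y v w) h)"
  by (simp add: multilinear)
 note t = trilinear_comp[OF this gl vl wl]
 show "convolve3 Z C (%h v w. sweedler Z H (%x y. q x y v w) h) g v w c = convolve4 Z C q g g v w c"
 proof (cases "c \<in> U C")
  case c: True
  have "sweedler3 Z C (%x y z. sweedler Z H (%x y'. q x y' (v y) (w z)) (g x)) c
    = sweedler Z C (%r z. sweedler Z C (%x y. sweedler Z H (%x y'. q x y' (v y) (w z)) (g x)) r) c"
   by (rule C.sweedler3_coassoc[OF Z t c, symmetric])
  also have "... = sweedler Z C (%r z. sweedler3 Z C (%x y u. q (g x) (g y) (v u) (w z)) r) c"
  proof (rule C.sweedler_cong[OF Z c])
   fix r z assume rz: "r \<in> U C" "z \<in> U C"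
   show "sweedler Z C (%x y. sweedler Z H (%x y'. q x y' (v y) (w z)) (g x)) r
     = sweedler3 Z C (%x y u. q (g x) (g y) (v u) (w z)) r"
    using fun_cong[OF convolve_point_left[OF Z V tz[OF rz(2)] g v], of r] rz
    by (simp add: convolve_def convolve3_def)
   show "sweedler3 Z C (%x y u. q (g x) (g y) (v u) (w z)) r \<in> U Z"
    by (rule klinearD(1)[OF C.sweedler3_linear[OF Z tz'] rz(1)]) (rule rz)
  qed
  also have "... = sweedler Z C (%u r. sweedler3 Z C (%x y z. q (g u) (g x) (v y) (w z)) r) c"
   by (rule C.sweedler4_coassoc[OF Z q' c])
  finally show ?thesis using c by (simp add: convolve3_def convolve4_def)
 qed (simp add: convolve3_def convolve4_def)
qed

abbreviation (input) "Q == conv K C H"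

interpretation Q: monoid Q by (rule C.conv_monoid[OF H.k_algebra_axioms])
interpretation QH: monoid "conv K C HH" by (rule C.conv_monoid[OF HH_k_algebra])

abbreviation (input) "i1 == %h. kpure K H H h 1\<^sub>H"
abbreviation (input) "i2 == %h. kpure K H H 1\<^sub>H h"

subsection \<open>The group of points\<close>

lemma mH: "bilinear K H H H (monoid.mult H)" by (rule H.mult_bilinear)

lemmas HH_mult = alg_tensor_mult_kpure[OF H_module H_module mH mH]
lemmas kp = kpure_bilinear[OF H_module H_module]

lemma i1_hom: "algebra_hom K H HH i1"
 using kp by (simp add: algebra_hom_def bilinear_def HH_mult)

lemma i2_hom: "algebra_hom K H HH i2"
 using kp by (simp add: algebra_hom_def bilinear_def HH_mult)

lemmas i1_linear = conjunct1[OF i1_hom[unfolded algebra_hom_def]]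
lemmas i2_linear = conjunct1[OF i2_hom[unfolded algebra_hom_def]]
lemma sweedler_alg_tensor [simp]: "sweedler (alg_tensor K X Y) C = sweedler (ktensor K X Y) C"
proof -
 have "tensor_lift (alg_tensor K X Y) b = tensor_lift (ktensor K X Y) b" for b :: "'c => 'c => _"
  by (rule tensor_lift_additive_record) simp_all
 then show ?thesis by (simp add: sweedler_def fun_eq_iff)
qed

lemma convolve_alg_tensor [simp]: "convolve (alg_tensor K X Y) C = convolve (ktensor K X Y) C"
 by (simp add: convolve_def fun_eq_iff)

lemma i1_i2:
 assumes "f \<in> Hom H" "g \<in> Hom H"
 shows "cc i1 f \<star>\<^sub>HH cc i2 g = convolve (ktensor K H H) C (kpure K H H) f g"
proof -
 have "cc i1 f \<star>\<^sub>HH cc i2 g = convolve HH C (%x y. i1 x *\<^sub>HH i2 y) f g"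
  unfolding conv_simps
  by (rule C.convolve_compose[OF HH.module_axioms HH.mult_bilinear assms i1_linear i2_linear])
 also have "... = convolve HH C (kpure K H H) f g"
  by (rule C.convolve_cong[OF HH.module_axioms bilinear_comp[OF HH.mult_bilinear i1_linear i2_linear] assms])
   (simp add: HH_mult)
 finally show ?thesis by simp
qed

lemma i1_i2_commute:
 assumes "f \<in> Hom H" "g \<in> Hom H"
 shows "cc i1 f \<star>\<^sub>HH cc i2 g = cc i2 g \<star>\<^sub>HH cc i1 f"
 by (rule C.conv_commute[OF HH_k_algebra assms i1_linear i2_linear]) (simp add: HH_mult)

text \<open>With the two embeddings \<open>i1\<close> and \<open>i2\<close> of \<open>H\<close> into \<open>H \<otimes> H\<close> the condition on the comultiplication is an equation in the convolution monoid
  of \<open>H \<otimes> H\<close>, where closure under products is a computation with commuting factors.\<close>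
lemma points_iff:
 "g \<in> points \<longleftrightarrow> g \<in> Hom H & cc (comult H) g = cc i1 g \<star>\<^sub>HH cc i2 g &
  cc (%h. counit H h *.\<^sub>H 1\<^sub>H) g = 1\<^sub>Q"
 unfolding points_def using i1_i2 by auto

lemma hom_in_QH: "algebra_hom K H HH \<phi> ==> f \<in> Hom H ==> cc \<phi> f \<in> U (conv K C HH)"
 using C.compose_hom[of H HH \<phi> f] by (simp add: algebra_hom_def module_hom_def)

lemma counit_hom: "algebra_hom K H H (%h. counit H h *.\<^sub>H 1\<^sub>H)"
 using HC.counit_smult_bilinear[OF H_module]
 by (simp add: algebra_hom_def bilinear_def H.counit_one H.counit_mult HC.counit_closed H.smult_mult_left H.smult_assoc1)

lemma points_mult_closed:
 assumes g: "g \<in> points" and h: "h \<in> points"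
 shows "g *\<^sub>Q h \<in> points"
 unfolding points_iff
proof (intro conjI)
 note hom = points_hom[OF g] points_hom[OF h]
 show cl: "g *\<^sub>Q h \<in> Hom H" using Q.m_closed[of g h] hom by simp
 note a = hom_in_QH[OF i1_hom hom(1)] hom_in_QH[OF i1_hom hom(2)] hom_in_QH[OF i2_hom hom(1)] hom_in_QH[OF i2_hom hom(2)]
 let ?m = "%x y. x \<star>\<^sub>HH y"
 have "cc (comult H) (g *\<^sub>Q h) = ?m (cc (comult H) g) (cc (comult H) h)"
  by (rule C.compose_algebra_hom(1)[OF H.k_algebra_axioms HH_k_algebra H.comult_algebra_hom hom])
 also have "... = ?m (?m (cc i1 g) (cc i2 g)) (?m (cc i1 h) (cc i2 h))"
  using g h by (simp only: points_iff)
 also have "... = ?m (cc i1 g) (?m (?m (cc i2 g) (cc i1 h)) (cc i2 h))"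
  using a by (simp only: QH.m_assoc QH.m_closed)
 also have "... = ?m (cc i1 g) (?m (?m (cc i1 h) (cc i2 g)) (cc i2 h))"
  by (simp only: i1_i2_commute[OF hom(2,1)])
 also have "... = ?m (?m (cc i1 g) (cc i1 h)) (?m (cc i2 g) (cc i2 h))"
  using a by (simp only: QH.m_assoc QH.m_closed)
 also have "... = ?m (cc i1 (g *\<^sub>Q h)) (cc i2 (g *\<^sub>Q h))"
  by (simp only: C.compose_algebra_hom(1)[OF H.k_algebra_axioms HH_k_algebra i1_hom hom]
   C.compose_algebra_hom(1)[OF H.k_algebra_axioms HH_k_algebra i2_hom hom])
 finally show "cc (comult H) (g *\<^sub>Q h) = ?m (cc i1 (g *\<^sub>Q h)) (cc i2 (g *\<^sub>Q h))" .
 show "cc (%h. counit H h *.\<^sub>H 1\<^sub>H) (g *\<^sub>Q h) = 1\<^sub>Q"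
  using g h by (simp only: C.compose_algebra_hom(1)[OF H.k_algebra_axioms H.k_algebra_axioms counit_hom hom] points_iff Q.l_one[OF Q.one_closed])
qed

lemma points_one: "1\<^sub>Q \<in> points"
 unfolding points_iff
proof (intro conjI)
 show "1\<^sub>Q \<in> Hom H" using Q.one_closed by simp
 show "cc (comult H) 1\<^sub>Q = cc i1 1\<^sub>Q \<star>\<^sub>HH cc i2 1\<^sub>Q"
  using C.compose_algebra_hom(2)[OF H.k_algebra_axioms HH_k_algebra H.comult_algebra_hom]
   C.compose_algebra_hom(2)[OF H.k_algebra_axioms HH_k_algebra i1_hom]
   C.compose_algebra_hom(2)[OF H.k_algebra_axioms HH_k_algebra i2_hom] QH.l_one[OF QH.one_closed]
  by (simp only:)
 show "cc (%h. counit H h *.\<^sub>H 1\<^sub>H) 1\<^sub>Q = 1\<^sub>Q"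
  by (rule C.compose_algebra_hom(2)[OF H.k_algebra_axioms H.k_algebra_axioms counit_hom])
qed

abbreviation (input) "pinv == cc (antipode H)"

lemma pinv_hom: "f \<in> Hom H ==> pinv f \<in> Hom H"
 by (rule C.compose_hom[OF H.antipode_linear])

lemma point_counit:
 assumes "g \<in> points"
 shows "cc (%h. counit H h *.\<^sub>H 1\<^sub>H) g = 1\<^sub>Q"
 using assms by (simp add: points_iff)

lemma idH: "klinear K H H (%h. h)" by (simp add: klinear_def)

lemma pinv_left:
 assumes g: "g \<in> points" shows "pinv g *\<^sub>Q g = 1\<^sub>Q"
proof -
 have b: "bilinear K H H H (%x y. antipode H x *\<^sub>H y)"
  by (rule bilinear_comp[OF mH H.antipode_linear idH])
 have "pinv g *\<^sub>Q g = convolve H C (%x y. antipode H x *\<^sub>H y) g g"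
  using C.convolve_compose_left[OF H_module mH points_hom[OF g] points_hom[OF g] H.antipode_linear] by simp
 also have "... = cc (sweedler H H (%x y. antipode H x *\<^sub>H y)) g"
  by (rule compose_point[OF H_module b g, symmetric])
 also have "... = cc (%h. counit H h *.\<^sub>H 1\<^sub>H) g"
  by (rule C.compose_cong[OF points_hom[OF g]]) (rule H.antipode_left)
 finally show ?thesis by (simp only: point_counit[OF g])
qed

lemma pinv_right:
 assumes g: "g \<in> points" shows "g *\<^sub>Q pinv g = 1\<^sub>Q"
proof -
 have b: "bilinear K H H H (%x y. x *\<^sub>H antipode H y)"
  by (rule bilinear_comp[OF mH idH H.antipode_linear])
 have "g *\<^sub>Q pinv g = convolve H C (%x y. x *\<^sub>H antipode H y) g g"
  using C.convolve_compose_right[OF H_module mH points_hom[OF g] points_hom[OF g] H.antipode_linear] by simp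
 also have "... = cc (sweedler H H (%x y. x *\<^sub>H antipode H y)) g"
  by (rule compose_point[OF H_module b g, symmetric])
 also have "... = cc (%h. counit H h *.\<^sub>H 1\<^sub>H) g"
  by (rule C.compose_cong[OF points_hom[OF g]]) (rule H.antipode_right)
 finally show ?thesis by (simp only: point_counit[OF g])
qed

text \<open>The inverse of \<open>g\<close> is \<open>S \<circ> g\<close>. Its image under \<open>\<Delta>\<close> and the product of its two embeddings are both inverse to the image of \<open>g\<close>, so they are equal by uniqueness of inverses.\<close>
lemma points_inv_closed:
 assumes g: "g \<in> points" shows "pinv g \<in> points"
 unfolding points_iff
proof (intro conjI)
 note hom = points_hom[OF g] and hom' = pinv_hom[OF points_hom[OF g]]
 show "pinv g \<in> Hom H" by (rule hom')
 let ?m = "%x y. x \<star>\<^sub>HH y"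
 note H2 = H.k_algebra_axioms HH_k_algebra
 note a = hom_in_QH[OF i1_hom hom] hom_in_QH[OF i1_hom hom'] hom_in_QH[OF i2_hom hom] hom_in_QH[OF i2_hom hom']
  hom_in_QH[OF H.comult_algebra_hom hom] hom_in_QH[OF H.comult_algebra_hom hom']
 have one: "?m (cc \<phi> g) (cc \<phi> (pinv g)) = \<one>\<^bsub>conv K C HH\<^esub>" "?m (cc \<phi> (pinv g)) (cc \<phi> g) = \<one>\<^bsub>conv K C HH\<^esub>"
  if "algebra_hom K H HH \<phi>" for \<phi>
  by (simp_all only: C.compose_algebra_hom(1)[OF H2 that hom hom', symmetric] pinv_right[OF g]
   C.compose_algebra_hom(1)[OF H2 that hom' hom, symmetric] pinv_left[OF g] C.compose_algebra_hom(2)[OF H2 that])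
 have "?m (?m (cc i1 (pinv g)) (cc i2 (pinv g))) (cc (comult H) g)
   = ?m (?m (cc i2 (pinv g)) (cc i1 (pinv g))) (?m (cc i1 g) (cc i2 g))"
  using g by (simp only: points_iff i1_i2_commute[OF hom' hom'])
 also have "... = ?m (cc i2 (pinv g)) (?m (?m (cc i1 (pinv g)) (cc i1 g)) (cc i2 g))"
  using a by (simp only: QH.m_assoc QH.m_closed)
 also have "... = \<one>\<^bsub>conv K C HH\<^esub>"
  using a by (simp only: one i1_hom i2_hom QH.l_one)
 finally have l: "?m (?m (cc i1 (pinv g)) (cc i2 (pinv g))) (cc (comult H) g) = \<one>\<^bsub>conv K C HH\<^esub>" .
 show "cc (comult H) (pinv g) = ?m (cc i1 (pinv g)) (cc i2 (pinv g))"
  by (rule QH.inv_unique[OF l one(1)[OF H.comult_algebra_hom] a(5) QH.m_closed[OF a(2,4)] a(6), symmetric])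
 note He = C.compose_algebra_hom[OF H.k_algebra_axioms H.k_algebra_axioms counit_hom]
 show "cc (%h. counit H h *.\<^sub>H 1\<^sub>H) (pinv g) = 1\<^sub>Q"
  using He(1)[OF hom hom'] C.compose_hom[OF conjunct1[OF counit_hom[unfolded algebra_hom_def]] hom']
  by (simp add: pinv_right[OF g, simplified] He(2) point_counit[OF g] Q.l_one[simplified])
qed

definition point_group :: "('c => 'h) monoid"
 where "point_group = (conv K C H) \<lparr>carrier := points\<rparr>"

lemma point_group_simps [simp]:
 "U point_group = points" "monoid.mult point_group = monoid.mult (conv K C H)"
 "\<one>\<^bsub>point_group\<^esub> = \<one>\<^bsub>conv K C H\<^esub>"
 by (simp_all add: point_group_def)

lemma group_points: "group point_group"
proof (rule groupI)
 show "EX y:U point_group. y \<otimes>\<^bsub>point_group\<^esub> x = \<one>\<^bsub>point_group\<^esub>" if "x \<in> U point_group" for x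
  using that pinv_left[of x] points_inv_closed[of x] by (simp del: conv_simps) blast
qed (use points_mult_closed points_one points_hom Q.m_assoc Q.l_one in \<open>simp_all del: conv_simps(2)\<close>)

abbreviation (input) "gm x y == x \<otimes>\<^bsub>point_group\<^esub> y"
abbreviation (input) "gi x == inv\<^bsub>point_group\<^esub> x"

lemma inv_point: "g \<in> points ==> gi g = pinv g"
 using group.inv_equality[OF group_points, of "pinv g" g] pinv_left points_inv_closed
 by (simp del: conv_simps)

end

section \<open>Generic points\<close>

context cocommutative_hopf_algebra
begin

abbreviation (input) "HH == tensor_coalgebra K H H"

definition proj1 :: "('c, 'c) tensor => 'c"
 where "proj1 = restrict (tensor_lift H (%h k. counit H k *.\<^sub>H h)) (U (ktensor K H H))"

definition proj2 :: "('c, 'c) tensor => 'c"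
 where "proj2 = restrict (tensor_lift H (%h k. counit H h *.\<^sub>H k)) (U (ktensor K H H))"

interpretation HC: cocommutative_coalgebra K H by (rule cocommutative_coalgebra)
interpretation HP: coalgebra_pair K H H
 by (intro coalgebra_pair.intro cocommutative_coalgebra)

lemma two_variables: "hopf_points K H HH"
 by (intro hopf_points.intro cocommutative_hopf_algebra_axioms HP.CD_cocommutative_coalgebra)

lemma one_variable: "hopf_points K H H"
 by (intro hopf_points.intro cocommutative_hopf_algebra_axioms cocommutative_coalgebra)

interpretation P: hopf_points K H HH by (rule two_variables)

lemma proj_bilinear:
 "bilinear K H H H (%h k. counit H k *.\<^sub>H h)" "bilinear K H H H (%h k. counit H h *.\<^sub>H k)"
 using HC.counit_smult_bilinear[OF module_axioms] by (auto intro: bilinear_flip)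

lemma proj_hom: "proj1 \<in> module_hom K HH H" "proj2 \<in> module_hom K HH H"
proof -
 have "klinear K HH H (tensor_lift H (%h k. counit H k *.\<^sub>H h))"
  "klinear K HH H (tensor_lift H (%h k. counit H h *.\<^sub>H k))"
  using tensor_lift_linear[OF module_axioms module_axioms module_axioms] proj_bilinear by simp_all
 from linear_restrict_hom[OF HP.CD_module this(1)] linear_restrict_hom[OF HP.CD_module this(2)]
 show "proj1 \<in> module_hom K HH H" "proj2 \<in> module_hom K HH H"
  by (simp_all add: proj1_def proj2_def)
qed

lemma proj_pure:
 assumes "h \<in> U H" "k \<in> U H"
 shows "proj1 (kpure K H H h k) = counit H k *.\<^sub>H h" "proj2 (kpure K H H h k) = counit H h *.\<^sub>H k"
 using assms tensor_lift_kpure[OF module_axioms module_axioms module_axioms proj_bilinear(1)]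
  tensor_lift_kpure[OF module_axioms module_axioms module_axioms proj_bilinear(2)]
 by (simp_all add: proj1_def proj2_def HP.p_closed)

text \<open>In each case a double sum over \<open>\<Delta> h\<close> and \<open>\<Delta> k\<close> has counits in the unwanted legs, which the counit laws remove.\<close>
lemma convolve_proj:
 assumes Z: "module K Z" and b: "bilinear K H H Z b" and h: "h \<in> U H" and k: "k \<in> U H"
 shows "convolve Z HH b proj1 proj2 (kpure K H H h k) = b h k"
  and "convolve Z HH b proj1 proj1 (kpure K H H h k) = counit H k *.\<^sub>Z sweedler Z H b h"
  and "convolve Z HH b proj2 proj2 (kpure K H H h k) = counit H h *.\<^sub>Z sweedler Z H b k"
proof -
 let ?p = "kpure K H H"
 interpret Z: module K Z by (rule Z)
 note pl = proj_hom[THEN module_hom_linear, simplified]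
 note bD = bilinearD[OF b]
 have k1: "klinear K H Z (%k. counit H k *.\<^sub>Z z)" if "z \<in> U Z" for z
  using HC.counit_smult_bilinear[OF Z] that by (simp add: bilinear_def)
 have eps: "sweedler Z H (%k1 k2. counit H k1 *.\<^sub>Z (counit H k2 *.\<^sub>Z z)) k = counit H k *.\<^sub>Z z"
  if "z \<in> U Z" "k \<in> U H" for z k
  by (rule HC.sweedler_counit_left[OF Z k1 that(2)]) (rule that)
 have start: "convolve Z HH b f g (?p h k) = sweedler Z H (%h1 h2. sweedler Z H (%k1 k2.
   b (f (?p h1 k1)) (g (?p h2 k2))) k) h"
  if "klinear K (ktensor K H H) H f" "klinear K (ktensor K H H) H g" for f g
  using h k by (simp add: convolve_def HP.p_closed HP.sweedler_CD_pure[OF Z bilinear_comp[OF b that]])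
 have b1: "bilinear K H Z Z (%h z. counit H h *.\<^sub>Z z)" by (rule HC.counit_smult_bilinear[OF Z])
 have kH: "klinear K H Z (%y. b h' y)" "klinear K H Z (%x. b x h')" if "h' \<in> U H" for h'
  using b that by (simp_all add: bilinear_def)
 have sm: "klinear K Z Z (%z. r *.\<^sub>Z z)" if "r \<in> U K" for r
  using that by (auto simp: klinear_def Z.smult_r_distr Z.smult_assoc1[symmetric] m_comm)
 have sc: "r *.\<^sub>Z (r' *.\<^sub>Z z) = r' *.\<^sub>Z (r *.\<^sub>Z z)"
  if "r \<in> U K" "r' \<in> U K" "z \<in> U Z" for r r' z
  using that by (simp add: Z.smult_assoc1[symmetric] m_comm)
 have swap_eps: "sweedler Z H (%x y. counit H y *.\<^sub>Z f x) c = f c" if f: "klinear K H Z f" and c: "c \<in> U H" for f c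
 proof -
  have bf: "bilinear K H H Z (%x y. counit H x *.\<^sub>Z f y)"
   using b1 f by (simp add: multilinear)
  show ?thesis
   using HC.sweedler_swap[OF Z bf c] HC.sweedler_counit_left[OF Z f c] by simp
 qed
 show "convolve Z HH b proj1 proj2 (?p h k) = b h k"
 proof -
  have "convolve Z HH b proj1 proj2 (?p h k) = sweedler Z H (%h1 h2. counit H h2 *.\<^sub>Z b h1 k) h"
   unfolding start[OF pl]
  proof (rule HC.sweedler_cong[OF Z h])
   fix h1 h2 assume hh: "h1 \<in> U H" "h2 \<in> U H"
   have "sweedler Z H (%k1 k2. b (proj1 (?p h1 k1)) (proj2 (?p h2 k2))) k
    = sweedler Z H (%k1 k2. counit H k1 *.\<^sub>Z (counit H h2 *.\<^sub>Z b h1 k2)) k"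
    using hh by (intro HC.sweedler_cong[OF Z k]) (auto simp: proj_pure bD HC.counit_closed intro: sc)
   also have "... = counit H h2 *.\<^sub>Z b h1 k"
    by (rule HC.sweedler_counit_left[OF Z linear_comp[OF sm kH(1)] k]) (simp_all add: hh HC.counit_closed)
   finally show "sweedler Z H (%k1 k2. b (proj1 (?p h1 k1)) (proj2 (?p h2 k2))) k
    = counit H h2 *.\<^sub>Z b h1 k" .
   show "counit H h2 *.\<^sub>Z b h1 k \<in> U Z" using hh k by (simp add: bD HC.counit_closed)
  qed
  also have "... = b h k" by (rule swap_eps[OF kH(2)[OF k] h])
  finally show ?thesis .
 qed
 show "convolve Z HH b proj1 proj1 (?p h k) = counit H k *.\<^sub>Z sweedler Z H b h"
 proof -
  have "convolve Z HH b proj1 proj1 (?p h k) = sweedler Z H (%h1 h2. counit H k *.\<^sub>Z b h1 h2) h"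
   unfolding start[OF pl(1,1)]
  proof (rule HC.sweedler_cong[OF Z h])
   fix h1 h2 assume hh: "h1 \<in> U H" "h2 \<in> U H"
   have "sweedler Z H (%k1 k2. b (proj1 (?p h1 k1)) (proj1 (?p h2 k2))) k
    = sweedler Z H (%k1 k2. counit H k1 *.\<^sub>Z (counit H k2 *.\<^sub>Z b h1 h2)) k"
    using hh by (intro HC.sweedler_cong[OF Z k]) (auto simp: proj_pure bD HC.counit_closed intro: sc)
   also have "... = counit H k *.\<^sub>Z b h1 h2" using hh k by (intro eps bD(1))
   finally show "sweedler Z H (%k1 k2. b (proj1 (?p h1 k1)) (proj1 (?p h2 k2))) k
    = counit H k *.\<^sub>Z b h1 h2" .
   show "counit H k *.\<^sub>Z b h1 h2 \<in> U Z" using hh k by (simp add: bD HC.counit_closed)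
  qed
  also have "... = counit H k *.\<^sub>Z sweedler Z H b h"
   by (rule HC.sweedler_map[OF Z Z b sm h, symmetric]) (simp add: k HC.counit_closed)
  finally show ?thesis .
 qed
 show "convolve Z HH b proj2 proj2 (?p h k) = counit H h *.\<^sub>Z sweedler Z H b k"
 proof -
  have bk: "sweedler Z H b k \<in> U Z" by (rule klinearD(1)[OF HC.sweedler_linear[OF Z b] k])
  have "convolve Z HH b proj2 proj2 (?p h k)
   = sweedler Z H (%h1 h2. counit H h1 *.\<^sub>Z (counit H h2 *.\<^sub>Z sweedler Z H b k)) h"
   unfolding start[OF pl(2,2)]
  proof (rule HC.sweedler_cong[OF Z h])
   fix h1 h2 assume hh: "h1 \<in> U H" "h2 \<in> U H"
   have "sweedler Z H (%k1 k2. b (proj2 (?p h1 k1)) (proj2 (?p h2 k2))) k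
    = sweedler Z H (%k1 k2. counit H h1 *.\<^sub>Z (counit H h2 *.\<^sub>Z b k1 k2)) k"
    using hh by (intro HC.sweedler_cong[OF Z k]) (auto simp: proj_pure bD HC.counit_closed intro: sc)
   also have "... = counit H h1 *.\<^sub>Z (counit H h2 *.\<^sub>Z sweedler Z H b k)"
    by (rule HC.sweedler_map[OF Z Z b linear_comp[OF sm sm] k, symmetric]) (simp_all add: hh HC.counit_closed)
   finally show "sweedler Z H (%k1 k2. b (proj2 (?p h1 k1)) (proj2 (?p h2 k2))) k
    = counit H h1 *.\<^sub>Z (counit H h2 *.\<^sub>Z sweedler Z H b k)" .
   show "counit H h1 *.\<^sub>Z (counit H h2 *.\<^sub>Z sweedler Z H b k) \<in> U Z" using hh bk by (simp add: HC.counit_closed)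
  qed
  also have "... = counit H h *.\<^sub>Z sweedler Z H b k" by (rule eps[OF bk h])
  finally show ?thesis .
 qed
qed

lemma sweedler_kpure: "h \<in> U H ==> sweedler (ktensor K H H) H (kpure K H H) h = comult H h"
 using HC.sweedler_swap[OF ktensor_module[OF module_axioms module_axioms] kpure_bilinear[OF module_axioms module_axioms], of h]
  cocommutative[of h] by simp

lemma proj_points: "proj1 \<in> P.points" "proj2 \<in> P.points"
proof -
 note M = module_axioms
 note Z = ktensor_module[OF M M]
 note cl = HC.comult_linear
 note pl = proj_hom[THEN module_hom_linear, simplified]
 have c: "cmp HH (comult H) f = convolve (ktensor K H H) HH (kpure K H H) f f"
  if f: "f \<in> module_hom K HH H" and p: "!!h k. [|h \<in> U H; k \<in> U H|]
   ==> convolve (ktensor K H H) HH (kpure K H H) f f (kpure K H H h k) = comult H (f (kpure K H H h k))" for f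
 proof (rule P.C.hom_eqI)
  show a: "cmp HH (comult H) f \<in> P.Hom (ktensor K H H)" by (rule P.C.compose_hom[OF cl f])
  show b: "convolve (ktensor K H H) HH (kpure K H H) f f \<in> P.Hom (ktensor K H H)"
   by (rule P.C.convolve_hom[OF Z kpure_bilinear[OF M M] f f])
  fix c assume c: "c \<in> U HH"
  show "cmp HH (comult H) f c = convolve (ktensor K H H) HH (kpure K H H) f f c"
  proof (rule ktensor_linear_eq[OF M M, where f = "cmp HH (comult H) f" and t = c])
   show "klinear K (ktensor K H H) (ktensor K H H) (cmp HH (comult H) f)"
    using module_hom_linear[OF a] by simp
   show "klinear K (ktensor K H H) (ktensor K H H) (convolve (ktensor K H H) HH (kpure K H H) f f)"
    using module_hom_linear[OF b] by simp
  qed (use c p in \<open>auto simp: compose_def HP.p_closed\<close>)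
 qed
 have cu: "counit H (f c) = counit HH c" if c: "c \<in> U HH" and f: "f \<in> module_hom K HH H"
   and p: "!!h k. [|h \<in> U H; k \<in> U H|] ==> counit H (f (kpure K H H h k)) = counit H h \<otimes> counit H k" for f c
  using c[simplified]
 proof (induction c rule: ktensor_induct[OF M M, consumes 1, case_names pure add])
  case (add s t)
  then show ?case
   using module_homD(3)[OF f, of s t] P.C.counit_add[of s t] module_homD(2)[OF f, of s] module_homD(2)[OF f, of t]
   by (simp add: HC.counit_add)
 qed (simp add: p HP.counit_CD_pure)
 show "proj1 \<in> P.points"
  unfolding P.points_def
  using proj_hom(1) c[OF proj_hom(1)] cu[OF _ proj_hom(1)]
  by (simp add: conv_def compose_def fun_eq_iff convolve_proj[OF Z kpure_bilinear[OF M M]] proj_pure sweedler_kpure HC.counit_closed HC.counit_smult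
    klinearD[OF cl] m_comm)
 show "proj2 \<in> P.points"
  unfolding P.points_def
  using proj_hom(2) c[OF proj_hom(2)] cu[OF _ proj_hom(2)]
  by (simp add: conv_def compose_def fun_eq_iff convolve_proj[OF Z kpure_bilinear[OF M M]] proj_pure sweedler_kpure HC.counit_closed HC.counit_smult
    klinearD[OF cl] m_comm)
qed

text \<open>The projections \<open>id \<otimes> \<epsilon>\<close> and \<open>\<epsilon> \<otimes> id\<close> form the generic pair of points: convolving them along a bilinear map \<open>b\<close> gives back \<open>b\<close>.
  Hence a two-variable identity for points implies the identity for elements of \<open>H\<close>.\<close>
lemma bilinear_eq_of_points:
 assumes "module K Z" "bilinear K H H Z b" "bilinear K H H Z b'"
  "convolve Z HH b proj1 proj2 = convolve Z HH b' proj1 proj2" "h \<in> U H" "k \<in> U H"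
 shows "b h k = b' h k"
 using convolve_proj(1)[OF assms(1,2,5,6)] convolve_proj(1)[OF assms(1,3,5,6)] assms(4) by simp

definition id_point :: "'c => 'c" where "id_point = restrict (%h. h) (U H)"

lemma id_point: "id_point \<in> hopf_points.points K H H"
proof -
 interpret O: hopf_points K H H by (rule one_variable)
 note M = module_axioms
 have "id_point \<in> module_hom K H H"
  unfolding id_point_def by (rule linear_restrict_hom[OF M]) (simp add: klinear_def)
 moreover have "cmp H (comult H) id_point = convolve (ktensor K H H) H (kpure K H H) id_point id_point"
  unfolding convolve_def compose_def
 proof (rule restrict_ext)
  fix c assume c: "c \<in> U H"
  have "sweedler (ktensor K H H) H (%x y. kpure K H H (id_point x) (id_point y)) c
   = sweedler (ktensor K H H) H (kpure K H H) c"
   by (rule HC.sweedler_cong[OF ktensor_module[OF M M] c])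
    (auto simp: id_point_def bilinearD(1)[OF kpure_bilinear[OF M M]])
  then show "comult H (id_point c) = sweedler (ktensor K H H) H (%x y. kpure K H H (id_point x) (id_point y)) c"
   using c by (simp add: sweedler_kpure id_point_def)
 qed
 moreover have "cmp H (%h. counit H h *.\<^sub>H 1\<^sub>H) id_point = \<one>\<^bsub>conv K H H\<^esub>"
  by (auto simp: conv_def compose_def id_point_def)
 ultimately show ?thesis by (simp add: O.points_def)
qed

end

section \<open>Partial representations\<close>

text \<open>Two of the four relations of \<open>H\<^sub>p\<^sub>a\<^sub>r\<close> suffice: replacing \<open>h\<close> by \<open>S h\<close> yields the others, because \<open>S\<close> is an involution
  and a coalgebra map if \<open>H\<close> is cocommutative (see \<open>partial_rep_rel34\<close>).\<close>
definition partial_rep ::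
 "('k, 'w) ring_scheme => ('k, 'h, 'y) hopf_scheme => ('k, 'e, 'z) module_scheme => ('h => 'e) => bool"
 where "partial_rep K H E \<pi> \<longleftrightarrow> klinear K H E \<pi> & \<pi> 1\<^sub>H = 1\<^sub>E &
  (ALL h:U H. ALL k:U H.
   sweedler E H (%x y. \<pi> h *\<^sub>E \<pi> x *\<^sub>E \<pi> (antipode H y)) k
   = sweedler E H (%x y. \<pi> (h *\<^sub>H x) *\<^sub>E \<pi> (antipode H y)) k) &
  (ALL h:U H. ALL k:U H.
   sweedler E H (%x y. \<pi> x *\<^sub>E \<pi> (antipode H y) *\<^sub>E \<pi> k) h
   = sweedler E H (%x y. \<pi> x *\<^sub>E \<pi> (antipode H y *\<^sub>H k)) h)"

context hopf_points
begin

interpretation HC: cocommutative_coalgebra K H by (rule H.cocommutative_coalgebra)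
interpretation PG: group point_group by (rule group_points)

context
 fixes E :: "('k, 'e, 'u) module_scheme" and \<pi> :: "'h => 'e"
 assumes E: "k_algebra K E" and \<pi>: "klinear K H E \<pi>"
begin

interpretation E: k_algebra K E by (rule E)

abbreviation (input) "S == antipode H"
abbreviation (input) "br g == cmp C \<pi> g"
abbreviation (input) "bm x y == x \<otimes>\<^bsub>conv K C E\<^esub> y"

lemma \<pi>S: "klinear K H E (%h. \<pi> (S h))"
 by (rule linear_comp[OF \<pi> H.antipode_linear])

lemma rel1_trilinear:
 "trilinear K H H H E (%h x y. \<pi> h *\<^sub>E \<pi> x *\<^sub>E \<pi> (S y))"
 "trilinear K H H H E (%h x y. \<pi> (h *\<^sub>H x) *\<^sub>E \<pi> (S y))"
 using \<pi> \<pi>S E.mult_bilinear mH by (simp_all add: multilinear)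

lemma rel2_trilinear:
 "trilinear K H H H E (%x y h. \<pi> x *\<^sub>E \<pi> (S y) *\<^sub>E \<pi> h)"
 "trilinear K H H H E (%x y h. \<pi> x *\<^sub>E \<pi> (S y *\<^sub>H h))"
 using \<pi> \<pi>S E.mult_bilinear mH klinearD[OF H.antipode_linear] by (simp_all add: multilinear)

lemma rel1_bilinear:
 "bilinear K H H E (%h. sweedler E H (%x y. \<pi> h *\<^sub>E \<pi> x *\<^sub>E \<pi> (S y)))"
 "bilinear K H H E (%h. sweedler E H (%x y. \<pi> (h *\<^sub>H x) *\<^sub>E \<pi> (S y)))"
 by (rule HC.sweedler_param_bilinear[OF E.module_axioms H_module] rel1_trilinear)+

lemma rel2_bilinear:
 "bilinear K H H E (%h k. sweedler E H (%x y. \<pi> x *\<^sub>E \<pi> (S y) *\<^sub>E \<pi> k) h)"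
 "bilinear K H H E (%h k. sweedler E H (%x y. \<pi> x *\<^sub>E \<pi> (S y *\<^sub>H k)) h)"
proof -
 have "trilinear K H H H E (%k x y. \<pi> x *\<^sub>E \<pi> (S y) *\<^sub>E \<pi> k)"
  "trilinear K H H H E (%k x y. \<pi> x *\<^sub>E \<pi> (S y *\<^sub>H k))"
  using rel2_trilinear by (simp_all add: multilinear)
 from this[THEN HC.sweedler_param_bilinear[OF E.module_axioms H_module]]
 show "bilinear K H H E (%h k. sweedler E H (%x y. \<pi> x *\<^sub>E \<pi> (S y) *\<^sub>E \<pi> k) h)"
  "bilinear K H H E (%h k. sweedler E H (%x y. \<pi> x *\<^sub>E \<pi> (S y *\<^sub>H k)) h)"
  by (auto simp: bilinear_def)
qed

lemma idH': "klinear K H H (%h. h)" by (simp add: klinear_def)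

lemma rel1_left:
 assumes g: "g \<in> points" and k: "k \<in> points"
 shows "convolve E C (%h. sweedler E H (%x y. \<pi> h *\<^sub>E \<pi> x *\<^sub>E \<pi> (S y))) g k
  = bm (bm (br g) (br k)) (br (cmp C S k))"
proof -
 note g' = points_hom[OF g] and k' = points_hom[OF k]
 show ?thesis
  unfolding convolve_point_right[OF E.module_axioms H_module rel1_trilinear(1) k g']
  by (simp only: C.convolve3_mult[OF E \<pi> \<pi> \<pi>S g' k' k'] C.compose_compose[OF k'])
qed

lemma rel1_right:
 assumes g: "g \<in> points" and k: "k \<in> points"
 shows "convolve E C (%h. sweedler E H (%x y. \<pi> (h *\<^sub>H x) *\<^sub>E \<pi> (S y))) g k
  = bm (br (g \<otimes>\<^bsub>point_group\<^esub> k)) (br (cmp C S k))"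
proof -
 note M = E.module_axioms and m = E.mult_bilinear
 note g' = points_hom[OF g] and k' = points_hom[OF k]
 have b: "bilinear K H H E (%u z. \<pi> u *\<^sub>E \<pi> (S z))" by (rule bilinear_comp[OF m \<pi> \<pi>S])
 have "bm (br (g \<otimes>\<^bsub>point_group\<^esub> k)) (br (cmp C S k))
   = convolve E C (%u z. \<pi> u *\<^sub>E \<pi> (S z)) (convolve H C (monoid.mult H) g k) k"
  unfolding conv_simps C.compose_compose[OF k'] point_group_simps
  by (rule C.convolve_compose[OF M m C.convolve_hom[OF H_module mH g' k'] k' \<pi> \<pi>S])
 also have "... = convolve3 E C (%x y z. \<pi> (x *\<^sub>H y) *\<^sub>E \<pi> (S z)) g k k"
  by (rule C.convolve_nest_left[OF M H_module b mH g' k' k'])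
 also have "... = convolve E C (%h. sweedler E H (%x y. \<pi> (h *\<^sub>H x) *\<^sub>E \<pi> (S y))) g k"
  by (rule convolve_point_right[OF M H_module rel1_trilinear(2) k g', symmetric])
 finally show ?thesis ..
qed

lemma rel2_left:
 assumes g: "g \<in> points" and k: "k \<in> points"
 shows "convolve E C (%h k. sweedler E H (%x y. \<pi> x *\<^sub>E \<pi> (S y) *\<^sub>E \<pi> k) h) g k
  = bm (bm (br g) (br (cmp C S g))) (br k)"
proof -
 note g' = points_hom[OF g] and k' = points_hom[OF k]
 show ?thesis
  unfolding convolve_point_left[OF E.module_axioms H_module rel2_trilinear(1) g k']
  by (simp only: C.convolve3_mult[OF E \<pi> \<pi>S \<pi> g' g' k'] C.compose_compose[OF g'])
qed

lemma rel2_right: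
 assumes g: "g \<in> points" and k: "k \<in> points"
 shows "convolve E C (%h k. sweedler E H (%x y. \<pi> x *\<^sub>E \<pi> (S y *\<^sub>H k)) h) g k
  = bm (br g) (br (cmp C S g \<otimes>\<^bsub>point_group\<^esub> k))"
proof -
 note M = E.module_axioms and m = E.mult_bilinear
 note g' = points_hom[OF g] and k' = points_hom[OF k]
 have b: "bilinear K H H H (%x z. S x *\<^sub>H z)" by (rule bilinear_comp[OF mH H.antipode_linear idH'])
 have b2: "bilinear K H H E (%x u. \<pi> x *\<^sub>E \<pi> u)" by (rule bilinear_comp[OF m \<pi> \<pi>])
 have "bm (br g) (br (cmp C S g \<otimes>\<^bsub>point_group\<^esub> k))
   = convolve E C (%x u. \<pi> x *\<^sub>E \<pi> u) g (convolve H C (%x z. S x *\<^sub>H z) g k)"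
  unfolding conv_simps point_group_simps C.convolve_compose_left[OF H_module mH g' k' H.antipode_linear]
  by (rule C.convolve_compose[OF M m g' C.convolve_hom[OF H_module b g' k'] \<pi> \<pi>])
 also have "... = convolve3 E C (%x y z. \<pi> x *\<^sub>E \<pi> (S y *\<^sub>H z)) g g k"
  by (rule C.convolve_nest_right[OF M H_module b2 b g' g' k'])
 also have "... = convolve E C (%h k. sweedler E H (%x y. \<pi> x *\<^sub>E \<pi> (S y *\<^sub>H k)) h) g k"
  by (rule convolve_point_left[OF M H_module rel2_trilinear(2) g k', symmetric])
 finally show ?thesis ..
qed

end

end

context cocommutative_hopf_algebra
begin

interpretation P: hopf_points K H HH by (rule two_variables)

abbreviation (input) star2 ("_ \<ast>\<^sub>_ _" [70, 1000, 71] 70)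
 where "f \<ast>\<^sub>E g == f \<otimes>\<^bsub>conv K HH E\<^esub> g"

text \<open>A map is a partial representation as soon as its values at points of \<open>H \<otimes> H\<close> satisfy the group identities
  \<open>\<pi>\<^sub>g \<pi>\<^sub>k \<pi>\<^sub>k\<^sup>-\<^sup>1 = \<pi>\<^sub>g\<^sub>k \<pi>\<^sub>k\<^sup>-\<^sup>1\<close> and \<open>\<pi>\<^sub>g \<pi>\<^sub>g\<^sup>-\<^sup>1 \<pi>\<^sub>k = \<pi>\<^sub>g \<pi>\<^sub>g\<^sup>-\<^sup>1\<^sub>k\<close>; it is enough to test the two projections.\<close>
lemma partial_repI:
 fixes E :: "('a, 'e, 'u) module_scheme"
 assumes E: "k_algebra K E" and \<pi>: "klinear K H E \<pi>" and one: "\<pi> 1\<^sub>H = 1\<^sub>E"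
  and r1: "!!g k. [|g \<in> P.points; k \<in> P.points|] ==>
   cmp HH \<pi> g \<ast>\<^sub>E cmp HH \<pi> k \<ast>\<^sub>E cmp HH \<pi> (P.gi k)
   = cmp HH \<pi> (g \<otimes>\<^bsub>P.point_group\<^esub> k) \<ast>\<^sub>E cmp HH \<pi> (P.gi k)"
  and r2: "!!g k. [|g \<in> P.points; k \<in> P.points|] ==>
   cmp HH \<pi> g \<ast>\<^sub>E cmp HH \<pi> (P.gi g) \<ast>\<^sub>E cmp HH \<pi> k
   = cmp HH \<pi> g \<ast>\<^sub>E cmp HH \<pi> (P.gi g \<otimes>\<^bsub>P.point_group\<^esub> k)"
 shows "partial_rep K H E \<pi>"
proof -
 interpret E: k_algebra K E by (rule E)
 note M = E.module_axioms
 note pp = proj_points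
 show ?thesis
  unfolding partial_rep_def
 proof (intro conjI ballI \<pi> one)
  fix h k assume hk: "h \<in> U H" "k \<in> U H"
  show "sweedler E H (%x y. \<pi> h *\<^sub>E \<pi> x *\<^sub>E \<pi> (antipode H y)) k
   = sweedler E H (%x y. \<pi> (h *\<^sub>H x) *\<^sub>E \<pi> (antipode H y)) k"
   by (rule bilinear_eq_of_points[OF M P.rel1_bilinear[OF E \<pi>] _ hk])
    (simp only: P.rel1_left[OF E \<pi> pp] P.rel1_right[OF E \<pi> pp] r1[OF pp, unfolded P.inv_point[OF pp(2)]])
  show "sweedler E H (%x y. \<pi> x *\<^sub>E \<pi> (antipode H y) *\<^sub>E \<pi> k) h
   = sweedler E H (%x y. \<pi> x *\<^sub>E \<pi> (antipode H y *\<^sub>H k)) h"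
   by (rule bilinear_eq_of_points[OF M P.rel2_bilinear[OF E \<pi>] _ hk])
    (simp only: P.rel2_left[OF E \<pi> pp] P.rel2_right[OF E \<pi> pp] r2[OF pp, unfolded P.inv_point[OF pp(1)]])
 qed
qed

end

lemma opposite_simps [simp]:
 "U (opposite R) = U R" "add (opposite R) = add R" "zero (opposite R) = zero R"
 "smult (opposite R) = smult R" "one (opposite R) = one R" "x \<otimes>\<^bsub>opposite R\<^esub> y = y *\<^sub>R x"
 by (simp_all add: opposite_def)

lemma klinear_opposite [simp]:
 "klinear K (opposite R) Z = klinear K R Z" "klinear K Z (opposite R) = klinear K Z R"
 by (simp_all add: klinear_def fun_eq_iff)

lemma bilinear_opposite [simp]:
 "bilinear K (opposite R) (opposite R) (opposite R) b = bilinear K R R R b"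
 by (simp add: bilinear_def)

lemma opposite_module: "module K R ==> module K (opposite R)"
 by (rule module_record_cong) simp_all

lemma opposite_mult: "monoid.mult (opposite R) = (%x y. y *\<^sub>R x)"
 by (simp add: opposite_def)

lemma opposite_mult_bilinear:
 "bilinear K R R R (monoid.mult R) ==>
  bilinear K (opposite R) (opposite R) (opposite R) (monoid.mult (opposite R))"
 unfolding opposite_mult bilinear_opposite by (rule bilinear_flip)

lemma opposite_k_algebra:
 assumes "k_algebra K R" shows "k_algebra K (opposite R)"
proof -
 interpret R: k_algebra K R by fact
 interpret O: module K "opposite R" by (rule opposite_module) (rule R.module_axioms)
 have "monoid (opposite R)" by (rule monoidI) (auto simp: R.m_assoc)
 then have "ring (opposite R)"
  by (intro ringI O.abelian_group_axioms) (auto simp: R.l_distr R.r_distr)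
 then show ?thesis
  by (intro k_algebra.intro O.module_axioms k_algebra_axioms.intro)
   (auto simp: R.smult_mult_left R.smult_mult_right)
qed

context hopf_points
begin

interpretation HC: cocommutative_coalgebra K H by (rule H.cocommutative_coalgebra)
interpretation PG: group point_group by (rule group_points)

lemma br_hom: "[|klinear K H E \<pi>; g \<in> points|] ==> cmp C \<pi> g \<in> Hom E"
 by (rule C.compose_hom[OF _ points_hom])

lemma br_one:
 assumes "klinear K H E \<pi>" "\<pi> 1\<^sub>H = 1\<^sub>E"
 shows "cmp C \<pi> \<one>\<^bsub>point_group\<^esub> = \<one>\<^bsub>conv K C E\<^esub>"
 using C.compose_const_hom[OF assms(1) H.one_closed] assms(2) by (simp add: C.one_conv)

lemma conv_opposite:
 fixes E :: "('k, 'e, 'u) module_scheme"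
 assumes "k_algebra K E" "f \<in> Hom E" "g \<in> Hom E"
 shows "f \<otimes>\<^bsub>conv K C (opposite E)\<^esub> g = g \<star>\<^sub>E f"
proof -
 interpret E: k_algebra K E by fact
 have "sweedler (opposite E) C = sweedler E C"
 proof -
  have "tensor_lift (opposite E) b = tensor_lift E b" for b :: "'c => 'c => _"
   by (rule tensor_lift_additive_record) simp_all
  then show ?thesis by (simp add: sweedler_def fun_eq_iff)
 qed
 then have "convolve (opposite E) C b f g = convolve E C b f g" for b :: "'e => 'e => 'e"
  by (simp add: convolve_def fun_eq_iff)
 then show ?thesis
  using C.convolve_commute[OF E.module_axioms E.mult_bilinear assms(3,2)]
  by (simp add: opposite_mult)
qed

context
 fixes E :: "('k, 'e, 'u) module_scheme" and \<pi> :: "'h => 'e"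
 assumes E: "k_algebra K E" and pr: "partial_rep K H E \<pi>"
begin

interpretation E: k_algebra K E by (rule E)
interpretation EC: monoid "conv K C E" by (rule C.conv_monoid[OF E])

abbreviation (input) "rr g == cmp C \<pi> g"
abbreviation (input) "mm x y == x \<star>\<^sub>E y"
abbreviation (input) "ee g == cmp C \<pi> g \<star>\<^sub>E cmp C \<pi> (gi g)"

lemma pr_linear: "klinear K H E \<pi>" using pr by (simp add: partial_rep_def)

lemma pr_closed: "g \<in> points ==> rr g \<in> U (conv K C E)"
 using br_hom[OF pr_linear] by simp

lemma pr_one: "rr \<one>\<^bsub>point_group\<^esub> = \<one>\<^bsub>conv K C E\<^esub>"
 using br_one[OF pr_linear] pr by (simp add: partial_rep_def)

lemma pr_rel1:
 assumes "g \<in> points" "k \<in> points"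
 shows "mm (mm (rr g) (rr k)) (rr (gi k)) = mm (rr (gm g k)) (rr (gi k))"
 unfolding inv_point[OF assms(2)]
  rel1_left[OF E pr_linear assms, symmetric] rel1_right[OF E pr_linear assms, symmetric]
 by (rule C.convolve_cong[OF E.module_axioms rel1_bilinear(1)[OF E pr_linear] points_hom points_hom])
  (use assms pr in \<open>auto simp: partial_rep_def\<close>)

lemma pr_rel2:
 assumes "g \<in> points" "k \<in> points"
 shows "mm (mm (rr g) (rr (gi g))) (rr k) = mm (rr g) (rr (gm (gi g) k))"
 unfolding inv_point[OF assms(1)]
  rel2_left[OF E pr_linear assms, symmetric] rel2_right[OF E pr_linear assms, symmetric]
 by (rule C.convolve_cong[OF E.module_axioms rel2_bilinear(1)[OF E pr_linear] points_hom points_hom])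
  (use assms pr in \<open>auto simp: partial_rep_def\<close>)

lemma pr_idem_absorb: "g \<in> points ==> mm (ee g) (rr g) = rr g"
proof -
 assume g: "g \<in> points"
 have "gm (gi g) g = \<one>\<^bsub>point_group\<^esub>" using PG.l_inv[of g] g by simp
 then have "mm (ee g) (rr g) = mm (rr g) \<one>\<^bsub>conv K C E\<^esub>" by (simp only: pr_rel2[OF g g] pr_one)
 then show ?thesis by (simp only: EC.r_one[OF pr_closed[OF g]])
qed

text \<open>The usual calculus of partial representations of a group, with \<open>\<epsilon>\<^sub>g = \<pi>\<^sub>g \<pi>\<^sub>g\<^sup>-\<^sup>1\<close>: here \<open>\<pi>\<^sub>g \<epsilon>\<^sub>h = \<epsilon>\<^sub>g\<^sub>h \<pi>\<^sub>g\<close>, and the next lemmas derive that the \<open>\<epsilon>\<^sub>g\<close> are commuting idempotents.\<close>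
lemma pr_shift:
 assumes g: "g \<in> points" and h: "h \<in> points"
 shows "mm (rr g) (ee h) = mm (ee (gm g h)) (rr g)"
proof -
 have gh: "gm g h \<in> points" and i: "gi h \<in> points" "gi g \<in> points" and ghi: "gi (gm g h) \<in> points"
  using g h PG.m_closed[of g h] PG.inv_closed by simp_all
 have "mm (ee (gm g h)) (rr g) = mm (rr (gm g h)) (rr (gm (gi (gm g h)) g))"
  by (rule pr_rel2[OF gh g])
 also have "gm (gi (gm g h)) g = gi h"
  using PG.inv_mult_group[of g h] g h i PG.m_assoc[of "gi h" "gi g" g] PG.l_inv[of g] PG.r_one[of "gi h"]
  by (simp del: point_group_simps(2,3))
 also have "mm (rr (gm g h)) (rr (gi h)) = mm (mm (rr g) (rr h)) (rr (gi h))"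
  by (rule pr_rel1[OF g h, symmetric])
 also have "... = mm (rr g) (ee h)"
  by (rule EC.m_assoc) (use g h i pr_closed in auto)
 finally show ?thesis ..
qed

lemma pr_ee_closed: "g \<in> points ==> ee g \<in> U (conv K C E)"
 using pr_closed PG.inv_closed[of g] EC.m_closed by simp

lemma pr_commute:
 assumes g: "g \<in> points" and h: "h \<in> points"
 shows "mm (ee g) (ee h) = mm (ee h) (ee g)"
proof -
 have i: "gi g \<in> points" "gm (gi g) h \<in> points" using g h PG.m_closed[of "gi g" h] PG.inv_closed by simp_all
 note cl = pr_closed[OF g] pr_closed[OF h] pr_closed[OF i(1)] pr_ee_closed[OF g] pr_ee_closed[OF h] pr_ee_closed[OF i(2)]
 have "mm (ee g) (ee h) = mm (rr g) (mm (rr (gi g)) (ee h))"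
  by (rule EC.m_assoc) (fact cl)+
 also have "... = mm (rr g) (mm (ee (gm (gi g) h)) (rr (gi g)))"
  by (simp only: pr_shift[OF i(1) h])
 also have "... = mm (mm (rr g) (ee (gm (gi g) h))) (rr (gi g))"
  by (rule EC.m_assoc[symmetric]) (fact cl)+
 also have "... = mm (mm (ee (gm g (gm (gi g) h))) (rr g)) (rr (gi g))"
  by (simp only: pr_shift[OF g i(2)])
 also have "gm g (gm (gi g) h) = h"
  using PG.m_assoc[of g "gi g" h] g h i PG.r_inv[of g] PG.l_one[of h] by (simp del: point_group_simps(2,3))
 also have "mm (mm (ee h) (rr g)) (rr (gi g)) = mm (ee h) (ee g)"
  by (rule EC.m_assoc) (fact cl)+
 finally show ?thesis .
qed

lemma pr_idem:
 assumes g: "g \<in> points"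
 shows "mm (ee g) (ee g) = ee g"
proof -
 have i: "gi g \<in> points" using g PG.inv_closed by simp
 have "mm (ee g) (ee g) = mm (mm (ee g) (rr g)) (rr (gi g))"
  by (rule EC.m_assoc[symmetric]) (fact pr_ee_closed[OF g] pr_closed[OF g] pr_closed[OF i])+
 then show ?thesis by (simp only: pr_idem_absorb[OF g])
qed

end

end

lemma (in monoid) interchange3:
 assumes "a \<in> U G" "b \<in> U G" "c \<in> U G" "x \<in> U G" "y \<in> U G" "z \<in> U G"
  "x \<otimes> b = b \<otimes> x" "x \<otimes> c = c \<otimes> x" "y \<otimes> c = c \<otimes> y"
 shows "a \<otimes> x \<otimes> (b \<otimes> y) \<otimes> (c \<otimes> z) = (a \<otimes> b \<otimes> c) \<otimes> (x \<otimes> y \<otimes> z)"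
proof -
 have "a \<otimes> x \<otimes> (b \<otimes> y) \<otimes> (c \<otimes> z) = a \<otimes> ((x \<otimes> b) \<otimes> (y \<otimes> c) \<otimes> z)"
  using assms(1-6) by (simp add: m_assoc)
 also have "... = a \<otimes> ((b \<otimes> x) \<otimes> (c \<otimes> y) \<otimes> z)" by (simp only: assms(7,9))
 also have "... = a \<otimes> b \<otimes> ((x \<otimes> c) \<otimes> y \<otimes> z)"
  using assms(1-6) by (simp add: m_assoc)
 also have "... = a \<otimes> b \<otimes> ((c \<otimes> x) \<otimes> y \<otimes> z)" by (simp only: assms(8))
 also have "... = (a \<otimes> b \<otimes> c) \<otimes> (x \<otimes> y \<otimes> z)"
  using assms(1-6) by (simp add: m_assoc)
 finally show ?thesis .
qed

lemma (in monoid) interchange2: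
 assumes "a \<in> U G" "b \<in> U G" "x \<in> U G" "y \<in> U G" "x \<otimes> b = b \<otimes> x"
 shows "a \<otimes> x \<otimes> (b \<otimes> y) = (a \<otimes> b) \<otimes> (x \<otimes> y)"
proof -
 have "a \<otimes> x \<otimes> (b \<otimes> y) = a \<otimes> ((x \<otimes> b) \<otimes> y)" using assms(1-4) by (simp add: m_assoc)
 also have "... = a \<otimes> ((b \<otimes> x) \<otimes> y)" by (simp only: assms(5))
 finally show ?thesis using assms(1-4) by (simp add: m_assoc)
qed

context cocommutative_hopf_algebra
begin

interpretation HC: cocommutative_coalgebra K H by (rule cocommutative_coalgebra)
interpretation P: hopf_points K H HH by (rule two_variables)
interpretation PG: group P.point_group by (rule P.group_points)

abbreviation (input) "cc f g == cmp HH f g"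

lemma comult_one: "comult H 1\<^sub>H = kpure K H H 1\<^sub>H 1\<^sub>H"
 using ring_hom_one[OF comult_ring_hom] by simp

lemma sweedler_one:
 assumes "module K Z" "bilinear K H H Z b"
 shows "sweedler Z H b 1\<^sub>H = b 1\<^sub>H 1\<^sub>H"
 unfolding sweedler_def comult_one
 by (rule tensor_lift_kpure[OF module_axioms module_axioms assms]) auto

text \<open>For a group this is clear: the pointwise product of two partial representations with commuting values is one, since the defining
  relations can be sorted into a relation for each factor. Evaluation at points transfers it to \<open>H\<close>.\<close>
lemma partial_rep_product:
 fixes E :: "('a, 'e, 'u) module_scheme"
 assumes E: "k_algebra K E" and L: "partial_rep K H E L" and R: "partial_rep K H E R"
  and LR: "!!h k. [|h \<in> U H; k \<in> U H|] ==> L h *\<^sub>E R k = R k *\<^sub>E L h"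
 shows "partial_rep K H E (sweedler E H (%x y. L x *\<^sub>E R y))"
  (is "partial_rep K H E ?\<sigma>")
proof -
 interpret E: k_algebra K E by (rule E)
 interpret EC: monoid "conv K HH E" by (rule P.C.conv_monoid[OF E])
 have Ll: "klinear K H E L" and Rl: "klinear K H E R" using L R by (simp_all add: partial_rep_def)
 note M = E.module_axioms and b = bilinear_comp[OF E.mult_bilinear Ll Rl]
 have \<sigma>: "cc ?\<sigma> g = cc L g \<ast>\<^sub>E cc R g" if "g \<in> P.points" for g
  using P.compose_point[OF M b that] P.C.convolve_compose[OF M E.mult_bilinear P.points_hom[OF that] P.points_hom[OF that] Ll Rl]
  by simp
 note c = P.pr_closed[OF E L] P.pr_closed[OF E R]
 have lr: "cc R g \<ast>\<^sub>E cc L k = cc L k \<ast>\<^sub>E cc R g" if "g \<in> P.points" "k \<in> P.points" for g k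
  by (rule P.C.conv_commute[OF E P.points_hom[OF that(1)] P.points_hom[OF that(2)] Rl Ll]) (simp add: LR)
 have pc: "g \<otimes>\<^bsub>P.point_group\<^esub> k \<in> P.points" "P.gi g \<in> P.points"
  if "g \<in> P.points" "k \<in> P.points" for g k
  using that PG.m_closed[of g k] PG.inv_closed[of g] by (simp_all del: P.point_group_simps(2,3))
 show ?thesis
 proof (rule partial_repI[OF E])
  show "klinear K H E ?\<sigma>" by (rule HC.sweedler_linear[OF M b])
  show "?\<sigma> 1\<^sub>H = 1\<^sub>E" using L R by (simp add: sweedler_one[OF M b] partial_rep_def)
 next
  fix g k assume gk: "g \<in> P.points" "k \<in> P.points"
  note p = gk pc[OF gk] pc[OF gk(2,2)]
  show "cc ?\<sigma> g \<ast>\<^sub>E cc ?\<sigma> k \<ast>\<^sub>E cc ?\<sigma> (P.gi k)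
   = cc ?\<sigma> (g \<otimes>\<^bsub>P.point_group\<^esub> k) \<ast>\<^sub>E cc ?\<sigma> (P.gi k)"
   using EC.interchange3[OF c(1)[OF p(1)] c(1)[OF p(2)] c(1)[OF p(6)] c(2)[OF p(1)] c(2)[OF p(2)] c(2)[OF p(6)]
     lr[OF p(1,2)] lr[OF p(1,6)] lr[OF p(2,6)]]
    EC.interchange2[OF c(1)[OF p(3)] c(1)[OF p(6)] c(2)[OF p(3)] c(2)[OF p(6)] lr[OF p(3,6)]]
   by (simp only: \<sigma>[OF p(1)] \<sigma>[OF p(2)] \<sigma>[OF p(3)] \<sigma>[OF p(6)] P.pr_rel1[OF E L gk] P.pr_rel1[OF E R gk])
  have q: "P.gi g \<otimes>\<^bsub>P.point_group\<^esub> k \<in> P.points" using pc[OF p(4) p(2)] by simp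
  show "cc ?\<sigma> g \<ast>\<^sub>E cc ?\<sigma> (P.gi g) \<ast>\<^sub>E cc ?\<sigma> k
   = cc ?\<sigma> g \<ast>\<^sub>E cc ?\<sigma> (P.gi g \<otimes>\<^bsub>P.point_group\<^esub> k)"
   using EC.interchange3[OF c(1)[OF p(1)] c(1)[OF p(4)] c(1)[OF p(2)] c(2)[OF p(1)] c(2)[OF p(4)] c(2)[OF p(2)]
     lr[OF p(1,4)] lr[OF p(1,2)] lr[OF p(4,2)]]
    EC.interchange2[OF c(1)[OF p(1)] c(1)[OF q] c(2)[OF p(1)] c(2)[OF q] lr[OF p(1) q]]
   by (simp only: \<sigma>[OF p(1)] \<sigma>[OF p(2)] \<sigma>[OF p(4)] \<sigma>[OF q] P.pr_rel2[OF E L gk] P.pr_rel2[OF E R gk])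
 qed
qed

text \<open>Inversion in the group of points is an involution; evaluated at the identity point this is \<open>S \<circ> S = id\<close>.\<close>
lemma antipode_antipode: "h \<in> U H ==> antipode H (antipode H h) = h"
proof -
 assume h: "h \<in> U H"
 interpret O: hopf_points K H H by (rule one_variable)
 interpret OG: group O.point_group by (rule O.group_points)
 note i = id_point
 have ci: "O.gi id_point \<in> O.points" using OG.inv_closed[of id_point] i by simp
 have "O.gi (O.gi id_point) = id_point"
  using OG.inv_inv[of id_point] i by simp
 then have "cmp H (antipode H) (cmp H (antipode H) id_point) h = id_point h"
  using O.inv_point[OF ci] O.inv_point[OF i] by simp
 then show ?thesis using h antipode_closed by (auto simp: compose_eq id_point_def)
qed

lemma antipode_one: "antipode H 1\<^sub>H = 1\<^sub>H"
proof -
 have "klinear K H H (%h. h)" by (simp add: klinear_def)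
 from bilinear_comp[OF mult_bilinear this antipode_linear]
 show ?thesis
  using antipode_right[of "1\<^sub>H"] klinearD(1)[OF antipode_linear, of "1\<^sub>H"]
  by (simp add: sweedler_one[OF module_axioms] counit_one)
qed

text \<open>In group terms \<open>g \<mapsto> \<pi>\<^sub>g\<^sup>-\<^sup>1\<close> reverses products. The two relations are exchanged, as the relations are mirror images of each other.\<close>
lemma partial_rep_opposite:
 fixes E :: "('a, 'e, 'u) module_scheme"
 assumes E: "k_algebra K E" and pr: "partial_rep K H E \<pi>"
 shows "partial_rep K H (opposite E) (%h. \<pi> (antipode H h))"
proof -
 interpret E: k_algebra K E by (rule E)
 interpret EC: monoid "conv K HH E" by (rule P.C.conv_monoid[OF E])
 have l: "klinear K H E \<pi>" and one: "\<pi> 1\<^sub>H = 1\<^sub>E" using pr by (simp_all add: partial_rep_def)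
 have pS: "cc (%h. \<pi> (antipode H h)) g = cc \<pi> (P.gi g)" if "g \<in> P.points" for g
  using P.inv_point[OF that] by (simp add: compose_def fun_eq_iff)
 note cl = P.pr_closed[OF E pr]
 note op = P.conv_opposite[OF E, folded conv_simps(1)[of K HH E]]
 show ?thesis
 proof (rule partial_repI[OF opposite_k_algebra[OF E]])
  show "klinear K H (opposite E) (%h. \<pi> (antipode H h))"
   using linear_comp[OF l antipode_linear] by simp
  show "\<pi> (antipode H 1\<^sub>H) = \<one>\<^bsub>opposite E\<^esub>" by (simp add: antipode_one one)
 next
  fix g k assume gk: "g \<in> P.points" "k \<in> P.points"
  let ?i = "%g. P.gi g" and ?m = "%g k. g \<otimes>\<^bsub>P.point_group\<^esub> k"
  have i: "?i g \<in> P.points" "?i k \<in> P.points" using gk PG.inv_closed by simp_all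
  have ii: "?i (?i g) = g" "?i (?i k) = k" using gk PG.inv_inv by simp_all
  have im: "?i (?m g k) = ?m (?i k) (?i g)" "?i (?m (?i g) k) = ?m (?i k) g"
   using gk PG.inv_mult_group[of g k] PG.inv_mult_group[of "?i g" k] i ii by (simp_all del: P.point_group_simps(2,3))
  have mc: "?m (?i k) (?i g) \<in> P.points" "?m (?i k) g \<in> P.points" "?m g k \<in> P.points" "?m (?i g) k \<in> P.points"
   using gk i PG.m_closed by (simp_all del: P.point_group_simps(2,3))
  note cls = cl[OF gk(1)] cl[OF gk(2)] cl[OF i(1)] cl[OF i(2)] cl[OF mc(1)] cl[OF mc(2)]
  show "cc (%h. \<pi> (antipode H h)) g \<otimes>\<^bsub>conv K HH (opposite E)\<^esub> cc (%h. \<pi> (antipode H h)) k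
    \<otimes>\<^bsub>conv K HH (opposite E)\<^esub> cc (%h. \<pi> (antipode H h)) (?i k)
   = cc (%h. \<pi> (antipode H h)) (?m g k) \<otimes>\<^bsub>conv K HH (opposite E)\<^esub> cc (%h. \<pi> (antipode H h)) (?i k)"
  proof -
   have "cc \<pi> k \<ast>\<^sub>E (cc \<pi> (?i k) \<ast>\<^sub>E cc \<pi> (?i g)) = cc \<pi> k \<ast>\<^sub>E cc \<pi> (?m (?i k) (?i g))"
    using P.pr_rel2[OF E pr gk(2) i(1)] by (simp only: EC.m_assoc[OF cls(2,4,3)])
   then show ?thesis
    by (simp only: pS gk i ii mc im op[OF cls(3,4)] op[OF EC.m_closed[OF cls(4,3)] cls(2)] op[OF cls(5,2)])
  qed
  show "cc (%h. \<pi> (antipode H h)) g \<otimes>\<^bsub>conv K HH (opposite E)\<^esub> cc (%h. \<pi> (antipode H h)) (?i g)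
    \<otimes>\<^bsub>conv K HH (opposite E)\<^esub> cc (%h. \<pi> (antipode H h)) k
   = cc (%h. \<pi> (antipode H h)) g \<otimes>\<^bsub>conv K HH (opposite E)\<^esub> cc (%h. \<pi> (antipode H h)) (?m (?i g) k)"
  proof -
   have "cc \<pi> (?i k) \<ast>\<^sub>E (cc \<pi> g \<ast>\<^sub>E cc \<pi> (?i g)) = cc \<pi> (?m (?i k) g) \<ast>\<^sub>E cc \<pi> (?i g)"
    using P.pr_rel1[OF E pr i(2) gk(1)] by (simp only: EC.m_assoc[OF cls(4,1,3)])
   then show ?thesis
    by (simp only: pS gk i ii mc im op[OF cls(3,1)] op[OF EC.m_closed[OF cls(1,3)] cls(4)] op[OF cls(3,6)])
  qed
 qed
qed

lemma partial_rep_algebra_hom: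
 fixes E :: "('a, 'e, 'u) module_scheme"
 assumes X: "k_algebra K X" and E: "k_algebra K E" and pr: "partial_rep K H X \<pi>" and j: "algebra_hom K X E j"
 shows "partial_rep K H E (%h. j (\<pi> h))"
proof -
 interpret X: k_algebra K X by (rule X)
 interpret E: k_algebra K E by (rule E)
 have l: "klinear K H X \<pi>" and one: "\<pi> 1\<^sub>H = 1\<^sub>X" using pr by (simp_all add: partial_rep_def)
 have jl: "klinear K X E j" and j1: "j 1\<^sub>X = 1\<^sub>E"
  and jm: "!!x y. [|x \<in> U X; y \<in> U X|] ==> j (x *\<^sub>X y) = j x *\<^sub>E j y"
  using j by (auto simp: algebra_hom_def)
 have jp: "klinear K H E (%h. j (\<pi> h))" by (rule linear_comp[OF jl l])
 have cc: "cc (%h. j (\<pi> h)) g = cc j (cc \<pi> g)" if "g \<in> P.points" for g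
  by (simp add: P.C.compose_compose[OF P.br_hom[OF l that]] compose_def fun_eq_iff)
 note hm = P.C.compose_algebra_hom(1)[OF X E j, symmetric]
 interpret XC: monoid "conv K HH X" by (rule P.C.conv_monoid[OF X])
 note cl = P.br_hom[OF l]
 have mc: "f \<ast>\<^sub>X g \<in> P.Hom X" if "f \<in> P.Hom X" "g \<in> P.Hom X" for f g
  using XC.m_closed[of f g] that by simp
 show ?thesis
 proof (rule partial_repI[OF E jp])
  show "j (\<pi> 1\<^sub>H) = 1\<^sub>E" by (simp add: one j1)
 next
  fix g k assume gk: "g \<in> P.points" "k \<in> P.points"
  have i: "P.gi g \<in> P.points" "P.gi k \<in> P.points"
   using gk PG.inv_closed by simp_all
  have m: "g \<otimes>\<^bsub>P.point_group\<^esub> k \<in> P.points" "P.gi g \<otimes>\<^bsub>P.point_group\<^esub> k \<in> P.points"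
   using gk i PG.m_closed by (simp_all del: P.point_group_simps(2,3))
  show "cc (%h. j (\<pi> h)) g \<ast>\<^sub>E cc (%h. j (\<pi> h)) k \<ast>\<^sub>E cc (%h. j (\<pi> h)) (P.gi k)
   = cc (%h. j (\<pi> h)) (g \<otimes>\<^bsub>P.point_group\<^esub> k) \<ast>\<^sub>E cc (%h. j (\<pi> h)) (P.gi k)"
   using gk i m by (simp only: cc hm cl mc P.pr_rel1[OF X pr gk])
  show "cc (%h. j (\<pi> h)) g \<ast>\<^sub>E cc (%h. j (\<pi> h)) (P.gi g) \<ast>\<^sub>E cc (%h. j (\<pi> h)) k
   = cc (%h. j (\<pi> h)) g \<ast>\<^sub>E cc (%h. j (\<pi> h)) (P.gi g \<otimes>\<^bsub>P.point_group\<^esub> k)"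
   using gk i m by (simp only: cc hm cl mc P.pr_rel2[OF X pr gk])
 qed
qed

end

context hopf_points
begin

context
 fixes E :: "('k, 'e, 'u) module_scheme" and \<pi> :: "'h => 'e"
 assumes E: "k_algebra K E" and \<pi>: "klinear K H E \<pi>"
begin

interpretation E: k_algebra K E by (rule E)

lemma idempotent_linear: "klinear K H E (sweedler E H (%x y. \<pi> x *\<^sub>E \<pi> (antipode H y)))"
 by (rule cocommutative_coalgebra.sweedler_linear[OF H.cocommutative_coalgebra E.module_axioms
  bilinear_comp[OF E.mult_bilinear \<pi> linear_comp[OF \<pi> H.antipode_linear]]])

lemma idempotent_point:
 assumes g: "g \<in> points"
 shows "cc (sweedler E H (%x y. \<pi> x *\<^sub>E \<pi> (antipode H y))) g = cc \<pi> g \<star>\<^sub>E cc \<pi> (gi g)"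
 unfolding inv_point[OF g] C.compose_compose[OF points_hom[OF g]] conv_simps
  compose_point[OF E.module_axioms bilinear_comp[OF E.mult_bilinear \<pi> linear_comp[OF \<pi> H.antipode_linear]] g]
 by (rule C.convolve_compose[OF E.module_axioms E.mult_bilinear points_hom[OF g] points_hom[OF g] \<pi> linear_comp[OF \<pi> H.antipode_linear], symmetric])

lemma conjugate_trilinear: "trilinear K E H H E (%b x y. \<pi> (antipode H x) *\<^sub>E b *\<^sub>E \<pi> y)"
 using E.mult_bilinear \<pi> linear_comp[OF \<pi> H.antipode_linear] by (simp add: multilinear)

lemma conjugate_bilinear:
 "bilinear K E H E (%b. sweedler E H (%x y. \<pi> (antipode H x) *\<^sub>E b *\<^sub>E \<pi> y))"
 by (rule cocommutative_coalgebra.sweedler_param_bilinear[OF H.cocommutative_coalgebra E.module_axioms E.module_axioms conjugate_trilinear])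

text \<open>The right action \<open>b [h] = \<Sum> [S h\<^sub>1] b [h\<^sub>2]\<close> is conjugation when \<open>h\<close> is a point.\<close>
lemma conjugate_point:
 assumes g: "g \<in> points" and w: "w \<in> Hom E"
 shows "convolve E C (%b h. sweedler E H (%x y. \<pi> (antipode H x) *\<^sub>E b *\<^sub>E \<pi> y) h) w g = cc \<pi> (gi g) \<star>\<^sub>E w \<star>\<^sub>E cc \<pi> g"
proof -
 note M = E.module_axioms and g' = points_hom[OF g]
 note \<pi>S = linear_comp[OF \<pi> H.antipode_linear]
 have t: "trilinear K H E H E (%x b y. \<pi> (antipode H x) *\<^sub>E b *\<^sub>E \<pi> y)"
  using conjugate_trilinear by (simp add: multilinear)
 have id: "klinear K E E (%b. b)" and w': "cc (%b. b) w = w"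
  using extensional_restrict[OF module_homD(5)[OF w]] by (simp_all add: klinear_def compose_def)
 show ?thesis
  unfolding convolve_point_right[OF M M conjugate_trilinear g w] C.convolve3_swap12[OF M t g' w g'] inv_point[OF g]
   C.compose_compose[OF g'] C.convolve3_mult[OF E \<pi>S id \<pi> g' w g'] w' ..
qed

lemma conjugate_point_const:
 assumes g: "g \<in> points" and b: "b \<in> U E"
 shows "cc (sweedler E H (%x y. \<pi> (antipode H x) *\<^sub>E b *\<^sub>E \<pi> y)) g
  = cc \<pi> (gi g) \<star>\<^sub>E C.const_hom E b \<star>\<^sub>E cc \<pi> g"
 unfolding conjugate_point[OF g C.const_hom_hom[OF E.module_axioms b], symmetric]
 by (rule C.convolve_const_left[OF E.module_axioms E.module_axioms conjugate_bilinear b points_hom[OF g], symmetric])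

end

end

section \<open>Free algebras\<close>

context cring
begin

definition word_conv :: "('s list => 'a) => ('s list => 'a) => 's list => 'a"
 where "word_conv f g w = (\<Oplus>i \<in> {..length w}. f (take i w) \<otimes> g (drop i w))"

lemma word_conv_closed:
 "[|!!w. f w \<in> U R; !!w. g w \<in> U R|] ==> word_conv f g w \<in> U R"
 unfolding word_conv_def by (auto intro!: finsum_closed)

lemma word_conv_Nil:
 "[|!!w. f w \<in> U R; !!w. g w \<in> U R|] ==> word_conv f g [] = f [] \<otimes> g []"
 unfolding word_conv_def by simp

lemma word_conv_Cons:
 assumes "!!w. f w \<in> U R" "!!w. g w \<in> U R"
 shows "word_conv f g (a # w) = f [] \<otimes> g (a # w) \<oplus> word_conv (%v. f (a # v)) g w"
proof -
 have "word_conv f g (a # w) = (\<Oplus>i \<in> {..length w}. f (a # take i w) \<otimes> g (drop i w)) \<oplus> f [] \<otimes> g (a # w)"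
  unfolding word_conv_def using assms by (simp add: finsum_Suc2 del: finsum_Suc)
 then show ?thesis
  using word_conv_closed[of "%v. f (a # v)" g w] assms by (simp add: word_conv_def a_comm)
qed

lemma word_conv_zero: "(!!w. g w \<in> U R) ==> word_conv (%w. \<zero>) g w = \<zero>"
 by (simp add: word_conv_def)

lemma word_conv_add_left:
 assumes "!!w. f w \<in> U R" "!!w. f' w \<in> U R" "!!w. g w \<in> U R"
 shows "word_conv (%w. f w \<oplus> f' w) g w = word_conv f g w \<oplus> word_conv f' g w"
 unfolding word_conv_def using assms by (simp add: l_distr finsum_addf Pi_def)

lemma word_conv_add_right:
 assumes "!!w. f w \<in> U R" "!!w. g w \<in> U R" "!!w. g' w \<in> U R"
 shows "word_conv f (%w. g w \<oplus> g' w) w = word_conv f g w \<oplus> word_conv f g' w"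
 unfolding word_conv_def using assms by (simp add: r_distr finsum_addf Pi_def)

lemma word_conv_smult_left:
 assumes "!!w. f w \<in> U R" "!!w. g w \<in> U R" "k \<in> U R"
 shows "word_conv (%w. k \<otimes> f w) g w = k \<otimes> word_conv f g w"
 unfolding word_conv_def using assms by (simp add: m_assoc finsum_rdistr Pi_def)

lemma word_conv_smult_right:
 assumes "!!w. f w \<in> U R" "!!w. g w \<in> U R" "k \<in> U R"
 shows "word_conv f (%w. k \<otimes> g w) w = k \<otimes> word_conv f g w"
 unfolding word_conv_def using assms by (simp add: m_lcomm finsum_rdistr Pi_def)

lemma word_conv_assoc:
 assumes "!!w. f w \<in> U R" "!!w. g w \<in> U R" "!!w. h w \<in> U R"
 shows "word_conv (word_conv f g) h w = word_conv f (word_conv g h) w"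
 using assms
proof (induction w arbitrary: f g h)
 case Nil
 then show ?case by (simp add: word_conv_Nil word_conv_closed m_assoc)
next
 case (Cons a w)
 have fg: "word_conv f g v \<in> U R" and gh: "word_conv g h v \<in> U R" for v
  using Cons.prems by (auto intro: word_conv_closed)
 note cl = Cons.prems fg gh
 have d: "word_conv (%v. f (a # v)) g v \<in> U R" for v using cl by (intro word_conv_closed)
 have e: "word_conv (%v. g (a # v)) h w \<in> U R" using cl by (intro word_conv_closed)
 have e': "word_conv (%v. f (a # v)) (word_conv g h) w \<in> U R" using cl by (intro word_conv_closed)
 have "word_conv (word_conv f g) h (a # w)
   = (f [] \<otimes> g []) \<otimes> h (a # w) \<oplus> word_conv (%v. f [] \<otimes> g (a # v) \<oplus> word_conv (%v. f (a # v)) g v) h w"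
  using cl by (simp add: word_conv_Cons word_conv_Nil)
 also have "word_conv (%v. f [] \<otimes> g (a # v) \<oplus> word_conv (%v. f (a # v)) g v) h w
   = f [] \<otimes> word_conv (%v. g (a # v)) h w \<oplus> word_conv (%v. f (a # v)) (word_conv g h) w"
  using cl d by (simp add: word_conv_add_left word_conv_smult_left Cons.IH)
 also have "(f [] \<otimes> g []) \<otimes> h (a # w) \<oplus> (f [] \<otimes> word_conv (%v. g (a # v)) h w \<oplus> word_conv (%v. f (a # v)) (word_conv g h) w)
   = f [] \<otimes> (g [] \<otimes> h (a # w) \<oplus> word_conv (%v. g (a # v)) h w) \<oplus> word_conv (%v. f (a # v)) (word_conv g h) w"
  using cl e e' by (simp add: r_distr m_assoc a_assoc)
 also have "... = word_conv f (word_conv g h) (a # w)"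
  using cl by (simp add: word_conv_Cons)
 finally show ?case .
qed

abbreviation (input) "delta w == %v. if v = w then \<one> else \<zero>"

lemma word_conv_delta_Nil_left: "(!!w. f w \<in> U R) ==> word_conv (delta []) f w = f w"
 by (cases w) (simp_all add: word_conv_Nil word_conv_Cons word_conv_zero)

lemma word_conv_delta_Cons:
 "(!!w. f w \<in> U R) ==> word_conv (delta (a # u)) f w
  = (case w of [] => \<zero> | b # v => if b = a then word_conv (delta u) f v else \<zero>)"
proof -
 assume f: "!!w. f w \<in> U R"
 have "word_conv (delta u) f v \<in> U R" for v by (rule word_conv_closed) (auto simp: f)
 then show ?thesis using f by (cases w) (auto simp: word_conv_Nil word_conv_Cons word_conv_zero)
qed

lemma word_conv_delta: "word_conv (delta u) (delta v) w = delta (u @ v) w"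
proof (induction u arbitrary: w)
 case Nil
 then show ?case by (simp add: word_conv_delta_Nil_left)
next
 case (Cons a u)
 then show ?case by (auto simp: word_conv_delta_Cons split: list.splits)
qed

lemma word_conv_one_right: "(!!w. f w \<in> U R) ==> word_conv f (delta []) w = f w"
proof (induction w arbitrary: f)
 case (Cons a w)
 have "word_conv (%v. f (a # v)) (delta []) w = f (a # w)" using Cons.prems by (rule Cons.IH)
 then show ?case using Cons.prems by (simp add: word_conv_Cons)
qed (simp add: word_conv_Nil)

lemma word_conv_support:
 assumes "word_conv f g w ~= \<zero>" "!!w. f w \<in> U R" "!!w. g w \<in> U R"
 shows "w \<in> (%(u, v). u @ v) ` ({w. f w ~= \<zero>} \<times> {w. g w ~= \<zero>})"
proof -
 have "\<exists>i. f (take i w) \<otimes> g (drop i w) ~= \<zero>"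
  using assms(1) unfolding word_conv_def by (metis (no_types, lifting) add.finprod_one_eqI)
 then obtain i where i: "f (take i w) \<otimes> g (drop i w) ~= \<zero>" ..
 then have "f (take i w) ~= \<zero>" "g (drop i w) ~= \<zero>" using assms(2,3) by auto
 then show ?thesis by (intro image_eqI[of _ _ "(take i w, drop i w)"]) auto
qed

end

lemma free_algebra_simps:
 "f \<in> U (free_algebra K S) \<longleftrightarrow> (\<forall>w. f w \<in> U K) & finite {w. f w ~= 0\<^sub>K} & {w. f w ~= 0\<^sub>K} <= lists S"
 "f \<otimes>\<^bsub>free_algebra K S\<^esub> g = (%w. \<Oplus>\<^bsub>K\<^esub>i \<in> {..length w}. f (take i w) *\<^sub>K g (drop i w))"
 "\<one>\<^bsub>free_algebra K S\<^esub> = (%w. if w = [] then 1\<^sub>K else 0\<^sub>K)"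
 "\<zero>\<^bsub>free_algebra K S\<^esub> = (%w. 0\<^sub>K)"
 "f \<oplus>\<^bsub>free_algebra K S\<^esub> g = (%w. f w +\<^sub>K g w)"
 "k \<odot>\<^bsub>free_algebra K S\<^esub> f = (%w. k *\<^sub>K f w)"
 by (auto simp: free_algebra_def)

context cring
begin

abbreviation (input) "FA S == free_algebra R S"

lemma FA_mult: "f \<otimes>\<^bsub>FA S\<^esub> g = word_conv f g"
 by (simp add: free_algebra_simps word_conv_def fun_eq_iff)

lemma FA_carrierD: "f \<in> U (FA S) ==> f w \<in> U R"
 by (simp add: free_algebra_simps)

lemma FA_carrierI:
 assumes "!!w. f w \<in> U R" "{w. f w ~= \<zero>} <= A" "finite A" "A <= lists S"
 shows "f \<in> U (FA S)"
 unfolding free_algebra_simps using assms finite_subset by blast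

lemma FA_support:
 "f \<in> U (FA S) ==> finite {w. f w ~= \<zero>}" "f \<in> U (FA S) ==> {w. f w ~= \<zero>} <= lists S"
 by (simp_all add: free_algebra_simps)

lemma FA_add_closed:
 assumes f: "f \<in> U (FA S)" and g: "g \<in> U (FA S)"
 shows "(%w. f w \<oplus> g w) \<in> U (FA S)"
 by (rule FA_carrierI[of _ "{w. f w ~= \<zero>} \<union> {w. g w ~= \<zero>}"])
  (use FA_carrierD[OF f] FA_carrierD[OF g] FA_support[OF f] FA_support[OF g] in \<open>simp_all, auto\<close>)

lemma FA_smult_closed:
 assumes f: "f \<in> U (FA S)" and k: "k \<in> U R"
 shows "(%w. k \<otimes> f w) \<in> U (FA S)"
 by (rule FA_carrierI[of _ "{w. f w ~= \<zero>}"])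
  (use FA_carrierD[OF f] FA_support[OF f] k in \<open>simp_all, auto\<close>)

lemma FA_mult_closed:
 assumes f: "f \<in> U (FA S)" and g: "g \<in> U (FA S)"
 shows "word_conv f g \<in> U (FA S)"
proof -
 note cl = FA_carrierD[OF f] FA_carrierD[OF g]
 have s: "{w. word_conv f g w ~= \<zero>} <= (%(u, v). u @ v) ` ({w. f w ~= \<zero>} \<times> {w. g w ~= \<zero>})"
  using word_conv_support cl by blast
 have "finite ((%(u, v). u @ v) ` ({w. f w ~= \<zero>} \<times> {w. g w ~= \<zero>}))"
  using f g by (simp add: free_algebra_simps)
 moreover have "(%(u, v). u @ v) ` ({w. f w ~= \<zero>} \<times> {w. g w ~= \<zero>}) <= lists S"
 proof
  fix x assume "x \<in> (%(u, v). u @ v) ` ({w. f w ~= \<zero>} \<times> {w. g w ~= \<zero>})"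
  then obtain u v where x: "x = u @ v" and "f u ~= \<zero>" "g v ~= \<zero>" by auto
  then have "u \<in> lists S" "v \<in> lists S" using FA_support(2)[OF f] FA_support(2)[OF g] by blast+
  then show "x \<in> lists S" by (simp add: x)
 qed
 ultimately show ?thesis
  using cl by (intro FA_carrierI[OF _ s]) (auto intro: word_conv_closed)
qed

lemma FA_delta: "w \<in> lists S ==> delta w \<in> U (FA S)"
 by (auto simp: free_algebra_simps)

lemma FA_zero_closed: "(%w. \<zero>) \<in> U (FA S)"
 by (simp add: free_algebra_simps)

lemma free_algebra_k_algebra: "k_algebra R (FA S)"
proof -
 have ag: "abelian_group (FA S)"
 proof (rule abelian_groupI)
  fix f assume f: "f \<in> U (FA S)"
  have "(%w. (\<ominus> \<one>) \<otimes> f w) \<in> U (FA S)" by (rule FA_smult_closed[OF f]) simp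
  then show "EX y:U (FA S). y \<oplus>\<^bsub>FA S\<^esub> f = \<zero>\<^bsub>FA S\<^esub>"
   using FA_carrierD[OF f]
   by (intro bexI[of _ "%w. (\<ominus> \<one>) \<otimes> f w"]) (auto simp: free_algebra_simps(4,5) l_minus l_neg)
 qed (auto simp: free_algebra_simps(4,5) FA_add_closed FA_zero_closed FA_carrierD a_ac)
 have mo: "monoid (FA S)"
  by (rule monoidI)
   (auto simp: FA_mult FA_mult_closed free_algebra_simps(3) FA_delta FA_carrierD fun_eq_iff
    word_conv_assoc word_conv_delta_Nil_left word_conv_one_right)
 have "ring (FA S)"
  by (rule ringI[OF ag mo])
   (auto simp: FA_mult free_algebra_simps(5) FA_carrierD word_conv_add_left word_conv_add_right fun_eq_iff)
 moreover have "module R (FA S)"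
  by (rule moduleI[OF is_cring ag])
   (auto simp: free_algebra_simps(5,6) FA_smult_closed FA_carrierD l_distr r_distr m_assoc fun_eq_iff)
 ultimately show ?thesis
  by (intro k_algebra.intro k_algebra_axioms.intro)
   (auto simp: FA_mult free_algebra_simps(6) FA_carrierD word_conv_smult_left word_conv_smult_right fun_eq_iff)
qed

lemma FA_induct [consumes 1, case_names monomial add]:
 assumes f: "f \<in> U (FA S)"
  and mono: "!!k w. [|k \<in> U R; w \<in> lists S|] ==> P (%v. k \<otimes> delta w v)"
  and add: "!!f g. [|f \<in> U (FA S); g \<in> U (FA S); P f; P g|] ==> P (%v. f v \<oplus> g v)"
 shows "P f"
proof -
 have "f \<in> U (FA S) ==> {w. f w ~= \<zero>} <= A ==> P f" if "finite A" "A <= lists S" for A f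
  using that
 proof (induction A arbitrary: f rule: finite_induct)
  case empty
  then have "f = (%v. \<zero> \<otimes> delta [] v)" by (auto simp: fun_eq_iff)
  then show ?case using mono[of \<zero> "[]"] by simp
 next
  case (insert w A)
  note fc = FA_carrierD[OF insert.prems(1)]
  define g where "g = (%v. if v = w then \<zero> else f v)"
  have g: "g \<in> U (FA S)"
   by (rule FA_carrierI[of _ "{w. f w ~= \<zero>}"])
    (use fc FA_support[OF insert.prems(1)] in \<open>simp_all add: g_def, auto\<close>)
  have w: "w \<in> lists S" using insert.prems by auto
  have "P g"
   using insert.prems by (intro insert.IH g) (auto simp: g_def)
  moreover have "P (%v. f w \<otimes> delta w v)" using fc w by (rule mono)
  moreover have "(%v. f w \<otimes> delta w v) \<in> U (FA S)"
   using FA_smult_closed[OF FA_delta[OF w], of "f w"] fc by simp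
  ultimately have "P (%v. g v \<oplus> f w \<otimes> delta w v)" using g by (intro add)
  also have "(%v. g v \<oplus> f w \<otimes> delta w v) = f"
   using fc by (auto simp: g_def fun_eq_iff)
  finally show ?case .
 qed
 from this[of "{w. f w ~= \<zero>}" f] f show ?thesis by (simp add: free_algebra_simps)
qed

end

definition linear_ext ::
 "('k, 'x) ring_scheme => ('k, 'v, 'y) module_scheme => ('s list => 'v) => ('s list => 'k) => 'v"
 where "linear_ext K V \<phi> f = (\<Oplus>\<^bsub>V\<^esub>w \<in> {w. f w ~= 0\<^sub>K}. f w *.\<^sub>V \<phi> w)"

section \<open>Quotient algebras\<close>

context module
begin

lemma linear_ext_superset:
 assumes "\<phi> \<in> lists S \<rightarrow> U M" "f \<in> U (free_algebra R S)" "finite A" "{w. f w ~= \<zero>} <= A" "A <= lists S"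
 shows "linear_ext R M \<phi> f = (\<Oplus>\<^bsub>M\<^esub>w \<in> A. f w *.\<^sub>M \<phi> w)"
 unfolding linear_ext_def
proof (rule M.add.finprod_mono_neutral_cong_left)
 have fw: "f w \<in> U R" for w using assms(2) by (simp add: free_algebra_simps)
 show "f i *.\<^sub>M \<phi> i = 0\<^sub>M" if "i \<in> A - {w. f w ~= \<zero>}" for i
  using that assms(1,5) by (simp add: funcset_mem subset_iff)
 show "(%w. f w *.\<^sub>M \<phi> w) \<in> A \<rightarrow> U M"
  using assms(1,5) fw by (simp add: Pi_def subset_iff)
qed (use assms in auto)

lemma linear_ext_linear:
 assumes \<phi>: "\<phi> \<in> lists S \<rightarrow> U M"
 shows "klinear R (free_algebra R S) M (linear_ext R M \<phi>)"
proof -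
 have fw: "f w \<in> U R" if "f \<in> U (free_algebra R S)" for f w using that by (simp add: free_algebra_simps)
 have supp: "finite {w. f w ~= \<zero>}" "{w. f w ~= \<zero>} <= lists S" if "f \<in> U (free_algebra R S)" for f
  using that by (simp_all add: free_algebra_simps)
 interpret F: k_algebra R "free_algebra R S" by (rule R.free_algebra_k_algebra)
 have cl: "linear_ext R M \<phi> f \<in> U M" if "f \<in> U (free_algebra R S)" for f
  unfolding linear_ext_def using fw[OF that] supp[OF that] \<phi> by (intro M.finsum_closed) (simp add: Pi_def subset_iff)
 have add: "linear_ext R M \<phi> (f \<oplus>\<^bsub>free_algebra R S\<^esub> g) = linear_ext R M \<phi> f +\<^sub>M linear_ext R M \<phi> g"
  if f: "f \<in> U (free_algebra R S)" and g: "g \<in> U (free_algebra R S)" for f g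
 proof -
  let ?A = "{w. f w ~= \<zero>} \<union> {w. g w ~= \<zero>}"
  have A: "finite ?A" "?A <= lists S" using supp f g by auto
  have s: "{w. (f \<oplus>\<^bsub>free_algebra R S\<^esub> g) w ~= \<zero>} <= ?A"
   by (auto simp: free_algebra_simps)
  have "linear_ext R M \<phi> (f \<oplus>\<^bsub>free_algebra R S\<^esub> g) = (\<Oplus>\<^bsub>M\<^esub>w \<in> ?A. (f w \<oplus> g w) *.\<^sub>M \<phi> w)"
   using linear_ext_superset[OF \<phi> F.add.m_closed[OF f g] A(1) s A(2)] by (simp add: free_algebra_simps)
  also have "... = (\<Oplus>\<^bsub>M\<^esub>w \<in> ?A. f w *.\<^sub>M \<phi> w +\<^sub>M g w *.\<^sub>M \<phi> w)"
   using fw[OF f] fw[OF g] A(2) \<phi>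
   by (intro M.add.finprod_cong[OF refl])
    (simp_all add: simp_implies_def smult_l_distr Pi_def subset_iff)
  also have "... = (\<Oplus>\<^bsub>M\<^esub>w \<in> ?A. f w *.\<^sub>M \<phi> w) +\<^sub>M (\<Oplus>\<^bsub>M\<^esub>w \<in> ?A. g w *.\<^sub>M \<phi> w)"
   using fw[OF f] fw[OF g] A(2) \<phi> by (intro M.add.finprod_multf) (simp_all add: Pi_def subset_iff)
  also have "... = linear_ext R M \<phi> f +\<^sub>M linear_ext R M \<phi> g"
   using linear_ext_superset[OF \<phi> f A(1) _ A(2)] linear_ext_superset[OF \<phi> g A(1) _ A(2)] by simp
  finally show ?thesis .
 qed
 have smult: "linear_ext R M \<phi> (k \<odot>\<^bsub>free_algebra R S\<^esub> f) = k *.\<^sub>M linear_ext R M \<phi> f"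
  if f: "f \<in> U (free_algebra R S)" and k: "k \<in> U R" for f k
 proof -
  let ?A = "{w. f w ~= \<zero>}"
  have A: "finite ?A" "?A <= lists S" using supp[OF f] by auto
  have s: "{w. (k \<odot>\<^bsub>free_algebra R S\<^esub> f) w ~= \<zero>} <= ?A"
   using k by (auto simp: free_algebra_simps)
  have "linear_ext R M \<phi> (k \<odot>\<^bsub>free_algebra R S\<^esub> f) = (\<Oplus>\<^bsub>M\<^esub>w \<in> ?A. (k \<otimes> f w) *.\<^sub>M \<phi> w)"
   using linear_ext_superset[OF \<phi> F.smult_closed[OF k f] A(1) s A(2)] by (simp add: free_algebra_simps)
  also have "... = (\<Oplus>\<^bsub>M\<^esub>w \<in> ?A. k *.\<^sub>M (f w *.\<^sub>M \<phi> w))"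
   using fw[OF f] A(2) \<phi> k
   by (intro M.add.finprod_cong[OF refl]) (simp_all add: simp_implies_def smult_assoc1 Pi_def subset_iff)
  also have "... = k *.\<^sub>M linear_ext R M \<phi> f"
   unfolding linear_ext_def using fw[OF f] A(2) \<phi> k
   by (intro finsum_smult_ldistr[symmetric] A(1)) (simp_all add: Pi_def subset_iff)
  finally show ?thesis .
 qed
 show ?thesis using cl add smult by (simp add: klinear_def)
qed

lemma linear_ext_delta:
 assumes \<phi>: "\<phi> \<in> lists S \<rightarrow> U M" and w: "w \<in> lists S"
 shows "linear_ext R M \<phi> (%v. if v = w then \<one> else \<zero>) = \<phi> w"
proof -
 have "linear_ext R M \<phi> (%v. if v = w then \<one> else \<zero>) = (\<Oplus>\<^bsub>M\<^esub>v \<in> {w}. (if v = w then \<one> else \<zero>) *.\<^sub>M \<phi> v)"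
  using w by (intro linear_ext_superset[OF \<phi> R.FA_delta[OF w]]) auto
 moreover have "\<phi> w \<in> U M" using \<phi> w by blast
 ultimately show ?thesis by (simp add: Pi_def)
qed

end

context
 fixes K :: "('k, 'w) ring_scheme" and R :: "('k, 'r, 'z) module_scheme" and I :: "'r set"
 assumes R: "k_algebra K R" and I: "ideal I R"
begin

interpretation R: k_algebra K R by (rule R)
interpretation I: ideal I R by (rule I)
interpretation Q: ring "R Quot I" by (rule I.quotient_is_ring)

abbreviation (input) "QA == quotient_algebra R I"
abbreviation (input) "cl x == I +>\<^bsub>R\<^esub> x"

lemma QA_simps:
 "U QA = U (R Quot I)" "monoid.mult QA = monoid.mult (R Quot I)" "1\<^sub>QA = \<one>\<^bsub>R Quot I\<^esub>"
 "0\<^sub>QA = \<zero>\<^bsub>R Quot I\<^esub>" "add QA = add (R Quot I)"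
 by (simp_all add: quotient_algebra_def)

lemma ideal_smult: "[|k \<in> U K; x \<in> I|] ==> k *.\<^sub>R x \<in> I"
 using I.I_l_closed[of x "k *.\<^sub>R 1\<^sub>R"] I.a_Hcarr[of x] by (simp add: R.smult_mult_left)

lemma cl_carrier: "X \<in> U QA \<longleftrightarrow> (EX x:U R. X = cl x)"
 by (auto simp: QA_simps FactRing_simps)

lemma cl_self: "x \<in> U R ==> x \<in> cl x"
 by (rule I.a_rcos_self)

lemma cl_eq: "x \<in> U R ==> y \<in> cl x ==> cl y = cl x"
 using I.a_repr_independence' by blast

lemma cl_mem: "x \<in> U R ==> y \<in> cl x ==> y \<in> U R & y \<ominus>\<^sub>R x \<in> I"
 using I.a_rcos_module_imp[of x y] R.a_r_coset_subset_G[of I x] I.a_subset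
 by (auto simp: a_minus_def)

lemma cl_eqI: "[|x \<in> U R; y \<in> U R; y \<ominus>\<^sub>R x \<in> I|] ==> cl y = cl x"
 using I.a_rcos_module_rev[of x y] cl_eq[of x y] by (simp add: a_minus_def)

lemma cl_smult:
 assumes k: "k \<in> U K" and x: "x \<in> U R"
 shows "k *.\<^sub>QA cl x = cl (k *.\<^sub>R x)"
proof -
 have "cl (k *.\<^sub>R y) = cl (k *.\<^sub>R x)" if "y \<in> cl x" for y
 proof (rule cl_eqI)
  have y: "y \<in> U R" "y \<ominus>\<^sub>R x \<in> I" using cl_mem[OF x that] by auto
  have "k *.\<^sub>R y \<ominus>\<^sub>R k *.\<^sub>R x = k *.\<^sub>R (y \<ominus>\<^sub>R x)"
   using k x y by (simp add: a_minus_def R.smult_r_distr R.smult_r_minus)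
  then show "k *.\<^sub>R y \<ominus>\<^sub>R k *.\<^sub>R x \<in> I" using ideal_smult[OF k y(2)] by simp
  show "k *.\<^sub>R y \<in> U R" using k y by simp
 qed (use k x in simp)
 then have "(\<Union>y \<in> cl x. cl (k *.\<^sub>R y)) = cl (k *.\<^sub>R x)"
  by (intro UN_constant_eq[OF cl_self[OF x]]) blast
 then show ?thesis by (simp add: quotient_algebra_def)
qed

lemma cl_ring_hom: "(%x. cl x) \<in> ring_hom R (R Quot I)"
 by (rule I.rcos_ring_hom)

lemma cl_add: "[|x \<in> U R; y \<in> U R|] ==> cl (x +\<^sub>R y) = cl x +\<^sub>QA cl y"
 using ring_hom_add[OF cl_ring_hom] by (simp add: QA_simps)

lemma cl_mult: "[|x \<in> U R; y \<in> U R|] ==> cl (x *\<^sub>R y) = cl x *\<^sub>QA cl y"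
 using ring_hom_mult[OF cl_ring_hom] by (simp add: QA_simps)

lemma cl_one: "cl 1\<^sub>R = 1\<^sub>QA"
 using ring_hom_one[OF cl_ring_hom] by (simp add: QA_simps)

lemma cl_closed: "x \<in> U R ==> cl x \<in> U QA"
 by (auto simp: cl_carrier)

lemma cl_zero: "x \<in> I ==> cl x = 0\<^sub>QA"
 using I.a_rcos_const[of x] by (simp add: QA_simps FactRing_def)

lemma quotient_k_algebra: "k_algebra K QA"
proof -
 have ag: "abelian_group QA"
 proof (rule abelian_groupI)
  show "EX y:U QA. y +\<^sub>QA x = 0\<^sub>QA" if "x \<in> U QA" for x
   using that unfolding QA_simps by (intro bexI[of _ "\<ominus>\<^bsub>R Quot I\<^esub> x"]) (auto simp: Q.l_neg)
 qed (auto simp: QA_simps Q.a_ac)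
 have "monoid QA" by (rule monoidI) (auto simp: QA_simps Q.m_assoc)
 then have ring: "ring QA" by (intro ringI ag) (auto simp: QA_simps Q.l_distr Q.r_distr)
 have mod: "module K QA"
  by (rule moduleI[OF R.is_cring ag])
   (auto simp: cl_carrier cl_smult R.smult_l_distr R.smult_r_distr R.smult_assoc1 simp flip: cl_add)
 show ?thesis
  by (intro k_algebra.intro mod ring k_algebra_axioms.intro)
   (auto simp: cl_carrier cl_smult R.smult_mult_left R.smult_mult_right simp flip: cl_mult)
qed

lemma cl_algebra_hom: "algebra_hom K R QA (%x. cl x)"
 by (simp add: algebra_hom_def klinear_def cl_closed cl_add cl_smult cl_mult cl_one)

lemma quotient_lift:
 assumes E: "k_algebra K E" and \<phi>: "algebra_hom K R E \<phi>" and 0: "!!x. x \<in> I ==> \<phi> x = 0\<^sub>E"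
 shows "algebra_hom K QA E (%X. \<phi> (SOME x. x \<in> X))"
  and "!!X x. [|X \<in> U QA; x \<in> X|] ==> \<phi> (SOME x. x \<in> X) = \<phi> x"
proof -
 interpret E: k_algebra K E by (rule E)
 have l: "klinear K R E \<phi>" using \<phi> by (simp add: algebra_hom_def)
 have eq: "\<phi> y = \<phi> x" if "x \<in> U R" "y \<in> cl x" for x y
 proof -
  have y: "y \<in> U R" "y \<ominus>\<^sub>R x \<in> I" using cl_mem[OF that] by auto
  have "\<phi> y \<ominus>\<^sub>E \<phi> x = 0\<^sub>E"
   using klinear_minus[OF R.module_axioms E.module_axioms l y(1) that(1)] 0[OF y(2)] by simp
  then show ?thesis
   by (rule E.eq_of_minus_eq_zero[OF _ klinearD(1)[OF l y(1)] klinearD(1)[OF l that(1)]])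
 qed
 have some: "\<phi> (SOME y. y \<in> cl x) = \<phi> x" if "x \<in> U R" for x
  using someI[of "%y. y \<in> cl x", OF cl_self[OF that]] eq[OF that] by blast
 show "!!X x. [|X \<in> U QA; x \<in> X|] ==> \<phi> (SOME x. x \<in> X) = \<phi> x"
  using some eq by (auto simp: cl_carrier)
 show "algebra_hom K QA E (%X. \<phi> (SOME x. x \<in> X))"
  unfolding algebra_hom_def klinear_def
  using klinearD[OF l] \<phi>
  by (auto simp: cl_carrier cl_smult some algebra_hom_def simp flip: cl_add cl_mult cl_one)
qed

end

lemma algebra_hom_comp:
 "[|algebra_hom K Y Z g; algebra_hom K X Y f|] ==> algebra_hom K X Z (%x. g (f x))"
 by (auto simp: algebra_hom_def klinear_def)

lemma algebra_hom_kernel_ideal: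
 assumes R: "k_algebra K R" and E: "k_algebra K E" and \<phi>: "algebra_hom K R E \<phi>"
 shows "ideal {x \<in> U R. \<phi> x = 0\<^sub>E} R"
proof -
 interpret R: k_algebra K R by (rule R)
 interpret E: k_algebra K E by (rule E)
 have "\<phi> \<in> ring_hom R E"
  using \<phi> by (auto simp: algebra_hom_def klinear_def ring_hom_def)
 then interpret h: ring_hom_ring R E \<phi>
  by (intro ring_hom_ringI2 R.ring_axioms E.ring_axioms)
 show ?thesis using h.kernel_is_ideal unfolding a_kernel_def' .
qed

section \<open>The universal property of \<open>H\<^sub>p\<^sub>a\<^sub>r\<close>\<close>

context cocommutative_hopf_algebra
begin

interpretation HC: cocommutative_coalgebra K H by (rule cocommutative_coalgebra)

abbreviation (input) "FR == free_algebra K (U H)"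
abbreviation (input) "TA == tensor_algebra K H"
abbreviation (input) "HP == Hpar K H"
abbreviation (input) "\<iota> == tensor_gen K H"
abbreviation (input) "pc == par_class K H"

lemma FR_k_algebra: "k_algebra K FR" by (rule free_algebra_k_algebra)

interpretation FR: k_algebra K FR by (rule FR_k_algebra)

lemma free_gen_closed: "h \<in> U H ==> free_gen K h \<in> U FR"
 by (auto simp: free_algebra_simps free_gen_def)

lemma tensor_alg_rels_closed: "tensor_alg_rels K H <= U FR"
 unfolding tensor_alg_rels_def Let_def by (auto intro!: FR.minus_closed FR.add.m_closed FR.smult_closed free_gen_closed)

lemma tensor_ideal: "ideal (tensor_alg_ideal K H) FR"
 unfolding tensor_alg_ideal_def by (rule FR.genideal_ideal) (rule tensor_alg_rels_closed)

lemmas TA_k_algebra = quotient_k_algebra[OF FR_k_algebra tensor_ideal, folded tensor_algebra_def]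
interpretation TA: k_algebra K TA by (rule TA_k_algebra)

lemma tensor_gen_linear: "klinear K H TA \<iota>"
proof -
 note hom = cl_algebra_hom[OF FR_k_algebra tensor_ideal, folded tensor_algebra_def]
 have l: "klinear K FR TA (%x. tensor_alg_ideal K H +>\<^bsub>FR\<^esub> x)" using hom by (simp add: algebra_hom_def)
 have rel: "tensor_alg_ideal K H +>\<^bsub>FR\<^esub> y = tensor_alg_ideal K H +>\<^bsub>FR\<^esub> x"
  if "y \<ominus>\<^sub>FR x \<in> tensor_alg_rels K H" "x \<in> U FR" "y \<in> U FR" for x y
  using that FR.genideal_self[OF tensor_alg_rels_closed]
  by (intro cl_eqI[OF FR_k_algebra tensor_ideal]) (auto simp: tensor_alg_ideal_def)
 have "\<iota> (g +\<^sub>H h) = \<iota> g +\<^sub>TA \<iota> h" if "g \<in> U H" "h \<in> U H" for g h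
 proof -
  have "\<iota> (g +\<^sub>H h) = tensor_alg_ideal K H +>\<^bsub>FR\<^esub> (free_gen K g +\<^sub>FR free_gen K h)"
   unfolding tensor_gen_def using that
   by (intro rel FR.add.m_closed free_gen_closed) (auto simp: tensor_alg_rels_def Let_def)
  then show ?thesis using that klinearD(2)[OF l] free_gen_closed by (simp add: tensor_gen_def)
 qed
 moreover have "\<iota> (k *.\<^sub>H h) = k *.\<^sub>TA \<iota> h" if "k \<in> U K" "h \<in> U H" for k h
 proof -
  have "\<iota> (k *.\<^sub>H h) = tensor_alg_ideal K H +>\<^bsub>FR\<^esub> (k *.\<^sub>FR free_gen K h)"
   unfolding tensor_gen_def using that
   by (intro rel FR.smult_closed free_gen_closed) (auto simp: tensor_alg_rels_def Let_def)
  then show ?thesis using that klinearD(3)[OF l] free_gen_closed by (simp add: tensor_gen_def)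
 qed
 moreover have "\<iota> h \<in> U TA" if "h \<in> U H" for h
  using klinearD(1)[OF l free_gen_closed[OF that]] by (simp add: tensor_gen_def)
 ultimately show ?thesis by (simp add: klinear_def)
qed

context
 fixes E :: "('a, 'e, 'u) module_scheme" and \<pi> :: "'c => 'e"
 assumes E: "k_algebra K E" and \<pi>: "klinear K H E \<pi>"
begin

interpretation E: k_algebra K E by (rule E)

abbreviation (input) "S == antipode H"

lemma par_rel_bilinear:
 assumes "h \<in> U H"
 shows "bilinear K H H E (%x y. \<pi> h *\<^sub>E \<pi> x *\<^sub>E \<pi> (S y))"
  "bilinear K H H E (%x y. \<pi> (h *\<^sub>H x) *\<^sub>E \<pi> (S y))"
  "bilinear K H H E (%x y. \<pi> x *\<^sub>E \<pi> (S y) *\<^sub>E \<pi> h)"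
  "bilinear K H H E (%x y. \<pi> x *\<^sub>E \<pi> (S y *\<^sub>H h))"
  "bilinear K H H E (%x y. \<pi> h *\<^sub>E \<pi> (S x) *\<^sub>E \<pi> y)"
  "bilinear K H H E (%x y. \<pi> (h *\<^sub>H S x) *\<^sub>E \<pi> y)"
  "bilinear K H H E (%x y. \<pi> (S x) *\<^sub>E \<pi> y *\<^sub>E \<pi> h)"
  "bilinear K H H E (%x y. \<pi> (S x) *\<^sub>E \<pi> (y *\<^sub>H h))"
 using assms \<pi> linear_comp[OF \<pi> antipode_linear] E.mult_bilinear mult_bilinear klinearD[OF antipode_linear]
 by (simp_all add: multilinear)

end

lemma sweedler_antipode:
 assumes Z: "module K Z" and b: "bilinear K H H Z b" and h: "h \<in> U H"
 shows "sweedler Z H b (antipode H h) = sweedler Z H (%x y. b (antipode H x) (antipode H y)) h"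
proof -
 interpret O: hopf_points K H H by (rule one_variable)
 have "cmp H (antipode H) id_point \<in> O.points" by (rule O.points_inv_closed[OF id_point])
 from O.point_sweedler[OF Z b this h]
 have "sweedler Z H b (antipode H h) = sweedler Z H (%x y. b (cmp H (antipode H) id_point x)
   (cmp H (antipode H) id_point y)) h"
  using h by (simp add: compose_eq id_point_def)
 also have "... = sweedler Z H (%x y. b (antipode H x) (antipode H y)) h"
  using klinearD(1)[OF antipode_linear] bilinearD(1)[OF b]
  by (intro HC.sweedler_cong[OF Z h]) (auto simp: compose_eq id_point_def)
 finally show ?thesis .
qed

lemma sweedler_minus:
 assumes Z: "module K Z" and b: "bilinear K H H Z b" and b': "bilinear K H H Z b'" and h: "h \<in> U H"
 shows "sweedler Z H (%x y. b x y \<ominus>\<^sub>Z b' x y) h = sweedler Z H b h \<ominus>\<^sub>Z sweedler Z H b' h"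
proof -
 interpret Z: module K Z by (rule Z)
 have KK: "module K (ktensor K H H)" by (rule ktensor_module[OF module_axioms module_axioms])
 have b2: "bilinear K H H Z (%x y. b x y \<ominus>\<^sub>Z b' x y)"
  using b b' by (auto simp: multilinear a_minus_def Z.minus_add Z.a_ac Z.smult_r_distr Z.smult_r_minus)
 note l = tensor_lift_linear[OF module_axioms module_axioms Z]
 show ?thesis unfolding sweedler_def
 proof (rule ktensor_linear_eq[OF module_axioms module_axioms l[OF b2], where g = "%t. tensor_lift Z b t \<ominus>\<^sub>Z tensor_lift Z b' t"])
  show "klinear K (ktensor K H H) Z (%t. tensor_lift Z b t \<ominus>\<^sub>Z tensor_lift Z b' t)"
   using l[OF b] l[OF b']
   by (auto simp: klinear_def a_minus_def Z.minus_add Z.a_ac Z.smult_r_distr Z.smult_r_minus)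
 qed (simp_all add: tensor_lift_kpure[OF module_axioms module_axioms Z] b b' b2 HC.comult_closed h)
qed

text \<open>The two remaining relations of \<open>H\<^sub>p\<^sub>a\<^sub>r\<close> are the two of \<open>partial_rep\<close> with \<open>S k\<close> and \<open>S h\<close> in place of \<open>k\<close> and \<open>h\<close>.\<close>
lemma partial_rep_rel34:
 fixes E :: "('a, 'e, 'u) module_scheme"
 assumes E: "k_algebra K E" and pr: "partial_rep K H E \<pi>" and h: "h \<in> U H" and k: "k \<in> U H"
 shows "sweedler E H (%x y. \<pi> h *\<^sub>E \<pi> (antipode H x) *\<^sub>E \<pi> y) k
   = sweedler E H (%x y. \<pi> (h *\<^sub>H antipode H x) *\<^sub>E \<pi> y) k"
  and "sweedler E H (%x y. \<pi> (antipode H x) *\<^sub>E \<pi> y *\<^sub>E \<pi> k) h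
   = sweedler E H (%x y. \<pi> (antipode H x) *\<^sub>E \<pi> (y *\<^sub>H k)) h"
proof -
 interpret E: k_algebra K E by (rule E)
 have l: "klinear K H E \<pi>" using pr by (simp add: partial_rep_def)
 note M = E.module_axioms
 note b = par_rel_bilinear[OF E l]
 have sk: "antipode H k \<in> U H" "antipode H h \<in> U H" using h k klinearD(1)[OF antipode_linear] by auto
 have e: "sweedler E H (%x y. f (antipode H x) (antipode H (antipode H y))) z = sweedler E H (%x y. f (antipode H x) y) z"
  if "bilinear K H H E (%x y. f (antipode H x) y)" "z \<in> U H" for f z
  by (rule HC.sweedler_cong[OF M that(2)]) (use bilinearD(1)[OF that(1)] in \<open>auto simp: antipode_antipode\<close>)
 show "sweedler E H (%x y. \<pi> h *\<^sub>E \<pi> (antipode H x) *\<^sub>E \<pi> y) k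
   = sweedler E H (%x y. \<pi> (h *\<^sub>H antipode H x) *\<^sub>E \<pi> y) k"
  using pr h sk e[OF b(5)[OF h] k] e[OF b(6)[OF h] k]
   sweedler_antipode[OF M b(1)[OF h] k] sweedler_antipode[OF M b(2)[OF h] k]
  by (simp add: partial_rep_def)
 show "sweedler E H (%x y. \<pi> (antipode H x) *\<^sub>E \<pi> y *\<^sub>E \<pi> k) h
   = sweedler E H (%x y. \<pi> (antipode H x) *\<^sub>E \<pi> (y *\<^sub>H k)) h"
  using pr k sk e[OF b(7)[OF k] h] e[OF b(8)[OF k] h]
   sweedler_antipode[OF M b(3)[OF k] h] sweedler_antipode[OF M b(4)[OF k] h]
  by (simp add: partial_rep_def)
qed

lemma par_rels_closed: "par_rels K H <= U TA"
proof -
 note b = par_rel_bilinear[OF TA_k_algebra tensor_gen_linear]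
 have d: "bilinear K H H TA (%x y. f x y \<ominus>\<^sub>TA g x y)" if "bilinear K H H TA f" "bilinear K H H TA g" for f g
  using that by (auto simp: multilinear a_minus_def TA.minus_add TA.a_ac TA.smult_r_distr TA.smult_r_minus)
 note c = klinearD(1)[OF HC.sweedler_linear[OF TA.module_axioms d]]
 show ?thesis
  unfolding par_rels_def Let_def
  using klinearD(1)[OF tensor_gen_linear]
  by (auto intro!: TA.minus_closed c b)
qed

lemma par_ideal_ideal: "ideal (par_ideal K H) TA"
 unfolding par_ideal_def by (rule TA.genideal_ideal) (rule par_rels_closed)

lemmas HP_k_algebra = quotient_k_algebra[OF TA_k_algebra par_ideal_ideal, folded Hpar_def]
interpretation HP: k_algebra K HP by (rule HP_k_algebra)

lemma par_cl_hom: "algebra_hom K TA HP (%t. par_ideal K H +>\<^bsub>TA\<^esub> t)"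
 using cl_algebra_hom[OF TA_k_algebra par_ideal_ideal] by (simp add: Hpar_def)

lemma tensor_cl_hom: "algebra_hom K FR TA (%f. tensor_alg_ideal K H +>\<^bsub>FR\<^esub> f)"
 using cl_algebra_hom[OF FR_k_algebra tensor_ideal] by (simp add: tensor_algebra_def)

lemma sweedler_algebra_hom:
 assumes E: "k_algebra K E" and E': "k_algebra K E'" and \<phi>: "klinear K E E' \<phi>" and b: "bilinear K H H E b" "bilinear K H H E b'"
  and k: "k \<in> U H"
 shows "\<phi> (sweedler E H (%x y. b x y \<ominus>\<^sub>E b' x y) k) = sweedler E' H (%x y. \<phi> (b x y)) k \<ominus>\<^bsub>E'\<^esub> sweedler E' H (%x y. \<phi> (b' x y)) k"
proof -
 interpret E: k_algebra K E by (rule E)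
 interpret E': k_algebra K E' by (rule E')
 note M = E.module_axioms E'.module_axioms
 show ?thesis
  unfolding sweedler_minus[OF M(1) b k]
  by (simp only: klinear_minus[OF M \<phi> klinearD(1)[OF HC.sweedler_linear[OF M(1) b(1)] k] klinearD(1)[OF HC.sweedler_linear[OF M(1) b(2)] k]]
   HC.sweedler_map[OF M b(1) \<phi> k] HC.sweedler_map[OF M b(2) \<phi> k])
qed

lemma par_class_partial_rep: "partial_rep K H HP pc"
proof -
 let ?q = "%t. par_ideal K H +>\<^bsub>TA\<^esub> t"
 have ql: "klinear K TA HP ?q" and q1: "?q 1\<^sub>TA = 1\<^sub>HP"
  and qm: "!!x y. [|x \<in> U TA; y \<in> U TA|] ==> ?q (x *\<^sub>TA y) = ?q x *\<^sub>HP ?q y"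
  using par_cl_hom by (auto simp: algebra_hom_def)
 have pc: "pc h = ?q (\<iota> h)" for h by (simp add: par_class_def)
 have rel0: "?q r = 0\<^sub>HP" if "r \<in> par_rels K H" for r
  using cl_zero[OF TA_k_algebra par_ideal_ideal, of r] TA.genideal_self[OF par_rels_closed] that
  by (auto simp: Hpar_def par_ideal_def)
 note il = klinearD(1)[OF tensor_gen_linear] and al = klinearD(1)[OF antipode_linear]
 note b = par_rel_bilinear[OF TA_k_algebra tensor_gen_linear]
 have lin: "klinear K H HP pc" unfolding pc by (rule linear_comp[OF ql tensor_gen_linear])
 note c = par_rel_bilinear[OF HP_k_algebra lin]
 have eqI: "sweedler HP H f' k = sweedler HP H g' k"
  if rel: "sweedler TA H (%x y. f x y \<ominus>\<^sub>TA g x y) k \<in> par_rels K H" and k: "k \<in> U H"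
   and f: "bilinear K H H TA f" and g: "bilinear K H H TA g" and f': "bilinear K H H HP f'" and g': "bilinear K H H HP g'"
   and e: "!!x y. [|x \<in> U H; y \<in> U H|] ==> ?q (f x y) = f' x y & ?q (g x y) = g' x y" for f g f' g' k
 proof -
  have "sweedler HP H (%x y. ?q (f x y)) k = sweedler HP H f' k" "sweedler HP H (%x y. ?q (g x y)) k = sweedler HP H g' k"
   by (rule HC.sweedler_cong[OF HP.module_axioms k], simp_all add: e bilinearD(1)[OF f'] bilinearD(1)[OF g'])+
  then show ?thesis
   using sweedler_algebra_hom[OF TA_k_algebra HP_k_algebra ql f g k] rel0[OF rel]
    HC.sweedler_linear[OF HP.module_axioms f', THEN klinearD(1), OF k] HC.sweedler_linear[OF HP.module_axioms g', THEN klinearD(1), OF k]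
   by - (rule HP.eq_of_minus_eq_zero, simp_all)
 qed
 show ?thesis
  unfolding partial_rep_def
 proof (intro conjI ballI lin)
  have "\<iota> 1\<^sub>H \<ominus>\<^bsub>TA\<^esub> 1\<^sub>TA \<in> par_rels K H" by (simp add: par_rels_def Let_def)
  from rel0[OF this] klinear_minus[OF TA.module_axioms HP.module_axioms ql il TA.one_closed, of "1\<^sub>H"]
  show "pc 1\<^sub>H = 1\<^sub>HP"
   unfolding pc q1[symmetric]
   by (intro HP.eq_of_minus_eq_zero[OF _ klinearD(1)[OF ql il] klinearD(1)[OF ql]]) simp_all
 next
  fix h k assume h: "h \<in> U H" and k: "k \<in> U H"
  show "sweedler HP H (%x y. pc h *\<^sub>HP pc x *\<^sub>HP pc (antipode H y)) k
   = sweedler HP H (%x y. pc (h *\<^sub>H x) *\<^sub>HP pc (antipode H y)) k"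
   by (rule eqI[OF _ k b(1,2)[OF h] c(1,2)[OF h]],
     (use h k in \<open>auto simp: par_rels_def Let_def\<close>)[1], use h il al in \<open>simp add: qm pc\<close>)
  show "sweedler HP H (%x y. pc x *\<^sub>HP pc (antipode H y) *\<^sub>HP pc k) h
   = sweedler HP H (%x y. pc x *\<^sub>HP pc (antipode H y *\<^sub>H k)) h"
   by (rule eqI[OF _ h b(3,4)[OF k] c(3,4)[OF k]],
     (use h k in \<open>auto simp: par_rels_def Let_def\<close>)[1], use k il al in \<open>simp add: qm pc\<close>)
 qed
qed

definition word_prod :: "('a, 'e, 'u) module_scheme => ('c => 'e) => 'c list => 'e"
 where "word_prod E \<pi> w = foldr (%h e. \<pi> h *\<^sub>E e) w 1\<^sub>E"

abbreviation (input) "rep z == SOME f. f \<in> (SOME t. t \<in> z)"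

lemma par_extend_eq: "par_extend K V \<phi> z = linear_ext K V \<phi> (rep z)"
 by (simp add: par_extend_def linear_ext_def Let_def)

abbreviation (input) "\<Theta> f == par_ideal K H +>\<^bsub>TA\<^esub> (tensor_alg_ideal K H +>\<^bsub>FR\<^esub> f)"

lemma \<Theta>_hom: "algebra_hom K FR HP (%f. \<Theta> f)"
 by (rule algebra_hom_comp[OF par_cl_hom tensor_cl_hom])

lemma TA_carrier: "t \<in> U TA \<longleftrightarrow> (EX f:U FR. t = tensor_alg_ideal K H +>\<^bsub>FR\<^esub> f)"
 using cl_carrier[OF FR_k_algebra tensor_ideal] by (simp add: tensor_algebra_def)

lemma HP_carrier: "z \<in> U HP \<longleftrightarrow> (EX t:U TA. z = par_ideal K H +>\<^bsub>TA\<^esub> t)"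
 using cl_carrier[OF TA_k_algebra par_ideal_ideal] by (simp add: Hpar_def)

lemma rep:
 assumes z: "z \<in> U HP"
 shows "(SOME t. t \<in> z) \<in> z" "(SOME t. t \<in> z) \<in> U TA" "rep z \<in> (SOME t. t \<in> z)" "rep z \<in> U FR" "\<Theta> (rep z) = z"
proof -
 obtain t where t: "t \<in> U TA" "z = par_ideal K H +>\<^bsub>TA\<^esub> t" using z by (auto simp: HP_carrier)
 show 1: "(SOME t. t \<in> z) \<in> z" using cl_self[OF TA_k_algebra par_ideal_ideal t(1)] t(2) by (auto intro: someI)
 show 2: "(SOME t. t \<in> z) \<in> U TA" using cl_mem[OF TA_k_algebra par_ideal_ideal t(1)] 1 t(2) by blast
 have 3: "par_ideal K H +>\<^bsub>TA\<^esub> (SOME t. t \<in> z) = z" using cl_eq[OF TA_k_algebra par_ideal_ideal t(1)] 1 t(2) by blast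
 obtain f where f: "f \<in> U FR" "(SOME t. t \<in> z) = tensor_alg_ideal K H +>\<^bsub>FR\<^esub> f" using 2 by (auto simp: TA_carrier)
 have "\<exists>f. f \<in> (SOME t. t \<in> z)" unfolding f(2) using cl_self[OF FR_k_algebra tensor_ideal f(1)] by blast
 then show 4: "rep z \<in> (SOME t. t \<in> z)" by (rule someI_ex)
 show 5: "rep z \<in> U FR" using cl_mem[OF FR_k_algebra tensor_ideal f(1)] 4 f(2) by blast
 have 6: "tensor_alg_ideal K H +>\<^bsub>FR\<^esub> rep z = (SOME t. t \<in> z)" using cl_eq[OF FR_k_algebra tensor_ideal f(1)] 4 f(2) by blast
 show "\<Theta> (rep z) = z" by (simp only: 6 3)
qed

lemma delta_append:
 "(%x. if x = u then \<one> else \<zero>) *\<^sub>FR (%x. if x = v then \<one> else \<zero>) = (%x. if x = u @ v then \<one> else \<zero>)"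
 unfolding FA_mult by (rule ext) (rule word_conv_delta)

lemma FR_induct [consumes 1, case_names monomial add]:
 assumes f: "f \<in> U FR"
  and mono: "!!k w. [|k \<in> U K; w \<in> lists (U H)|] ==> P (k *.\<^sub>FR (%x. if x = w then \<one> else \<zero>))"
  and add: "!!f g. [|f \<in> U FR; g \<in> U FR; P f; P g|] ==> P (f +\<^sub>FR g)"
 shows "P f"
 using f by (induction f rule: FA_induct) (use mono add in \<open>simp_all add: free_algebra_simps(5,6)\<close>)

lemma Hpar_induct [consumes 1, case_names one Cons smult add]:
 assumes z: "z \<in> U HP" and one: "P 1\<^sub>HP"
  and Cons: "!!h z. [|h \<in> U H; z \<in> U HP; P z|] ==> P (pc h *\<^sub>HP z)"
  and smult: "!!k z. [|k \<in> U K; z \<in> U HP; P z|] ==> P (k *.\<^sub>HP z)"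
  and add: "!!y z. [|y \<in> U HP; z \<in> U HP; P y; P z|] ==> P (y +\<^sub>HP z)"
 shows "P z"
proof -
 have l: "klinear K FR HP (%f. \<Theta> f)" using \<Theta>_hom by (simp add: algebra_hom_def)
 have w: "P (\<Theta> (%x. if x = w then \<one> else \<zero>))" if "w \<in> lists (U H)" for w
  using that
 proof (induction w)
  case Nil
  then show ?case using one \<Theta>_hom by (simp add: algebra_hom_def free_algebra_simps(3))
 next
  case (Cons h w)
  have gen: "(%x. if x = [h] then \<one> else \<zero>) = free_gen K h" by (simp add: free_gen_def fun_eq_iff)
  have "(%x. if x = h # w then \<one> else \<zero>) = free_gen K h *\<^sub>FR (%x. if x = w then \<one> else \<zero>)"
   using delta_append[of "[h]" w] by (simp only: gen append.simps)
  then have "\<Theta> (%x. if x = h # w then \<one> else \<zero>) = pc h *\<^sub>HP \<Theta> (%x. if x = w then \<one> else \<zero>)"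
   using \<Theta>_hom free_gen_closed[of h] FA_delta[of w "U H"] Cons
   by (simp add: algebra_hom_def par_class_def tensor_gen_def)
  then show ?case
   using Cons assms(3)[of h] klinearD(1)[OF l FA_delta[of w "U H"]] by simp
 qed
 have "P (\<Theta> f)" if "f \<in> U FR" for f
  using that
 proof (induction f rule: FR_induct)
  case (monomial k v)
  show ?case
   using smult[OF monomial(1) _ w[OF monomial(2)]]
   by (simp only: klinearD[OF l] monomial(1) FA_delta[OF monomial(2)])
 next
  case (add f g)
  then show ?case using assms(5) by (simp add: klinearD[OF l])
 qed
 from this[OF rep(4)[OF z]] show ?thesis by (simp only: rep(5)[OF z])
qed

context
 fixes E :: "('a, 'e, 'u) module_scheme" and \<pi> :: "'c => 'e"
 assumes E: "k_algebra K E" and pr: "partial_rep K H E \<pi>"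
begin

interpretation E: k_algebra K E by (rule E)

lemma \<pi>_linear: "klinear K H E \<pi>" using pr by (simp add: partial_rep_def)

lemma word_prod_closed: "w \<in> lists (U H) ==> word_prod E \<pi> w \<in> U E"
 by (induction w) (simp_all add: word_prod_def klinearD[OF \<pi>_linear])

lemma word_prod_append:
 "[|u \<in> lists (U H); v \<in> lists (U H)|] ==> word_prod E \<pi> (u @ v) = word_prod E \<pi> u *\<^sub>E word_prod E \<pi> v"
proof (induction u)
 case Nil
 then show ?case using word_prod_closed[of v] by (simp add: word_prod_def)
next
 case (Cons h u)
 then show ?case using word_prod_closed[of u] word_prod_closed[of v]
  by (simp add: word_prod_def E.m_assoc klinearD[OF \<pi>_linear])
qed

lemma free_hom: "algebra_hom K FR E (linear_ext K E (word_prod E \<pi>))"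
proof -
 let ?\<Phi> = "linear_ext K E (word_prod E \<pi>)"
 have wp: "word_prod E \<pi> \<in> lists (U H) \<rightarrow> U E" using word_prod_closed by blast
 note l = E.linear_ext_linear[OF wp]
 note d = E.linear_ext_delta[OF wp] and ld = klinearD[OF l]
 have one: "?\<Phi> 1\<^sub>FR = 1\<^sub>E" using d[of "[]"] by (simp add: free_algebra_simps(3) word_prod_def)
 have mult: "?\<Phi> (f *\<^sub>FR g) = ?\<Phi> f *\<^sub>E ?\<Phi> g" if "f \<in> U FR" "g \<in> U FR" for f g
  using that
 proof (induction f rule: FR_induct)
  case f: (monomial k u)
  from f(3) show ?case
  proof (induction g rule: FR_induct)
   case g: (monomial l v)
   then show ?case using f(1,2) FA_delta[of u "U H"] FA_delta[of v "U H"] FA_delta[of "u @ v" "U H"]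
     word_prod_closed[of u] word_prod_closed[of v]
    by (simp add: FR.smult_mult_left FR.smult_mult_right E.smult_mult_left E.smult_mult_right delta_append ld d word_prod_append)
  next
   case (add g g')
   have "k *.\<^sub>FR (%x. if x = u then \<one> else \<zero>) \<in> U FR" using f(1,2) FA_delta[of u "U H"] by simp
   then show ?case using add by (simp add: FR.r_distr E.r_distr ld)
  qed
 next
  case (add f f')
  then show ?case by (simp add: FR.l_distr E.l_distr ld)
 qed
 show ?thesis using l one mult by (simp add: algebra_hom_def)
qed

lemma free_hom_gen: "h \<in> U H ==> linear_ext K E (word_prod E \<pi>) (free_gen K h) = \<pi> h"
 using E.linear_ext_delta[of "word_prod E \<pi>" "U H" "[h]"] word_prod_closed klinearD(1)[OF \<pi>_linear, of h]
 by (simp add: free_gen_def word_prod_def Pi_def)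

text \<open>The universal property: a partial representation kills first the relations of the tensor algebra, then those of \<open>H\<^sub>p\<^sub>a\<^sub>r\<close>.
  Hence the value computed from a representative is multiplicative and independent of the representative.\<close>
lemma par_extend_algebra_hom:
 shows "algebra_hom K HP E (par_extend K E (word_prod E \<pi>))"
  and "h \<in> U H ==> par_extend K E (word_prod E \<pi>) (pc h) = \<pi> h"
proof -
 let ?\<Phi> = "linear_ext K E (word_prod E \<pi>)"
 note F = FR_k_algebra and T = TA_k_algebra
 have fl: "klinear K FR E ?\<Phi>" using free_hom by (simp add: algebra_hom_def)
 have ms: "x \<ominus>\<^sub>E x = 0\<^sub>E" if "x \<in> U E" for x
  using that by (simp add: a_minus_def E.r_neg)
 have "tensor_alg_rels K H <= {x \<in> U FR. ?\<Phi> x = 0\<^sub>E}"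
 proof
  fix r assume r: "r \<in> tensor_alg_rels K H"
  have rc: "r \<in> U FR" using r tensor_alg_rels_closed by blast
  have "?\<Phi> r = 0\<^sub>E"
   using r unfolding tensor_alg_rels_def Let_def
   by (auto simp: klinear_minus[OF FR.module_axioms E.module_axioms fl] free_gen_closed klinearD[OF fl] free_hom_gen
     klinearD[OF \<pi>_linear] ms)
  then show "r \<in> {x \<in> U FR. ?\<Phi> x = 0\<^sub>E}" using rc by simp
 qed
 then have k1: "?\<Phi> x = 0\<^sub>E" if "x \<in> tensor_alg_ideal K H" for x
  using that FR.genideal_minimal[OF algebra_hom_kernel_ideal[OF F E free_hom]] by (auto simp: tensor_alg_ideal_def)
 let ?\<Psi> = "%t. ?\<Phi> (SOME f. f \<in> t)"
 have q1: "algebra_hom K TA E ?\<Psi>"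
  unfolding tensor_algebra_def by (rule quotient_lift(1)[OF F tensor_ideal E free_hom]) (rule k1)
 have q1': "?\<Psi> X = ?\<Phi> x" if "X \<in> U TA" "x \<in> X" for X x
  using that unfolding tensor_algebra_def by (intro quotient_lift(2)[OF F tensor_ideal E free_hom] k1)
 have \<Psi>l: "klinear K TA E ?\<Psi>" and \<Psi>1: "?\<Psi> 1\<^sub>TA = 1\<^sub>E"
  and \<Psi>m: "!!x y. [|x \<in> U TA; y \<in> U TA|] ==> ?\<Psi> (x *\<^sub>TA y) = ?\<Psi> x *\<^sub>E ?\<Psi> y"
  using q1 by (auto simp: algebra_hom_def)
 have \<Psi>i: "?\<Psi> (\<iota> h) = \<pi> h" if h: "h \<in> U H" for h
  using q1'[OF klinearD(1)[OF tensor_gen_linear h], of "free_gen K h"] cl_self[OF F tensor_ideal free_gen_closed[OF h]]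
  by (simp add: tensor_gen_def free_hom_gen h)
 note il = klinearD(1)[OF tensor_gen_linear] and al = klinearD(1)[OF antipode_linear]
 note b = par_rel_bilinear[OF T tensor_gen_linear] and c = par_rel_bilinear[OF E \<pi>_linear]
 have eqI: "?\<Psi> (sweedler TA H (%x y. f x y \<ominus>\<^sub>TA g x y) k) = 0\<^sub>E"
  if f: "bilinear K H H TA f" and g: "bilinear K H H TA g" and k: "k \<in> U H"
   and f': "bilinear K H H E f'" and g': "bilinear K H H E g'"
   and ff': "!!x y. [|x \<in> U H; y \<in> U H|] ==> ?\<Psi> (f x y) = f' x y"
   and gg': "!!x y. [|x \<in> U H; y \<in> U H|] ==> ?\<Psi> (g x y) = g' x y"
   and eq: "sweedler E H f' k = sweedler E H g' k" for f g f' g' k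
 proof -
  have "sweedler E H (%x y. ?\<Psi> (f x y)) k = sweedler E H f' k"
   by (rule HC.sweedler_cong[OF E.module_axioms k]) (auto simp: ff' bilinearD(1)[OF f'])
  moreover have "sweedler E H (%x y. ?\<Psi> (g x y)) k = sweedler E H g' k"
   by (rule HC.sweedler_cong[OF E.module_axioms k]) (auto simp: gg' bilinearD(1)[OF g'])
  ultimately show ?thesis
   using klinearD(1)[OF HC.sweedler_linear[OF E.module_axioms g'] k]
   by (simp add: sweedler_algebra_hom[OF T E \<Psi>l f g k] eq ms)
 qed
 note eqIs = eqI[OF b(1) b(2) _ c(1) c(2)] eqI[OF b(3) b(4) _ c(3) c(4)]
  eqI[OF b(5) b(6) _ c(5) c(6)] eqI[OF b(7) b(8) _ c(7) c(8)]
 have one: "?\<Psi> (\<iota> 1\<^sub>H \<ominus>\<^bsub>TA\<^esub> 1\<^sub>TA) = 0\<^sub>E"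
  using pr by (simp add: klinear_minus[OF TA.module_axioms E.module_axioms \<Psi>l] il \<Psi>i \<Psi>1 partial_rep_def ms)
 have "par_rels K H <= {r. ?\<Psi> r = 0\<^sub>E}"
  unfolding par_rels_def Let_def
 proof (intro Un_least subsetI; (elim CollectE exE conjE)?)
  show "r \<in> {r. ?\<Psi> r = 0\<^sub>E}" if "r \<in> {\<iota> 1\<^sub>H \<ominus>\<^bsub>TA\<^esub> 1\<^sub>TA}" for r
   using that one by simp
 next
  fix r h k assume hk: "h \<in> U H" "k \<in> U H"
  note pr' = pr[unfolded partial_rep_def] partial_rep_rel34[OF E pr hk]
  show "r \<in> {r. ?\<Psi> r = 0\<^sub>E}" if "r = sweedler TA H (%x y. \<iota> h *\<^sub>TA \<iota> x *\<^sub>TA \<iota> (antipode H y) \<ominus>\<^sub>TA \<iota> (h *\<^sub>H x) *\<^sub>TA \<iota> (antipode H y)) k"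
   unfolding that mem_Collect_eq
   by (rule eqIs(1)[OF hk(1) hk(1) hk(2) hk(1) hk(1)]) (use pr' hk in \<open>simp_all add: \<Psi>m \<Psi>i il al\<close>)
  show "r \<in> {r. ?\<Psi> r = 0\<^sub>E}" if "r = sweedler TA H (%x y. \<iota> x *\<^sub>TA \<iota> (antipode H y) *\<^sub>TA \<iota> k \<ominus>\<^sub>TA \<iota> x *\<^sub>TA \<iota> (antipode H y *\<^sub>H k)) h"
   unfolding that mem_Collect_eq
   by (rule eqIs(2)[OF hk(2) hk(2) hk(1) hk(2) hk(2)]) (use pr' hk in \<open>simp_all add: \<Psi>m \<Psi>i il al\<close>)
  show "r \<in> {r. ?\<Psi> r = 0\<^sub>E}" if "r = sweedler TA H (%x y. \<iota> h *\<^sub>TA \<iota> (antipode H x) *\<^sub>TA \<iota> y \<ominus>\<^sub>TA \<iota> (h *\<^sub>H antipode H x) *\<^sub>TA \<iota> y) k"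
   unfolding that mem_Collect_eq
   by (rule eqIs(3)[OF hk(1) hk(1) hk(2) hk(1) hk(1)]) (use pr' hk in \<open>simp_all add: \<Psi>m \<Psi>i il al\<close>)
  show "r \<in> {r. ?\<Psi> r = 0\<^sub>E}" if "r = sweedler TA H (%x y. \<iota> (antipode H x) *\<^sub>TA \<iota> y *\<^sub>TA \<iota> k \<ominus>\<^sub>TA \<iota> (antipode H x) *\<^sub>TA \<iota> (y *\<^sub>H k)) h"
   unfolding that mem_Collect_eq
   by (rule eqIs(4)[OF hk(2) hk(2) hk(1) hk(2) hk(2)]) (use pr' hk in \<open>simp_all add: \<Psi>m \<Psi>i il al\<close>)
 qed
 then have rel: "?\<Psi> r = 0\<^sub>E" if "r \<in> par_rels K H" for r using that by blast
 have "par_rels K H <= {x \<in> U TA. ?\<Psi> x = 0\<^sub>E}" using rel par_rels_closed by blast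
 then have k2: "?\<Psi> x = 0\<^sub>E" if "x \<in> par_ideal K H" for x
  using that TA.genideal_minimal[OF algebra_hom_kernel_ideal[OF T E q1]] by (auto simp: par_ideal_def)
 show "algebra_hom K HP E (par_extend K E (word_prod E \<pi>))"
  unfolding par_extend_eq[abs_def] Hpar_def
  by (rule quotient_lift(1)[OF T par_ideal_ideal E q1]) (rule k2)
 show "par_extend K E (word_prod E \<pi>) (pc h) = \<pi> h" if h: "h \<in> U H"
 proof -
  have z: "pc h \<in> U HP" using il[OF h] by (auto simp: par_class_def HP_carrier)
  have "par_extend K E (word_prod E \<pi>) (pc h) = ?\<Psi> (\<iota> h)"
   unfolding par_extend_eq
   by (rule quotient_lift(2)[OF T par_ideal_ideal E q1, folded Hpar_def])
    (use k2 z cl_self[OF T par_ideal_ideal il[OF h]] in \<open>simp_all add: par_class_def\<close>)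
  then show ?thesis by (simp only: \<Psi>i[OF h])
 qed
qed

text \<open>Actions of \<open>H\<^sub>p\<^sub>a\<^sub>r\<close> are prescribed on words. If the prescription factors through an algebra that carries a partial representation, the action is the one obtained from the universal property.\<close>
lemma par_extend_factor:
 assumes V: "module K V" and L: "klinear K E V L" and z: "z \<in> U HP"
  and \<phi>: "!!w. w \<in> lists (U H) ==> \<phi> w = L (word_prod E \<pi> w)"
 shows "par_extend K V \<phi> z = L (par_extend K E (word_prod E \<pi>) z)"
proof -
 interpret V: module K V by (rule V)
 have wp: "word_prod E \<pi> \<in> lists (U H) \<rightarrow> U E" using word_prod_closed by blast
 have wV: "\<phi> \<in> lists (U H) \<rightarrow> U V" using wp \<phi> klinearD(1)[OF L] by (simp add: Pi_def)
 note l1 = V.linear_ext_linear[OF wV] and l2 = E.linear_ext_linear[OF wp]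
 have "linear_ext K V \<phi> f = L (linear_ext K E (word_prod E \<pi>) f)" if "f \<in> U FR" for f
  using that
 proof (induction f rule: FR_induct)
  case (monomial k v)
  note d = FA_delta[OF monomial(2)]
  show ?case
   by (simp only: klinearD(3)[OF l1 monomial(1) d] klinearD(3)[OF l2 monomial(1) d]
    V.linear_ext_delta[OF wV monomial(2)] E.linear_ext_delta[OF wp monomial(2)] \<phi>[OF monomial(2)]
    klinearD(3)[OF L monomial(1) word_prod_closed[OF monomial(2)]])
 next
  case (add f g)
  then show ?case by (simp add: klinearD[OF l1] klinearD[OF l2] klinearD[OF L])
 qed
 then show ?thesis unfolding par_extend_eq using rep(4)[OF z] by blast
qed

end

end

section \<open>The partial smash product\<close>

context cocommutative_coalgebra
begin

lemma convolve_nest_convolve3: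
 assumes Z: "module K Z" and W: "module K W" and b: "bilinear K X W Z b" and t: "trilinear K Y Q V W t"
  and f: "f \<in> Hom X" and g: "g \<in> Hom Y" and h: "h \<in> Hom Q" and k: "k \<in> Hom V"
 shows "convolve Z C b f (convolve3 W C t g h k) = convolve4 Z C (%x y u v. b x (t y u v)) f g h k"
 unfolding convolve_def convolve4_def
proof (intro restrict_ext sweedler_cong[OF Z])
 note fl = module_hom_linear[OF f] and t' = trilinear_comp[OF t module_hom_linear[OF g] module_hom_linear[OF h] module_hom_linear[OF k]]
 fix x y assume xy: "x \<in> U C" "y \<in> U C"
 have bl: "klinear K W Z (b (f x))" using b klinearD(1)[OF fl xy(1)] by (simp add: bilinear_def)
 have t2: "trilinear K C C C Z (%y z u. b (f x) (t (g y) (h z) (k u)))"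
  using t' klinearD[OF bl] by (simp add: multilinear)
 have "b (f x) (sweedler3 W C (%x y z. t (g x) (h y) (k z)) y)
   = sweedler Z C (%y r. b (f x) (sweedler W C (%z u. t (g y) (h z) (k u)) r)) y"
  unfolding sweedler3_def
  by (rule sweedler_map[OF W Z sweedler_param_bilinear[OF W C.module_axioms t'] bl xy(2)])
 also have "... = sweedler3 Z C (%y' z u. b (f x) (t (g y') (h z) (k u))) y"
  unfolding sweedler3_def
 proof (rule sweedler_cong[OF Z xy(2)])
  fix y r assume yr: "y \<in> U C" "r \<in> U C"
  have "bilinear K C C W (%z u. t (g y) (h z) (k u))" using t' yr by (simp add: trilinear_def)
  from sweedler_map[OF W Z this bl yr(2)]
  show "b (f x) (sweedler W C (%z u. t (g y) (h z) (k u)) r) = sweedler Z C (%z u. b (f x) (t (g y) (h z) (k u))) r" .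
  show "sweedler Z C (%z u. b (f x) (t (g y) (h z) (k u))) r \<in> U Z"
   using bilinearD(1)[OF sweedler_param_bilinear[OF Z C.module_axioms t2] yr] .
 qed
 finally show "b (f x) (convolve3 W C t g h k y) = sweedler3 Z C (%y' z u. b (f x) (t (g y') (h z) (k u))) y"
  using xy by (simp add: convolve3_def)
 show "sweedler3 Z C (%y' z u. b (f x) (t (g y') (h z) (k u))) y \<in> U Z"
  by (rule klinearD(1)[OF sweedler3_linear[OF Z t2] xy(2)])
qed

end

locale cocommutative_partial_action =
 cocommutative_hopf_algebra K H + symmetric_partial_action K H A act
 for K :: "('k, 'x) ring_scheme" (structure) and H :: "('k, 'h, 'y) hopf_scheme" (structure)
  and A :: "('k, 'a, 'z) module_scheme" (structure) and act :: "'h => 'a => 'a"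
begin

interpretation HC: cocommutative_coalgebra K H by (rule cocommutative_coalgebra)

abbreviation (input) "AH == ktensor K A H"
abbreviation (input) "am == monoid.mult (smash_ambient K H A act)"
abbreviation (input) "p == kpure K A H"
abbreviation (input) "se == smash_elem K H A act"

lemmas A_module = A.module_axioms
lemmas AH_module = ktensor_module[OF A_module module_axioms]
lemmas p_bilinear = kpure_bilinear[OF A_module module_axioms]

lemma act_bilinear: "bilinear K H A A act"
 by (simp add: multilinear act_closed act_add_left act_smult_left act_add_right act_smult_right)

text \<open>The product \<open>(a \<otimes> h) (b \<otimes> k)\<close> is a composite of left multiplication by \<open>a\<close>, right multiplication by \<open>k\<close> and the twist \<open>h \<otimes> b \<mapsto> \<Sum> (h\<^sub>1 \<cdot> b) \<otimes> h\<^sub>2\<close>,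
  so that its multilinearity and its value at points can be computed for each factor.\<close>
definition left_A :: "'a => ('a, 'h) tensor => ('a, 'h) tensor"
 where "left_A a = tensor_lift AH (%b k. p (a *\<^sub>A b) k)"

definition right_H :: "('a, 'h) tensor => 'h => ('a, 'h) tensor"
 where "right_H u k = tensor_lift AH (%b h. p b (h *\<^sub>H k)) u"

definition twist :: "'h => 'a => ('a, 'h) tensor"
 where "twist h b = sweedler AH H (%x y. p (act x b) y) h"

lemma left_A_tri: "trilinear K A A H AH (%a b k. p (a *\<^sub>A b) k)"
 using p_bilinear A.mult_bilinear by (simp add: multilinear)

lemma right_H_tri: "trilinear K H A H AH (%k b h. p b (h *\<^sub>H k))"
 using p_bilinear mult_bilinear by (simp add: multilinear)

lemma left_A_bilinear: "bilinear K A AH AH left_A"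
 unfolding bilinear_def left_A_def
 using tensor_lift_param[OF A_module module_axioms AH_module A_module left_A_tri]
  tensor_lift_linear[OF A_module module_axioms AH_module] left_A_tri by (simp add: trilinear_def)

lemma left_A_pure: "[|a \<in> U A; b \<in> U A; k \<in> U H|] ==> left_A a (p b k) = p (a *\<^sub>A b) k"
 unfolding left_A_def using left_A_tri
 by (intro tensor_lift_kpure[OF A_module module_axioms AH_module]) (simp add: trilinear_def)

lemma right_H_bilinear: "bilinear K AH H AH right_H"
 unfolding bilinear_def right_H_def
 using tensor_lift_param[OF A_module module_axioms AH_module module_axioms right_H_tri]
  tensor_lift_linear[OF A_module module_axioms AH_module] right_H_tri by (simp add: trilinear_def)

lemma right_H_pure: "[|b \<in> U A; h \<in> U H; k \<in> U H|] ==> right_H (p b h) k = p b (h *\<^sub>H k)"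
 unfolding right_H_def using right_H_tri
 by (intro tensor_lift_kpure[OF A_module module_axioms AH_module]) (simp add: trilinear_def)

lemma twist_tri: "trilinear K H H A AH (%x y b. p (act x b) y)"
 using p_bilinear act_bilinear by (simp add: multilinear)

lemma twist_bilinear: "bilinear K H A AH twist"
proof -
 have "trilinear K A H H AH (%b x y. p (act x b) y)" using twist_tri by (simp add: multilinear)
 from HC.sweedler_param_bilinear[OF AH_module A_module this]
 show ?thesis unfolding twist_def by (auto simp: bilinear_def)
qed

lemma twisted_product:
 "[|a \<in> U A; h \<in> U H; b \<in> U A; k \<in> U H|] ==>
  sweedler AH H (%x y. p (a *\<^sub>A act x b) (y *\<^sub>H k)) h = left_A a (right_H (twist h b) k)"
proof -
 assume a: "a \<in> U A" and h: "h \<in> U H" and b: "b \<in> U A" and k: "k \<in> U H"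
 have l: "klinear K AH AH (%u. left_A a (right_H u k))"
  using a k left_A_bilinear right_H_bilinear by (simp add: multilinear)
 have tb: "bilinear K H H AH (%x y. p (act x b) y)" using twist_tri b by (simp add: multilinear)
 have "left_A a (right_H (twist h b) k) = sweedler AH H (%x y. left_A a (right_H (p (act x b) y) k)) h"
  unfolding twist_def by (rule HC.sweedler_map[OF AH_module AH_module tb l h])
 also have "... = sweedler AH H (%x y. p (a *\<^sub>A act x b) (y *\<^sub>H k)) h"
  by (rule HC.sweedler_cong[OF AH_module h])
   (use a b k bilinearD(1)[OF p_bilinear] in \<open>auto simp: right_H_pure left_A_pure act_closed\<close>)
 finally show ?thesis ..
qed

lemma product_quadrilinear: "quadrilinear K A H A H AH (%a h b k. left_A a (right_H (twist h b) k))"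
 using left_A_bilinear right_H_bilinear twist_bilinear by (simp add: multilinear)

lemma am_eq:
 assumes u: "u \<in> U AH" and v: "v \<in> U AH"
 shows "am u v = tensor_lift AH (%a h. tensor_lift AH (%b k. left_A a (right_H (twist h b) k)) v) u"
proof -
 have q: "bilinear K A H AH (%b k. left_A a (right_H (twist h b) k))" if "a \<in> U A" "h \<in> U H" for a h
  using product_quadrilinear that by (simp add: multilinear)
 have "am u v = tensor_lift AH (%a h. tensor_lift AH (%b k. sweedler AH H (%x y. p (a *\<^sub>A act x b) (y *\<^sub>H k)) h) v) u"
  by (simp add: smash_ambient_def)
 also have "... = tensor_lift AH (%a h. tensor_lift AH (%b k. left_A a (right_H (twist h b) k)) v) u"
  by (rule tensor_lift_cong[OF A_module module_axioms AH_module u], rule tensor_lift_cong[OF A_module module_axioms AH_module v])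
   (use klinearD(1)[OF tensor_lift_linear[OF A_module module_axioms AH_module q] v] bilinearD(1)[OF q]
    in \<open>auto simp: twisted_product\<close>)
 finally show ?thesis .
qed

lemma am_bilinear: "bilinear K AH AH AH am"
proof -
 let ?q = "%a h b k. left_A a (right_H (twist h b) k)"
 note lin = left_A_bilinear right_H_bilinear twist_bilinear
 note L = tensor_lift_linear[OF A_module module_axioms AH_module]
  and Pm = tensor_lift_param[OF A_module module_axioms AH_module]
 have q: "bilinear K A H AH (?q a h)" if "a \<in> U A" "h \<in> U H" for a h
  using product_quadrilinear that by (simp add: multilinear)
 have q1: "trilinear K A A H AH (%a. ?q a h)" if "h \<in> U H" for h
  using product_quadrilinear that by (simp add: multilinear)
 have q2: "trilinear K H A H AH (?q a)" if "a \<in> U A" for a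
  using product_quadrilinear that by (simp add: quadrilinear_def)
 have t: "trilinear K AH A H AH (%v a h. tensor_lift AH (?q a h) v)"
  unfolding trilinear_def bilinear_def
  using L[OF q] Pm[OF A_module q1] Pm[OF module_axioms q2] by simp
 then have tv: "bilinear K A H AH (%a h. tensor_lift AH (?q a h) v)" if "v \<in> U AH" for v
  using that by (simp add: trilinear_def)
 have "bilinear K AH AH AH (%u v. tensor_lift AH (%a h. tensor_lift AH (?q a h) v) u)"
  unfolding bilinear_def using L[OF tv] Pm[OF AH_module t] by simp
 then show ?thesis
  by (simp add: multilinear am_eq AH_module[THEN module.smult_closed] abelian_groupE(1)[OF module.axioms(2)[OF AH_module]])
qed

lemma am_pure:
 assumes "a \<in> U A" "h \<in> U H" "b \<in> U A" "k \<in> U H"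
 shows "am (p a h) (p b k) = left_A a (right_H (twist h b) k)"
proof -
 let ?q = "%a h b k. left_A a (right_H (twist h b) k)"
 have q: "bilinear K A H AH (?q a h)" if "a \<in> U A" "h \<in> U H" for a h
  using product_quadrilinear that by (simp add: multilinear)
 have b: "bilinear K A H AH (%a h. ?q a h b k)"
  using product_quadrilinear assms by (simp add: multilinear)
 note pc = bilinearD(1)[OF p_bilinear]
 have "am (p a h) (p b k) = tensor_lift AH (%a h. tensor_lift AH (?q a h) (p b k)) (p a h)"
  using assms by (intro am_eq pc)
 also have "... = tensor_lift AH (%a h. ?q a h b k) (p a h)"
  by (rule tensor_lift_cong[OF A_module module_axioms AH_module pc[OF assms(1,2)]])
   (use assms bilinearD(1)[OF b] in \<open>auto simp: tensor_lift_kpure[OF A_module module_axioms AH_module q]\<close>)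
 also have "... = ?q a h b k"
  by (rule tensor_lift_kpure[OF A_module module_axioms AH_module b assms(1,2)])
 finally show ?thesis .
qed

lemma se_tri: "trilinear K A H H AH (%a x y. p (a *\<^sub>A act x 1\<^sub>A) y)"
 using p_bilinear act_bilinear A.mult_bilinear by (simp add: multilinear)

lemma se_bilinear: "bilinear K A H AH se"
 unfolding smash_elem_def[abs_def]
 using HC.sweedler_param_bilinear[OF AH_module A_module se_tri] by simp

lemma act_one_linear: "a \<in> U A ==> klinear K H A (%h. act h a)"
 using act_bilinear by (simp add: bilinear_def)

end

locale partial_action_points = cocommutative_partial_action K H A act + C: cocommutative_coalgebra K C
 for K :: "('k, 'x) ring_scheme" (structure) and H :: "('k, 'h, 'y) hopf_scheme" (structure)
  and A :: "('k, 'a, 'z) module_scheme" (structure) and act :: "'h => 'a => 'a"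
  and C :: "('k, 'c, 'u) hopf_scheme"

sublocale partial_action_points \<subseteq> pts: hopf_points K H C
 by (intro hopf_points.intro cocommutative_hopf_algebra_axioms C.cocommutative_coalgebra_axioms)

context partial_action_points
begin

interpretation HC: cocommutative_coalgebra K H by (rule cocommutative_coalgebra)
interpretation AC: monoid "conv K C A" by (rule C.conv_monoid[OF A.k_algebra_axioms])
interpretation PG: group pts.point_group by (rule pts.group_points)

abbreviation (input) "Hom == module_hom K C"
abbreviation (input) "act_on g w == convolve A C act g w"
abbreviation (input) "d a g == cmp C (%h. act h a) g"
abbreviation (input) "am' u v == u \<otimes>\<^bsub>conv K C A\<^esub> v"
abbreviation (input) "gm x y == x \<otimes>\<^bsub>pts.point_group\<^esub> y"
abbreviation (input) "gi x == inv\<^bsub>pts.point_group\<^esub> x"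
abbreviation (input) "tens u g == convolve AH C p u g"

lemma d_hom: "[|a \<in> U A; g \<in> pts.points|] ==> d a g \<in> Hom A"
 by (rule pts.br_hom[OF act_one_linear])

lemma act_on_hom: "[|g \<in> pts.points; w \<in> Hom A|] ==> act_on g w \<in> Hom A"
 by (rule C.convolve_hom[OF A_module act_bilinear pts.points_hom])

lemma act_on_one: "w \<in> Hom A ==> act_on \<one>\<^bsub>pts.point_group\<^esub> w = w"
 unfolding pts.point_group_simps C.one_conv C.convolve_const_left[OF A_module module_axioms act_bilinear one_closed]
 by (rule extensionalityI[of _ "U C"]) (auto simp: compose_eq act_one module_homD(2,5))

lemma d_one: "a \<in> U A ==> d a \<one>\<^bsub>pts.point_group\<^esub> = C.const_hom A a"
 unfolding pts.point_group_simps C.one_conv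
 using C.compose_const_hom[OF act_one_linear one_closed] by (simp add: act_one)

lemma d_eq: "[|a \<in> U A; g \<in> pts.points|] ==> d a g = act_on g (C.const_hom A a)"
 by (rule C.convolve_const_right[OF A_module A_module act_bilinear _ pts.points_hom, symmetric])

text \<open>The first axiom of a partial action: a point acts by multiplicative maps on the convolution algebra of \<open>A\<close>.\<close>
lemma act_on_mult:
 assumes g: "g \<in> pts.points" and u: "u \<in> Hom A" and v: "v \<in> Hom A"
 shows "act_on g (am' u v) = am' (act_on g u) (act_on g v)"
proof -
 note M = A_module and m = A.mult_bilinear and g' = pts.points_hom[OF g]
 have q: "quadrilinear K H H A A A (%x y a b. act x a *\<^sub>A act y b)"
  using act_bilinear m by (simp add: multilinear)
 have q': "quadrilinear K H A H A A (%x a y b. act x a *\<^sub>A act y b)"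
  using act_bilinear m by (simp add: multilinear)
 have t: "trilinear K H A A A (%h a b. act h (a *\<^sub>A b))"
  using act_bilinear m by (simp add: multilinear)
 have "act_on g (am' u v) = convolve3 A C (%h a b. act h (a *\<^sub>A b)) g u v"
  unfolding conv_simps by (rule C.convolve_nest_right[OF M M act_bilinear m g' u v])
 also have "... = convolve3 A C (%h a b. sweedler A H (%x y. act x a *\<^sub>A act y b) h) g u v"
  by (rule C.convolve3_cong[OF M t g' u v, symmetric]) (simp add: act_mult)
 also have "... = convolve4 A C (%x y a b. act x a *\<^sub>A act y b) g g u v"
  by (rule pts.convolve3_point_left[OF M M M q g u v])
 also have "... = convolve4 A C (%x a y b. act x a *\<^sub>A act y b) g u g v"
  by (rule C.convolve4_swap23[OF M q g' g' u v, symmetric])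
 also have "... = am' (act_on g u) (act_on g v)"
  unfolding conv_simps by (rule C.convolve_nest_both[OF M M M m act_bilinear act_bilinear g' u g' v, symmetric])
 finally show ?thesis .
qed

lemma act_on_unit:
 assumes g: "g \<in> pts.points" and w: "w \<in> Hom A"
 shows "am' (d 1\<^sub>A g) (act_on g w) = act_on g w" and "am' (act_on g w) (d 1\<^sub>A g) = act_on g w"
proof -
 have o: "C.const_hom A 1\<^sub>A \<in> Hom A" by (rule C.const_hom_hom[OF A_module A.one_closed])
 have "am' (C.const_hom A 1\<^sub>A) w = w" "am' w (C.const_hom A 1\<^sub>A) = w"
  using AC.l_one[of w] AC.r_one[of w] w by (simp_all add: C.one_conv)
 then show "am' (d 1\<^sub>A g) (act_on g w) = act_on g w" and "am' (act_on g w) (d 1\<^sub>A g) = act_on g w"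
  using act_on_mult[OF g o w] act_on_mult[OF g w o] d_eq[OF A.one_closed g] by simp_all
qed

text \<open>The two forms of the composition axiom of a symmetric partial action, \<open>g \<cdot> (k \<cdot> a) = (g \<cdot> 1) (g k \<cdot> a)\<close> and \<open>g \<cdot> (k \<cdot> a) = (g k \<cdot> a) (g \<cdot> 1)\<close>.\<close>
lemma act_on_d:
 assumes g: "g \<in> pts.points" and k: "k \<in> pts.points" and a: "a \<in> U A"
 shows "act_on g (d a k) = am' (d 1\<^sub>A g) (d a (gm g k))" and "act_on g (d a k) = am' (d a (gm g k)) (d 1\<^sub>A g)"
proof -
 note M = A_module and m = A.mult_bilinear and g' = pts.points_hom[OF g] and k' = pts.points_hom[OF k]
 have l1: "klinear K H A (%h. act h 1\<^sub>A)" by (rule act_one_linear) simp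
 note la = act_one_linear[OF a]
 have b: "bilinear K H H A (%h k. act h (act k a))" using act_bilinear la by (simp add: multilinear)
 have bm: "bilinear K H H A (%h k. act (h *\<^sub>H k) a)" using mult_bilinear la by (simp add: multilinear)
 have b1: "bilinear K H A A (%x v. act x 1\<^sub>A *\<^sub>A v)" using m l1 by (simp add: multilinear)
 have b2: "bilinear K A H A (%v x. v *\<^sub>A act x 1\<^sub>A)" using m l1 by (simp add: multilinear)
 have t1: "trilinear K H H H A (%x y k. act x 1\<^sub>A *\<^sub>A act (y *\<^sub>H k) a)"
  using m l1 bm by (simp add: multilinear)
 have t2: "trilinear K H H H A (%x y k. act (x *\<^sub>H k) a *\<^sub>A act y 1\<^sub>A)"
  using m l1 bm by (simp add: multilinear)
 have s: "act_on g (d a k) = convolve A C (%h k. act h (act k a)) g k"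
  by (rule C.convolve_compose_right[OF M act_bilinear g' k' la])
 have dgk: "d a (gm g k) = convolve A C (%h k. act (h *\<^sub>H k) a) g k"
  using C.compose_convolve[OF module_axioms M mult_bilinear g' k' la] by simp
 note dgkh = C.convolve_hom[OF M bm g' k']
 have "am' (d 1\<^sub>A g) (d a (gm g k)) = convolve A C (%x v. act x 1\<^sub>A *\<^sub>A v) g (convolve A C (%h k. act (h *\<^sub>H k) a) g k)"
  unfolding dgk using C.convolve_compose_left[OF M m g' dgkh l1] by simp
 also have "... = convolve3 A C (%x y k. act x 1\<^sub>A *\<^sub>A act (y *\<^sub>H k) a) g g k"
  by (rule C.convolve_nest_right[OF M M b1 bm g' g' k'])
 also have "... = convolve A C (%h k. sweedler A H (%x y. act x 1\<^sub>A *\<^sub>A act (y *\<^sub>H k) a) h) g k"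
  by (rule pts.convolve_point_left[OF M module_axioms t1 g k', symmetric])
 also have "... = act_on g (d a k)"
  unfolding s by (rule C.convolve_cong[OF M b g' k', symmetric]) (use act_act a in simp)
 finally show "act_on g (d a k) = am' (d 1\<^sub>A g) (d a (gm g k))" ..
 have "am' (d a (gm g k)) (d 1\<^sub>A g) = convolve A C (%v x. v *\<^sub>A act x 1\<^sub>A) (convolve A C (%h k. act (h *\<^sub>H k) a) g k) g"
  unfolding dgk using C.convolve_compose_right[OF M m dgkh g' l1] by simp
 also have "... = convolve3 A C (%x k y. act (x *\<^sub>H k) a *\<^sub>A act y 1\<^sub>A) g k g"
  by (rule C.convolve_nest_left[OF M M b2 bm g' k' g'])
 also have "... = convolve3 A C (%x y k. act (x *\<^sub>H k) a *\<^sub>A act y 1\<^sub>A) g g k"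
  by (rule C.convolve3_swap23[OF M t2 g' g' k'])
 also have "... = convolve A C (%h k. sweedler A H (%x y. act (x *\<^sub>H k) a *\<^sub>A act y 1\<^sub>A) h) g k"
  by (rule pts.convolve_point_left[OF M module_axioms t2 g k', symmetric])
 also have "... = act_on g (d a k)"
  unfolding s by (rule C.convolve_cong[OF M b g' k', symmetric]) (use act_act_symmetric a in simp)
 finally show "act_on g (d a k) = am' (d a (gm g k)) (d 1\<^sub>A g)" ..
qed

text \<open>For points the product of \<open>A \<otimes> H\<close> has the form known from skew group rings, \<open>(u \<otimes> g) (v \<otimes> k) = u (g \<cdot> v) \<otimes> g k\<close>. One copy of \<open>g\<close> acts, the other multiplies \<open>k\<close>.\<close>
lemma tens_mult:
 assumes u: "u \<in> Hom A" and g: "g \<in> pts.points" and v: "v \<in> Hom A" and k: "k \<in> pts.points"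
 shows "convolve AH C am (tens u g) (tens v k) = tens (am' u (act_on g v)) (gm g k)"
proof -
 note M = AH_module and g' = pts.points_hom[OF g] and k' = pts.points_hom[OF k]
 have rt: "trilinear K H A H AH (%h b k. right_H (twist h b) k)"
  using right_H_bilinear twist_bilinear by (simp add: multilinear)
 have gv: "act_on g v \<in> Hom A" by (rule act_on_hom[OF g v])
 have gk: "gm g k \<in> Hom H" using C.convolve_hom[OF module_axioms mult_bilinear g' k'] by simp
 have tw3: "trilinear K H A H AH (%x b y. p (act x b) y)" using twist_tri by (simp add: multilinear)
 have tau: "convolve AH C twist g v = tens (act_on g v) g"
 proof -
  have "convolve AH C twist g v = convolve3 AH C (%x y b. p (act x b) y) g g v"
   unfolding twist_def by (rule pts.convolve_point_left[OF M A_module twist_tri g v])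
  also have "... = convolve3 AH C (%x b y. p (act x b) y) g v g"
   by (rule C.convolve3_swap23[OF M tw3 g' v g'])
  also have "... = tens (act_on g v) g"
   by (rule C.convolve_nest_left[OF M A_module p_bilinear act_bilinear g' v g', symmetric])
  finally show ?thesis .
 qed
 have right: "convolve AH C right_H (tens w g) k = tens w (gm g k)" if w: "w \<in> Hom A" for w
 proof -
  have t: "trilinear K A H H AH (%x y z. right_H (p x y) z)" using right_H_bilinear p_bilinear by (simp add: multilinear)
  have "convolve AH C right_H (tens w g) k = convolve3 AH C (%x y z. right_H (p x y) z) w g k"
   by (rule C.convolve_nest_left[OF M M right_H_bilinear p_bilinear w g' k'])
  also have "... = convolve3 AH C (%x y z. p x (y *\<^sub>H z)) w g k"
   by (rule C.convolve3_cong[OF M t w g' k', symmetric]) (simp add: right_H_pure)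
  also have "... = tens w (gm g k)"
   using C.convolve_nest_right[OF M module_axioms p_bilinear mult_bilinear w g' k'] by simp
  finally show ?thesis .
 qed
 have left: "convolve AH C left_A u (tens w m) = tens (am' u w) m" if w: "w \<in> Hom A" and m: "m \<in> Hom H" for w m
 proof -
  have t: "trilinear K A A H AH (%x y z. left_A x (p y z))" using left_A_bilinear p_bilinear by (simp add: multilinear)
  have "convolve AH C left_A u (tens w m) = convolve3 AH C (%x y z. left_A x (p y z)) u w m"
   by (rule C.convolve_nest_right[OF M M left_A_bilinear p_bilinear u w m])
  also have "... = convolve3 AH C (%x y z. p (x *\<^sub>A y) z) u w m"
   by (rule C.convolve3_cong[OF M t u w m, symmetric]) (simp add: left_A_pure)
  also have "... = tens (am' u w) m"
   using C.convolve_nest_left[OF M A_module p_bilinear A.mult_bilinear u w m] by simp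
  finally show ?thesis .
 qed
 have "convolve AH C am (tens u g) (tens v k) = convolve4 AH C (%a h b k. am (p a h) (p b k)) u g v k"
  by (rule C.convolve_nest_both[OF M M M am_bilinear p_bilinear p_bilinear u g' v k'])
 also have "... = convolve4 AH C (%a h b k. left_A a (right_H (twist h b) k)) u g v k"
  unfolding convolve4_def
 proof (intro restrict_ext C.sweedler_cong[OF M])
  fix x y assume xy: "x \<in> U C" "y \<in> U C"
  have "trilinear K H A H AH (%h b k. left_A (u x) (right_H (twist h b) k))"
   using product_quadrilinear module_homD(2)[OF u xy(1)] by (simp add: quadrilinear_def)
  note t = trilinear_comp[OF this module_hom_linear[OF g'] module_hom_linear[OF v] module_hom_linear[OF k']]
  show "sweedler3 AH C (%y' z ua. am (p (u x) (g y')) (p (v z) (k ua))) y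
   = sweedler3 AH C (%y' z ua. left_A (u x) (right_H (twist (g y') (v z)) (k ua))) y"
   by (rule C.sweedler3_cong[OF M xy(2) _ t])
    (simp add: am_pure module_homD(2)[OF u xy(1)] module_homD(2)[OF g'] module_homD(2)[OF v] module_homD(2)[OF k'])
  show "sweedler3 AH C (%y' z ua. left_A (u x) (right_H (twist (g y') (v z)) (k ua))) y \<in> U AH"
   by (rule klinearD(1)[OF C.sweedler3_linear[OF M t] xy(2)])
 qed
 also have "... = convolve AH C left_A u (convolve3 AH C (%h b k. right_H (twist h b) k) g v k)"
  by (rule C.convolve_nest_convolve3[OF M M left_A_bilinear rt u g' v k', symmetric])
 also have "convolve3 AH C (%h b k. right_H (twist h b) k) g v k = convolve AH C right_H (convolve AH C twist g v) k"
  by (rule C.convolve_nest_left[OF M M right_H_bilinear twist_bilinear g' v k', symmetric])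
 also have "... = tens (act_on g v) (gm g k)" by (simp only: tau right[OF gv])
 also have "convolve AH C left_A u ... = tens (am' u (act_on g v)) (gm g k)" by (rule left[OF gv gk])
 finally show ?thesis .
qed

definition sm :: "('c => 'a) => ('c => 'h) => 'c => ('a, 'h) tensor"
 where "sm u g = convolve AH C se u g"

lemma sm_tens:
 assumes u: "u \<in> Hom A" and g: "g \<in> pts.points"
 shows "sm u g = tens (am' u (d 1\<^sub>A g)) g"
proof -
 note M = AH_module and g' = pts.points_hom[OF g]
 have l1: "klinear K H A (%h. act h 1\<^sub>A)" by (rule act_one_linear) simp
 have b: "bilinear K A H A (%a x. a *\<^sub>A act x 1\<^sub>A)" using A.mult_bilinear l1 by (simp add: multilinear)
 have "sm u g = convolve3 AH C (%a x y. p (a *\<^sub>A act x 1\<^sub>A) y) u g g"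
  unfolding sm_def smash_elem_def[abs_def] by (rule pts.convolve_point_right[OF M A_module se_tri g u])
 also have "... = convolve AH C p (convolve A C (%a x. a *\<^sub>A act x 1\<^sub>A) u g) g"
  by (rule C.convolve_nest_left[OF M A_module p_bilinear b u g' g', symmetric])
 also have "convolve A C (%a x. a *\<^sub>A act x 1\<^sub>A) u g = am' u (d 1\<^sub>A g)"
  using C.convolve_compose_right[OF A_module A.mult_bilinear u g' l1] by simp
 finally show ?thesis .
qed

end

context cocommutative_coalgebra
begin

lemma sweedler_submodule:
 assumes "module K W" "module K Z" "klinear K W Z (%x. x)" "bilinear K C C W b" "c \<in> U C"
 shows "sweedler W C b c = sweedler Z C b c"
 using sweedler_map[OF assms(1,2,4,3,5)] .

lemma convolve_submodule:
 assumes "module K W" "module K Z" "klinear K W Z (%x. x)" "bilinear K X Y W b" "f \<in> Hom X" "g \<in> Hom Y"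
 shows "convolve W C b f g = convolve Z C b f g"
 unfolding convolve_def
 by (rule restrict_ext) (rule sweedler_submodule[OF assms(1-3)
  bilinear_comp[OF assms(4) module_hom_linear[OF assms(5)] module_hom_linear[OF assms(6)]]])

end

context cocommutative_partial_action
begin

interpretation HC: cocommutative_coalgebra K H by (rule cocommutative_coalgebra)

abbreviation (input) "SP == smash K H A act"

lemma unit_pure: "p 1\<^sub>A 1\<^sub>H \<in> U AH"
 by (rule bilinearD(1)[OF p_bilinear]) auto

lemma smash_simps:
 "U SP = {am u (p 1\<^sub>A 1\<^sub>H) | u. u \<in> U AH}" "monoid.mult SP = am" "1\<^sub>SP = p 1\<^sub>A 1\<^sub>H"
 "add SP = add AH" "zero SP = zero AH" "smult SP = smult AH"
 by (simp_all add: smash_def Let_def) (simp_all add: smash_ambient_def)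

lemma se_eq: "[|a \<in> U A; h \<in> U H|] ==> se a h = am (p a h) (p 1\<^sub>A 1\<^sub>H)"
proof -
 assume ah: "a \<in> U A" "h \<in> U H"
 have "se a h = sweedler AH H (%x y. p (a *\<^sub>A act x 1\<^sub>A) (y *\<^sub>H 1\<^sub>H)) h"
  unfolding smash_elem_def
  by (rule HC.sweedler_cong[OF AH_module ah(2)])
   (use ah bilinearD(1)[OF p_bilinear] in \<open>auto simp: act_closed\<close>)
 also have "... = am (p a h) (p 1\<^sub>A 1\<^sub>H)"
  using ah by (simp add: am_pure twisted_product)
 finally show ?thesis .
qed

lemma smash_subset: "u \<in> U SP ==> u \<in> U AH"
 unfolding smash_simps using bilinearD(1)[OF am_bilinear _ unit_pure] by auto

lemma smash_module: "module K SP"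
proof (rule module_of_subset[OF AH_module smash_simps(4,5,6) smash_subset])
 interpret AH: module K AH by (rule AH_module)
 note r = bilinearD(2)[OF am_bilinear _ _ unit_pure, symmetric] bilinearD(4)[OF am_bilinear _ _ unit_pure, symmetric]
 show smult: "k *.\<^sub>AH x \<in> U SP" if "k \<in> U K" "x \<in> U SP" for k x
  using that r(2) AH.smult_closed unfolding smash_simps by blast
 show "x +\<^sub>AH y \<in> U SP" if "x \<in> U SP" "y \<in> U SP" for x y
  using that r(1) AH.a_closed unfolding smash_simps by blast
 show "0\<^sub>AH \<in> U SP"
  using smult[of "0\<^sub>K" "am (p 1\<^sub>A 1\<^sub>H) (p 1\<^sub>A 1\<^sub>H)"] unit_pure bilinearD(1)[OF am_bilinear unit_pure unit_pure]
  unfolding smash_simps by auto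
qed

lemma smash_incl: "klinear K SP AH (%x. x)"
 by (simp add: klinear_def smash_subset smash_simps(4,5,6))

lemma se_in_smash: "[|a \<in> U A; h \<in> U H|] ==> se a h \<in> U SP"
 unfolding smash_simps using se_eq bilinearD(1)[OF p_bilinear] by blast

lemma se_bilinear_smash: "bilinear K A H SP se"
 using se_bilinear by (simp add: multilinear se_in_smash smash_simps(4,5,6))

lemma smash_induct [consumes 1, case_names elem add]:
 assumes u: "u \<in> U SP"
  and elem: "!!a h. [|a \<in> U A; h \<in> U H|] ==> P (se a h)"
  and add: "!!u v. [|u \<in> U SP; v \<in> U SP; P u; P v|] ==> P (u +\<^sub>SP v)"
 shows "P u"
proof -
 obtain v where v: "v \<in> U AH" "u = am v (p 1\<^sub>A 1\<^sub>H)" using u unfolding smash_simps by blast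
 have "P (am v (p 1\<^sub>A 1\<^sub>H))" using v(1)
 proof (induction v rule: ktensor_induct[OF A_module module_axioms, consumes 1, case_names pure add])
  case (pure a h)
  then show ?case using elem[of a h] by (simp add: se_eq)
 next
  case (add s t)
  have "am s (p 1\<^sub>A 1\<^sub>H) \<in> U SP" "am t (p 1\<^sub>A 1\<^sub>H) \<in> U SP"
   using add.hyps unfolding smash_simps by blast+
  then show ?case
   using assms(3)[OF _ _ add.IH] bilinearD(2)[OF am_bilinear add.hyps unit_pure] by (simp add: smash_simps(4))
 qed
 then show ?thesis by (simp add: v)
qed

lemma se_one_right: "a \<in> U A ==> se a 1\<^sub>H = p a 1\<^sub>H"
 unfolding smash_elem_def using se_tri
 by (subst sweedler_one[OF AH_module]) (auto simp: act_one multilinear)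

lemma smash_one_closed: "1\<^sub>SP \<in> U SP" and se_one: "se 1\<^sub>A 1\<^sub>H = 1\<^sub>SP"
 using se_one_right[of "1\<^sub>A"] se_in_smash[of "1\<^sub>A" "1\<^sub>H"] by (simp_all add: smash_simps(3))

lemma am_one_left:
 assumes "u \<in> U AH" shows "am (p 1\<^sub>A 1\<^sub>H) u = u"
proof (rule ktensor_linear_eq[OF A_module module_axioms, where f = "am (p 1\<^sub>A 1\<^sub>H)" and g = "%u. u" and t = u and Z = AH])
 show "am (p 1\<^sub>A 1\<^sub>H) (p b k) = p b k" if bk: "b \<in> U A" "k \<in> U H" for b k
 proof -
  have "twist 1\<^sub>H b = p b 1\<^sub>H"
   unfolding twist_def using twist_tri bk
   by (subst sweedler_one[OF AH_module]) (auto simp: act_one multilinear)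
  then show ?thesis using bk by (simp add: am_pure right_H_pure left_A_pure)
 qed
qed (use am_bilinear unit_pure assms in \<open>auto simp: bilinear_def klinear_def\<close>)

end

context partial_action_points
begin

interpretation HC: cocommutative_coalgebra K H by (rule cocommutative_coalgebra)
interpretation AC: monoid "conv K C A" by (rule C.conv_monoid[OF A.k_algebra_axioms])
interpretation PG: group pts.point_group by (rule pts.group_points)

abbreviation (input) "oneA == \<one>\<^bsub>conv K C A\<^esub>"
abbreviation (input) "oneG == \<one>\<^bsub>pts.point_group\<^esub>"

lemma oneA_hom: "oneA \<in> Hom A" using AC.one_closed by simp

lemma d_one_idem: "g \<in> pts.points ==> am' (d 1\<^sub>A g) (d 1\<^sub>A g) = d 1\<^sub>A g"
 using act_on_unit(1)[of g "C.const_hom A 1\<^sub>A"] d_eq[of "1\<^sub>A" g] C.const_hom_hom[OF A_module A.one_closed]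
 by simp

lemma sm_hom_smash:
 assumes "u \<in> Hom A" "g \<in> pts.points"
 shows "sm u g \<in> Hom SP"
 unfolding sm_def C.convolve_submodule[OF smash_module AH_module smash_incl se_bilinear_smash assms(1) pts.points_hom[OF assms(2)], symmetric]
 by (rule C.convolve_hom[OF smash_module se_bilinear_smash assms(1) pts.points_hom[OF assms(2)]])

text \<open>The elements \<open>u # g = u (g \<cdot> 1) \<otimes> g\<close> multiply by \<open>(u # g) (v # k) = u (g \<cdot> v) # g k\<close>: the idempotents \<open>g \<cdot> 1\<close> are absorbed by \<open>g \<cdot> v\<close>, and \<open>g \<cdot> (k \<cdot> 1)\<close> produces \<open>g k \<cdot> 1\<close>.\<close>
lemma sm_mult:
 assumes u: "u \<in> Hom A" and g: "g \<in> pts.points" and v: "v \<in> Hom A" and k: "k \<in> pts.points"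
 shows "convolve AH C am (sm u g) (sm v k) = sm (am' u (act_on g v)) (gm g k)"
proof -
 note dc = d_hom[OF A.one_closed]
 have gk: "gm g k \<in> pts.points" using g k PG.m_closed by simp
 note cl = dc[OF g] dc[OF k] dc[OF gk] act_on_hom[OF g v] act_on_hom[OF g dc[OF k]] u v
 note cl' = cl[folded conv_simps(1)[of K C A]]
 have cu: "am' u (d 1\<^sub>A g) \<in> Hom A" "am' v (d 1\<^sub>A k) \<in> Hom A" "am' u (act_on g v) \<in> Hom A"
  using AC.m_closed[OF cl'(6,1)] AC.m_closed[OF cl'(7,2)] AC.m_closed[OF cl'(6,4)] by simp_all
 have e: "am' (am' u (d 1\<^sub>A g)) (act_on g (am' v (d 1\<^sub>A k))) = am' (am' u (act_on g v)) (d 1\<^sub>A (gm g k))"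
 proof -
  have "am' (am' u (d 1\<^sub>A g)) (act_on g (am' v (d 1\<^sub>A k)))
   = am' u (am' (am' (d 1\<^sub>A g) (act_on g v)) (act_on g (d 1\<^sub>A k)))"
   unfolding act_on_mult[OF g v dc[OF k]] using cl' by (simp add: AC.m_assoc del: conv_simps)
  also have "... = am' u (am' (act_on g v) (am' (d 1\<^sub>A g) (d 1\<^sub>A (gm g k))))"
   by (simp only: act_on_unit(1)[OF g v] act_on_d(1)[OF g k A.one_closed])
  also have "... = am' u (am' (am' (act_on g v) (d 1\<^sub>A g)) (d 1\<^sub>A (gm g k)))"
   using cl' by (simp add: AC.m_assoc del: conv_simps pts.point_group_simps)
  also have "... = am' (am' u (act_on g v)) (d 1\<^sub>A (gm g k))"
   unfolding act_on_unit(2)[OF g v] using cl' by (simp add: AC.m_assoc del: conv_simps pts.point_group_simps)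
  finally show ?thesis .
 qed
 show ?thesis
  unfolding sm_tens[OF u g] sm_tens[OF v k] sm_tens[OF cu(3) gk] tens_mult[OF cu(1) g cu(2) k] e ..
qed

lemma sm_one_right: "w \<in> Hom A ==> sm w oneG = cmp C (%a. se a 1\<^sub>H) w"
 unfolding sm_def pts.point_group_simps C.one_conv
 by (rule C.convolve_const_right[OF AH_module module_axioms se_bilinear one_closed])

lemma sm_const: "[|a \<in> U A; g \<in> pts.points|] ==> sm (C.const_hom A a) g = cmp C (se a) g"
 unfolding sm_def by (rule C.convolve_const_left[OF AH_module A_module se_bilinear _ pts.points_hom])

lemma sm_one: "g \<in> pts.points ==> sm oneA g = cmp C (se 1\<^sub>A) g"
 unfolding C.one_conv by (rule sm_const) auto

end

context cocommutative_partial_action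
begin

interpretation HC: cocommutative_coalgebra K H by (rule cocommutative_coalgebra)
interpretation P1: partial_action_points K H A act H
 by (intro partial_action_points.intro cocommutative_partial_action_axioms cocommutative_coalgebra)
interpretation P2: partial_action_points K H A act HH
 by (intro partial_action_points.intro cocommutative_partial_action_axioms hopf_points.axioms(2)[OF two_variables])

lemma se_mult_closed:
 assumes a: "a \<in> U A" and h: "h \<in> U H" and b: "b \<in> U A" and k: "k \<in> U H"
 shows "am (se a h) (se b k) \<in> U SP"
proof -
 interpret AC: monoid "conv K HH A" by (rule P2.C.conv_monoid[OF A.k_algebra_axioms])
 interpret PG: group P2.pts.point_group by (rule P2.pts.group_points)
 note pp = proj_points
 have l: "klinear K H AH (se a)" "klinear K H AH (se b)"
  using se_bilinear a b by (auto simp: bilinear_def)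
 have bl: "bilinear K H H AH (%x y. am (se a x) (se b y))" by (rule bilinear_comp[OF am_bilinear l])
 note c = P2.C.const_hom_hom[OF A_module a] P2.C.const_hom_hom[OF A_module b]
 let ?w = "P2.C.const_hom A a \<otimes>\<^bsub>conv K HH A\<^esub> convolve A HH act proj1 (P2.C.const_hom A b)"
 have w: "?w \<in> module_hom K HH A"
  using AC.m_closed[of "P2.C.const_hom A a"] c P2.act_on_hom[OF pp(1) c(2)] by simp
 have g: "proj1 \<otimes>\<^bsub>P2.pts.point_group\<^esub> proj2 \<in> P2.pts.points" using PG.m_closed pp by simp
 have "am (se a h) (se b k) = convolve AH HH (%x y. am (se a x) (se b y)) proj1 proj2 (kpure K H H h k)"
  by (rule convolve_proj(1)[OF AH_module bl h k, symmetric])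
 also have "convolve AH HH (%x y. am (se a x) (se b y)) proj1 proj2
  = convolve AH HH am (cmp HH (se a) proj1) (cmp HH (se b) proj2)"
  by (rule P2.C.convolve_compose[OF AH_module am_bilinear _ _ l, symmetric]) (use pp P2.pts.points_hom in auto)
 also have "... = P2.sm ?w (proj1 \<otimes>\<^bsub>P2.pts.point_group\<^esub> proj2)"
  unfolding P2.sm_const[OF a pp(1), symmetric] P2.sm_const[OF b pp(2), symmetric]
  by (rule P2.sm_mult[OF c(1) pp(1) c(2) pp(2)])
 also have "... (kpure K H H h k) \<in> U SP"
  by (rule module_homD(2)[OF P2.sm_hom_smash[OF w g]])
   (use bilinearD(1)[OF kpure_bilinear[OF module_axioms module_axioms] h k] in \<open>simp add: tensor_coalgebra_def Let_def\<close>)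
 finally show ?thesis .
qed

lemma smash_mult_closed:
 assumes u: "u \<in> U SP" and v: "v \<in> U SP" shows "am u v \<in> U SP"
proof -
 interpret SP: module K SP by (rule smash_module)
 note d = bilinearD(2,3)[OF am_bilinear, folded smash_simps(4)]
 have 1: "am (se a h) v \<in> U SP" if "a \<in> U A" "h \<in> U H" for a h
  using v by (induction v rule: smash_induct)
   (use that in \<open>simp_all add: d smash_subset se_in_smash se_mult_closed\<close>)
 show ?thesis using u
  by (induction u rule: smash_induct) (use v in \<open>simp_all add: d smash_subset 1\<close>)
qed

lemma smash_mult_bilinear: "bilinear K SP SP SP (monoid.mult SP)"
 using am_bilinear by (simp add: multilinear smash_simps(2,4,5,6) smash_subset smash_mult_closed)

lemma smash_one_right:
 assumes "u \<in> U SP" shows "u *\<^sub>SP 1\<^sub>SP = u"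
 using assms
proof (induction u rule: smash_induct)
 case (elem a h)
 interpret AC: monoid "conv K H A" by (rule HC.conv_monoid[OF A.k_algebra_axioms])
 interpret PG: group P1.pts.point_group by (rule P1.pts.group_points)
 note i = id_point and il = P1.pts.points_hom[OF id_point]
 note c = HC.const_hom_hom[OF A_module elem(1)]
 have l: "klinear K H AH (se a)" using se_bilinear elem(1) by (auto simp: bilinear_def)
 have e1: "P1.sm \<one>\<^bsub>conv K H A\<^esub> \<one>\<^bsub>P1.pts.point_group\<^esub> = HC.const_hom AH 1\<^sub>SP"
  unfolding P1.sm_one_right[OF P1.oneA_hom] unfolding HC.one_conv
  using HC.compose_const_hom[where \<phi> = "%a. se a 1\<^sub>H" and Z = A and Z' = AH, OF _ A.one_closed] se_bilinear se_one
  by (auto simp: bilinear_def)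
 have "convolve AH H am (cmp H (se a) id_point) (HC.const_hom AH 1\<^sub>SP)
  = P1.sm (HC.const_hom A a \<otimes>\<^bsub>conv K H A\<^esub> convolve A H act id_point \<one>\<^bsub>conv K H A\<^esub>) (id_point \<otimes>\<^bsub>P1.pts.point_group\<^esub> \<one>\<^bsub>P1.pts.point_group\<^esub>)"
  unfolding e1[symmetric] P1.sm_const[OF elem(1) i, symmetric]
  using PG.one_closed by (intro P1.sm_mult[OF c i P1.oneA_hom]) simp
 also have "... = P1.sm (HC.const_hom A a \<otimes>\<^bsub>conv K H A\<^esub> cmp H (%h. act h 1\<^sub>A) id_point) id_point"
  using PG.r_one[of id_point] i P1.d_eq[of "1\<^sub>A" id_point] by (simp add: HC.one_conv)
 also have "... = P1.sm (HC.const_hom A a) id_point"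
  using AC.m_closed[of "HC.const_hom A a" "cmp H (%h. act h 1\<^sub>A) id_point"] c P1.d_hom[OF A.one_closed i]
   AC.m_assoc[of "HC.const_hom A a" "cmp H (%h. act h 1\<^sub>A) id_point" "cmp H (%h. act h 1\<^sub>A) id_point"]
   P1.d_one_idem[OF i]
  by (simp add: P1.sm_tens[OF _ i])
 finally have "convolve AH H am (cmp H (se a) id_point) (HC.const_hom AH 1\<^sub>SP) h = cmp H (se a) id_point h"
  by (simp only: P1.sm_const[OF elem(1) i])
 moreover have "convolve AH H am (cmp H (se a) id_point) (HC.const_hom AH 1\<^sub>SP)
   = cmp H (%u. am u 1\<^sub>SP) (cmp H (se a) id_point)"
  by (rule HC.convolve_const_right[OF AH_module AH_module am_bilinear smash_subset[OF smash_one_closed] HC.compose_hom[OF l il]])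
 ultimately show ?case using elem(2) by (simp add: compose_eq id_point_def smash_simps(2))
next
 case (add u v)
 then show ?case using bilinearD(2)[OF smash_mult_bilinear add.hyps smash_one_closed] by simp
qed

lemma smash_one_left: "u \<in> U SP ==> 1\<^sub>SP *\<^sub>SP u = u"
 by (simp add: smash_simps(2,3) am_one_left smash_subset)

end

context partial_action_points
begin

interpretation AC: monoid "conv K C A" by (rule C.conv_monoid[OF A.k_algebra_axioms])
interpretation PG: group pts.point_group by (rule pts.group_points)

context
 fixes E :: "('k, 'e, 'v) module_scheme" and j :: "('a, 'h) tensor => 'e"
 assumes E: "k_algebra K E" and j: "klinear K SP E j"
  and j_mult: "!!u v. [|u \<in> U SP; v \<in> U SP|] ==> j (am u v) = j u *\<^sub>E j v"
begin

lemma smash_hom_points: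
 assumes f: "f \<in> Hom SP" and g: "g \<in> Hom SP"
 shows "cmp C j (convolve AH C am f g) = cmp C j f \<star>\<^sub>E cmp C j g"
proof -
 interpret E: k_algebra K E by (rule E)
 note b = smash_mult_bilinear[unfolded smash_simps(2)]
 have jb: "bilinear K SP SP E (%x y. j (am x y))" by (rule linear_bilinear[OF j b])
 have "cmp C j (convolve AH C am f g) = cmp C j (convolve SP C am f g)"
  by (simp only: C.convolve_submodule[OF smash_module AH_module smash_incl b f g])
 also have "... = convolve E C (%x y. j (am x y)) f g"
  by (rule C.compose_convolve[OF smash_module E.module_axioms b f g j])
 also have "... = convolve E C (%x y. j x *\<^sub>E j y) f g"
  by (rule C.convolve_cong[OF E.module_axioms jb f g j_mult])
 also have "... = cmp C j f \<star>\<^sub>E cmp C j g"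
  unfolding conv_simps by (rule C.convolve_compose[OF E.module_axioms E.mult_bilinear f g j j, symmetric])
 finally show ?thesis .
qed

lemma base_points:
 assumes "w \<in> Hom A"
 shows "cmp C j (sm w oneG) = cmp C (%a. j (se a 1\<^sub>H)) w"
 unfolding sm_one_right[OF assms] by (rule C.compose_compose[OF assms])

lemma hopf_points_image:
 assumes g: "g \<in> pts.points"
 shows "cmp C j (sm oneA g) = cmp C (%h. j (se 1\<^sub>A h)) g"
 unfolding sm_one[OF g] by (rule C.compose_compose[OF pts.points_hom[OF g]])

text \<open>Both sides are the image of \<open>(g k \<cdot> a) # g\<close>: on the left \<open>(1 # g) ((k \<cdot> a) # 1) = (g \<cdot> (k \<cdot> a)) # g\<close>, and \<open>g \<cdot> (k \<cdot> a) = (g k \<cdot> a) (g \<cdot> 1)\<close>.\<close>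
lemma smash_covariant:
 assumes g: "g \<in> pts.points" and k: "k \<in> pts.points" and a: "a \<in> U A"
 shows "cmp C (%h. j (se 1\<^sub>A h)) g \<star>\<^sub>E cmp C (%a. j (se a 1\<^sub>H)) (d a k)
  = cmp C (%a. j (se a 1\<^sub>H)) (d a (gm g k)) \<star>\<^sub>E cmp C (%h. j (se 1\<^sub>A h)) g"
proof -
 have gk: "gm g k \<in> pts.points" using g k PG.m_closed by simp
 have o: "oneG \<in> pts.points" using PG.one_closed by simp
 note dk = d_hom[OF a k] and dgk = d_hom[OF a gk] and d1 = d_hom[OF A.one_closed g]
 have "cmp C (%h. j (se 1\<^sub>A h)) g \<star>\<^sub>E cmp C (%a. j (se a 1\<^sub>H)) (d a k)
   = cmp C j (sm (am' oneA (act_on g (d a k))) (gm g oneG))"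
  unfolding hopf_points_image[OF g, symmetric] base_points[OF dk, symmetric]
  by (simp only: smash_hom_points[OF sm_hom_smash[OF oneA_hom g] sm_hom_smash[OF dk o], symmetric] sm_mult[OF oneA_hom g dk o])
 also have "sm (am' oneA (act_on g (d a k))) (gm g oneG) = sm (am' (d a (gm g k)) (d 1\<^sub>A g)) g"
  using AC.l_one[of "act_on g (d a k)"] act_on_hom[OF g dk] PG.r_one[of g] g
  by (simp only: act_on_d(2)[OF g k a] conv_simps pts.point_group_simps(1))
 also have "... = sm (d a (gm g k)) g"
  using AC.m_assoc[of "d a (gm g k)" "d 1\<^sub>A g" "d 1\<^sub>A g"] AC.m_closed[of "d a (gm g k)" "d 1\<^sub>A g"] dgk d1 d_one_idem[OF g]
  by (simp add: sm_tens[OF _ g])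
 also have "... = sm (am' (d a (gm g k)) (act_on oneG oneA)) (gm oneG g)"
  using AC.r_one[of "d a (gm g k)"] dgk PG.l_one[of g] g
  by (simp only: act_on_one[OF oneA_hom] conv_simps(1) pts.point_group_simps(1))
 also have "cmp C j ... = cmp C (%a. j (se a 1\<^sub>H)) (d a (gm g k)) \<star>\<^sub>E cmp C (%h. j (se 1\<^sub>A h)) g"
  unfolding hopf_points_image[OF g, symmetric] base_points[OF dgk, symmetric]
  by (simp only: smash_hom_points[OF sm_hom_smash[OF dgk o] sm_hom_smash[OF oneA_hom g], symmetric] sm_mult[OF dgk o oneA_hom g])
 finally show ?thesis .
qed

text \<open>\<open>(1 # g) (1 # k) = (g \<cdot> 1) # g k\<close>, which is also the product on the right.\<close>
lemma smash_projective:
 assumes g: "g \<in> pts.points" and k: "k \<in> pts.points"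
 shows "cmp C (%h. j (se 1\<^sub>A h)) g \<star>\<^sub>E cmp C (%h. j (se 1\<^sub>A h)) k
  = cmp C (%a. j (se a 1\<^sub>H)) (d 1\<^sub>A g) \<star>\<^sub>E cmp C (%h. j (se 1\<^sub>A h)) (gm g k)"
proof -
 have gk: "gm g k \<in> pts.points" using g k PG.m_closed by simp
 have o: "oneG \<in> pts.points" using PG.one_closed by simp
 note d1 = d_hom[OF A.one_closed g]
 have "cmp C (%h. j (se 1\<^sub>A h)) g \<star>\<^sub>E cmp C (%h. j (se 1\<^sub>A h)) k
   = cmp C j (sm (am' oneA (act_on g oneA)) (gm g k))"
  unfolding hopf_points_image[OF g, symmetric] hopf_points_image[OF k, symmetric]
  by (simp only: smash_hom_points[OF sm_hom_smash[OF oneA_hom g] sm_hom_smash[OF oneA_hom k], symmetric] sm_mult[OF oneA_hom g oneA_hom k])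
 also have "am' oneA (act_on g oneA) = d 1\<^sub>A g"
  using AC.l_one[of "act_on g oneA"] act_on_hom[OF g oneA_hom] d_eq[OF A.one_closed g, folded C.one_conv] by (simp only: conv_simps(1))
 also have "sm (d 1\<^sub>A g) (gm g k) = sm (am' (d 1\<^sub>A g) (act_on oneG oneA)) (gm oneG (gm g k))"
  using AC.r_one[of "d 1\<^sub>A g"] d1 PG.l_one[of "gm g k"] gk
  by (simp only: act_on_one[OF oneA_hom] conv_simps(1) pts.point_group_simps(1))
 also have "cmp C j ... = cmp C (%a. j (se a 1\<^sub>H)) (d 1\<^sub>A g) \<star>\<^sub>E cmp C (%h. j (se 1\<^sub>A h)) (gm g k)"
  unfolding hopf_points_image[OF gk, symmetric] base_points[OF d1, symmetric]
  by (simp only: smash_hom_points[OF sm_hom_smash[OF d1 o] sm_hom_smash[OF oneA_hom gk], symmetric] sm_mult[OF d1 o oneA_hom gk])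
 finally show ?thesis .
qed

end

end

section \<open>Covariant pairs\<close>

text \<open>The properties of the pair \<open>h \<mapsto> 1 # h\<close>, \<open>a \<mapsto> a # 1\<close> that the argument uses: conjugation by \<open>\<lambda>\<^sub>g\<close> moves \<open>k \<cdot> a\<close> to \<open>g k \<cdot> a\<close>, and \<open>\<lambda>\<close> is
  multiplicative up to the idempotent \<open>g \<cdot> 1\<close>. The conditions are stable under passage to the opposite algebra and antipode, so
  they hold for left and for right multiplications.\<close>
locale covariant_points = partial_action_points K H A act C + E: k_algebra K E
 for K :: "('k, 'x) ring_scheme" (structure) and H :: "('k, 'h, 'y) hopf_scheme" (structure)
  and A :: "('k, 'a, 'z) module_scheme" (structure) and act :: "'h => 'a => 'a"
  and C :: "('k, 'c, 'u) hopf_scheme" and E :: "('k, 'e, 'v) module_scheme" +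
 fixes lam :: "'h => 'e" and kap :: "'a => 'e"
 assumes lam: "klinear K H E lam" and lam_one: "lam 1\<^sub>H = 1\<^sub>E" and kap: "klinear K A E kap"
  and covariant: "[|g \<in> pts.points; k \<in> pts.points; a \<in> U A|] ==>
   cmp C lam g \<star>\<^sub>E cmp C kap (cmp C (%h. act h a) k)
   = cmp C kap (cmp C (%h. act h a) (g \<otimes>\<^bsub>pts.point_group\<^esub> k)) \<star>\<^sub>E cmp C lam g"
  and projective: "[|g \<in> pts.points; k \<in> pts.points|] ==>
   cmp C lam g \<star>\<^sub>E cmp C lam k
   = cmp C kap (cmp C (%h. act h 1\<^sub>A) g) \<star>\<^sub>E cmp C lam (g \<otimes>\<^bsub>pts.point_group\<^esub> k)"
begin

interpretation PG: group pts.point_group by (rule pts.group_points)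
interpretation Q: monoid "conv K C E" by (rule C.conv_monoid[OF E.k_algebra_axioms])

abbreviation (input) "lg g == cmp C lam g"
abbreviation (input) "kd a g == cmp C kap (cmp C (%h. act h a) g)"
abbreviation (input) "qm x y == x \<star>\<^sub>E y"

lemma lg_closed: "g \<in> pts.points ==> lg g \<in> U (conv K C E)"
 using pts.br_hom[OF lam] by simp

lemma kd_closed: "[|a \<in> U A; g \<in> pts.points|] ==> kd a g \<in> U (conv K C E)"
 using C.compose_hom[OF kap d_hom] by simp

lemma lg_one: "lg oneG = \<one>\<^bsub>conv K C E\<^esub>"
 by (rule pts.br_one[OF lam lam_one])

lemma gi_closed: "g \<in> pts.points ==> gi g \<in> pts.points"
 using PG.inv_closed by simp

lemma gm_closed: "[|g \<in> pts.points; k \<in> pts.points|] ==> gm g k \<in> pts.points"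
 using PG.m_closed by simp

lemma lg_inverse: "g \<in> pts.points ==> qm (lg g) (lg (gi g)) = kd 1\<^sub>A g"
 using projective[of g "gi g"] kd_closed[of "1\<^sub>A" g] PG.r_inv[of g] gi_closed[of g]
 by (simp only: lg_one Q.r_one pts.point_group_simps(1) A.one_closed)

lemma lg_inverse': "g \<in> pts.points ==> qm (lg (gi g)) (lg g) = kd 1\<^sub>A (gi g)"
 using lg_inverse[of "gi g"] gi_closed[of g] PG.inv_inv[of g] by (simp only: pts.point_group_simps(1))

lemma lg_absorb: "g \<in> pts.points ==> qm (kd 1\<^sub>A g) (lg g) = lg g"
 using projective[of g oneG] lg_closed[of g] PG.r_one[of g] PG.one_closed
 by (simp only: lg_one Q.r_one pts.point_group_simps(1))

lemma kd_idem: "g \<in> pts.points ==> qm (kd 1\<^sub>A g) (kd 1\<^sub>A g) = kd 1\<^sub>A g"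
 using Q.m_assoc[of "kd 1\<^sub>A g" "lg g" "lg (gi g)"] kd_closed[of "1\<^sub>A" g] lg_closed[of g] lg_closed[of "gi g"]
 by (simp only: lg_inverse lg_absorb gi_closed A.one_closed)

text \<open>A covariant pair makes \<open>\<lambda>\<close> a partial representation: \<open>\<lambda>\<^sub>g \<lambda>\<^sub>k \<lambda>\<^sub>k\<^sup>-\<^sup>1 = \<lambda>\<^sub>g (k \<cdot> 1) = (g k \<cdot> 1) \<lambda>\<^sub>g\<close>, and projectivity for \<open>g k\<close> and \<open>k\<^sup>-\<^sup>1\<close> gives \<open>\<lambda>\<^sub>g\<^sub>k \<lambda>\<^sub>k\<^sup>-\<^sup>1\<close>.\<close>
lemma lg_rel1:
 assumes g: "g \<in> pts.points" and k: "k \<in> pts.points"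
 shows "qm (qm (lg g) (lg k)) (lg (gi k)) = qm (lg (gm g k)) (lg (gi k))"
proof -
 note gk = gm_closed[OF g k] and ik = gi_closed[OF k]
 have e: "gm (gm g k) (gi k) = g" using PG.m_assoc[of g k "gi k"] g k ik PG.r_inv[of k] PG.r_one[of g]
  by (simp only: pts.point_group_simps(1))
 have "qm (qm (lg g) (lg k)) (lg (gi k)) = qm (lg g) (kd 1\<^sub>A k)"
  by (simp only: Q.m_assoc[OF lg_closed[OF g] lg_closed[OF k] lg_closed[OF ik]] lg_inverse[OF k])
 also have "... = qm (kd 1\<^sub>A (gm g k)) (lg g)" by (rule covariant[OF g k A.one_closed])
 also have "... = qm (lg (gm g k)) (lg (gi k))" by (simp only: projective[OF gk ik] e)
 finally show ?thesis .
qed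

lemma lg_rel2:
 assumes g: "g \<in> pts.points" and k: "k \<in> pts.points"
 shows "qm (qm (lg g) (lg (gi g))) (lg k) = qm (lg g) (lg (gm (gi g) k))"
proof -
 have e: "gm g (gm (gi g) k) = k" using PG.m_assoc[of g "gi g" k] g k gi_closed[OF g] PG.r_inv[of g] PG.l_one[of k]
  by (simp only: pts.point_group_simps(1))
 show ?thesis by (simp only: lg_inverse[OF g] projective[OF g gm_closed[OF gi_closed[OF g] k]] e)
qed

end

context partial_action_points
begin

interpretation PG: group pts.point_group by (rule pts.group_points)

lemma covariant_points_smash:
 assumes E: "k_algebra K E" and j: "klinear K SP E j"
  and j_mult: "!!u v. [|u \<in> U SP; v \<in> U SP|] ==> j (am u v) = j u *\<^sub>E j v"
  and j_one: "j 1\<^sub>SP = 1\<^sub>E"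
 shows "covariant_points K H A act C E (%h. j (se 1\<^sub>A h)) (%a. j (se a 1\<^sub>H))"
proof -
 have l: "klinear K H SP (se 1\<^sub>A)" "klinear K A SP (%a. se a 1\<^sub>H)"
  using se_bilinear_smash by (auto simp: bilinear_def)
 show ?thesis
  by (intro covariant_points.intro covariant_points_axioms.intro partial_action_points_axioms E)
   (simp_all add: linear_comp[OF j l(1)] linear_comp[OF j l(2)] se_one j_one
    smash_covariant[OF E j j_mult] smash_projective[OF E j j_mult] del: conv_simps pts.point_group_simps(2,3))
qed

text \<open>Reversing products and inverting \<open>g\<close> turns \<open>\<lambda>\<^sub>g\<^sup>-\<^sup>1 (g k \<cdot> a) = (k \<cdot> a) \<lambda>\<^sub>g\<^sup>-\<^sup>1\<close> into the covariance condition again. For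
  projectivity the idempotent appears on the wrong side and is moved by covariance.\<close>
lemma covariant_points_opposite:
 assumes E: "k_algebra K E" and op: "covariant_points K H A act C (opposite E) lam kap"
 shows "covariant_points K H A act C E (%h. lam (antipode H h)) kap"
proof -
 interpret E: k_algebra K E by (rule E)
 interpret O: covariant_points K H A act C "opposite E" lam kap by (rule op)
 interpret Q: monoid "conv K C E" by (rule C.conv_monoid[OF E])
 have r: "cmp C (%h. lam (antipode H h)) g = O.lg (gi g)" if "g \<in> pts.points" for g
  using C.compose_compose[OF pts.points_hom[OF that], of lam "antipode H"] pts.inv_point[OF that] by (simp only:)
 note opp = pts.conv_opposite[OF E]
 have lh: "O.lg g \<in> Hom E" if "g \<in> pts.points" for g using pts.br_hom[OF O.lam[simplified] that] .
 have kh: "O.kd a g \<in> Hom E" if "a \<in> U A" "g \<in> pts.points" for a g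
  using C.compose_hom[OF O.kap[simplified] d_hom[OF that]] .
 have lin: "klinear K H E (%h. lam (antipode H h))"
  by (rule linear_comp[OF O.lam[simplified] antipode_linear])
 have cov: "O.lg (gi g) \<star>\<^sub>E O.kd a k = O.kd a (gm g k) \<star>\<^sub>E O.lg (gi g)"
  if g: "g \<in> pts.points" and k: "k \<in> pts.points" and a: "a \<in> U A" for g k a
 proof -
  note ig = O.gi_closed[OF g] and gk = O.gm_closed[OF g k]
  have e: "gm (gi g) (gm g k) = k" using PG.m_assoc[of "gi g" g k] g k ig PG.l_inv[of g] PG.l_one[of k]
   by (simp only: pts.point_group_simps(1))
  show ?thesis using O.covariant[OF ig gk a]
   unfolding e opp[OF lh[OF ig] kh[OF a gk]] opp[OF kh[OF a k] lh[OF ig]] by (rule sym)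
 qed
 have proj: "O.lg (gi g) \<star>\<^sub>E O.lg (gi k) = O.kd 1\<^sub>A g \<star>\<^sub>E O.lg (gi (gm g k))"
  if g: "g \<in> pts.points" and k: "k \<in> pts.points" for g k
 proof -
  note ig = O.gi_closed[OF g] and ik = O.gi_closed[OF k] and gk = O.gm_closed[OF g k]
  have i: "gi (gm g k) = gm (gi k) (gi g)" using PG.inv_mult_group[of g k] g k by (simp only: pts.point_group_simps(1))
  note igk = O.gi_closed[OF gk]
  have e: "gm (gm g k) (gi k) = g" using PG.m_assoc[of g k "gi k"] g k ik PG.r_inv[of k] PG.r_one[of g]
   by (simp only: pts.point_group_simps(1))
  have "O.lg (gi g) \<star>\<^sub>E O.lg (gi k) = O.lg (gi (gm g k)) \<star>\<^sub>E O.kd 1\<^sub>A (gi k)"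
   using O.projective[OF ik ig]
   unfolding opp[OF lh[OF ik] lh[OF ig]] opp[OF kh[OF A.one_closed ik] lh[OF O.gm_closed[OF ik ig]]] i .
  also have "... = O.kd 1\<^sub>A g \<star>\<^sub>E O.lg (gi (gm g k))"
   using cov[OF gk ik A.one_closed] unfolding e .
  finally show ?thesis .
 qed
 show ?thesis
  by (intro covariant_points.intro covariant_points_axioms.intro partial_action_points_axioms E)
   (use lin O.lam_one O.kap cov proj in \<open>simp_all add: r O.gm_closed antipode_one del: conv_simps pts.point_group_simps(2,3)\<close>)
qed

end

context cocommutative_partial_action
begin

lemma covariant_partial_rep:
 assumes "covariant_points K H A act HH E lam kap"
 shows "partial_rep K H E lam"
proof -
 interpret X: covariant_points K H A act HH E lam kap by (rule assms)
 show ?thesis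
  by (rule partial_repI[OF X.E.k_algebra_axioms X.lam X.lam_one X.lg_rel1 X.lg_rel2])
qed

end

context cocommutative_coalgebra
begin

lemma compose_left_cong:
 assumes E: "k_algebra K E" and W: "module K W" and L: "klinear K E W L"
  and \<phi>: "klinear K X E \<phi>" and \<psi>: "klinear K X E \<psi>"
  and eq: "!!x e. [|x \<in> U X; e \<in> U E|] ==> L (\<phi> x *\<^sub>E e) = L (\<psi> x *\<^sub>E e)"
  and u: "u \<in> Hom X" and f: "f \<in> Hom E"
 shows "cmp C L (cmp C \<phi> u \<star>\<^sub>E f)
  = cmp C L (cmp C \<psi> u \<star>\<^sub>E f)"
proof -
 interpret E: k_algebra K E by (rule E)
 note M = E.module_axioms and m = E.mult_bilinear
 have b: "bilinear K X E E (%x e. \<phi> x *\<^sub>E e)" "bilinear K X E E (%x e. \<psi> x *\<^sub>E e)"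
  using m \<phi> \<psi> by (simp_all add: multilinear)
 show ?thesis
  unfolding conv_simps convolve_compose_left[OF M m u f \<phi>] convolve_compose_left[OF M m u f \<psi>]
   compose_convolve[OF M W b(1) u f L] compose_convolve[OF M W b(2) u f L]
  by (rule convolve_cong[OF W linear_bilinear[OF L b(1)] u f]) (rule eq)
qed

end

context cocommutative_partial_action
begin

interpretation HC: cocommutative_coalgebra K H by (rule cocommutative_coalgebra)

lemma se_factor:
 assumes a: "a \<in> U A" and h: "h \<in> U H"
 shows "am (se a 1\<^sub>H) (se 1\<^sub>A h) = se a h"
proof -
 have e: "am (p a 1\<^sub>H) (p b k) = left_A a (p b k)" if bk: "b \<in> U A" "k \<in> U H" for b k
 proof -
  have "twist 1\<^sub>H b = p b 1\<^sub>H"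
   unfolding twist_def using twist_tri bk
   by (subst sweedler_one[OF AH_module]) (auto simp: act_one multilinear)
  then show ?thesis using a bk by (simp add: am_pure right_H_pure)
 qed
 have tb: "bilinear K H H AH (%x y. p (1\<^sub>A *\<^sub>A act x 1\<^sub>A) y)" using se_tri by (simp add: trilinear_def)
 have l: "klinear K AH AH (am (p a 1\<^sub>H))"
  using am_bilinear bilinearD(1)[OF p_bilinear a one_closed] by (simp add: bilinear_def)
 have "am (p a 1\<^sub>H) (se 1\<^sub>A h) = sweedler AH H (%x y. am (p a 1\<^sub>H) (p (1\<^sub>A *\<^sub>A act x 1\<^sub>A) y)) h"
  unfolding smash_elem_def by (rule HC.sweedler_map[OF AH_module AH_module tb l h])
 also have "... = se a h"
  unfolding smash_elem_def
  by (rule HC.sweedler_cong[OF AH_module h])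
   (use a bilinearD(1)[OF p_bilinear] in \<open>auto simp: e act_closed left_A_pure\<close>)
 finally show ?thesis by (simp add: se_one_right a)
qed

end

section \<open>Trace functionals\<close>

text \<open>In the application \<open>E\<close> is the enveloping algebra of \<open>A # H\<close>, and \<open>j1\<close> and \<open>j2\<close> give left and right multiplications. A linear map \<open>T\<close>
  on \<open>E\<close> stands for \<open>e \<mapsto> [e m]\<close> with values in one of the two quotients of a bimodule.\<close>
locale commuting_smash_homs = cocommutative_partial_action K H A act + E: k_algebra K E
 for K :: "('k, 'x) ring_scheme" (structure) and H :: "('k, 'h, 'y) hopf_scheme" (structure)
  and A :: "('k, 'a, 'z) module_scheme" (structure) and act :: "'h => 'a => 'a"
  and E :: "('k, 'e, 'v) module_scheme" +
 fixes j1 :: "('a, 'h) tensor => 'e" and j2 :: "('a, 'h) tensor => 'e"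
 assumes j1: "klinear K (smash K H A act) E j1" and j2: "klinear K (smash K H A act) E j2"
  and j1_mult: "[|u \<in> U (smash K H A act); v \<in> U (smash K H A act)|]
   ==> j1 (monoid.mult (smash_ambient K H A act) u v) = j1 u *\<^sub>E j1 v"
  and j2_mult: "[|u \<in> U (smash K H A act); v \<in> U (smash K H A act)|]
   ==> j2 (monoid.mult (smash_ambient K H A act) u v) = j2 v *\<^sub>E j2 u"
  and j1_one: "j1 \<one>\<^bsub>smash K H A act\<^esub> = 1\<^sub>E" and j2_one: "j2 \<one>\<^bsub>smash K H A act\<^esub> = 1\<^sub>E"
  and j_commute: "[|u \<in> U (smash K H A act); v \<in> U (smash K H A act)|]
   ==> j1 u *\<^sub>E j2 v = j2 v *\<^sub>E j1 u"
begin

interpretation HC: cocommutative_coalgebra K H by (rule cocommutative_coalgebra)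

definition lam1 :: "'h => 'e" where "lam1 h = j1 (se 1\<^sub>A h)"
definition lam2 :: "'h => 'e" where "lam2 h = j2 (se 1\<^sub>A h)"
definition rho :: "'h => 'e" where "rho h = lam2 (antipode H h)"
definition kap1 :: "'a => 'e" where "kap1 a = j1 (se a 1\<^sub>H)"
definition kap2 :: "'a => 'e" where "kap2 a = j2 (se a 1\<^sub>H)"
definition sig :: "'h => 'e" where "sig = sweedler E H (%x y. lam1 x *\<^sub>E rho y)"
definition tau :: "'h => 'e" where "tau = sweedler E H (%x y. sig (antipode H x) *\<^sub>E sig y)"

lemma covariant1: "partial_action_points K H A act C ==> covariant_points K H A act C E lam1 kap1"
 using partial_action_points.covariant_points_smash[OF _ E.k_algebra_axioms j1 j1_mult j1_one]
 unfolding lam1_def[abs_def] kap1_def[abs_def] .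

lemma covariant2: "partial_action_points K H A act C ==> covariant_points K H A act C E rho kap2"
proof -
 assume a: "partial_action_points K H A act C"
 have "covariant_points K H A act C (opposite E) lam2 kap2"
  using partial_action_points.covariant_points_smash[OF a opposite_k_algebra[OF E.k_algebra_axioms], of j2] j2 j2_mult j2_one
  unfolding lam2_def[abs_def] kap2_def[abs_def] by simp
 from partial_action_points.covariant_points_opposite[OF a E.k_algebra_axioms this]
 show ?thesis unfolding rho_def[abs_def] .
qed

lemma variables:
 "partial_action_points K H A act H" "partial_action_points K H A act HH"
 by (intro partial_action_points.intro cocommutative_partial_action_axioms cocommutative_coalgebra
  hopf_points.axioms(2)[OF two_variables])+

interpretation L: covariant_points K H A act H E lam1 kap1 by (rule covariant1[OF variables(1)])
interpretation R: covariant_points K H A act H E rho kap2 by (rule covariant2[OF variables(1)])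
interpretation PG: group L.pts.point_group by (rule L.pts.group_points)
interpretation Q: monoid "conv K H E" by (rule HC.conv_monoid[OF E.k_algebra_axioms])

lemmas E_module = E.module_axioms

lemma lam2_linear: "klinear K H E lam2"
 unfolding lam2_def[abs_def] using linear_comp[OF j2] se_bilinear_smash by (auto simp: bilinear_def)

lemma commute_se:
 "[|a \<in> U A; h \<in> U H; b \<in> U A; k \<in> U H|] ==> j1 (se a h) *\<^sub>E j2 (se b k) = j2 (se b k) *\<^sub>E j1 (se a h)"
 by (rule j_commute) (auto intro: se_in_smash)

lemma antipode_H: "h \<in> U H ==> antipode H h \<in> U H"
 by (rule klinearD(1)[OF antipode_linear])

lemma commute:
 "[|h \<in> U H; k \<in> U H|] ==> lam1 h *\<^sub>E rho k = rho k *\<^sub>E lam1 h"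
 "[|h \<in> U H; b \<in> U A|] ==> lam1 h *\<^sub>E kap2 b = kap2 b *\<^sub>E lam1 h"
 "[|a \<in> U A; k \<in> U H|] ==> kap1 a *\<^sub>E rho k = rho k *\<^sub>E kap1 a"
 "[|a \<in> U A; b \<in> U A|] ==> kap1 a *\<^sub>E kap2 b = kap2 b *\<^sub>E kap1 a"
 by (simp_all add: lam1_def rho_def lam2_def kap1_def kap2_def commute_se antipode_H)

text \<open>This is what makes \<open>F\<^sub>1 M\<close> a module over \<open>H\<^sub>p\<^sub>a\<^sub>r\<close>.\<close>
lemma sig_partial_rep: "partial_rep K H E sig"
 unfolding sig_def
 by (rule partial_rep_product[OF E.k_algebra_axioms covariant_partial_rep[OF covariant1[OF variables(2)]]
  covariant_partial_rep[OF covariant2[OF variables(2)]] commute(1)])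

lemmas sig_linear = conjunct1[OF sig_partial_rep[unfolded partial_rep_def]]

lemma lam_rho_bilinear: "bilinear K H H E (%x y. lam1 x *\<^sub>E rho y)"
 by (rule bilinear_comp[OF E.mult_bilinear L.lam R.lam])

lemma tau_bilinear: "bilinear K H H E (%x y. sig (antipode H x) *\<^sub>E sig y)"
 by (rule bilinear_comp[OF E.mult_bilinear linear_comp[OF sig_linear antipode_linear] sig_linear])

lemma tau_linear: "klinear K H E tau"
 unfolding tau_def by (rule HC.sweedler_linear[OF E_module tau_bilinear])

abbreviation (input) "pf \<phi> g == cmp H \<phi> g"
abbreviation (input) "qm x y == x \<otimes>\<^bsub>conv K H E\<^esub> y"
abbreviation (input) "gi x == inv\<^bsub>L.pts.point_group\<^esub> x"
abbreviation (input) "kd1 a g == pf kap1 (pf (%h. act h a) g)"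
abbreviation (input) "kd2 a g == pf kap2 (pf (%h. act h a) g)"

lemma inv_points: "g \<in> L.pts.points ==> pf \<phi> (gi g) = pf (%h. \<phi> (antipode H h)) g"
 by (simp only: L.pts.inv_point HC.compose_compose[OF L.pts.points_hom])

lemma pf_closed: "[|klinear K H E \<phi>; g \<in> L.pts.points|] ==> pf \<phi> g \<in> U (conv K H E)"
 using L.pts.br_hom by simp

lemma sig_points: "g \<in> L.pts.points ==> pf sig g = qm (pf lam1 g) (pf rho g)"
 unfolding sig_def conv_simps L.pts.compose_point[OF E_module lam_rho_bilinear]
 by (rule HC.convolve_compose[OF E_module E.mult_bilinear _ _ L.lam R.lam, symmetric]) (rule L.pts.points_hom, assumption)+

lemma tau_points: "g \<in> L.pts.points ==> pf tau g = qm (pf sig (gi g)) (pf sig g)"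
 unfolding tau_def inv_points conv_simps L.pts.compose_point[OF E_module tau_bilinear]
 by (rule HC.convolve_compose[OF E_module E.mult_bilinear _ _ linear_comp[OF sig_linear antipode_linear] sig_linear, symmetric])
  (rule L.pts.points_hom, assumption)+

lemma commute_points:
 assumes "g \<in> L.pts.points" "k \<in> L.pts.points"
 shows "qm (pf lam1 g) (pf rho k) = qm (pf rho k) (pf lam1 g)"
  and "a \<in> U A ==> qm (pf lam1 g) (kd2 a k) = qm (kd2 a k) (pf lam1 g)"
  and "a \<in> U A ==> qm (kd1 a k) (pf rho g) = qm (pf rho g) (kd1 a k)"
  and "[|a \<in> U A; b \<in> U A|] ==> qm (kd1 a g) (kd2 b k) = qm (kd2 b k) (kd1 a g)"
 using assms
 by (auto intro!: HC.conv_commute[OF E.k_algebra_axioms] L.pts.points_hom L.d_hom L.lam R.lam L.kap R.kap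
  simp: commute simp del: conv_simps)

text \<open>The factors for left and right multiplication commute, so \<open>\<tau>\<^sub>g = (\<lambda>\<^sub>g\<^sup>-\<^sup>1 \<lambda>\<^sub>g) (\<rho>\<^sub>g\<^sup>-\<^sup>1 \<rho>\<^sub>g)\<close>, and each bracket is the idempotent \<open>g\<^sup>-\<^sup>1 \<cdot> 1\<close> on its side.\<close>
lemma tau_points_kap:
 assumes g: "g \<in> L.pts.points" shows "pf tau g = qm (kd1 1\<^sub>A (gi g)) (kd2 1\<^sub>A (gi g))"
proof -
 note ig = L.gi_closed[OF g]
 note c = L.lg_closed[OF g] L.lg_closed[OF ig] R.lg_closed[OF g] R.lg_closed[OF ig]
 have "pf tau g = qm (qm (pf lam1 (gi g)) (pf lam1 g)) (qm (pf rho (gi g)) (pf rho g))"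
  unfolding tau_points[OF g] sig_points[OF g] sig_points[OF ig]
  by (rule Q.interchange2[OF c(2,1,4,3)]) (rule commute_points(1)[OF g ig, symmetric])
 then show ?thesis by (simp only: L.lg_inverse'[OF g] R.lg_inverse'[OF g])
qed

lemma eval_const:
 assumes L: "klinear K E W L" and \<phi>: "klinear K H E \<phi>" and e: "e \<in> U E" and h: "h \<in> U H"
 shows "pf L (qm (pf \<phi> id_point) (HC.const_hom E e)) h = L (\<phi> h *\<^sub>E e)"
proof -
 have "qm (pf \<phi> id_point) (HC.const_hom E e) = pf (%x. x *\<^sub>E e) (pf \<phi> id_point)"
  unfolding conv_simps
  by (rule HC.convolve_const_right[OF E_module E_module E.mult_bilinear e L.pts.br_hom[OF \<phi> id_point]])
 then show ?thesis using h by (simp add: compose_eq id_point_def)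
qed

lemma const_E: "e \<in> U E ==> HC.const_hom E e \<in> U (conv K H E)"
 using HC.const_hom_hom[OF E_module] by simp

lemma Hom_E: "f \<in> U (conv K H E) ==> f \<in> module_hom K H E" by simp

context
 fixes W :: "('k, 'w, 't) module_scheme" and T :: "'e => 'w"
 assumes W: "module K W" and T: "klinear K E W T"
  and trace: "!!u e. [|u \<in> U SP; e \<in> U E|] ==> T (j2 u *\<^sub>E e) = T (j1 u *\<^sub>E e)"
begin

text \<open>A functional that does not distinguish left from right multiplication sends \<open>\<sigma>\<^sub>g f = \<rho>\<^sub>g \<lambda>\<^sub>g f\<close> and \<open>\<lambda>\<^sub>g\<^sup>-\<^sup>1 \<lambda>\<^sub>g f\<close> to the same
  value. The latter is \<open>f\<close> times an idempotent on the left; half of this idempotent moves to the right, which gives \<open>\<tau>\<^sub>g f\<close>.\<close>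
lemma trace_points:
 assumes g: "g \<in> L.pts.points" and f: "f \<in> U (conv K H E)"
 shows "pf T (qm (pf sig g) f) = pf T (qm (pf tau g) f)"
proof -
 note ig = L.gi_closed[OF g]
 note c = L.lg_closed[OF g] L.lg_closed[OF ig] R.lg_closed[OF g] L.kd_closed[OF A.one_closed ig] R.kd_closed[OF A.one_closed ig]
 note d = L.d_hom[OF A.one_closed ig]
 have r: "pf T (qm (pf rho g) f) = pf T (qm (pf lam1 (gi g)) f)" if f: "f \<in> U (conv K H E)" for f
  unfolding inv_points[OF g]
  by (rule HC.compose_left_cong[OF E.k_algebra_axioms W T R.lam linear_comp[OF L.lam antipode_linear] _ L.pts.points_hom[OF g] Hom_E[OF f]])
   (simp add: rho_def lam1_def lam2_def antipode_H trace se_in_smash)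
 have k: "pf T (qm (kd2 1\<^sub>A (gi g)) f) = pf T (qm (kd1 1\<^sub>A (gi g)) f)" if f: "f \<in> U (conv K H E)" for f
  by (rule HC.compose_left_cong[OF E.k_algebra_axioms W T R.kap L.kap _ d Hom_E[OF f]])
   (simp add: kap1_def kap2_def trace se_in_smash)
 have "pf T (qm (pf sig g) f) = pf T (qm (pf rho g) (qm (pf lam1 g) f))"
  unfolding sig_points[OF g] commute_points(1)[OF g g] by (simp only: Q.m_assoc[OF c(3,1) f])
 also have "... = pf T (qm (kd1 1\<^sub>A (gi g)) f)"
  unfolding r[OF Q.m_closed[OF c(1) f]] Q.m_assoc[OF c(2,1) f, symmetric] L.lg_inverse'[OF g] ..
 also have "... = pf T (qm (kd2 1\<^sub>A (gi g)) (qm (kd1 1\<^sub>A (gi g)) f))"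
  unfolding k[OF Q.m_closed[OF c(4) f]] Q.m_assoc[OF c(4,4) f, symmetric] L.kd_idem[OF ig] ..
 also have "... = pf T (qm (pf tau g) f)"
  unfolding tau_points_kap[OF g] commute_points(4)[OF ig ig A.one_closed A.one_closed] Q.m_assoc[OF c(5,4) f] ..
 finally show ?thesis .
qed

text \<open>If \<open>b\<close> commutes with the idempotents \<open>\<sigma>\<^sub>g \<sigma>\<^sub>g\<^sup>-\<^sup>1\<close>, then \<open>b \<sigma>\<^sub>g = b \<sigma>\<^sub>g \<sigma>\<^sub>g\<^sup>-\<^sup>1 \<sigma>\<^sub>g = \<sigma>\<^sub>g (\<sigma>\<^sub>g\<^sup>-\<^sup>1 b \<sigma>\<^sub>g)\<close>. Lemma \<open>trace_points\<close> replaces the first factor by \<open>\<tau>\<^sub>g\<close>, which is absorbed by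
  \<open>\<sigma>\<^sub>g\<^sup>-\<^sup>1\<close>. So \<open>T\<close> is compatible with the right action of \<open>H\<^sub>p\<^sub>a\<^sub>r\<close> on \<open>B\<close>.\<close>
lemma trace_conjugate:
 assumes b: "b \<in> U E" and h: "h \<in> U H" and e: "e \<in> U E"
  and comm: "!!k. k \<in> U H ==> b *\<^sub>E sweedler E H (%x y. sig x *\<^sub>E sig (antipode H y)) k
   = sweedler E H (%x y. sig x *\<^sub>E sig (antipode H y)) k *\<^sub>E b"
 shows "T (b *\<^sub>E sig h *\<^sub>E e) = T (sweedler E H (%x y. sig (antipode H x) *\<^sub>E b *\<^sub>E sig y) h *\<^sub>E e)"
proof -
 note g = id_point and ig = L.gi_closed[OF id_point] and Ek = E.k_algebra_axioms and m = E.mult_bilinear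
 let ?b = "HC.const_hom E b" and ?e = "HC.const_hom E e"
 let ?s = "pf sig id_point" and ?i = "pf sig (gi id_point)"
 note el = L.pts.idempotent_linear[OF Ek sig_linear]
 have bs: "klinear K H E (%h. b *\<^sub>E sig h)" using m sig_linear b by (simp add: multilinear)
 have cl: "klinear K H E (sweedler E H (%x y. sig (antipode H x) *\<^sub>E b *\<^sub>E sig y))"
  using L.pts.conjugate_bilinear[OF Ek sig_linear] b by (simp add: bilinear_def)
 note c = pf_closed[OF sig_linear g] pf_closed[OF sig_linear ig] const_E[OF b] const_E[OF e]
 have bE: "qm ?b (qm ?s ?i) = qm (qm ?s ?i) ?b"
  unfolding L.pts.idempotent_point[OF Ek sig_linear g, symmetric]
  unfolding conv_simps HC.convolve_const_left[OF E_module E_module m b L.pts.br_hom[OF el g]]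
   HC.convolve_const_right[OF E_module E_module m b L.pts.br_hom[OF el g]]
  unfolding HC.compose_compose[OF L.pts.points_hom[OF g]]
  by (rule HC.compose_cong[OF L.pts.points_hom[OF g] comm])
 have absorb: "qm (qm ?s ?i) ?s = ?s" "qm (qm ?i ?s) ?i = ?i"
  using L.pts.pr_idem_absorb[OF Ek sig_partial_rep g] L.pts.pr_idem_absorb[OF Ek sig_partial_rep ig]
   PG.inv_inv[of id_point] g by (simp_all only: L.pts.point_group_simps(1))
 have "pf (%h. b *\<^sub>E sig h) id_point = qm ?b ?s"
  unfolding conv_simps HC.convolve_const_left[OF E_module E_module m b L.pts.br_hom[OF sig_linear g]]
  unfolding HC.compose_compose[OF L.pts.points_hom[OF g]] ..
 also have "... = qm (qm ?b (qm ?s ?i)) ?s" using c by (simp only: absorb(1) Q.m_assoc Q.m_closed)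
 also have "... = qm ?s (qm (qm ?i ?b) ?s)" unfolding bE using c by (simp only: Q.m_assoc Q.m_closed)
 finally have 1: "pf (%h. b *\<^sub>E sig h) id_point = qm ?s (qm (qm ?i ?b) ?s)" .
 have "T (b *\<^sub>E sig h *\<^sub>E e) = pf T (qm (qm ?s (qm (qm ?i ?b) ?s)) ?e) h"
  unfolding eval_const[OF T bs e h, symmetric] 1 ..
 also have "qm (qm ?s (qm (qm ?i ?b) ?s)) ?e = qm ?s (qm (qm (qm ?i ?b) ?s) ?e)"
  using c by (simp only: Q.m_assoc Q.m_closed)
 also have "pf T ... = pf T (qm (pf tau id_point) (qm (qm (qm ?i ?b) ?s) ?e))"
  by (rule trace_points[OF g]) (use c in \<open>simp only: Q.m_closed\<close>)
 also have "qm (pf tau id_point) (qm (qm (qm ?i ?b) ?s) ?e) = qm (qm (qm (qm (qm ?i ?s) ?i) ?b) ?s) ?e"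
  unfolding tau_points[OF g] using c by (simp only: Q.m_assoc Q.m_closed)
 also have "... = qm (pf (sweedler E H (%x y. sig (antipode H x) *\<^sub>E b *\<^sub>E sig y)) id_point) ?e"
  unfolding absorb(2) L.pts.conjugate_point_const[OF Ek sig_linear g b] ..
 finally show ?thesis unfolding eval_const[OF T cl e h] .
qed

end

text \<open>The converse. Modulo the relations for \<open>A\<close> the element \<open>\<lambda>\<^sub>g = (g \<cdot> 1) \<lambda>\<^sub>g\<close> agrees with the one that has \<open>g \<cdot> 1 = \<rho>\<^sub>g \<rho>\<^sub>g\<^sup>-\<^sup>1\<close> on the right side, that is
  with \<open>\<sigma>\<^sub>g \<rho>\<^sub>g\<^sup>-\<^sup>1\<close>, hence with \<open>\<tau>\<^sub>g \<rho>\<^sub>g\<^sup>-\<^sup>1\<close>. The idempotents in \<open>\<tau>\<^sub>g\<close> are absorbed by \<open>\<rho>\<^sub>g\<^sup>-\<^sup>1\<close> after both are moved to the right side, and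
  \<open>\<rho>\<^sub>g\<^sup>-\<^sup>1\<close> is right multiplication by \<open>1 # g\<close>.\<close>
lemma trace_of_coinvariant:
 fixes W :: "('k, 'w, 't) module_scheme" and T :: "'e => 'w"
 assumes W: "module K W" and T: "klinear K E W T"
  and base: "!!a e. [|a \<in> U A; e \<in> U E|] ==> T (kap1 a *\<^sub>E e) = T (kap2 a *\<^sub>E e)"
  and coinv: "!!h e. [|h \<in> U H; e \<in> U E|] ==> T (sig h *\<^sub>E e) = T (tau h *\<^sub>E e)"
  and u: "u \<in> U SP" and e: "e \<in> U E"
 shows "T (j1 u *\<^sub>E e) = T (j2 u *\<^sub>E e)"
proof -
 note g = id_point and ig = L.gi_closed[OF id_point]
 note c = L.lg_closed[OF g] R.lg_closed[OF g] R.lg_closed[OF ig] L.kd_closed[OF A.one_closed g]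
  R.kd_closed[OF A.one_closed g] L.kd_closed[OF A.one_closed ig] R.kd_closed[OF A.one_closed ig]
 note m = E.mult_bilinear
 let ?l = "pf lam1 id_point" and ?r = "pf rho id_point" and ?r' = "pf rho (gi id_point)"
 have k: "pf T (qm (kd1 1\<^sub>A k) f) = pf T (qm (kd2 1\<^sub>A k) f)"
  if "f \<in> U (conv K H E)" "k \<in> L.pts.points" for f k
  using that by (intro HC.compose_left_cong[OF E.k_algebra_axioms W T L.kap R.kap base] L.d_hom Hom_E) auto
 have lam: "T (lam1 h *\<^sub>E e) = T (lam2 h *\<^sub>E e)" if h: "h \<in> U H" and e: "e \<in> U E" for h e
 proof -
  let ?e = "HC.const_hom E e"
  note ce = const_E[OF e]
  have "T (lam1 h *\<^sub>E e) = pf T (qm ?l ?e) h" by (rule eval_const[OF T L.lam e h, symmetric])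
  also have "pf T (qm ?l ?e) = pf T (qm (kd1 1\<^sub>A id_point) (qm ?l ?e))"
   unfolding Q.m_assoc[OF c(4,1) ce, symmetric] L.lg_absorb[OF g] ..
  also have "... = pf T (qm (kd2 1\<^sub>A id_point) (qm ?l ?e))"
   by (rule k[OF Q.m_closed[OF c(1) ce] g])
  also have "qm (kd2 1\<^sub>A id_point) (qm ?l ?e) = qm (pf sig id_point) (qm ?r' ?e)"
   unfolding Q.m_assoc[OF c(5,1) ce, symmetric] commute_points(2)[OF g g A.one_closed, symmetric]
   unfolding R.lg_inverse[OF g, symmetric] sig_points[OF g] using c ce by (simp only: Q.m_assoc Q.m_closed)
  also have "pf T ... = pf T (qm (pf tau id_point) (qm ?r' ?e))"
   by (rule HC.compose_left_cong[OF E.k_algebra_axioms W T sig_linear tau_linear coinv L.pts.points_hom[OF g] Hom_E[OF Q.m_closed[OF c(3) ce]]])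
  also have "qm (pf tau id_point) (qm ?r' ?e) = qm (kd1 1\<^sub>A (gi id_point)) (qm ?r' ?e)"
   unfolding tau_points_kap[OF g] Q.m_assoc[OF c(6,7) Q.m_closed[OF c(3) ce]] Q.m_assoc[OF c(7,3) ce, symmetric] R.lg_absorb[OF ig] ..
  also have "pf T ... = pf T (qm (kd2 1\<^sub>A (gi id_point)) (qm ?r' ?e))"
   by (rule k[OF Q.m_closed[OF c(3) ce] ig])
  also have "qm (kd2 1\<^sub>A (gi id_point)) (qm ?r' ?e) = qm (pf (%h. rho (antipode H h)) id_point) ?e"
   unfolding Q.m_assoc[OF c(7,3) ce, symmetric] R.lg_absorb[OF ig]
   unfolding inv_points[OF g] ..
  also have "pf T ... h = T (rho (antipode H h) *\<^sub>E e)"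
   by (rule eval_const[OF T linear_comp[OF R.lam antipode_linear] e h])
  also have "... = T (lam2 h *\<^sub>E e)" using h by (simp add: rho_def antipode_antipode)
  finally show ?thesis .
 qed
 note jd = klinearD[OF j1] klinearD[OF j2]
 have o: "se a 1\<^sub>H \<in> U SP" "se 1\<^sub>A h \<in> U SP" if "a \<in> U A" "h \<in> U H" for a h
  using that by (auto intro: se_in_smash)
 show ?thesis using u
 proof (induction u rule: smash_induct)
  case (elem a h)
  note o = o[OF elem]
  have kl: "kap1 a \<in> U E" "kap2 a \<in> U E" "lam1 h \<in> U E" "lam2 h \<in> U E"
   using elem klinearD(1)[OF L.kap] klinearD(1)[OF R.kap] klinearD(1)[OF L.lam] klinearD(1)[OF lam2_linear] by auto
  have ahe: "se a h = am (se a 1\<^sub>H) (se 1\<^sub>A h)"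
   using se_factor elem by simp
  have "T (j1 (se a h) *\<^sub>E e) = T (kap1 a *\<^sub>E (lam1 h *\<^sub>E e))"
   using kl e o by (simp add: ahe j1_mult kap1_def lam1_def E.m_assoc)
  also have "... = T (kap2 a *\<^sub>E (lam1 h *\<^sub>E e))" using kl e elem by (intro base) auto
  also have "... = T (lam1 h *\<^sub>E (kap2 a *\<^sub>E e))"
   using kl e elem by (simp add: E.m_assoc[symmetric] commute(2))
  also have "... = T (lam2 h *\<^sub>E (kap2 a *\<^sub>E e))" using kl e elem by (intro lam) auto
  also have "... = T (j2 (se a h) *\<^sub>E e)"
   using kl e o by (simp add: ahe j2_mult kap2_def lam2_def E.m_assoc)
  finally show ?case .
 next
  case (add u v)
  then show ?case using e by (simp add: jd E.l_distr klinearD[OF T])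
 qed
qed

text \<open>Covariance of \<open>\<lambda>\<close> and \<open>\<rho>\<close>, stated for elements: it makes the action of \<open>[h]\<close> on \<open>A \<otimes> M\<close> well defined over \<open>A\<^sup>e\<close>.\<close>
lemma sig_kap:
 assumes a: "a \<in> U A" and h: "h \<in> U H"
 shows "sig h *\<^sub>E kap1 a = sweedler E H (%x y. kap1 (act x a) *\<^sub>E sig y) h"
  and "sig h *\<^sub>E kap2 a = sweedler E H (%x y. kap2 (act x a) *\<^sub>E sig y) h"
proof -
 note g = id_point and m = E.mult_bilinear
 have o: "\<one>\<^bsub>L.pts.point_group\<^esub> \<in> L.pts.points" using PG.one_closed by simp
 have go: "id_point \<otimes>\<^bsub>L.pts.point_group\<^esub> \<one>\<^bsub>L.pts.point_group\<^esub> = id_point" using PG.r_one g by simp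
 note al = act_one_linear[OF a]
 note c = L.lg_closed[OF g] R.lg_closed[OF g] L.kd_closed[OF a g] R.kd_closed[OF a g] L.kd_closed[OF a o] R.kd_closed[OF a o]
 have k: "pf kap (pf (%h. act h a) \<one>\<^bsub>L.pts.point_group\<^esub>) = HC.const_hom E (kap a)" if "klinear K A E kap" for kap
  unfolding L.d_one[OF a] by (rule HC.compose_const_hom[OF that a])
 have fin: "sig h *\<^sub>E kap a = sweedler E H (%x y. kap (act x a) *\<^sub>E sig y) h"
  if kap: "klinear K A E kap" and eq: "qm (pf sig id_point) (pf kap (pf (%h. act h a) \<one>\<^bsub>L.pts.point_group\<^esub>))
   = qm (pf kap (pf (%h. act h a) id_point)) (pf sig id_point)" for kap
 proof -
  note kl = linear_comp[OF kap al]
  note ka = klinearD(1)[OF kap a]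
  have "qm (pf kap (pf (%h. act h a) id_point)) (pf sig id_point) = convolve E H (%x y. kap (act x a) *\<^sub>E sig y) id_point id_point"
   unfolding HC.compose_compose[OF L.pts.points_hom[OF g]] conv_simps
   by (rule HC.convolve_compose[OF E_module m L.pts.points_hom[OF g] L.pts.points_hom[OF g] kl sig_linear])
  also have "... = pf (sweedler E H (%x y. kap (act x a) *\<^sub>E sig y)) id_point"
   by (rule L.pts.compose_point[OF E_module bilinear_comp[OF m kl sig_linear] g, symmetric])
  finally have "qm (pf sig id_point) (HC.const_hom E (kap a)) = pf (sweedler E H (%x y. kap (act x a) *\<^sub>E sig y)) id_point"
   unfolding eq[unfolded k[OF kap]] .
  then have "pf (%x. x) (qm (pf sig id_point) (HC.const_hom E (kap a))) h
   = pf (%x. x) (pf (sweedler E H (%x y. kap (act x a) *\<^sub>E sig y)) id_point) h" by simp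
  then show ?thesis
   using eval_const[of E "%x. x", OF _ sig_linear ka h] h by (simp add: klinear_def compose_eq id_point_def)
 qed
 show "sig h *\<^sub>E kap1 a = sweedler E H (%x y. kap1 (act x a) *\<^sub>E sig y) h"
 proof (rule fin[OF L.kap])
  have "qm (pf sig id_point) (kd1 a \<one>\<^bsub>L.pts.point_group\<^esub>) = qm (qm (pf lam1 id_point) (kd1 a \<one>\<^bsub>L.pts.point_group\<^esub>)) (pf rho id_point)"
   unfolding sig_points[OF g] Q.m_assoc[OF c(1,2,5)] Q.m_assoc[OF c(1,5,2)] commute_points(3)[OF g o a] ..
  also have "... = qm (kd1 a id_point) (pf sig id_point)"
   unfolding L.covariant[OF g o a] go sig_points[OF g] Q.m_assoc[OF c(3,1,2)] ..
  finally show "qm (pf sig id_point) (kd1 a \<one>\<^bsub>L.pts.point_group\<^esub>) = qm (kd1 a id_point) (pf sig id_point)" .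
 qed
 show "sig h *\<^sub>E kap2 a = sweedler E H (%x y. kap2 (act x a) *\<^sub>E sig y) h"
 proof (rule fin[OF R.kap])
  have "qm (pf sig id_point) (kd2 a \<one>\<^bsub>L.pts.point_group\<^esub>) = qm (pf lam1 id_point) (qm (kd2 a id_point) (pf rho id_point))"
   unfolding sig_points[OF g] Q.m_assoc[OF c(1,2,6)] R.covariant[OF g o a] go ..
  also have "... = qm (kd2 a id_point) (pf sig id_point)"
   unfolding sig_points[OF g] Q.m_assoc[OF c(1,4,2), symmetric] Q.m_assoc[OF c(4,1,2), symmetric] commute_points(2)[OF g g a] ..
  finally show "qm (pf sig id_point) (kd2 a \<one>\<^bsub>L.pts.point_group\<^esub>) = qm (kd2 a id_point) (pf sig id_point)" .
 qed
qed

lemma sig_kap_sweedler3: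
 assumes a: "a \<in> U A" and h: "h \<in> U H"
 shows "sweedler3 E H (%x y z. kap1 (act x a) *\<^sub>E (lam1 y *\<^sub>E rho z)) h = sig h *\<^sub>E kap1 a"
proof -
 have kc: "kap1 (act x a) \<in> U E" if "x \<in> U H" for x
  using klinearD(1)[OF L.kap] act_closed a that by simp
 have "sweedler E H (%y z. kap1 (act x a) *\<^sub>E (lam1 y *\<^sub>E rho z)) y = kap1 (act x a) *\<^sub>E sig y"
  if "x \<in> U H" "y \<in> U H" for x y
  unfolding sig_def
  using HC.sweedler_map[OF E_module E_module lam_rho_bilinear _ that(2), of "%e. kap1 (act x a) *\<^sub>E e"]
   E.mult_bilinear kc[OF that(1)] by (simp add: bilinear_def)
 then show ?thesis
  unfolding sweedler3_def sig_kap(1)[OF a h]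
  by (intro HC.sweedler_cong[OF E_module h]) (use kc klinearD(1)[OF sig_linear] in auto)
qed

end

section \<open>The algebra \<open>B\<close> and its right action\<close>

context k_algebra
begin

lemma generated_subalgebra_subset:
 "S <= U M ==> generated_subalgebra R M S <= U M"
 unfolding generated_subalgebra_def using carrier_is_subring by (intro Inter_lower) auto

lemma generated_subalgebra_closed:
 assumes S: "S <= U M"
 shows "s \<in> S ==> s \<in> generated_subalgebra R M S"
  and "1\<^sub>M \<in> generated_subalgebra R M S"
  and "0\<^sub>M \<in> generated_subalgebra R M S"
  and "[|x \<in> generated_subalgebra R M S; y \<in> generated_subalgebra R M S|] ==> x +\<^sub>M y \<in> generated_subalgebra R M S"
  and "[|x \<in> generated_subalgebra R M S; y \<in> generated_subalgebra R M S|] ==> x *\<^sub>M y \<in> generated_subalgebra R M S"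
  and "[|k \<in> U R; x \<in> generated_subalgebra R M S|] ==> k *.\<^sub>M x \<in> generated_subalgebra R M S"
 unfolding generated_subalgebra_def by (auto dest: subringE)

lemma generated_subalgebra_induct [consumes 2, case_names gen one add mult smult]:
 assumes S: "S <= U M" and z: "z \<in> generated_subalgebra R M S"
  and gen: "!!s. s \<in> S ==> P s" and one: "P 1\<^sub>M"
  and add: "!!x y. [|x \<in> generated_subalgebra R M S; y \<in> generated_subalgebra R M S; P x; P y|] ==> P (x +\<^sub>M y)"
  and mult: "!!x y. [|x \<in> generated_subalgebra R M S; y \<in> generated_subalgebra R M S; P x; P y|] ==> P (x *\<^sub>M y)"
  and smult: "!!k x. [|k \<in> U R; x \<in> generated_subalgebra R M S; P x|] ==> P (k *.\<^sub>M x)"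
 shows "P z"
proof -
 let ?U = "{x \<in> generated_subalgebra R M S. P x}"
 note c = generated_subalgebra_closed[OF S] and sub = generated_subalgebra_subset[OF S]
 have "\<ominus>\<^bsub>M\<^esub> x \<in> ?U" if x: "x \<in> ?U" for x
 proof -
  have xM: "x \<in> U M" using x sub by blast
  then have "\<ominus>\<^bsub>M\<^esub> x = \<ominus> \<one> *.\<^sub>M x" by (simp add: smult_l_minus)
  then show ?thesis using x c(6)[of "\<ominus> \<one>" x] smult[of "\<ominus> \<one>" x] by simp
 qed
 then have "subring ?U M" using c one add mult sub by (intro subringI) auto
 then have "generated_subalgebra R M S <= ?U"
  unfolding generated_subalgebra_def[of R M S]
  using c(1,6) gen smult by (intro Inter_lower) (auto simp: generated_subalgebra_def[symmetric])
 then show ?thesis using z by blast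
qed

end

lemma (in module) linear_ext_submodule:
 fixes W :: "('a, 'c, 'u) module_scheme"
 assumes W: "module R W" and incl: "klinear R W M (%x. x)" and \<phi>: "\<phi> \<in> lists S \<rightarrow> U W"
  and f: "f \<in> U (free_algebra R S)"
 shows "linear_ext R W \<phi> f = linear_ext R M \<phi> f"
proof -
 interpret W: module R W by (rule W)
 interpret F: k_algebra R "free_algebra R S" by (rule R.free_algebra_k_algebra)
 have \<phi>': "\<phi> \<in> lists S \<rightarrow> U M" using \<phi> klinearD(1)[OF incl] by blast
 note l1 = linear_comp[OF incl W.linear_ext_linear[OF \<phi>]] and l2 = linear_ext_linear[OF \<phi>']
 show ?thesis using f
 proof (induction f rule: R.FA_induct)
  case (monomial k w)
  have e: "(%v. k \<otimes> (if v = w then \<one> else \<zero>)) = k \<odot>\<^bsub>free_algebra R S\<^esub> (%v. if v = w then \<one> else \<zero>)"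
   by (simp add: free_algebra_simps)
  show ?case
   unfolding e klinearD(3)[OF l1 monomial(1) R.FA_delta[OF monomial(2)]] klinearD(3)[OF l2 monomial(1) R.FA_delta[OF monomial(2)]]
    W.linear_ext_delta[OF \<phi> monomial(2)] linear_ext_delta[OF \<phi>' monomial(2)] ..
 next
  case (add f g)
  have e: "(%v. f v \<oplus> g v) = f \<oplus>\<^bsub>free_algebra R S\<^esub> g" by (simp add: free_algebra_simps)
  show ?case unfolding e klinearD(2)[OF l1 add.hyps] klinearD(2)[OF l2 add.hyps] by (simp only: add.IH)
 qed
qed

context cocommutative_hopf_algebra
begin

interpretation HC: cocommutative_coalgebra K H by (rule cocommutative_coalgebra)
interpretation P: hopf_points K H HH by (rule two_variables)
interpretation O: hopf_points K H H by (rule one_variable)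
interpretation PG: group P.point_group by (rule P.group_points)
interpretation OG: group O.point_group by (rule O.group_points)
interpretation HP: k_algebra K HP by (rule HP_k_algebra)
interpretation PQ: monoid "conv K HH HP" by (rule P.C.conv_monoid[OF HP_k_algebra])
interpretation OQ: monoid "conv K H HP" by (rule HC.conv_monoid[OF HP_k_algebra])

abbreviation (input) "BA == B_alg K H"
abbreviation (input) "pe == par_e K H"
abbreviation (input) "bet b h == sweedler HP H (%x y. pc (antipode H x) *\<^sub>HP b *\<^sub>HP pc y) h"

lemma par_e_eq: "par_e K H = sweedler HP H (%x y. pc x *\<^sub>HP pc (antipode H y))"
 by (rule ext) (simp add: par_e_def)

lemmas HP_module = HP.module_axioms
lemmas pc_linear = conjunct1[OF par_class_partial_rep[unfolded partial_rep_def]]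
lemmas pcS_linear = linear_comp[OF pc_linear antipode_linear]
lemmas pe_linear = O.idempotent_linear[OF HP_k_algebra pc_linear, folded par_e_eq]
lemmas bet_bilinear = O.conjugate_bilinear[OF HP_k_algebra pc_linear]

lemma pe_subset: "pe ` U H <= U HP"
 by (auto simp: klinearD(1)[OF pe_linear])

lemma BA_simps:
 "U BA = generated_subalgebra K HP (pe ` U H)"
 "add BA = add HP" "zero BA = zero HP" "smult BA = smult HP" "monoid.mult BA = monoid.mult HP" "one BA = one HP"
 by (simp_all add: B_alg_def)

lemmas BA_closed = HP.generated_subalgebra_closed[OF pe_subset, folded BA_simps(1)]
lemmas BA_induct = HP.generated_subalgebra_induct[OF pe_subset, folded BA_simps(1), consumes 1, case_names gen one add mult smult]

lemma BA_subset: "b \<in> U BA ==> b \<in> U HP"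
 unfolding BA_simps(1) by (rule subsetD[OF HP.generated_subalgebra_subset[OF pe_subset]])

lemma BA_module: "module K BA"
 by (rule module_of_subset[OF HP_module BA_simps(2,3,4) BA_subset BA_closed(3,4,6)])

lemma BA_incl: "klinear K BA HP (%x. x)"
 by (simp add: klinear_def BA_subset BA_simps(2,4))

lemma pe_closed: "h \<in> U H ==> pe h \<in> U BA"
 by (rule BA_closed(1)) simp

lemma BA_mult_bilinear: "bilinear K BA BA BA (monoid.mult HP)"
 using HP.mult_bilinear by (simp add: multilinear BA_simps(2,4) BA_subset BA_closed(5))

lemma pe_commute:
 assumes h: "h \<in> U H" and k: "k \<in> U H"
 shows "pe h *\<^sub>HP pe k = pe k *\<^sub>HP pe h"
proof -
 note M = HP_module and m = HP.mult_bilinear and pp = proj_points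
 note pl = P.points_hom[OF proj_points(1)] P.points_hom[OF proj_points(2)]
 have b: "bilinear K H H HP (%h k. pe h *\<^sub>HP pe k)" "bilinear K H H HP (%h k. pe k *\<^sub>HP pe h)"
  using bilinear_comp[OF m pe_linear pe_linear] bilinear_flip[OF bilinear_comp[OF m pe_linear pe_linear]] by simp_all
 have e: "cmp HH pe g = cmp HH pc g \<ast>\<^sub>HP cmp HH pc (P.gi g)"
  if "g \<in> P.points" for g
  unfolding par_e_eq by (rule P.idempotent_point[OF HP_k_algebra pc_linear that])
 have "convolve HP HH (%h k. pe h *\<^sub>HP pe k) proj1 proj2 = cmp HH pe proj1 \<ast>\<^sub>HP cmp HH pe proj2"
  unfolding conv_simps by (rule P.C.convolve_compose[OF M m pl pe_linear pe_linear, symmetric])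
 also have "... = cmp HH pe proj2 \<ast>\<^sub>HP cmp HH pe proj1"
  unfolding e[OF pp(1)] e[OF pp(2)] by (rule P.pr_commute[OF HP_k_algebra par_class_partial_rep pp])
 also have "... = convolve HP HH (%k h. pe k *\<^sub>HP pe h) proj2 proj1"
  unfolding conv_simps by (rule P.C.convolve_compose[OF M m pl(2,1) pe_linear pe_linear])
 also have "... = convolve HP HH (%h k. pe k *\<^sub>HP pe h) proj1 proj2"
  by (rule P.C.convolve_commute[OF M b(2) pl])
 finally show ?thesis by (rule bilinear_eq_of_points[OF M b _ h k])
qed

text \<open>\<open>B\<close> is commutative because its generators are the commuting idempotents of the universal partial representation; \<open>trace_conjugate\<close> applies to the elements of \<open>B\<close> for this reason.\<close>
lemma BA_commute:
 assumes b: "b \<in> U BA" and k: "k \<in> U H"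
 shows "b *\<^sub>HP pe k = pe k *\<^sub>HP b"
proof -
 note pk = klinearD(1)[OF pe_linear k]
 show ?thesis using b
 proof (induction b rule: BA_induct)
  case (mult x y)
  note xy = BA_subset[OF mult.hyps(1)] BA_subset[OF mult.hyps(2)]
  have "x *\<^sub>HP y *\<^sub>HP pe k = x *\<^sub>HP (pe k *\<^sub>HP y)" using HP.m_assoc[OF xy pk] mult.IH(2) by simp
  also have "... = pe k *\<^sub>HP (x *\<^sub>HP y)"
   using HP.m_assoc[OF xy(1) pk xy(2)] HP.m_assoc[OF pk xy] mult.IH(1) by simp
  finally show ?case .
 qed (use k pk in \<open>auto simp: pe_commute BA_subset HP.l_distr HP.r_distr HP.smult_mult_left HP.smult_mult_right\<close>)
qed

abbreviation (input) star1 (infixl "\<bullet>" 70)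
 where "f \<bullet> g == f \<otimes>\<^bsub>conv K H HP\<^esub> g"
abbreviation (input) "pcg == cmp H pc id_point"
abbreviation (input) "pcgi == cmp H pc (O.gi id_point)"

lemma bet_one: "h \<in> U H ==> bet 1\<^sub>HP h = pe (antipode H h)"
proof -
 assume h: "h \<in> U H"
 note aH = klinearD(1)[OF antipode_linear] and pH = klinearD(1)[OF pc_linear]
 have "pe (antipode H h) = sweedler HP H (%x y. pc (antipode H x) *\<^sub>HP pc (antipode H (antipode H y))) h"
  unfolding par_e_def by (rule sweedler_antipode[OF HP_module bilinear_comp[OF HP.mult_bilinear pc_linear pcS_linear] h])
 also have "... = bet 1\<^sub>HP h"
  by (rule HC.sweedler_cong[OF HP_module h]) (auto simp: antipode_antipode pH aH)
 finally show ?thesis ..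
qed

lemma BA_commute_points:
 assumes b: "b \<in> U BA"
 shows "pcg \<bullet> pcgi \<bullet> HC.const_hom HP b = HC.const_hom HP b \<bullet> (pcg \<bullet> pcgi)"
proof -
 note M = HP_module and m = HP.mult_bilinear and g = id_point and bb = BA_subset[OF b]
 show ?thesis
  unfolding O.idempotent_point[OF HP_k_algebra pc_linear g, folded par_e_eq, symmetric]
  unfolding conv_simps HC.convolve_const_left[OF M M m bb O.br_hom[OF pe_linear g]]
   HC.convolve_const_right[OF M M m bb O.br_hom[OF pe_linear g]]
  unfolding HC.compose_compose[OF O.points_hom[OF g]]
  by (rule HC.compose_cong[OF O.points_hom[OF g]]) (simp add: BA_commute[OF b])
qed

text \<open>Conjugation by a point is multiplicative on elements that commute with its idempotent.\<close>
lemma bet_mult: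
 assumes b: "b \<in> U BA" and b': "b' \<in> U BA" and h: "h \<in> U H"
 shows "bet (b *\<^sub>HP b') h = sweedler HP H (%x y. bet b x *\<^sub>HP bet b' y) h"
proof -
 note M = HP_module and m = HP.mult_bilinear and g = id_point
 note bb = BA_subset[OF b] BA_subset[OF b']
 note pr = HP_k_algebra par_class_partial_rep
 note ig = OG.inv_closed[of id_point, unfolded O.point_group_simps(1), OF g]
 note c = O.pr_closed[OF pr g] O.pr_closed[OF pr ig] HC.const_hom_hom[OF M bb(1), folded conv_simps(1)] HC.const_hom_hom[OF M bb(2), folded conv_simps(1)]
 let ?s = "pcg" and ?i = "pcgi"
 let ?b = "HC.const_hom HP b" and ?b' = "HC.const_hom HP b'"
 have bl: "klinear K H HP (bet b)" if "b \<in> U HP" for b using bet_bilinear that by (simp add: bilinear_def)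
 have bB: "bilinear K H H HP (%x y. bet b x *\<^sub>HP bet b' y)" by (rule bilinear_comp[OF m bl[OF bb(1)] bl[OF bb(2)]])
 note comm = BA_commute_points[OF b']
 have absorb: "?i \<bullet> ?s \<bullet> ?i = ?i"
  using O.pr_idem_absorb[OF pr ig] OG.inv_inv[of id_point] g by (simp only: O.point_group_simps(1))
 have mc: "HC.const_hom HP (b *\<^sub>HP b') = ?b \<bullet> ?b'"
  unfolding conv_simps HC.convolve_const_left[OF M M m bb(1) HC.const_hom_hom[OF M bb(2)]]
  by (rule HC.compose_const_hom[symmetric, OF _ bb(2)]) (use m bb(1) in \<open>simp add: bilinear_def\<close>)
 have "cmp H (bet (b *\<^sub>HP b')) id_point = ?i \<bullet> (?b \<bullet> ?b') \<bullet> ?s"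
  unfolding O.conjugate_point_const[OF HP_k_algebra pc_linear g HP.m_closed[OF bb]] mc ..
 also have "... = (?i \<bullet> ?b \<bullet> ?s) \<bullet> (?i \<bullet> ?b' \<bullet> ?s)"
 proof -
  have "(?i \<bullet> ?b \<bullet> ?s) \<bullet> (?i \<bullet> ?b' \<bullet> ?s)
   = ?i \<bullet> ?b \<bullet> (?s \<bullet> ?i \<bullet> ?b') \<bullet> ?s"
   using c by (simp only: OQ.m_assoc OQ.m_closed)
  also have "... = ?i \<bullet> ?b \<bullet> (?b' \<bullet> (?s \<bullet> ?i)) \<bullet> ?s"
   by (simp only: comm)
  also have "... = ?i \<bullet> (?b \<bullet> ?b') \<bullet> (?s \<bullet> ?i \<bullet> ?s)"
   using c by (simp only: OQ.m_assoc OQ.m_closed)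
  finally show ?thesis by (simp only: O.pr_idem_absorb[OF pr g])
 qed
 also have "... = cmp H (sweedler HP H (%x y. bet b x *\<^sub>HP bet b' y)) id_point"
  unfolding O.conjugate_point_const[OF HP_k_algebra pc_linear g bb(1), symmetric] O.conjugate_point_const[OF HP_k_algebra pc_linear g bb(2), symmetric]
  unfolding conv_simps O.compose_point[OF M bB g]
  by (rule HC.convolve_compose[OF M m O.points_hom[OF g] O.points_hom[OF g] bl[OF bb(1)] bl[OF bb(2)]])
 finally have "cmp H (bet (b *\<^sub>HP b')) id_point h = cmp H (sweedler HP H (%x y. bet b x *\<^sub>HP bet b' y)) id_point h"
  by simp
 then show ?thesis using h by (simp add: compose_eq id_point_def)
qed

text \<open>\<open>[g\<^sup>-\<^sup>1] \<epsilon>\<^sub>k [g] = \<epsilon>\<^sub>g\<^sup>-\<^sup>1\<^sub>k [g\<^sup>-\<^sup>1] [g]\<close> is a product of two of the idempotents; with \<open>bet_mult\<close> it follows that \<open>B\<close> is stable under conjugation.\<close>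
lemma bet_pe:
 assumes h: "h \<in> U H" and k: "k \<in> U H" shows "bet (pe k) h \<in> U BA"
proof -
 note M = HP_module and m = HP.mult_bilinear and pp = proj_points
 note pr = HP_k_algebra par_class_partial_rep
 note pl = P.points_hom[OF pp(1)] P.points_hom[OF pp(2)]
 let ?i = "P.gi proj1"
 have i: "?i \<in> P.points" and ik: "?i \<otimes>\<^bsub>P.point_group\<^esub> proj2 \<in> P.points"
  using PG.inv_closed[of proj1] PG.m_closed[of "?i" proj2] pp by simp_all
 have ii: "P.gi ?i = proj1" using PG.inv_inv[of proj1] pp by (simp only: P.point_group_simps(1))
 have e: "cmp HH pe g = cmp HH pc g \<ast>\<^sub>HP cmp HH pc (P.gi g)"
  if "g \<in> P.points" for g
  unfolding par_e_eq by (rule P.idempotent_point[OF HP_k_algebra pc_linear that])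
 note c = P.pr_closed[OF pr pp(1)] P.pr_closed[OF pr i] P.br_hom[OF pe_linear ik, folded conv_simps(1)]
 have peB: "klinear K H BA pe"
  using pe_linear by (simp add: klinear_def BA_simps(2,4) pe_closed)
 note peH = P.br_hom[OF peB ik] P.br_hom[OF peB i]
 have bb: "bilinear K H H HP (%h k. bet (pe k) h)"
  using bilinear_flip[OF bilinear_comp[OF bet_bilinear pe_linear, of H "%x. x"]] by (simp add: klinear_def)
 have "convolve HP HH (%h k. bet (pe k) h) proj1 proj2 = convolve HP HH (%k h. bet (pe k) h) proj2 proj1"
  by (rule P.C.convolve_commute[OF M bb pl, symmetric])
 also have "... = convolve HP HH (%b h. bet b h) (cmp HH pe proj2) proj1"
  by (rule P.C.convolve_compose_left[OF M bet_bilinear pl(2,1) pe_linear, symmetric])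
 also have "... = cmp HH pc ?i \<ast>\<^sub>HP cmp HH pe proj2 \<ast>\<^sub>HP cmp HH pc proj1"
  by (rule P.conjugate_point[OF HP_k_algebra pc_linear pp(1) P.br_hom[OF pe_linear pp(2)]])
 also have "... = cmp HH pe (?i \<otimes>\<^bsub>P.point_group\<^esub> proj2) \<ast>\<^sub>HP cmp HH pc ?i \<ast>\<^sub>HP cmp HH pc proj1"
  by (simp only: e[OF pp(2)] e[OF ik] P.pr_shift[OF pr i pp(2)])
 also have "... = cmp HH pe (?i \<otimes>\<^bsub>P.point_group\<^esub> proj2) \<ast>\<^sub>HP cmp HH pe ?i"
  unfolding e[OF i] ii using c by (simp only: PQ.m_assoc)
 also have "... = convolve BA HH (monoid.mult HP) (cmp HH pe (?i \<otimes>\<^bsub>P.point_group\<^esub> proj2)) (cmp HH pe ?i)"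
  unfolding conv_simps by (rule P.C.convolve_submodule[OF BA_module M BA_incl BA_mult_bilinear peH, symmetric])
 finally have "bet (pe k) h = convolve BA HH (monoid.mult HP) (cmp HH pe (?i \<otimes>\<^bsub>P.point_group\<^esub> proj2)) (cmp HH pe ?i) (kpure K H H h k)"
  by (simp only: convolve_proj(1)[OF M bb h k, symmetric])
 also have "... \<in> U BA"
  by (rule module_homD(2)[OF P.C.convolve_hom[OF BA_module BA_mult_bilinear peH]])
   (use bilinearD(1)[OF kpure_bilinear[OF module_axioms module_axioms] h k] in \<open>simp add: tensor_coalgebra_def Let_def\<close>)
 finally show ?thesis .
qed

lemma bet_closed:
 assumes b: "b \<in> U BA" and h: "h \<in> U H" shows "bet b h \<in> U BA"
 using b h
proof (induction b arbitrary: h rule: BA_induct)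
 case (gen s)
 then show ?case by (auto simp: bet_pe)
next
 case one
 then show ?case by (simp add: bet_one pe_closed klinearD(1)[OF antipode_linear])
next
 case (add x y)
 then show ?case using bilinearD(2)[OF bet_bilinear] by (simp add: BA_subset BA_closed(4))
next
 case (mult x y)
 have l: "klinear K H BA (%h. bet b h)" if "b \<in> U BA" "!!h. h \<in> U H ==> bet b h \<in> U BA" for b
  using bet_bilinear BA_subset[OF that(1)] that(2) by (simp add: multilinear BA_simps(2,4))
 have b: "bilinear K H H BA (%u v. bet x u *\<^sub>HP bet y v)"
  by (rule bilinear_comp[OF BA_mult_bilinear l[OF mult.hyps(1) mult.IH(1)] l[OF mult.hyps(2) mult.IH(2)]])
 show ?case
  unfolding bet_mult[OF mult.hyps mult.prems] HC.sweedler_submodule[OF BA_module HP_module BA_incl b mult.prems, symmetric]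
  by (rule klinearD(1)[OF HC.sweedler_linear[OF BA_module b] mult.prems])
next
 case (smult k x)
 then show ?case using bilinearD(4)[OF bet_bilinear] by (simp add: BA_subset BA_closed(6))
qed

abbreviation (input) "XX == alg_tensor K (opposite HP) HP"
abbreviation (input) "xp == kpure K (opposite HP) HP"

lemmas op_module = opposite_module[OF HP_module]
lemmas XX_k_algebra = alg_tensor_k_algebra[OF opposite_k_algebra[OF HP_k_algebra] HP_k_algebra]
lemmas xp_mult = alg_tensor_mult_kpure[OF op_module HP_module opposite_mult_bilinear[OF HP.mult_bilinear] HP.mult_bilinear]
interpretation XX: k_algebra K XX by (rule XX_k_algebra)

lemma xp_bilinear: "bilinear K HP HP XX xp"
 using kpure_bilinear[OF op_module HP_module] by (simp add: multilinear)

text \<open>The right action of \<open>H\<^sub>p\<^sub>a\<^sub>r\<close> on \<open>B\<close> is given on words by iterated conjugation. Multiplication from both sides is an action of \<open>H\<^sub>p\<^sub>a\<^sub>r\<^sup>o\<^sup>p \<otimes> H\<^sub>p\<^sub>a\<^sub>r\<close>, and \<open>h \<mapsto> \<Sum> [S h\<^sub>1] \<otimes> [h\<^sub>2]\<close> is a partial representation there,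
  so the universal property shows that the action is well defined.\<close>
definition sandwich :: "('a, 'c) par => (('a, 'c) par, ('a, 'c) par) tensor => ('a, 'c) par"
 where "sandwich b = tensor_lift HP (%u v. u *\<^sub>HP b *\<^sub>HP v)"

lemma sandwich_trilinear: "trilinear K HP (opposite HP) HP HP (%b u v. u *\<^sub>HP b *\<^sub>HP v)"
 using HP.mult_bilinear by (simp add: multilinear)

lemma sandwich_bilinear: "bilinear K HP XX HP sandwich"
 unfolding bilinear_def sandwich_def
 using tensor_lift_param[OF op_module HP_module HP_module HP_module sandwich_trilinear]
  tensor_lift_linear[OF op_module HP_module HP_module] sandwich_trilinear by (simp add: trilinear_def)

lemma sandwich_pure: "[|b \<in> U HP; u \<in> U HP; v \<in> U HP|] ==> sandwich b (xp u v) = u *\<^sub>HP b *\<^sub>HP v"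
 unfolding sandwich_def using sandwich_trilinear
 by (intro tensor_lift_kpure[OF op_module HP_module HP_module]) (simp_all add: trilinear_def)

lemma sandwich_mult:
 assumes b: "b \<in> U HP" and s: "s \<in> U XX" and t: "t \<in> U XX"
 shows "sandwich b (s *\<^sub>XX t) = sandwich (sandwich b s) t"
proof -
 note sd = bilinearD[OF sandwich_bilinear] and md = bilinearD[OF XX.mult_bilinear]
  and xc = bilinearD(1)[OF xp_bilinear]
 have 1: "sandwich b (xp u v *\<^sub>XX t) = sandwich (sandwich b (xp u v)) t" if uv: "u \<in> U HP" "v \<in> U HP" for u v
  using t[simplified]
 proof (induction t rule: ktensor_induct[OF op_module HP_module, consumes 1, case_names pure add])
  case (pure x y)
  then show ?case using uv b by (simp add: xp_mult sandwich_pure HP.m_assoc)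
 next
  case (add x y)
  then show ?case using uv b sd md xc by simp
 qed
 show ?thesis using s[simplified]
 proof (induction s rule: ktensor_induct[OF op_module HP_module, consumes 1, case_names pure add])
  case (pure x y)
  then show ?case by (simp add: 1)
 next
  case (add x y)
  then show ?case using b t sd md by simp
 qed
qed

definition tauX :: "'c => (('a, 'c) par, ('a, 'c) par) tensor"
 where "tauX = sweedler XX H (%x y. xp (pc (antipode H x)) 1\<^sub>HP *\<^sub>XX xp 1\<^sub>HP (pc y))"

lemma xp_homs:
 "algebra_hom K (opposite HP) XX (%u. xp u 1\<^sub>HP)" "algebra_hom K HP XX (%v. xp 1\<^sub>HP v)"
 using xp_bilinear by (auto simp: algebra_hom_def bilinear_def xp_mult)

lemma tauX_factors:
 "partial_rep K H XX (%h. xp (pc (antipode H h)) 1\<^sub>HP)" "partial_rep K H XX (%h. xp 1\<^sub>HP (pc h))"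
 using partial_rep_algebra_hom[OF opposite_k_algebra[OF HP_k_algebra] XX_k_algebra partial_rep_opposite[OF HP_k_algebra par_class_partial_rep] xp_homs(1)]
  partial_rep_algebra_hom[OF HP_k_algebra XX_k_algebra par_class_partial_rep xp_homs(2)] by simp_all

lemma xp_commute:
 "[|u \<in> U HP; v \<in> U HP|] ==> xp u 1\<^sub>HP *\<^sub>XX xp 1\<^sub>HP v = xp 1\<^sub>HP v *\<^sub>XX xp u 1\<^sub>HP"
 by (simp add: xp_mult)

lemma tauX_partial_rep: "partial_rep K H XX tauX"
 unfolding tauX_def
 by (rule partial_rep_product[OF XX_k_algebra tauX_factors])
  (simp add: xp_commute klinearD(1)[OF pc_linear] klinearD(1)[OF antipode_linear])

lemmas tauX_linear = conjunct1[OF tauX_partial_rep[unfolded partial_rep_def]]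

lemma tauX_factors_bilinear: "bilinear K H H XX (%x y. xp (pc (antipode H x)) 1\<^sub>HP *\<^sub>XX xp 1\<^sub>HP (pc y))"
 by (rule bilinear_comp[OF XX.mult_bilinear tauX_factors(1)[unfolded partial_rep_def, THEN conjunct1] tauX_factors(2)[unfolded partial_rep_def, THEN conjunct1]])

lemma sandwich_tauX:
 assumes b: "b \<in> U HP" and h: "h \<in> U H" shows "sandwich b (tauX h) = bet b h"
proof -
 have l: "klinear K XX HP (sandwich b)" using sandwich_bilinear b by (simp add: bilinear_def)
 have "sandwich b (tauX h) = sweedler HP H (%x y. sandwich b (xp (pc (antipode H x)) 1\<^sub>HP *\<^sub>XX xp 1\<^sub>HP (pc y))) h"
  unfolding tauX_def by (rule HC.sweedler_map[OF XX.module_axioms HP_module tauX_factors_bilinear l h])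
 also have "... = bet b h"
  by (rule HC.sweedler_cong[OF HP_module h])
   (simp_all add: xp_mult sandwich_pure b klinearD(1)[OF pc_linear] klinearD(1)[OF antipode_linear])
 finally show ?thesis .
qed

abbreviation (input) "tX == par_extend K XX (word_prod XX tauX)"
lemmas tX_hom = par_extend_algebra_hom[OF XX_k_algebra tauX_partial_rep]
lemmas tX_linear = conjunct1[OF tX_hom(1)[unfolded algebra_hom_def]]

lemma foldl_bet:
 assumes "w \<in> lists (U H)" "b \<in> U HP"
 shows "foldl (%b h. bet b h) b w = sandwich b (word_prod XX tauX w)"
 using assms
proof (induction w arbitrary: b rule: list.induct)
 case Nil
 then show ?case by (simp add: word_prod_def sandwich_pure)
next
 case (Cons h w)
 then have hw: "h \<in> U H" "w \<in> lists (U H)" by simp_all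
 have "word_prod XX tauX (h # w) = tauX h *\<^sub>XX word_prod XX tauX w" by (simp add: word_prod_def)
 then show ?case
  using Cons.IH[OF hw(2) bilinearD(1)[OF bet_bilinear Cons.prems(2) hw(1)]]
   sandwich_mult[OF Cons.prems(2) klinearD(1)[OF tauX_linear hw(1)] word_prod_closed[OF XX_k_algebra tauX_partial_rep hw(2)]]
  by (simp add: sandwich_tauX[OF Cons.prems(2) hw(1)])
qed

lemma foldl_bet_closed: "[|w \<in> lists (U H); b \<in> U BA|] ==> foldl (%b h. bet b h) b w \<in> U BA"
 by (induction w arbitrary: b rule: list.induct) (auto simp: bet_closed)

lemma B_right_action:
 assumes b: "b \<in> U BA" and z: "z \<in> U HP"
 shows "B_right_action K H b z = sandwich b (tX z)" and "B_right_action K H b z \<in> U BA"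
proof -
 interpret BA: module K BA by (rule BA_module)
 let ?\<phi> = "%w. foldl (%b h. bet b h) b w"
 have f: "?\<phi> \<in> lists (U H) \<rightarrow> U BA" using b by (auto simp: foldl_bet_closed)
 have l: "klinear K XX HP (sandwich b)" using sandwich_bilinear BA_subset[OF b] by (simp add: bilinear_def)
 have 1: "B_right_action K H b z = linear_ext K BA ?\<phi> (rep z)"
  unfolding B_right_action_def par_right_action_def par_extend_eq ..
 also have "... = par_extend K HP ?\<phi> z"
  unfolding par_extend_eq by (rule HP.linear_ext_submodule[OF BA_module BA_incl f rep(4)[OF z]])
 also have "... = sandwich b (tX z)"
  by (rule par_extend_factor[OF XX_k_algebra tauX_partial_rep HP_module l z foldl_bet]) (auto simp: BA_subset b)
 finally show "B_right_action K H b z = sandwich b (tX z)" .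
 show "B_right_action K H b z \<in> U BA"
  unfolding 1 by (rule klinearD(1)[OF BA.linear_ext_linear[OF f] rep(4)[OF z]])
qed

lemma sandwich_pe:
 assumes c: "c \<in> U BA" and h: "h \<in> U H"
 shows "sandwich c (tX (pe h)) = c *\<^sub>HP pe h"
proof -
 note M = HP_module and m = HP.mult_bilinear and g = id_point and pr = HP_k_algebra par_class_partial_rep
 note cc = BA_subset[OF c] and pH = klinearD(1)[OF pc_linear] and aH = klinearD(1)[OF antipode_linear]
 note tXm = tX_hom(1)[unfolded algebra_hom_def, THEN conjunct2, THEN conjunct2, rule_format]
 note ig = OG.inv_closed[of id_point, unfolded O.point_group_simps(1), OF g]
 have ii: "O.gi (O.gi id_point) = id_point" using OG.inv_inv[of id_point] g by (simp only: O.point_group_simps(1))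
 have l: "klinear K HP HP (%z. sandwich c (tX z))"
  by (rule linear_comp[OF _ tX_linear]) (use sandwich_bilinear cc in \<open>simp add: bilinear_def\<close>)
 have bl: "klinear K H HP (bet c)" using bet_bilinear cc by (simp add: bilinear_def)
 note bb = bilinear_comp[OF bet_bilinear bl antipode_linear]
 note q = O.pr_closed[OF pr g] O.pr_closed[OF pr ig] HC.const_hom_hom[OF M cc, folded conv_simps(1)]
 note e = O.idempotent_point[OF HP_k_algebra pc_linear g, folded par_e_eq]
 let ?c = "HC.const_hom HP c"
 have "sandwich c (tX (pe h)) = sweedler HP H (%x y. sandwich c (tX (pc x *\<^sub>HP pc (antipode H y)))) h"
  unfolding par_e_eq by (rule HC.sweedler_map[OF M M bilinear_comp[OF m pc_linear pcS_linear] l h])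
 also have "... = sweedler HP H (%x y. bet (bet c x) (antipode H y)) h"
  by (rule HC.sweedler_cong[OF M h])
   (simp_all add: tXm tX_hom(2) pH aH sandwich_tauX[OF cc] sandwich_tauX[OF bilinearD(1)[OF bet_bilinear cc]]
    bilinearD(1)[OF bet_bilinear bilinearD(1)[OF bet_bilinear cc]]
    sandwich_mult[OF cc klinearD(1)[OF tauX_linear] klinearD(1)[OF tauX_linear]] bilinearD(1)[OF bet_bilinear cc])
 finally have 1: "sandwich c (tX (pe h)) = sweedler HP H (%x y. bet (bet c x) (antipode H y)) h" .
 have "cmp H (sweedler HP H (%x y. bet (bet c x) (antipode H y))) id_point = convolve HP H (%b h. bet b h) (cmp H (bet c) id_point) (O.gi id_point)"
  unfolding O.compose_point[OF M bb g] O.inv_point[OF g]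
  by (rule HC.convolve_compose[OF M bet_bilinear O.points_hom[OF g] O.points_hom[OF g] bl antipode_linear, symmetric])
 also have "... = pcg \<bullet> (pcgi \<bullet> ?c \<bullet> pcg) \<bullet> pcgi"
  unfolding O.conjugate_point[OF HP_k_algebra pc_linear ig O.br_hom[OF bl g]]
  unfolding ii O.conjugate_point_const[OF HP_k_algebra pc_linear g cc] ..
 also have "... = (pcg \<bullet> pcgi \<bullet> ?c) \<bullet> (pcg \<bullet> pcgi)" using q by (simp only: OQ.m_assoc OQ.m_closed)
 also have "... = ?c \<bullet> ((pcg \<bullet> pcgi) \<bullet> (pcg \<bullet> pcgi))"
  unfolding BA_commute_points[OF c] using q by (simp only: OQ.m_assoc OQ.m_closed)
 also have "... = ?c \<bullet> cmp H pe id_point" unfolding O.pr_idem[OF pr g] e ..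
 also have "... = cmp H (%h. c *\<^sub>HP pe h) id_point"
  unfolding conv_simps HC.convolve_const_left[OF M M m cc O.br_hom[OF pe_linear g]]
  unfolding HC.compose_compose[OF O.points_hom[OF g]] ..
 finally have "cmp H (sweedler HP H (%x y. bet (bet c x) (antipode H y))) id_point h = cmp H (%h. c *\<^sub>HP pe h) id_point h" by simp
 then show ?thesis using h by (simp add: 1 compose_eq id_point_def)
qed

text \<open>Elements of \<open>B\<close> act on \<open>B\<close> by multiplication. For a generator, conjugation by \<open>g\<close> and then by \<open>g\<^sup>-\<^sup>1\<close> multiplies by \<open>\<epsilon>\<^sub>g\<close> on both sides of an element that commutes with it.
  In particular \<open>B\<close> is generated by \<open>1\<close> as a right module.\<close>
lemma B_right_action_B:
 assumes c: "c \<in> U BA" and b: "b \<in> U BA"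
 shows "B_right_action K H c b = c *\<^sub>HP b"
proof -
 note tXd = klinearD[OF tX_linear] and sd = bilinearD[OF sandwich_bilinear]
 note tXm = tX_hom(1)[unfolded algebra_hom_def, THEN conjunct2]
 have "sandwich c (tX b) = c *\<^sub>HP b" using b c
 proof (induction b arbitrary: c rule: BA_induct)
  case (gen s)
  then show ?case by (auto simp: sandwich_pe)
 next
  case one
  then show ?case using tXm by (simp add: sandwich_pure BA_subset)
 next
  case (add x y)
  then show ?case using tXd sd by (simp add: BA_subset HP.r_distr)
 next
  case (mult x y)
  then show ?case using tXm tXd
   by (simp add: sandwich_mult BA_subset BA_closed(5) HP.m_assoc)
 next
  case (smult k x)
  then show ?case using tXd sd by (simp add: BA_subset HP.smult_mult_right)
 qed
 then show ?thesis by (simp add: B_right_action(1)[OF c BA_subset[OF b]])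
qed

end

section \<open>Coinvariants of bimodules\<close>

lemma restrict_scalars_left_module:
 fixes M :: "('r, 'm) module" and S :: "('s, 'x) ring_scheme"
 assumes M: "left_module R M" and S: "ring S" and \<phi>: "\<phi> \<in> ring_hom S R"
 shows "left_module S (restrict_scalars \<phi> M)"
proof -
 interpret M: left_module R M by (rule M)
 interpret S: ring S by (rule S)
 have "abelian_group (restrict_scalars \<phi> M)"
  by (rule abelian_groupI) (auto simp: restrict_scalars_def M.M.a_ac intro: M.M.l_neg bexI[of _ "\<ominus>\<^bsub>M\<^esub> x" for x])
 then show ?thesis
  using \<phi> M.smult_closed M.smult_l_distr M.smult_r_distr M.smult_assoc M.smult_one
  by (intro left_module.intro left_module_axioms.intro S) (auto simp: restrict_scalars_def ring_hom_def Pi_def)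
qed

lemma alg_tensor_lift_hom:
 assumes X: "k_algebra K X" and Y: "k_algebra K Y" and E: "k_algebra K E" and b: "bilinear K X Y E b"
  and one: "b 1\<^sub>X 1\<^sub>Y = 1\<^sub>E"
  and mult: "!!x y x' y'. [|x \<in> U X; y \<in> U Y; x' \<in> U X; y' \<in> U Y|]
   ==> b (x *\<^sub>X x') (y *\<^sub>Y y') = b x y *\<^sub>E b x' y'"
 shows "algebra_hom K (alg_tensor K X Y) E (tensor_lift E b)"
proof -
 interpret X: k_algebra K X by (rule X)
 interpret Y: k_algebra K Y by (rule Y)
 interpret E: k_algebra K E by (rule E)
 interpret XY: k_algebra K "alg_tensor K X Y" by (rule alg_tensor_k_algebra[OF X Y])
 note M = X.module_axioms Y.module_axioms and EM = E.module_axioms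
 note l = tensor_lift_linear[OF M EM b] and ld = klinearD[OF tensor_lift_linear[OF M EM b]]
 note pure = tensor_lift_kpure[OF M EM b]
 note mp = alg_tensor_mult_kpure[OF M X.mult_bilinear Y.mult_bilinear] and md = bilinearD[OF XY.mult_bilinear]
 note pcl = bilinearD(1)[OF kpure_bilinear[OF M]] and bc = bilinearD(1)[OF b]
 have 1: "tensor_lift E b (kpure K X Y x y \<otimes>\<^bsub>alg_tensor K X Y\<^esub> t) = b x y *\<^sub>E tensor_lift E b t"
  if xy: "x \<in> U X" "y \<in> U Y" and t: "t \<in> U (ktensor K X Y)" for x y t
  using t
 proof (induction t rule: ktensor_induct[OF M, consumes 1, case_names pure add])
  case (pure x' y')
  then show ?case using xy by (simp add: mp tensor_lift_kpure[OF M EM b] mult)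
 next
  case (add s t)
  then show ?case using xy md(1)[of "kpure K X Y x y" s] md(1)[of "kpure K X Y x y" t]
   md(3)[of "kpure K X Y x y" s t] pcl[OF xy] bc[OF xy] by (simp add: ld E.r_distr)
 qed
 have 2: "tensor_lift E b (s \<otimes>\<^bsub>alg_tensor K X Y\<^esub> t) = tensor_lift E b s *\<^sub>E tensor_lift E b t"
  if s: "s \<in> U (ktensor K X Y)" and t: "t \<in> U (ktensor K X Y)" for s t
  using s
 proof (induction s rule: ktensor_induct[OF M, consumes 1, case_names pure add])
  case (pure x' y')
  then show ?case using t by (simp add: 1 tensor_lift_kpure[OF M EM b])
 next
  case (add u v)
  then show ?case using t md(1)[of u t] md(1)[of v t] md(2)[of u v t] by (simp add: ld E.l_distr)
 qed
 show ?thesis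
  unfolding algebra_hom_def using l one 2 by (simp add: pure)
qed

locale unital_bilinear_algebra = R: module K R
 for K :: "('k, 'x) ring_scheme" and R :: "('k, 'r, 'y) module_scheme" +
 assumes R_mult: "bilinear K R R R (monoid.mult R)"
  and R_one: "1\<^sub>R \<in> U R"
  and R_one_left: "x \<in> U R ==> 1\<^sub>R *\<^sub>R x = x"
  and R_one_right: "x \<in> U R ==> x *\<^sub>R 1\<^sub>R = x"
begin

abbreviation (input) "Ren == enveloping K R"
abbreviation (input) "kp == kpure K R (opposite R)"

lemmas R = R.module_axioms
lemmas op = opposite_module[OF R]

lemma Ren_simps:
 "U Ren = U (ktensor K R (opposite R))" "add Ren = add (ktensor K R (opposite R))"
 "smult Ren = smult (ktensor K R (opposite R))" "1\<^sub>Ren = kp 1\<^sub>R 1\<^sub>R"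
 by (simp_all add: enveloping_def)

lemma Ren_mult_bilinear: "bilinear K Ren Ren Ren (monoid.mult Ren)"
 unfolding enveloping_def by (rule alg_tensor_mult_bilinear[OF R op R_mult opposite_mult_bilinear[OF R_mult]])

lemma Ren_mult:
 "[|x \<in> U R; y \<in> U R; x' \<in> U R; y' \<in> U R|] ==>
  kp x y *\<^sub>Ren kp x' y' = kp (x *\<^sub>R x') (y' *\<^sub>R y)"
 unfolding enveloping_def using alg_tensor_mult_kpure[OF R op R_mult opposite_mult_bilinear[OF R_mult], of x y x' y'] by simp

lemma kp_bilinear: "bilinear K R R Ren kp"
 using kpure_bilinear[OF R op] by (simp add: multilinear Ren_simps(1,2,3))

lemma kp_closed: "[|x \<in> U R; y \<in> U R|] ==> kp x y \<in> U Ren"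
 by (rule bilinearD(1)[OF kp_bilinear])

abbreviation (input) "jl x == kp x 1\<^sub>R"
abbreviation (input) "jr x == kp 1\<^sub>R x"

lemma env_trilinear: "trilinear K R R (opposite R) R (%x a b. b *\<^sub>R x *\<^sub>R a)"
 using R_mult by (simp add: multilinear)

lemma env_right_action_bilinear: "bilinear K R Ren R (env_right_action R)"
proof -
 have "bilinear K R (ktensor K R (opposite R)) R (env_right_action R)"
  unfolding bilinear_def env_right_action_def[abs_def]
  using tensor_lift_param[OF R op R R env_trilinear] tensor_lift_linear[OF R op R] env_trilinear
  by (simp add: trilinear_def)
 then show ?thesis by (simp add: multilinear Ren_simps(1,2,3))
qed

lemma env_right_action_pure:
 "[|x \<in> U R; a \<in> U R; b \<in> U R|] ==> env_right_action R x (kp a b) = b *\<^sub>R x *\<^sub>R a"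
 unfolding env_right_action_def using env_trilinear
 by (intro tensor_lift_kpure[OF R op R]) (simp_all add: trilinear_def)

lemma functor_data: "tensor_functor_data K Ren (env_right_action R) R"
 by (intro tensor_functor_data.intro tensor_functor_data_axioms.intro R) (simp_all add: bilinearD[OF env_right_action_bilinear])

end

locale bimodule_coinvariants = unital_bilinear_algebra K R
 for K :: "('k, 'x) ring_scheme" and R :: "('k, 'r, 'y) module_scheme"
  and M :: "(('r, 'r) tensor, 'm, 'z) module_scheme" +
 assumes M: "left_module (enveloping K R) M"
begin

abbreviation (input) "TP == tensor_product Ren (env_right_action R) R M"

interpretation M: left_module Ren M by (rule M)

lemma Ren_k_algebra: "k_algebra K Ren"
proof -
 note d = bilinearD(4,5)[OF Ren_mult_bilinear]
 have "module K Ren" unfolding enveloping_def by (rule alg_tensor_module[OF R op])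
 then show ?thesis
  by (intro k_algebra.intro k_algebra_axioms.intro M.R.ring_axioms) (simp_all add: d)
qed

interpretation Ren: k_algebra K Ren by (rule Ren_k_algebra)

interpretation F: tensor_functor_data K Ren "env_right_action R" R by (rule functor_data)

lemma TP_tensor_module: "tensor_module K Ren (env_right_action R) R M"
 by (rule F.tensor_module[OF M])

interpretation T: tensor_module K Ren "env_right_action R" R M by (rule TP_tensor_module)

lemmas TP_module = T.T_module
interpretation TM: module K TP by (rule TP_module)

definition coinv :: "'m => ('r, 'm) tensor"
 where "coinv m = pure_tensor Ren (env_right_action R) R M 1\<^sub>R m"

lemma coinv_closed: "m \<in> U M ==> coinv m \<in> U TP"
 unfolding coinv_def by (rule T.pure_closed[OF R_one])

lemma coinv_add: "[|m \<in> U M; n \<in> U M|] ==> coinv (m +\<^sub>M n) = coinv m +\<^sub>TP coinv n"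
 unfolding coinv_def by (rule T.pure_add_right[OF R_one])

lemma coinv_left: "[|x \<in> U R; m \<in> U M|] ==>
  coinv (jl x *.\<^sub>M m) = pure_tensor Ren (env_right_action R) R M x m"
 unfolding coinv_def
 using T.pure_balanced[OF R_one kp_closed[of x "1\<^sub>R"], of m] by (simp add: env_right_action_pure R_one R_one_left R_one_right)

lemma coinv_right: "[|x \<in> U R; m \<in> U M|] ==>
  coinv (jr x *.\<^sub>M m) = pure_tensor Ren (env_right_action R) R M x m"
 unfolding coinv_def
 using T.pure_balanced[OF R_one kp_closed[of "1\<^sub>R" x], of m] by (simp add: env_right_action_pure R_one R_one_left R_one_right)

lemma coinv_balanced: "[|x \<in> U R; m \<in> U M|] ==> coinv (jl x *.\<^sub>M m) = coinv (jr x *.\<^sub>M m)"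
 by (simp only: coinv_left coinv_right)

text \<open>\<open>x \<otimes> m = 1 \<otimes> x m\<close>, so the map \<open>m \<mapsto> 1 \<otimes> m\<close> is onto and \<open>R \<otimes> M\<close> is a quotient of \<open>M\<close>.\<close>
lemma coinv_surj:
 assumes "t \<in> U TP" obtains m where "m \<in> U M" "t = coinv m"
proof -
 have "EX m:U M. t = coinv m" using assms
 proof (induction t rule: T.tensor_induct)
  case (pure x m)
  then show ?case by (intro bexI[of _ "jl x *.\<^sub>M m"]) (simp_all add: coinv_left M.smult_closed kp_closed R_one)
 next
  case (add s t)
  then show ?case by (metis coinv_add M.a_closed)
 qed
 then show ?thesis using that by blast
qed

lemma unit_smult: "k \<in> U K ==> jl (k *.\<^sub>R 1\<^sub>R) = k *.\<^sub>Ren 1\<^sub>Ren"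
 using bilinearD(4)[OF kp_bilinear _ R_one R_one] by (simp add: Ren_simps(4))

lemma coinv_smult:
 assumes k: "k \<in> U K" and m: "m \<in> U M"
 shows "k *.\<^sub>TP coinv m = coinv ((k *.\<^sub>Ren 1\<^sub>Ren) *.\<^sub>M m)"
 unfolding unit_smult[OF k, symmetric] coinv_left[OF R.smult_closed[OF k R_one] m]
 unfolding coinv_def by (rule T.smult_pure[OF k R_one m])

lemma coinv_linear:
 assumes m: "m \<in> U M" shows "klinear K Ren TP (%e. coinv (e *.\<^sub>M m))"
 unfolding klinear_def
proof (intro conjI ballI)
 fix k e assume k: "k \<in> U K" and e: "e \<in> U Ren"
 have "(k *.\<^sub>Ren e) *.\<^sub>M m = (k *.\<^sub>Ren 1\<^sub>Ren) *.\<^sub>M (e *.\<^sub>M m)"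
  using k e m M.smult_assoc[of "k *.\<^sub>Ren 1\<^sub>Ren" e m] by (simp add: Ren.smult_mult_left)
 then show "coinv ((k *.\<^sub>Ren e) *.\<^sub>M m) = k *.\<^sub>TP coinv (e *.\<^sub>M m)"
  using k e m by (simp add: coinv_smult M.smult_closed)
qed (use m in \<open>simp_all add: coinv_closed M.smult_closed M.smult_l_distr coinv_add\<close>)

text \<open>The universal property of the coinvariants: an additive map that identifies left and right multiplications factors through \<open>1 \<otimes> m\<close>.\<close>
definition coinv_lift :: "('g, 'u) ring_scheme => ('m => 'g) => ('r, 'm) tensor => 'g"
 where "coinv_lift G f = tensor_lift G (%x m. f (jl x *.\<^sub>M m))"

context
 fixes G :: "('g, 'u) ring_scheme" and f :: "'m => 'g"
 assumes G: "abelian_group G" and f_closed: "!!m. m \<in> U M ==> f m \<in> U G"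
  and f_add: "!!m n. [|m \<in> U M; n \<in> U M|] ==> f (m +\<^sub>M n) = f m +\<^sub>G f n"
  and f_balanced: "!!x m. [|x \<in> U R; m \<in> U M|] ==> f (jl x *.\<^sub>M m) = f (jr x *.\<^sub>M m)"
begin

lemma coinv_lift_balanced: "balanced Ren (env_right_action R) R M G (%x m. f (jl x *.\<^sub>M m))"
proof (rule balancedI)
 note kd = bilinearD(2)[OF kp_bilinear _ _ R_one]
 show "f (jl (x +\<^sub>R y) *.\<^sub>M m) = f (jl x *.\<^sub>M m) +\<^sub>G f (jl y *.\<^sub>M m)"
  if "x \<in> U R" "y \<in> U R" "m \<in> U M" for x y m
  using that by (simp add: kd M.smult_l_distr kp_closed R_one f_add M.smult_closed)
 note ed = bilinearD[OF env_right_action_bilinear]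
 show "f (jl (env_right_action R x r) *.\<^sub>M m) = f (jl x *.\<^sub>M (r *.\<^sub>M m))"
  if x: "x \<in> U R" and r: "r \<in> U Ren" and m: "m \<in> U M" for x r m
  using r[unfolded Ren_simps]
 proof (induction r rule: ktensor_induct[OF R op, consumes 1, case_names pure add])
  case (pure u v)
  then have u: "u \<in> U R" and v: "v \<in> U R" by simp_all
  note mc = bilinearD(1)[OF R_mult]
  have "jl (v *\<^sub>R x *\<^sub>R u) = jl v *\<^sub>Ren (jl x *\<^sub>Ren jl u)"
   using x u v M.R.m_assoc[of "jl v" "jl x" "jl u"] by (simp add: Ren_mult R_one R_one_left mc kp_closed)
  then have "f (jl (v *\<^sub>R x *\<^sub>R u) *.\<^sub>M m) = f (jl v *.\<^sub>M ((jl x *\<^sub>Ren jl u) *.\<^sub>M m))"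
   using x u v m by (simp add: M.smult_assoc kp_closed R_one)
  also have "... = f ((jr v *\<^sub>Ren (jl x *\<^sub>Ren jl u)) *.\<^sub>M m)"
   using x u v m f_balanced[OF v, of "(jl x *\<^sub>Ren jl u) *.\<^sub>M m"]
   by (simp add: M.smult_assoc[of "jr v"] kp_closed R_one M.smult_closed)
  also have "jr v *\<^sub>Ren (jl x *\<^sub>Ren jl u) = jl x *\<^sub>Ren kp u v"
   using x u v by (simp add: Ren_mult R_one R_one_left R_one_right mc)
  finally show ?case using x u v m by (simp add: env_right_action_pure M.smult_assoc kp_closed R_one)
 next
  case (add s t)
  then show ?case using x m
   by (simp add: ed kd M.smult_l_distr M.smult_r_distr kp_closed R_one f_add M.smult_closed Ren_simps(1,2)[symmetric])
 qed
qed (simp_all add: f_closed f_add M.smult_closed M.smult_r_distr kp_closed R_one)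

lemma coinv_lift:
 shows coinv_lift_closed: "t \<in> U TP ==> coinv_lift G f t \<in> U G"
  and coinv_lift_add: "[|s \<in> U TP; t \<in> U TP|] ==>
   coinv_lift G f (s +\<^sub>TP t) = coinv_lift G f s +\<^sub>G coinv_lift G f t"
  and coinv_lift_coinv: "m \<in> U M ==> coinv_lift G f (coinv m) = f m"
proof -
 note b = coinv_lift_balanced
 show "coinv_lift G f t \<in> U G" if "t \<in> U TP"
  unfolding coinv_lift_def by (rule T.lift_closed[OF G b that])
 show "coinv_lift G f (s +\<^sub>TP t) = coinv_lift G f s +\<^sub>G coinv_lift G f t" if "s \<in> U TP" "t \<in> U TP"
  unfolding coinv_lift_def by (rule T.lift_add[OF G b that])
 show "coinv_lift G f (coinv m) = f m" if "m \<in> U M"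
  unfolding coinv_lift_def coinv_def T.lift_pure[OF G b R_one that]
  using M.smult_one[OF that] by (simp add: Ren_simps(4))
qed

end

end

lemma coinv_functor:
 fixes M N :: "(('r, 'r) tensor, 'm) module"
 assumes "bimodule_coinvariants K R M" "bimodule_coinvariants K R N" "f \<in> module_hom (enveloping K R) M N" "m \<in> U M"
 shows "snd (tensor_functor (enveloping K R) (env_right_action R) R) M N f (bimodule_coinvariants.coinv K R M m)
  = bimodule_coinvariants.coinv K R N (f m)"
proof -
 interpret M: bimodule_coinvariants K R M by fact
 interpret N: bimodule_coinvariants K R N by fact
 show ?thesis
  unfolding M.coinv_def N.coinv_def
  by (rule tensor_functor_data.tensor_functor_pure[OF M.functor_data M.TP_tensor_module N.TP_tensor_module assms(3) M.R_one assms(4)])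
qed

lemma functor_comp_is_functor:
 assumes F: "is_module_functor R S F" and G: "is_module_functor S T G"
 shows "is_module_functor R T (functor_comp G F)"
proof -
 have F1: "!!M. left_module R M ==> left_module S (fst F M)"
  and F2: "!!M N f. [|left_module R M; left_module R N; f \<in> module_hom R M N|] ==> snd F M N f \<in> module_hom S (fst F M) (fst F N)"
  and F3: "!!M. left_module R M ==> snd F M M (restrict id (U M)) = restrict id (U (fst F M))"
  and F4: "!!L M N f g. [|left_module R L; left_module R M; left_module R N; f \<in> module_hom R L M; g \<in> module_hom R M N|]
   ==> snd F L N (cmp L g f) = compose (U (fst F L)) (snd F M N g) (snd F L M f)"
  using F unfolding is_module_functor_def by blast+
 have G1: "!!M. left_module S M ==> left_module T (fst G M)"
  and G2: "!!M N f. [|left_module S M; left_module S N; f \<in> module_hom S M N|] ==> snd G M N f \<in> module_hom T (fst G M) (fst G N)"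
  and G3: "!!M. left_module S M ==> snd G M M (restrict id (U M)) = restrict id (U (fst G M))"
  and G4: "!!L M N f g. [|left_module S L; left_module S M; left_module S N; f \<in> module_hom S L M; g \<in> module_hom S M N|]
   ==> snd G L N (cmp L g f) = compose (U (fst G L)) (snd G M N g) (snd G L M f)"
  using G unfolding is_module_functor_def by blast+
 show ?thesis
  unfolding is_module_functor_def functor_comp_def
  by (simp add: F1 F2 F3 F4 G1 G2 G3 G4)
qed

section \<open>The comparison isomorphism\<close>

context cocommutative_coalgebra
begin

lemma sweedler3_map:
 assumes Z: "module K Z" and Z': "module K Z'" and t: "trilinear K C C C Z t" and f: "klinear K Z Z' f" and c: "c \<in> U C"
 shows "f (sweedler3 Z C t c) = sweedler3 Z' C (%x y z. f (t x y z)) c"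
proof -
 note b = sweedler_param_bilinear[OF Z C.module_axioms t]
 have tx: "bilinear K C C Z (t x)" if "x \<in> U C" for x using t that by (simp add: trilinear_def)
 have e: "f (sweedler Z C (t x) y) = sweedler Z' C (%y z. f (t x y z)) y" if "x \<in> U C" "y \<in> U C" for x y
  by (rule sweedler_map[OF Z Z' tx[OF that(1)] f that(2)])
 show ?thesis
  unfolding sweedler3_def sweedler_map[OF Z Z' b f c]
  by (rule sweedler_cong[OF Z' c]) (simp_all add: e[symmetric] klinearD(1)[OF f] bilinearD(1)[OF b])
qed

end

context cocommutative_hopf_algebra
begin

interpretation HP: k_algebra K HP by (rule HP_k_algebra)

lemma B_functor_data: "tensor_functor_data K HP (B_right_action K H) BA"
proof (intro tensor_functor_data.intro tensor_functor_data_axioms.intro BA_module)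
 show "B_right_action K H x r \<in> U BA" if "x \<in> U BA" "r \<in> U HP" for x r
  by (rule B_right_action(2)[OF that])
 show "B_right_action K H (k *.\<^sub>BA x) r = k *.\<^sub>BA B_right_action K H x r"
  if k: "k \<in> U K" and x: "x \<in> U BA" and r: "r \<in> U HP" for k x r
 proof -
  have kx: "k *.\<^sub>HP x \<in> U BA" by (rule BA_closed(6)[OF k x])
  show ?thesis
   using B_right_action(1)[OF kx r] B_right_action(1)[OF x r]
    bilinearD(4)[OF sandwich_bilinear k BA_subset[OF x] klinearD(1)[OF tX_linear r]]
   by (simp add: BA_simps(4))
 qed
qed

lemma B_right_action_par_class:
 "[|b \<in> U BA; h \<in> U H|] ==> B_right_action K H b (pc h) = bet b h"
 by (simp add: B_right_action(1) klinearD(1)[OF pc_linear] tX_hom(2) sandwich_tauX BA_subset)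

lemma B_right_action_one: "b \<in> U BA ==> B_right_action K H b 1\<^sub>HP = b"
 using tX_hom(1) by (simp add: B_right_action(1) algebra_hom_def sandwich_pure BA_subset)

lemma B_right_action_mult:
 "[|b \<in> U BA; y \<in> U HP; z \<in> U HP|] ==>
  B_right_action K H b (y *\<^sub>HP z) = B_right_action K H (B_right_action K H b y) z"
 using tX_hom(1) klinearD(1)[OF tX_linear] B_right_action(2)[of b y]
 by (simp add: B_right_action(1) algebra_hom_def sandwich_mult BA_subset)

lemma B_right_action_linear:
 "b \<in> U BA ==> klinear K HP HP (B_right_action K H b)"
proof -
 assume b: "b \<in> U BA"
 have "klinear K HP HP (%z. sandwich b (tX z))"
  by (rule linear_comp[OF _ tX_linear]) (use sandwich_bilinear BA_subset[OF b] in \<open>simp add: bilinear_def\<close>)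
 then show ?thesis by (simp add: klinear_def B_right_action(1)[OF b])
qed

end

context cocommutative_partial_action
begin

lemma A_unital: "unital_bilinear_algebra K A"
 by (intro unital_bilinear_algebra.intro unital_bilinear_algebra_axioms.intro A_module A.mult_bilinear) auto

lemma smash_unital: "unital_bilinear_algebra K SP"
 by (intro unital_bilinear_algebra.intro unital_bilinear_algebra_axioms.intro smash_module smash_mult_bilinear
  smash_one_closed smash_one_left smash_one_right)

end

locale smash_bimodule = cocommutative_partial_action K H A act
 for K :: "('k, 'x) ring_scheme" (structure) and H :: "('k, 'h, 'y) hopf_scheme" (structure)
  and A :: "('k, 'a, 'z) module_scheme" (structure) and act :: "'h => 'a => 'a" +
 fixes M :: "('a, 'h, 'm) smash_bimod"
 assumes M: "left_module (smash_env K H A act) M"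
begin

abbreviation (input) "EN == smash_env K H A act"
abbreviation (input) "kq == kpure K SP (opposite SP)"

interpretation HC: cocommutative_coalgebra K H by (rule cocommutative_coalgebra)
interpretation HP: k_algebra K HP by (rule HP_k_algebra)
interpretation M: left_module EN M by (rule M)

lemma smash_coinvariants: "bimodule_coinvariants K SP M"
 by (intro bimodule_coinvariants.intro bimodule_coinvariants_axioms.intro smash_unital M)

interpretation PC: bimodule_coinvariants K SP M by (rule smash_coinvariants)

lemmas EN_k_algebra = PC.Ren_k_algebra
interpretation EN: k_algebra K EN by (rule EN_k_algebra)

lemma smash_homs: "commuting_smash_homs K H A act EN (%u. kq u 1\<^sub>SP) (%u. kq 1\<^sub>SP u)"
 by (intro commuting_smash_homs.intro commuting_smash_homs_axioms.intro cocommutative_partial_action_axioms EN_k_algebra)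
  (use PC.kp_bilinear smash_one_closed PC.Ren_mult[unfolded smash_simps(2)] smash_one_left[of "1\<^sub>SP"] smash_one_left smash_one_right
   in \<open>simp_all add: bilinear_def PC.Ren_simps(4) smash_simps(2)\<close>)

interpretation J: commuting_smash_homs K H A act EN "%u. kq u 1\<^sub>SP" "%u. kq 1\<^sub>SP u" by (rule smash_homs)

lemma kq_eq: "[|u \<in> U SP; v \<in> U SP|] ==> kq u v = kq u 1\<^sub>SP *\<^sub>EN kq 1\<^sub>SP v"
 using PC.Ren_mult smash_one_closed smash_one_left smash_one_right by simp

definition base_hom :: "('a, 'a) tensor => (('a, 'h) tensor, ('a, 'h) tensor) tensor"
 where "base_hom = tensor_lift EN (%a b. kq (se a 1\<^sub>H) (se b 1\<^sub>H))"

abbreviation (input) "AM == base_restriction K H A act M"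

lemma AM_eq: "AM = restrict_scalars base_hom M"
 by (simp add: base_restriction_def base_hom_def)

lemma AM_simps: "U AM = U M" "add AM = add M" "zero AM = zero M" "t *.\<^sub>AM m = base_hom t *.\<^sub>M m"
 by (simp_all add: AM_eq restrict_scalars_def)

lemmas A_op_module = opposite_module[OF A_module]

lemma base_bilinear: "bilinear K A A EN (%a b. kq (se a 1\<^sub>H) (se b 1\<^sub>H))"
 by (rule bilinear_comp[OF PC.kp_bilinear]) (use se_bilinear_smash in \<open>simp_all add: bilinear_def\<close>)

lemma se_base_mult: "[|a \<in> U A; b \<in> U A|] ==> am (se a 1\<^sub>H) (se b 1\<^sub>H) = se (a *\<^sub>A b) 1\<^sub>H"
proof -
 assume ab: "a \<in> U A" "b \<in> U A"
 have "twist 1\<^sub>H b = p b 1\<^sub>H"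
  unfolding twist_def using twist_tri ab
  by (subst sweedler_one[OF AH_module]) (auto simp: act_one multilinear)
 then show ?thesis using ab by (simp add: se_one_right am_pure right_H_pure left_A_pure)
qed

lemma base_hom: "algebra_hom K (enveloping K A) EN base_hom"
 unfolding base_hom_def enveloping_def[of K A]
proof (rule alg_tensor_lift_hom[OF A.k_algebra_axioms opposite_k_algebra[OF A.k_algebra_axioms] EN_k_algebra])
 show "bilinear K A (opposite A) EN (%a b. kq (se a 1\<^sub>H) (se b 1\<^sub>H))"
  using base_bilinear by (simp add: multilinear)
 show "kq (se (x *\<^sub>A x') 1\<^sub>H) (se (y \<otimes>\<^bsub>opposite A\<^esub> y') 1\<^sub>H)
   = kq (se x 1\<^sub>H) (se y 1\<^sub>H) *\<^sub>EN kq (se x' 1\<^sub>H) (se y' 1\<^sub>H)"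
  if "x \<in> U A" "y \<in> U (opposite A)" "x' \<in> U A" "y' \<in> U (opposite A)" for x y x' y'
  using that by (simp add: PC.Ren_mult se_in_smash smash_simps(2) se_base_mult)
qed (simp add: se_one PC.Ren_simps(4))

lemma base_hom_pure: "[|a \<in> U A; b \<in> U A|] ==> base_hom (kpure K A (opposite A) a b) = kq (se a 1\<^sub>H) (se b 1\<^sub>H)"
 unfolding base_hom_def using base_bilinear
 by (intro tensor_lift_kpure[OF A_module A_op_module EN.module_axioms]) (simp_all add: multilinear)

lemma AM_left_module: "left_module (enveloping K A) AM"
proof -
 have "k_algebra K (enveloping K A)"
  unfolding enveloping_def by (rule alg_tensor_k_algebra[OF A.k_algebra_axioms opposite_k_algebra[OF A.k_algebra_axioms]])
 then interpret Ae: k_algebra K "enveloping K A" .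
 have "base_hom \<in> ring_hom (enveloping K A) EN"
  using base_hom by (auto simp: algebra_hom_def klinear_def intro!: ring_hom_memI)
 then show ?thesis unfolding AM_eq by (rule restrict_scalars_left_module[OF M Ae.ring_axioms])
qed

lemma base_coinvariants: "bimodule_coinvariants K A AM"
 by (intro bimodule_coinvariants.intro bimodule_coinvariants_axioms.intro A_unital AM_left_module)

interpretation AC: bimodule_coinvariants K A AM by (rule base_coinvariants)

abbreviation (input) "NN == tensor_product (enveloping K A) (env_right_action A) A AM"
abbreviation (input) "FF == tensor_product EN (env_right_action SP) SP M"

interpretation NN: module K NN by (rule AC.TP_module)
interpretation FF: module K FF by (rule PC.TP_module)

lemma AM_smult: "a \<in> U A ==> kpure K A (opposite A) a 1\<^sub>A *.\<^sub>AM m = J.kap1 a *.\<^sub>M m"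
 "a \<in> U A ==> kpure K A (opposite A) 1\<^sub>A a *.\<^sub>AM m = J.kap2 a *.\<^sub>M m"
 by (simp_all add: AM_simps base_hom_pure se_one J.kap1_def J.kap2_def)

abbreviation (input) "ncl == AC.coinv"
abbreviation (input) "qq == PC.coinv"

lemma ncl_balanced: "[|a \<in> U A; m \<in> U M|] ==> ncl (J.kap1 a *.\<^sub>M m) = ncl (J.kap2 a *.\<^sub>M m)"
 using AC.coinv_balanced[of a m] by (simp add: AM_smult AM_simps(1))

lemma ncl_closed: "m \<in> U M ==> ncl m \<in> U NN"
 using AC.coinv_closed by (simp add: AM_simps)

lemma ncl_linear:
 assumes m: "m \<in> U M" shows "klinear K EN NN (%e. ncl (e *.\<^sub>M m))"
 unfolding klinear_def
proof (intro conjI ballI)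
 fix k e assume k: "k \<in> U K" and e: "e \<in> U EN"
 note em = M.smult_closed[OF e m]
 have "base_hom (k \<odot>\<^bsub>enveloping K A\<^esub> \<one>\<^bsub>enveloping K A\<^esub>) = k *.\<^sub>EN 1\<^sub>EN"
  using base_hom k by (simp add: algebra_hom_def klinear_def AC.Ren_simps(4) AC.kp_closed)
 then have "k *.\<^sub>NN ncl (e *.\<^sub>M m) = ncl ((k *.\<^sub>EN 1\<^sub>EN) *.\<^sub>M (e *.\<^sub>M m))"
  using AC.coinv_smult[OF k, of "e *.\<^sub>M m"] em by (simp add: AM_simps)
 then show "ncl ((k *.\<^sub>EN e) *.\<^sub>M m) = k *.\<^sub>NN ncl (e *.\<^sub>M m)"
  using k e m M.smult_assoc[of "k *.\<^sub>EN 1\<^sub>EN" e m] by (simp add: EN.smult_mult_left)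
qed (use m in \<open>simp_all add: ncl_closed M.smult_closed M.smult_l_distr AC.coinv_add[unfolded AM_simps]\<close>)

lemma ncl_surj: "t \<in> U NN ==> EX m:U M. t = ncl m"
 using AC.coinv_surj[of t] by (metis AM_simps(1))

lemmas J_covariant = J.covariant1[OF J.variables(1)] J.covariant2[OF J.variables(1)]

lemma J_closed:
 "a \<in> U A ==> J.kap1 a \<in> U EN" "a \<in> U A ==> J.kap2 a \<in> U EN"
 "h \<in> U H ==> J.lam1 h \<in> U EN" "h \<in> U H ==> J.rho h \<in> U EN" "h \<in> U H ==> J.sig h \<in> U EN"
 using J_covariant[THEN covariant_points.kap] J_covariant[THEN covariant_points.lam] J.sig_linear by (auto simp: klinear_def)

abbreviation (input) "genact == F1_generator_action K H A act M"

lemma sig_balanced: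
 assumes a: "a \<in> U A" and h: "h \<in> U H" and m: "m \<in> U M"
 shows "ncl (J.sig h *.\<^sub>M (J.kap1 a *.\<^sub>M m)) = ncl (J.sig h *.\<^sub>M (J.kap2 a *.\<^sub>M m))"
proof -
 note l = ncl_linear[OF m]
 have sk: "bilinear K H H EN (%x y. J.kap1 (act x a) *\<^sub>EN J.sig y)" "bilinear K H H EN (%x y. J.kap2 (act x a) *\<^sub>EN J.sig y)"
  by (rule bilinear_comp[OF EN.mult_bilinear linear_comp[OF J_covariant(1)[THEN covariant_points.kap] act_one_linear[OF a]] J.sig_linear]
   bilinear_comp[OF EN.mult_bilinear linear_comp[OF J_covariant(2)[THEN covariant_points.kap] act_one_linear[OF a]] J.sig_linear])+
 have "ncl ((J.sig h *\<^sub>EN J.kap1 a) *.\<^sub>M m) = sweedler NN H (%x y. ncl ((J.kap1 (act x a) *\<^sub>EN J.sig y) *.\<^sub>M m)) h"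
  unfolding J.sig_kap(1)[OF a h] by (rule HC.sweedler_map[OF EN.module_axioms NN.module_axioms sk(1) l h])
 also have "... = sweedler NN H (%x y. ncl ((J.kap2 (act x a) *\<^sub>EN J.sig y) *.\<^sub>M m)) h"
  by (rule HC.sweedler_cong[OF NN.module_axioms h])
   (use a m in \<open>simp_all add: M.smult_assoc J_closed act_closed ncl_balanced M.smult_closed ncl_closed\<close>)
 also have "... = ncl ((J.sig h *\<^sub>EN J.kap2 a) *.\<^sub>M m)"
  unfolding J.sig_kap(2)[OF a h] by (rule HC.sweedler_map[OF EN.module_axioms NN.module_axioms sk(2) l h, symmetric])
 finally show ?thesis using a h m by (simp add: M.smult_assoc J_closed)
qed

text \<open>The action of \<open>[h]\<close> on \<open>A \<otimes> M\<close> is given by a sum over three legs of \<open>h\<close>. On \<open>1 \<otimes> m\<close> it reduces to \<open>1 \<otimes> \<sigma> h m\<close>, since \<open>a \<otimes> m = 1 \<otimes> a m\<close> and \<open>\<sigma> h a = \<Sum> (h\<^sub>1 \<cdot> a) \<sigma> h\<^sub>2\<close>.\<close>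
lemma generator_action:
 assumes h: "h \<in> U H" and m: "m \<in> U M" shows "genact h (ncl m) = ncl (J.sig h *.\<^sub>M m)"
proof -
 let ?f = "%m. ncl (J.sig h *.\<^sub>M m)"
 let ?b = "%a m. sweedler3 NN H (%x y z. pure_tensor (enveloping K A) (env_right_action A) A AM (act x a)
  (kq (se 1\<^sub>A y) (se 1\<^sub>A (antipode H z)) *.\<^sub>M m)) h"
 have f: "abelian_group NN" "!!m. m \<in> U AM ==> ?f m \<in> U NN"
  "!!m n. [|m \<in> U AM; n \<in> U AM|] ==> ?f (m +\<^sub>AM n) = ?f m +\<^sub>NN ?f n"
  "!!a m. [|a \<in> U A; m \<in> U AM|] ==> ?f (kpure K A (opposite A) a 1\<^sub>A *.\<^sub>AM m) = ?f (kpure K A (opposite A) 1\<^sub>A a *.\<^sub>AM m)"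
  using h by (simp_all add: NN.abelian_group_axioms AM_simps(1,2) ncl_closed M.smult_closed J_closed M.smult_r_distr
   AC.coinv_add[unfolded AM_simps] AM_smult sig_balanced)
 have e: "?b a m = ?f (kpure K A (opposite A) a 1\<^sub>A *.\<^sub>AM m)" if a: "a \<in> U A" and m: "m \<in> U AM" for a m
 proof -
  note m' = m[unfolded AM_simps] and l = ncl_linear[OF m[unfolded AM_simps]]
  note cov = J_covariant[THEN covariant_points.lam] J_covariant(1)[THEN covariant_points.kap]
  have t: "trilinear K H H H EN (%x y z. J.kap1 (act x a) *\<^sub>EN (J.lam1 y *\<^sub>EN J.rho z))"
   using EN.mult_bilinear cov act_bilinear a by (simp add: multilinear)
  have t': "trilinear K H H H NN (%x y z. ncl ((J.kap1 (act x a) *\<^sub>EN (J.lam1 y *\<^sub>EN J.rho z)) *.\<^sub>M m))"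
   using t klinearD[OF l] by (simp add: multilinear)
  have aH: "h \<in> U H ==> antipode H h \<in> U H" for h by (rule klinearD(1)[OF antipode_linear])
  have "?b a m = sweedler3 NN H (%x y z. ncl ((J.kap1 (act x a) *\<^sub>EN (J.lam1 y *\<^sub>EN J.rho z)) *.\<^sub>M m)) h"
  proof (rule HC.sweedler3_cong[OF NN.module_axioms h _ t'])
   fix x y z assume xyz: "x \<in> U H" "y \<in> U H" "z \<in> U H"
   have kqlr: "kq (se 1\<^sub>A y) (se 1\<^sub>A (antipode H z)) = J.lam1 y *\<^sub>EN J.rho z"
    using kq_eq[of "se 1\<^sub>A y" "se 1\<^sub>A (antipode H z)"] xyz
    by (simp add: J.lam1_def J.rho_def J.lam2_def se_in_smash aH)
   have ac: "act x a \<in> U A" and lr: "J.lam1 y *\<^sub>EN J.rho z \<in> U EN"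
    using xyz a by (auto intro: act_closed J_closed)
   show "pure_tensor (enveloping K A) (env_right_action A) A AM (act x a) (kq (se 1\<^sub>A y) (se 1\<^sub>A (antipode H z)) *.\<^sub>M m)
    = ncl ((J.kap1 (act x a) *\<^sub>EN (J.lam1 y *\<^sub>EN J.rho z)) *.\<^sub>M m)"
    unfolding kqlr M.smult_assoc[OF J_closed(1)[OF ac] lr m'] AM_smult(1)[OF ac, symmetric]
    by (rule AC.coinv_left[symmetric]) (use ac lr m' in \<open>simp_all add: AM_simps M.smult_closed\<close>)
  qed
  also have "... = ncl ((J.sig h *\<^sub>EN J.kap1 a) *.\<^sub>M m)"
   unfolding HC.sweedler3_map[OF EN.module_axioms NN.module_axioms t l h, symmetric] J.sig_kap_sweedler3[OF a h] ..
  finally show ?thesis using a h m' by (simp add: AM_smult M.smult_assoc J_closed)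
 qed
 interpret T: tensor_module K "enveloping K A" "env_right_action A" A AM by (rule AC.TP_tensor_module)
 note m' = m[folded AM_simps(1)]
 have "genact h (ncl m) = tensor_lift NN ?b (ncl m)"
  unfolding F1_generator_action_def Let_def ..
 also have "... = AC.coinv_lift NN ?f (ncl m)"
  unfolding AC.coinv_lift_def
  by (rule T.lift_cong[OF f(1) AC.coinv_closed[OF m'] e]) (assumption | rule f(2) left_module.smult_closed[OF AM_left_module] AC.kp_closed A.one_closed)+
 also have "... = ?f m" by (rule AC.coinv_lift_coinv[OF f m'])
 finally show ?thesis .
qed

abbreviation (input) "sh == par_extend K EN (word_prod EN J.sig)"
lemmas sh_hom = par_extend_algebra_hom[OF EN_k_algebra J.sig_partial_rep]
lemmas sh_linear = conjunct1[OF sh_hom(1)[unfolded algebra_hom_def]]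
lemmas sh_mult = sh_hom(1)[unfolded algebra_hom_def, THEN conjunct2, THEN conjunct2, rule_format]
lemmas sh_one = sh_hom(1)[unfolded algebra_hom_def, THEN conjunct2, THEN conjunct1]
lemmas sh_closed = klinearD(1)[OF sh_linear]

abbreviation (input) "F1M == F1_object K H A act M"

lemma F1M_simps: "U F1M = U NN" "add F1M = add NN" "zero F1M = zero NN"
 by (simp_all add: F1_object_def Let_def)

text \<open>By the universal property \<open>\<sigma>\<close> extends to an algebra homomorphism \<open>sh\<close> from \<open>H\<^sub>p\<^sub>a\<^sub>r\<close> to the enveloping algebra of \<open>A # H\<close>, and \<open>H\<^sub>p\<^sub>a\<^sub>r\<close> acts on \<open>F\<^sub>1 M\<close> through it.\<close>
lemma F1M_smult:
 assumes z: "z \<in> U HP" and m: "m \<in> U M"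
 shows "z *.\<^sub>F1M ncl m = ncl (sh z *.\<^sub>M m)"
proof -
 have "foldr genact w (ncl m) = ncl (word_prod EN J.sig w *.\<^sub>M m)" if "w \<in> lists (U H)" for w
  using that
 proof (induction w rule: list.induct)
  case Nil
  then show ?case using m by (simp add: word_prod_def M.smult_one)
 next
  case (Cons h w)
  then have hw: "h \<in> U H" "w \<in> lists (U H)" by simp_all
  note wc = word_prod_closed[OF EN_k_algebra J.sig_partial_rep hw(2)]
  have "word_prod EN J.sig (h # w) = J.sig h *\<^sub>EN word_prod EN J.sig w" by (simp add: word_prod_def)
  then show ?case
   using Cons.IH[OF hw(2)] by (simp add: generator_action[OF hw(1) M.smult_closed[OF wc m]] M.smult_assoc[OF J_closed(5)[OF hw(1)] wc m])
 qed
 from par_extend_factor[OF EN_k_algebra J.sig_partial_rep NN.module_axioms ncl_linear[OF m] z this]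
 show ?thesis by (simp add: F1_object_def Let_def par_left_action_def)
qed

lemma F1M_left_module: "left_module HP F1M"
proof -
 have "abelian_group F1M"
  by (rule abelian_groupI) (auto simp: F1M_simps NN.a_ac intro: NN.l_neg bexI[of _ "\<ominus>\<^bsub>NN\<^esub> x" for x])
 moreover have ex: thesis if "x \<in> U NN" "!!m. [|m \<in> U M; x = ncl m|] ==> thesis" for x thesis
  using ncl_surj[OF that(1)] that(2) by blast
 moreover have "ncl m +\<^sub>NN ncl n = ncl (m +\<^sub>M n)" if "m \<in> U M" "n \<in> U M" for m n
  using AC.coinv_add[unfolded AM_simps] that by simp
 ultimately show ?thesis
  by (intro left_module.intro left_module_axioms.intro HP.ring_axioms)
   (auto elim!: ex simp: F1M_smult M.smult_closed sh_closed F1M_simps ncl_closed sh_mult sh_one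
    M.smult_l_distr M.smult_r_distr M.smult_assoc M.smult_one klinearD(2)[OF sh_linear])
qed

lemma sh_sweedler:
 assumes b: "bilinear K H H HP b" and b': "bilinear K H H EN b'" and h: "h \<in> U H"
  and eq: "!!x y. [|x \<in> U H; y \<in> U H|] ==> sh (b x y) = b' x y"
 shows "sh (sweedler HP H b h) = sweedler EN H b' h"
 unfolding HC.sweedler_map[OF HP.module_axioms EN.module_axioms b sh_linear h]
 by (rule HC.sweedler_cong[OF EN.module_axioms h eq bilinearD(1)[OF b']])

lemma pc_closed: "h \<in> U H ==> pc h \<in> U HP"
 by (rule klinearD(1)[OF pc_linear])

lemma antipode_cl: "h \<in> U H ==> antipode H h \<in> U H"
 by (rule klinearD(1)[OF antipode_linear])

lemma sh_pe: "h \<in> U H ==> sh (pe h) = sweedler EN H (%x y. J.sig x *\<^sub>EN J.sig (antipode H y)) h"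
 unfolding par_e_def
 by (rule sh_sweedler[OF bilinear_comp[OF HP.mult_bilinear pc_linear pcS_linear]
  bilinear_comp[OF EN.mult_bilinear J.sig_linear linear_comp[OF J.sig_linear antipode_linear]]])
  (simp_all add: sh_mult sh_hom(2) pc_closed antipode_cl)

lemma sh_bet:
 assumes b: "b \<in> U HP" and h: "h \<in> U H"
 shows "sh (bet b h) = sweedler EN H (%x y. J.sig (antipode H x) *\<^sub>EN sh b *\<^sub>EN J.sig y) h"
proof -
 note O = hopf_points.conjugate_trilinear[OF one_variable]
 have "bilinear K H H HP (%x y. pc (antipode H x) *\<^sub>HP b *\<^sub>HP pc y)"
  "bilinear K H H EN (%x y. J.sig (antipode H x) *\<^sub>EN sh b *\<^sub>EN J.sig y)"
  using O[OF HP_k_algebra pc_linear] O[OF EN_k_algebra J.sig_linear] b sh_closed[OF b] by (simp_all add: trilinear_def)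
 from sh_sweedler[OF this h] show ?thesis
  by (simp add: sh_mult sh_hom(2) pc_closed antipode_cl b)
qed

lemma sh_commute:
 assumes b: "b \<in> U BA" and h: "h \<in> U H"
 shows "sh b *\<^sub>EN sweedler EN H (%x y. J.sig x *\<^sub>EN J.sig (antipode H y)) h
  = sweedler EN H (%x y. J.sig x *\<^sub>EN J.sig (antipode H y)) h *\<^sub>EN sh b"
 unfolding sh_pe[OF h, symmetric]
 using BA_commute[OF b h] sh_mult[OF BA_subset[OF b] klinearD(1)[OF pe_linear h]] sh_mult[OF klinearD(1)[OF pe_linear h] BA_subset[OF b]]
 by simp

lemma qq_closed: "m \<in> U M ==> qq m \<in> U FF" by (rule PC.coinv_closed)

lemma qq_trace:
 "[|u \<in> U SP; e \<in> U EN; m \<in> U M|] ==>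
  qq ((kq 1\<^sub>SP u *\<^sub>EN e) *.\<^sub>M m) = qq ((kq u 1\<^sub>SP *\<^sub>EN e) *.\<^sub>M m)"
 using PC.coinv_balanced[of u "e *.\<^sub>M m"]
 by (simp add: M.smult_assoc PC.kp_closed smash_one_closed M.smult_closed)

text \<open>The map \<open>b \<otimes> (1 \<otimes> m) \<mapsto> 1 \<otimes> b m\<close> is balanced over \<open>H\<^sub>p\<^sub>a\<^sub>r\<close>; for a generator this is \<open>trace_conjugate\<close>.\<close>
lemma qq_right_action:
 assumes b: "b \<in> U BA" and z: "z \<in> U HP" and m: "m \<in> U M"
 shows "qq (sh (B_right_action K H b z) *.\<^sub>M m) = qq (sh b *.\<^sub>M (sh z *.\<^sub>M m))"
 using z b m
proof (induction z arbitrary: b m rule: Hpar_induct)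
 case one
 then show ?case by (simp add: B_right_action_one sh_one M.smult_one)
next
 case (Cons h z)
 note b = Cons.prems(1) and m = Cons.prems(2) and bH = BA_subset[OF Cons.prems(1)]
 note zm = M.smult_closed[OF sh_closed[OF Cons.hyps(2)] m]
 note bh = bet_closed[OF b Cons.hyps(1)]
 note sb = sh_closed[OF bH] and sg = J_closed(5)[OF Cons.hyps(1)] and sz = sh_closed[OF Cons.hyps(2)]
 have "qq (sh (B_right_action K H b (pc h *\<^sub>HP z)) *.\<^sub>M m) = qq (sh (bet b h) *.\<^sub>M (sh z *.\<^sub>M m))"
  unfolding B_right_action_mult[OF b pc_closed[OF Cons.hyps(1)] Cons.hyps(2)] B_right_action_par_class[OF b Cons.hyps(1)]
  by (rule Cons.IH[OF bh m])
 also have "... = qq ((sweedler EN H (%x y. J.sig (antipode H x) *\<^sub>EN sh b *\<^sub>EN J.sig y) h *\<^sub>EN sh z) *.\<^sub>M m)"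
  unfolding sh_bet[OF bH Cons.hyps(1), symmetric] M.smult_assoc[OF sh_closed[OF BA_subset[OF bh]] sz m] ..
 also have "... = qq ((sh b *\<^sub>EN J.sig h *\<^sub>EN sh z) *.\<^sub>M m)"
  by (rule J.trace_conjugate[OF FF.module_axioms PC.coinv_linear[OF m] qq_trace[OF _ _ m] sb Cons.hyps(1) sz sh_commute[OF b], symmetric])
 also have "... = qq (sh b *.\<^sub>M (sh (pc h *\<^sub>HP z) *.\<^sub>M m))"
  using sb sg sz m by (simp add: sh_mult pc_closed Cons.hyps sh_hom(2) M.R.m_assoc M.smult_assoc)
 finally show ?case .
next
 case (smult k z)
 note l = PC.coinv_linear[OF smult.prems(2)]
 have e: "sh b *.\<^sub>M (sh z *.\<^sub>M m) = (sh b *\<^sub>EN sh z) *.\<^sub>M m" if "z \<in> U HP" for z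
  using that smult.prems by (simp add: M.smult_assoc sh_closed BA_subset)
 show ?case
  unfolding e[OF HP.smult_closed[OF smult.hyps]]
  using smult.IH[OF smult.prems] smult.prems smult.hyps klinearD[OF B_right_action_linear[OF smult.prems(1)]]
  by (simp add: e sh_closed BA_subset klinearD[OF sh_linear] klinearD[OF l] EN.smult_mult_right)
next
 case (add y z)
 note l = PC.coinv_linear[OF add.prems(2)]
 have e: "sh b *.\<^sub>M (sh z *.\<^sub>M m) = (sh b *\<^sub>EN sh z) *.\<^sub>M m" if "z \<in> U HP" for z
  using that add.prems by (simp add: M.smult_assoc sh_closed BA_subset)
 show ?case
  unfolding e[OF HP.a_closed[OF add.hyps]]
  using add.IH[OF add.prems] add.prems add.hyps klinearD[OF B_right_action_linear[OF add.prems(1)]]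
  by (simp add: e sh_closed BA_subset klinearD[OF sh_linear] klinearD[OF l] M.R.r_distr)
qed

definition to_smash :: "('a, 'm) tensor => (('a, 'h) tensor, 'm) tensor"
 where "to_smash = AC.coinv_lift FF qq"

lemma qq_data:
 "abelian_group FF" "!!m. m \<in> U AM ==> qq m \<in> U FF"
 "!!m n. [|m \<in> U AM; n \<in> U AM|] ==> qq (m +\<^sub>AM n) = qq m +\<^sub>FF qq n"
 "!!a m. [|a \<in> U A; m \<in> U AM|] ==> qq (kpure K A (opposite A) a 1\<^sub>A *.\<^sub>AM m) = qq (kpure K A (opposite A) 1\<^sub>A a *.\<^sub>AM m)"
 using PC.coinv_balanced
 by (simp_all add: FF.abelian_group_axioms AM_simps(1,2) qq_closed PC.coinv_add AM_smult J.kap1_def J.kap2_def se_in_smash)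

lemmas to_smash_closed = AC.coinv_lift_closed[OF qq_data, folded to_smash_def]
lemmas to_smash_add = AC.coinv_lift_add[OF qq_data, folded to_smash_def]
lemmas to_smash_ncl = AC.coinv_lift_coinv[OF qq_data, folded to_smash_def, unfolded AM_simps]

abbreviation (input) "ra == B_right_action K H"
abbreviation (input) "BT == tensor_product HP ra BA F1M"
abbreviation (input) "bp == pure_tensor HP ra BA F1M"

lemma BT_tensor_module: "tensor_module K HP ra BA F1M"
 by (rule tensor_functor_data.tensor_module[OF B_functor_data F1M_left_module])

interpretation BT: tensor_module K HP ra BA F1M by (rule BT_tensor_module)
interpretation BTM: module K BT by (rule BT.T_module)

lemma F1M_ex: "n \<in> U F1M ==> EX m:U M. n = ncl m"
 using ncl_surj by (simp add: F1M_simps)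

lemma ncl_F1M: "m \<in> U M ==> ncl m \<in> U F1M"
 by (simp add: F1M_simps ncl_closed)

lemma ncl_add: "[|m \<in> U M; n \<in> U M|] ==> ncl m +\<^sub>F1M ncl n = ncl (m +\<^sub>M n)"
 using AC.coinv_add[unfolded AM_simps] by (simp add: F1M_simps)

definition unit_pure_ncl :: "'m => (('k, 'h) par, ('a, 'm) tensor) tensor"
 where "unit_pure_ncl m = bp 1\<^sub>HP (ncl m)"

abbreviation (input) "rr == unit_pure_ncl"

text \<open>\<open>b \<otimes> n = 1 \<otimes> b n\<close>, as \<open>b\<close> is \<open>1\<close> acted on by \<open>b\<close>.\<close>
lemma bp_move:
 assumes b: "b \<in> U BA" and m: "m \<in> U M" shows "bp b (ncl m) = rr (sh b *.\<^sub>M m)"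
 using BT.pure_balanced[OF BA_closed(2) BA_subset[OF b] ncl_F1M[OF m]] B_right_action_B[OF BA_closed(2) b]
 by (simp add: unit_pure_ncl_def F1M_smult[OF BA_subset[OF b] m] BA_subset[OF b])

lemma rr_closed: "m \<in> U M ==> rr m \<in> U BT"
 unfolding unit_pure_ncl_def by (rule BT.pure_closed[OF BA_closed(2) ncl_F1M])

lemma rr_add: "[|m \<in> U M; n \<in> U M|] ==> rr (m +\<^sub>M n) = rr m +\<^sub>BT rr n"
 unfolding unit_pure_ncl_def by (simp add: ncl_add[symmetric] BT.pure_add_right[OF BA_closed(2)] ncl_F1M)

lemma rr_surj: "t \<in> U BT ==> EX m:U M. t = rr m"
proof (induction t rule: BT.tensor_induct)
 case (pure b n)
 then obtain m where "m \<in> U M" "n = ncl m" using F1M_ex by blast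
 then show ?case using bp_move[OF pure(1)] M.smult_closed[OF sh_closed[OF BA_subset[OF pure(1)]]] by auto
next
 case (add s t)
 then show ?case by (metis rr_add M.a_closed)
qed

lemma rr_linear:
 assumes m: "m \<in> U M" shows "klinear K EN BT (%e. rr (e *.\<^sub>M m))"
 unfolding klinear_def
proof (intro conjI ballI)
 fix k e assume k: "k \<in> U K" and e: "e \<in> U EN"
 note em = M.smult_closed[OF e m]
 note k1 = BA_closed(6)[OF k BA_closed(2)]
 have "k *.\<^sub>BT rr (e *.\<^sub>M m) = bp (k *.\<^sub>HP 1\<^sub>HP) (ncl (e *.\<^sub>M m))"
  unfolding unit_pure_ncl_def using BT.smult_pure[OF k BA_closed(2) ncl_F1M[OF em]] by (simp add: BA_simps(4))
 also have "... = rr ((k *.\<^sub>EN 1\<^sub>EN) *.\<^sub>M (e *.\<^sub>M m))"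
  unfolding bp_move[OF k1 em] using klinearD(3)[OF sh_linear k HP.one_closed] by (simp add: sh_one)
 finally show "rr ((k *.\<^sub>EN e) *.\<^sub>M m) = k *.\<^sub>BT rr (e *.\<^sub>M m)"
  using k e m M.smult_assoc[of "k *.\<^sub>EN 1\<^sub>EN" e m] by (simp add: EN.smult_mult_left)
qed (use m in \<open>simp_all add: rr_closed M.smult_closed M.smult_l_distr rr_add\<close>)

text \<open>\<open>1 \<otimes> [h] n\<close> is \<open>(1 [h]) \<otimes> n\<close>, and \<open>1 [h] = \<Sum> [S h\<^sub>1] [h\<^sub>2]\<close> lies in \<open>B\<close> and can be moved back.\<close>
lemma rr_sig:
 assumes h: "h \<in> U H" and m: "m \<in> U M"
 shows "rr (J.sig h *.\<^sub>M m) = rr (J.tau h *.\<^sub>M m)"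
proof -
 note one = BA_closed(2)
 note bh = bet_closed[OF one h]
 have s: "sh (bet 1\<^sub>HP h) = J.tau h"
  unfolding sh_bet[OF HP.one_closed h] sh_one J.tau_def
  by (rule HC.sweedler_cong[OF EN.module_axioms h]) (simp_all add: J_closed antipode_cl)
 have "rr (J.sig h *.\<^sub>M m) = bp (ra 1\<^sub>HP (pc h)) (ncl m)"
  unfolding unit_pure_ncl_def BT.pure_balanced[OF one pc_closed[OF h] ncl_F1M[OF m]] F1M_smult[OF pc_closed[OF h] m] sh_hom(2)[OF h] ..
 also have "... = rr (J.tau h *.\<^sub>M m)"
  unfolding B_right_action_par_class[OF one h] bp_move[OF bh m] s ..
 finally show ?thesis .
qed

text \<open>The relations \<open>\<sigma> h m = \<tau> h m\<close> and those for \<open>A\<close> imply all the relations of \<open>F M\<close>, by \<open>trace_of_coinvariant\<close>.\<close>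
lemma rr_balanced:
 assumes u: "u \<in> U SP" and m: "m \<in> U M"
 shows "rr (kq u 1\<^sub>SP *.\<^sub>M m) = rr (kq 1\<^sub>SP u *.\<^sub>M m)"
proof -
 have "rr ((kq u 1\<^sub>SP *\<^sub>EN 1\<^sub>EN) *.\<^sub>M m) = rr ((kq 1\<^sub>SP u *\<^sub>EN 1\<^sub>EN) *.\<^sub>M m)"
 proof (rule J.trace_of_coinvariant[OF BTM.module_axioms rr_linear[OF m] _ _ u M.R.one_closed])
  show "rr ((J.kap1 a *\<^sub>EN e) *.\<^sub>M m) = rr ((J.kap2 a *\<^sub>EN e) *.\<^sub>M m)" if "a \<in> U A" "e \<in> U EN" for a e
   using that m by (simp add: unit_pure_ncl_def M.smult_assoc J_closed ncl_balanced M.smult_closed)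
  have "J.tau h \<in> U EN" if "h \<in> U H" for h by (rule klinearD(1)[OF J.tau_linear that])
  then show "rr ((J.sig h *\<^sub>EN e) *.\<^sub>M m) = rr ((J.tau h *\<^sub>EN e) *.\<^sub>M m)" if "h \<in> U H" "e \<in> U EN" for h e
   using that m by (simp add: M.smult_assoc J_closed rr_sig M.smult_closed)
 qed
 then show ?thesis using u by (simp add: PC.kp_closed smash_one_closed)
qed

definition comparison :: "(('k, 'h) par, ('a, 'm) tensor) tensor => (('a, 'h) tensor, 'm) tensor"
 where "comparison = restrict (tensor_lift FF (%b n. to_smash (b *.\<^sub>F1M n))) (U BT)"

lemma comparison_balanced: "balanced HP ra BA F1M FF (%b n. to_smash (b *.\<^sub>F1M n))"
proof -
 interpret L: left_module HP F1M by (rule F1M_left_module)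
 have c: "b *.\<^sub>F1M n \<in> U NN" if "b \<in> U BA" "n \<in> U F1M" for b n
  using L.smult_closed[OF BA_subset[OF that(1)] that(2)] by (simp add: F1M_simps)
 show ?thesis
 proof (rule balancedI)
  show "to_smash (ra b z *.\<^sub>F1M n) = to_smash (b *.\<^sub>F1M (z *.\<^sub>F1M n))"
   if b: "b \<in> U BA" and z: "z \<in> U HP" and n: "n \<in> U F1M" for b z n
  proof -
   obtain m where m: "m \<in> U M" "n = ncl m" using F1M_ex[OF n] by blast
   note bH = BA_subset[OF b] BA_subset[OF B_right_action(2)[OF b z]]
   show ?thesis
    using qq_right_action[OF b z m(1)] bH z m(1) by (simp add: m(2) F1M_smult to_smash_ncl M.smult_closed sh_closed)
  qed
 qed (use c in \<open>simp_all add: BA_simps(2) BA_subset L.smult_l_distr[unfolded F1M_simps(2)] L.smult_r_distr[unfolded F1M_simps(2)] F1M_simps(2) to_smash_closed to_smash_add\<close>)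
qed

lemma comparison_rr: "m \<in> U M ==> comparison (rr m) = qq m"
 using BT.lift_pure[OF FF.abelian_group_axioms comparison_balanced BA_closed(2) ncl_F1M, of m] rr_closed[of m]
 by (simp add: comparison_def unit_pure_ncl_def F1M_smult sh_one M.smult_one to_smash_ncl)

lemma comparison_hom: "comparison \<in> module_hom K BT FF"
 unfolding comparison_def
proof (rule linear_restrict_hom[OF BTM.module_axioms])
 note b = comparison_balanced
 have k: "to_smash ((k *.\<^sub>BA b) *.\<^sub>F1M n) = k *.\<^sub>FF to_smash (b *.\<^sub>F1M n)"
  if k: "k \<in> U K" and b: "b \<in> U BA" and n: "n \<in> U F1M" for k b n
 proof -
  obtain m where m: "m \<in> U M" "n = ncl m" using F1M_ex[OF n] by blast
  note bH = BA_subset[OF b] BA_subset[OF BA_closed(6)[OF k b]]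
  show ?thesis
   using k bH m(1) klinearD(3)[OF sh_linear k bH(1)] klinearD(3)[OF PC.coinv_linear[OF m(1)] k sh_closed[OF bH(1)]]
   by (simp add: m(2) BA_simps(4) F1M_smult to_smash_ncl M.smult_closed sh_closed)
 qed
 show "klinear K BT FF (tensor_lift FF (%b n. to_smash (b *.\<^sub>F1M n)))"
  unfolding klinear_def
  using BT.lift_closed[OF FF.abelian_group_axioms b] BT.lift_add[OF FF.abelian_group_axioms b] BT.lift_smult[OF FF.module_axioms b k]
  by blast
qed

text \<open>The inverse is induced by \<open>m \<mapsto> 1 \<otimes> (1 \<otimes> m)\<close>; both maps are determined by their values on the classes of elements of \<open>M\<close>.\<close>
lemma comparison_iso: "comparison \<in> module_iso K BT FF"
proof -
 let ?\<psi> = "PC.coinv_lift BT rr"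
 have \<psi>: "?\<psi> (qq m) = rr m" if "m \<in> U M" for m
  by (rule PC.coinv_lift_coinv[OF BTM.abelian_group_axioms rr_closed rr_add rr_balanced that])
 have "inj_on comparison (U BT)"
 proof (rule inj_onI)
  fix s t assume st: "s \<in> U BT" "t \<in> U BT" "comparison s = comparison t"
  obtain m n where mn: "m \<in> U M" "s = rr m" "n \<in> U M" "t = rr n" using rr_surj[OF st(1)] rr_surj[OF st(2)] by blast
  then have "qq m = qq n" using st(3) by (simp add: comparison_rr)
  then show "s = t" using \<psi>[OF mn(1)] \<psi>[OF mn(3)] mn by simp
 qed
 moreover have "comparison ` U BT = U FF"
 proof
  show "comparison ` U BT <= U FF" using module_homD(2)[OF comparison_hom] by blast
  show "U FF <= comparison ` U BT"
  proof
   fix t assume "t \<in> U FF"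
   then obtain m where "m \<in> U M" "t = qq m" by (rule PC.coinv_surj)
   then show "t \<in> comparison ` U BT" using comparison_rr rr_closed by (metis image_eqI)
  qed
 qed
 ultimately show ?thesis using comparison_hom by (simp add: module_iso_def bij_betw_def)
qed

end

section \<open>Naturality\<close>

context cocommutative_partial_action
begin

abbreviation (input) "F1' == F1_functor K H A act"
abbreviation (input) "AF == tensor_functor (enveloping K A) (env_right_action A) A"
abbreviation (input) "env == smash_env K H A act"
abbreviation (input) "brs == base_restriction K H A act"

lemma smash_bimoduleI: "left_module env M ==> smash_bimodule K H A act M"
 by (intro smash_bimodule.intro smash_bimodule_axioms.intro cocommutative_partial_action_axioms)

lemma base_restriction_hom:
 fixes M N :: "('a, 'h, 'm) smash_bimod"
 assumes M: "left_module env M" and N: "left_module env N" and f: "f \<in> module_hom env M N"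
 shows "f \<in> module_hom (enveloping K A) (brs M) (brs N)"
proof -
 interpret M: smash_bimodule K H A act M by (rule smash_bimoduleI[OF M])
 interpret N: smash_bimodule K H A act N by (rule smash_bimoduleI[OF N])
 have b: "M.base_hom t \<in> U env" if "t \<in> U (enveloping K A)" for t
  using M.base_hom that by (simp add: algebra_hom_def klinear_def)
 show ?thesis
  by (rule module_homI) (use module_homD[OF f] b in \<open>simp_all add: M.AM_simps N.AM_simps M.base_hom_def N.base_hom_def\<close>)
qed

context
 fixes M N :: "('a, 'h, 'm) smash_bimod" and f
 assumes M: "left_module env M" and N: "left_module env N" and f: "f \<in> module_hom env M N"
begin

interpretation M: smash_bimodule K H A act M by (rule smash_bimoduleI[OF M])
interpretation N: smash_bimodule K H A act N by (rule smash_bimoduleI[OF N])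
interpretation MA: bimodule_coinvariants K A "brs M" by (rule M.base_coinvariants)
interpretation NA: bimodule_coinvariants K A "brs N" by (rule N.base_coinvariants)

lemma F1_morphism_coinv:
 "m \<in> U M ==> snd F1' M N f (MA.coinv m) = NA.coinv (f m)"
 unfolding F1_functor_def
 using coinv_functor[OF M.base_coinvariants N.base_coinvariants base_restriction_hom[OF M N f], of m]
 by (simp add: M.AM_simps)

lemma F1_morphism_hom: "snd F1' M N f \<in> module_hom (Hpar K H) (fst F1' M) (fst F1' N)"
proof -
 have h: "snd F1' M N f \<in> module_hom K (fst AF (brs M)) (fst AF (brs N))"
  unfolding F1_functor_def
  using tensor_functor_data.tensor_functor_hom[OF MA.functor_data MA.TP_tensor_module NA.TP_tensor_module base_restriction_hom[OF M N f]]
  by simp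
 have t: "fst AF X = tensor_product (enveloping K A) (env_right_action A) A X" for X :: "(('a, 'a) tensor, 'm) module"
  by (simp add: tensor_functor_def)
 have e: "fst F1' X = F1_object K H A act X" for X :: "('a, 'h, 'm) smash_bimod"
  by (simp add: F1_functor_def)
 have sm: "M.sh z = N.sh z" for z ..
 note fm = module_homD(2)[OF f]
 show ?thesis unfolding e
 proof (rule module_homI)
  show "snd F1' M N f (z \<odot>\<^bsub>M.F1M\<^esub> n) = z \<odot>\<^bsub>N.F1M\<^esub> snd F1' M N f n" if z: "z \<in> U (Hpar K H)" and n: "n \<in> U M.F1M" for z n
  proof -
   obtain m where m: "m \<in> U M" "n = MA.coinv m" using M.F1M_ex[OF n] by blast
   have zm: "M.sh z *.\<^sub>M m \<in> U M" by (rule left_module.smult_closed[OF M M.sh_closed[OF z] m(1)])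
   show ?thesis
    unfolding m(2) M.F1M_smult[OF z m(1)] F1_morphism_coinv[OF zm] F1_morphism_coinv[OF m(1)] N.F1M_smult[OF z fm[OF m(1)]]
     module_homD(4)[OF f M.sh_closed[OF z] m(1)] ..
  qed
 qed (use module_homD[OF h] in \<open>simp_all add: t M.F1M_simps N.F1M_simps\<close>)
qed

end

lemma A_functor:
 "is_module_functor (enveloping K A) K (AF :: (('a, 'a) tensor, 'm, 'k, ('a, 'm) tensor) mod_functor)"
 by (rule tensor_functor_data.tensor_functor_is_functor[OF unital_bilinear_algebra.functor_data[OF A_unital]])

lemma F1_is_functor:
 "is_module_functor env (Hpar K H) (F1' :: ((('a, 'h) tensor, ('a, 'h) tensor) tensor, 'm, ('k, 'h) par, ('a, 'm) tensor) mod_functor)"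
proof -
 note AF = A_functor[unfolded is_module_functor_def, THEN conjunct2, THEN conjunct2]
 have br: "left_module (enveloping K A) (brs X)" "U (brs X) = U X" "U (fst F1' X) = U (fst AF (brs X))"
  if "left_module env X" for X :: "('a, 'h, 'm) smash_bimod"
  using smash_bimodule.AM_left_module[OF smash_bimoduleI[OF that]] smash_bimodule.AM_simps(1)[OF smash_bimoduleI[OF that]]
   smash_bimodule.F1M_simps(1)[OF smash_bimoduleI[OF that]] by (simp_all add: F1_functor_def tensor_functor_def)
 have s: "snd F1' X Y g = snd AF (brs X) (brs Y) g" for X Y :: "('a, 'h, 'm) smash_bimod" and g
  by (simp add: F1_functor_def)
 show ?thesis
  unfolding is_module_functor_def
 proof (intro conjI allI impI ballI)
  fix L X Y :: "('a, 'h, 'm) smash_bimod" and f g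
  assume m: "left_module env L" "left_module env X" "left_module env Y"
   and fg: "f \<in> module_hom env L X" "g \<in> module_hom env X Y"
  show "snd F1' L Y (cmp L g f) = compose (U (fst F1' L)) (snd F1' X Y g) (snd F1' L X f)"
   using AF[THEN conjunct2, rule_format, OF br(1)[OF m(1)] br(1)[OF m(2)] br(1)[OF m(3)]
    base_restriction_hom[OF m(1,2) fg(1)] base_restriction_hom[OF m(2,3) fg(2)]]
   by (simp only: s br(2,3)[OF m(1)])
 next
  fix X :: "('a, 'h, 'm) smash_bimod"
  assume m: "left_module env X"
  show "snd F1' X X (restrict id (U X)) = restrict id (U (fst F1' X))"
   using AF[THEN conjunct1, rule_format, OF br(1)[OF m]] by (simp only: s br(2,3)[OF m])
  show "left_module (Hpar K H) (fst F1' X)"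
   using smash_bimodule.F1M_left_module[OF smash_bimoduleI[OF m]] by (simp add: F1_functor_def)
 next
  fix X Y :: "('a, 'h, 'm) smash_bimod" and f
  assume "left_module env X" "left_module env Y" "f \<in> module_hom env X Y"
  then show "snd F1' X Y f \<in> module_hom (Hpar K H) (fst F1' X) (fst F1' Y)" by (rule F1_morphism_hom)
 qed
qed

lemma F2_is_functor:
 "is_module_functor (Hpar K H) K (F2_functor K H :: (('k, 'h) par, 'n, 'k, (('k, 'h) par, 'n) tensor) mod_functor)"
 unfolding F2_functor_def by (rule tensor_functor_data.tensor_functor_is_functor[OF B_functor_data])

lemma F_is_functor:
 "is_module_functor env K (F_functor K H A act :: ((('a, 'h) tensor, ('a, 'h) tensor) tensor, 'm, 'k, (('a, 'h) tensor, 'm) tensor) mod_functor)"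
 unfolding F_functor_def
 by (rule tensor_functor_data.tensor_functor_is_functor[OF unital_bilinear_algebra.functor_data[OF smash_unital]])

abbreviation (input) "F21 == functor_comp (F2_functor K H) F1'"

text \<open>Both composites send the class of \<open>m\<close> to the class of \<open>f m\<close>.\<close>
lemma comparison_natural:
 fixes M N :: "('a, 'h, 'm) smash_bimod"
 assumes M: "left_module env M" and N: "left_module env N" and f: "f \<in> module_hom env M N"
 shows "compose (U (fst F21 M)) (smash_bimodule.comparison K H A act N) (snd F21 M N f)
  = compose (U (fst F21 M)) (snd (F_functor K H A act) M N f) (smash_bimodule.comparison K H A act M)"
proof -
 interpret M: smash_bimodule K H A act M by (rule smash_bimoduleI[OF M])
 interpret N: smash_bimodule K H A act N by (rule smash_bimoduleI[OF N])
 have e: "fst F1' X = F1_object K H A act X" for X :: "('a, 'h, 'm) smash_bimod"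
  by (simp add: F1_functor_def)
 have c: "U (fst F21 M) = U M.BT" by (simp add: functor_comp_def F1_functor_def F2_functor_def tensor_functor_def)
 note f1 = F1_morphism_hom[OF M N f, unfolded e]
 show ?thesis unfolding c
 proof (rule extensionalityI[OF compose_extensional compose_extensional])
  fix t assume t: "t \<in> U M.BT"
  obtain m where m: "m \<in> U M" "t = M.unit_pure_ncl m" using M.rr_surj[OF t] by blast
  have "snd F21 M N f t = N.unit_pure_ncl (f m)"
   unfolding functor_comp_def F2_functor_def snd_conv e m(2) M.unit_pure_ncl_def
    tensor_functor_data.tensor_functor_pure[OF B_functor_data M.BT_tensor_module N.BT_tensor_module f1 BA_closed(2) M.ncl_F1M[OF m(1)]]
    F1_morphism_coinv[OF M N f m(1)] N.unit_pure_ncl_def ..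
  moreover have "snd (F_functor K H A act) M N f (bimodule_coinvariants.coinv K (smash K H A act) M m)
    = bimodule_coinvariants.coinv K (smash K H A act) N (f m)"
   unfolding F_functor_def by (rule coinv_functor[OF M.smash_coinvariants N.smash_coinvariants f m(1)])
  ultimately show "compose (U M.BT) N.comparison (snd F21 M N f) t
   = compose (U M.BT) (snd (F_functor K H A act) M N f) M.comparison t"
   using t m module_homD(2)[OF f m(1)] by (simp add: compose_eq M.comparison_rr N.comparison_rr)
 qed
qed

lemma composite_naturally_isomorphic:
 "naturally_isomorphic env K
  (functor_comp (F2_functor K H) F1' :: ('a, 'h, 'm, 'k) composite_functor)
  (F_functor K H A act)"
 unfolding naturally_isomorphic_def
proof (intro conjI exI[of _ "smash_bimodule.comparison K H A act"] allI impI ballI)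
 show "is_module_functor env K (functor_comp (F2_functor K H) F1' :: ('a, 'h, 'm, 'k) composite_functor)"
  by (rule functor_comp_is_functor[OF F1_is_functor F2_is_functor])
 show "is_module_functor env K (F_functor K H A act :: ((('a, 'h) tensor, ('a, 'h) tensor) tensor, 'm, 'k, (('a, 'h) tensor, 'm) tensor) mod_functor)"
  by (rule F_is_functor)
 fix M :: "('a, 'h, 'm) smash_bimod"
 assume M: "left_module env M"
 show "smash_bimodule.comparison K H A act M \<in> module_iso K (fst F21 M) (fst (F_functor K H A act) M)"
  using smash_bimodule.comparison_iso[OF smash_bimoduleI[OF M]]
  by (simp add: functor_comp_def F1_functor_def F2_functor_def F_functor_def tensor_functor_def)
qed (rule comparison_natural)

end

theorem corollary3p19:
  fixes K :: "('k, 'x) ring_scheme"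
    and H :: "('k, 'h, 'y) hopf_scheme"
    and A :: "('k, 'a, 'z) module_scheme"
    and act :: "'h \<Rightarrow> 'a \<Rightarrow> 'a"
  assumes "cocommutative_hopf_algebra K H"
    and "symmetric_partial_action K H A act"
  defines "F1 \<equiv> F1_functor K H A act ::
      ((('a, 'h) tensor, ('a, 'h) tensor) tensor, 'm, ('k, 'h) par, ('a, 'm) tensor) mod_functor"
    and "F2 \<equiv> F2_functor K H ::
      (('k, 'h) par, ('a, 'm) tensor, 'k, (('k, 'h) par, ('a, 'm) tensor) tensor) mod_functor"
    and "F \<equiv> F_functor K H A act ::
      ((('a, 'h) tensor, ('a, 'h) tensor) tensor, 'm, 'k, (('a, 'h) tensor, 'm) tensor) mod_functor"
  shows "is_module_functor (smash_env K H A act) (Hpar K H) F1 \<and>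
    is_module_functor (Hpar K H) K F2 \<and>
    is_module_functor (smash_env K H A act) K F \<and>
    naturally_isomorphic (smash_env K H A act) K (functor_comp F2 F1) F"
proof -
  interpret cocommutative_partial_action K H A act
    by (intro cocommutative_partial_action.intro assms(1,2))
  show ?thesis
    unfolding F1_def F2_def F_def
    by (intro conjI F1_is_functor F2_is_functor F_is_functor composite_naturally_isomorphic)
qed


end
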